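(* Let $n\geq 3$, $N\geq 2$, and let $F:\mathbb{R}^n\times\mathbb{R}^{N\times n}\to\mathbb{R}^N$ be a Carathéodory map satisfying the AK-Condition of ellipticity with respect to a linear map $\mathbf{A}:\mathbb{R}^{N\times n}\to\mathbb{R}^N$ with $\nu(\mathbf{A})>0$. (1) There exists $C>0$ depending only on $F$ such that for all $u,v\in W^{1;2^*,2}(\mathbb{R}^n,\mathbb{R}^N)$, $$\|v-u\|_{W^{1;2^*,2}(\mathbb{R}^n)}\leq C\,\big\|F(\cdot,\mathrm{D}v)-F(\cdot,\mathrm{D}u)\big\|_{L^2(\mathbb{R}^n)}.$$ In particular, for any $f$ the system $F(\cdot,\mathrm{D}u)=f$ a.e. on $\mathbb{R}^n$ has at most one solution in $W^{1;2^*,2}(\mathbb{R}^n,\mathbb{R}^N)$. (2) Suppose in addition that $F(x,0)=0$ for a.e. $x\in\mathbb{R}^n$. Then for every $f\in L^2(\mathbb{R}^n,\mathbb{R}^N)$ the system $$F(\cdot,\mathrm{D}u)=f\quad\text{a.e. on }\mathbb{R}^n$$ has a unique solution $u\in W^{1;2^*,2}(\mathbb{R}^n,\mathbb{R}^N)$, and it satisfies $\|u\|_{W^{1;2^*,2}(\mathbb{R}^n)}\leq C\|f\|_{L^2(\mathbb{R}^n)}$ for some $C>0$ depending only on $F$.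
   Context: Matrices $X\in\mathbb{R}^{N\times n}$ (also written $\mathbb{R}^{Nn}$) have entries $X_{\beta j}$ and Euclidean (Frobenius) norm $|X|$; for $\xi\in\mathbb{R}^N$, $a\in\mathbb{R}^n$, $\xi\otimes a$ is the $N\times n$ matrix with entries $\xi_\beta a_j$. A linear map $\mathbf{A}:\mathbb{R}^{N\times n}\to\mathbb{R}^N$ is written $\mathbf{A}:X=\sum_{\alpha,\beta=1}^N\sum_{j=1}^n \mathbf{A}_{\alpha\beta j}X_{\beta j}e^\alpha$, and its ellipticity constant is $\nu(\mathbf{A}):=\min_{|\eta|=|a|=1}|\mathbf{A}:\eta\otimes a|$ (ellipticity of $\mathbf{A}$ means $\nu(\mathbf{A})>0$, i.e. $|\mathbf{A}:\xi\otimes a|\geq\nu(\mathbf{A})|\xi||a|$ for all $\xi,a$). A map $F:\mathbb{R}^n\times\mathbb{R}^{N\times n}\to\mathbb{R}^N$ is Carathéodory if $F(\cdot,X)$ is measurable for every $X$ and $F(x,\cdot)$ is continuous for a.e. $x$. $\mathrm{D}u$ is the $N\times n$ gradient matrix $(\mathrm{D}_iu_\alpha)$. AK-Condition: $F$ satisfies it with respect to $\mathbf{A}$ (with $\nu(\mathbf{A})>0$) if there exist a positive measurable function $\alpha$ on $\mathbb{R}^n$ with $\alpha,1/\alpha\in L^\infty(\mathbb{R}^n)$ and constants $\beta,\gamma>0$ with $\beta+\gamma<1$ such that for all $X,Y\in\mathbb{R}^{N\times n}$ and a.e. $x\in\mathbb{R}^n$: $$\Big|\alpha(x)\big[F(x,X+Y)-F(x,Y)\big]-\mathbf{A}:X\Big|\leq\beta\,\nu(\mathbf{A})|X|+\gamma|\mathbf{A}:X|.$$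 $2^*=\frac{2n}{n-2}$, and $W^{1;2^*,2}(\mathbb{R}^n,\mathbb{R}^N):=\{u\in L^{2^*}(\mathbb{R}^n,\mathbb{R}^N):\mathrm{D}u\in L^2(\mathbb{R}^n,\mathbb{R}^{N\times n})\}$ (weak gradient) with norm $\|u\|_{W^{1;2^*,2}}:=\|u\|_{L^{2^*}}+\|\mathrm{D}u\|_{L^2}$. *)

theory Defs
  imports "HOL-Analysis.Analysis"
begin

text \<open>Matrices in R^(N x n) are modelled as real^'n^'m (rows indexed by 'm, N = CARD('m);
  columns by 'n, n = CARD('n)); the norm on this type is the Frobenius norm.\<close>

definition outer :: "real^'m \<Rightarrow> real^'n \<Rightarrow> real^'n^'m" where
  "outer \<xi> a = (\<chi> \<beta> j. \<xi> $ \<beta> * a $ j)"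

definition ellip_const :: "(real^'n^'m \<Rightarrow> real^'m) \<Rightarrow> real" where
  "ellip_const A = Inf {norm (A (outer \<eta> a)) | \<eta> a. norm \<eta> = 1 \<and> norm a = 1}"

definition caratheodory :: "(real^'n \<Rightarrow> real^'n^'m \<Rightarrow> real^'m) \<Rightarrow> bool" where
  "caratheodory F \<longleftrightarrow> (\<forall>X. (\<lambda>x. F x X) \<in> borel_measurable lebesgue)
      \<and> (AE x in lebesgue. continuous_on UNIV (F x))"

definition AK_condition :: "(real^'n \<Rightarrow> real^'n^'m \<Rightarrow> real^'m) \<Rightarrow> (real^'n^'m \<Rightarrow> real^'m) \<Rightarrow> bool" where
  "AK_condition F A \<longleftrightarrow> (\<exists>\<alpha> \<beta> \<gamma>.
      \<alpha> \<in> borel_measurable lebesgue \<and> (\<forall>x. \<alpha> x > 0)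
      \<and> (\<exists>B. AE x in lebesgue. \<alpha> x \<le> B) \<and> (\<exists>B. AE x in lebesgue. 1 / \<alpha> x \<le> B)
      \<and> \<beta> > 0 \<and> \<gamma> > 0 \<and> \<beta> + \<gamma> < 1
      \<and> (\<forall>X Y. AE x in lebesgue.
            norm (\<alpha> x *\<^sub>R (F x (X + Y) - F x Y) - A X)
              \<le> \<beta> * ellip_const A * norm X + \<gamma> * norm (A X)))"

definition Lp_space :: "real \<Rightarrow> ('a::euclidean_space \<Rightarrow> 'b::euclidean_space) \<Rightarrow> bool" where
  "Lp_space p u \<longleftrightarrow> u \<in> borel_measurable lebesgue \<and> integrable lebesgue (\<lambda>x. norm (u x) powr p)"

definition Lp_norm :: "real \<Rightarrow> ('a::euclidean_space \<Rightarrow> 'b::euclidean_space) \<Rightarrow> real" where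
  "Lp_norm p u = (integral\<^sup>L lebesgue (\<lambda>x. norm (u x) powr p)) powr (1 / p)"

definition partial :: "'n::finite \<Rightarrow> (real^'n \<Rightarrow> real) \<Rightarrow> real^'n \<Rightarrow> real" where
  "partial j \<phi> x = deriv (\<lambda>t. \<phi> (x + t *\<^sub>R axis j 1)) 0"

fun iter_partial :: "'n::finite list \<Rightarrow> (real^'n \<Rightarrow> real) \<Rightarrow> real^'n \<Rightarrow> real" where
  "iter_partial [] \<phi> = \<phi>"
| "iter_partial (j # js) \<phi> = partial j (iter_partial js \<phi>)"

definition smooth_fun :: "(real^'n::finite \<Rightarrow> real) \<Rightarrow> bool" where
  "smooth_fun \<phi> \<longleftrightarrow> (\<forall>js. continuous_on UNIV (iter_partial js \<phi>)
      \<and> (\<forall>j x. (\<lambda>t. iter_partial js \<phi> (x + t *\<^sub>R axis j 1)) differentiable (at 0)))"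

definition test_fun :: "(real^'n::finite \<Rightarrow> real) \<Rightarrow> bool" where
  "test_fun \<phi> \<longleftrightarrow> smooth_fun \<phi> \<and> bounded {x. \<phi> x \<noteq> 0}"

definition locally_integrable :: "(real^'n::finite \<Rightarrow> real) \<Rightarrow> bool" where
  "locally_integrable g \<longleftrightarrow> (\<forall>K. compact K \<longrightarrow> set_integrable lebesgue K g)"

definition weak_gradient :: "(real^'n::finite \<Rightarrow> real^'m) \<Rightarrow> (real^'n \<Rightarrow> real^'n^'m) \<Rightarrow> bool" where
  "weak_gradient u G \<longleftrightarrow>
     (\<forall>\<beta>. locally_integrable (\<lambda>x. u x $ \<beta>))
   \<and> (\<forall>\<beta> j. locally_integrable (\<lambda>x. G x $ \<beta> $ j))
   \<and> (\<forall>\<phi> \<beta> j. test_fun \<phi> \<longrightarrow>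
        integral\<^sup>L lebesgue (\<lambda>x. u x $ \<beta> * partial j \<phi> x)
        = - integral\<^sup>L lebesgue (\<lambda>x. G x $ \<beta> $ j * \<phi> x))"

definition sobolev_exp :: "nat \<Rightarrow> real" where
  "sobolev_exp n = 2 * real n / (real n - 2)"

definition in_W :: "(real^'n::finite \<Rightarrow> real^'m::finite) \<Rightarrow> (real^'n \<Rightarrow> real^'n^'m) \<Rightarrow> bool" where
  "in_W u G \<longleftrightarrow> Lp_space (sobolev_exp CARD('n)) u \<and> weak_gradient u G \<and> Lp_space 2 G"

definition W_norm :: "(real^'n::finite \<Rightarrow> real^'m::finite) \<Rightarrow> (real^'n \<Rightarrow> real^'n^'m) \<Rightarrow> real" where
  "W_norm u G = Lp_norm (sobolev_exp CARD('n)) u + Lp_norm 2 G"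

end

theory Submission
  imports Defs
begin

text \<open>For a linear elliptic \<open>A\<close> the key facts are \<open>\<nu> |Du| \<le> |A : Du|\<close> and \<open>|u| \<le> C |A : Du|\<close>, with the
  \<open>L\<^sup>2\<close> norm on the gradients and the norm of exponent \<open>2n/(n-2)\<close> on \<open>u\<close>.  Both are proved without the
  continuous Fourier transform: on the lattice \<open>h \<int>\<^sup>n\<close> the symbol of a central difference is
  \<open>i\<close> times a real vector, so a finite Parseval identity gives the first inequality with the sharp
  constant, and the second is a discrete Gagliardo--Nirenberg--Sobolev inequality; letting \<open>h \<rightarrow> 0\<close>
  yields smooth compactly supported maps, and mollification and cut-off all of \<open>W\<close>.  The range of
  \<open>u \<mapsto> A : Du\<close> is closed by these estimates, and dense because the transposed system is elliptic
  with the same constant and so has no nontrivial square integrable null solution.  The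
  AK-condition makes \<open>\<alpha> F(\<cdot>, Du)\<close> a perturbation of \<open>A : Du\<close> that is Lipschitz in the norm
  \<open>|A : Du|\<close> with constant \<open>\<beta> + \<gamma> < 1\<close>.\<close>

text \<open>The AK-condition offers only the room \<beta> + \<gamma> < 1 relative to \<nu>(A) |X|,
  so the inequality between |Du| and |A : Du| is needed with exactly \<nu>(A); a lossy constant
  would destroy the contraction. For general matrix fields the inequality is false, since A has a
  kernel. Ellipticity speaks only of real rank one matrices, and a gradient has that form frequency
  by frequency. On a lattice the forward difference has the complex symbol exp(i t) - 1 in each
  direction, which is not a multiple of a real vector; this forces central differences. These skip
  every second point and do not telescope from cell to cell, so the Sobolev bound uses forward
  differences; both have the same limit. The Sobolev bound is stated for weak equations B : Dw = g
  in which w has no gradient of its own, because an element orthogonal to the range of A : D is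
  known only to be square integrable and to solve such an equation for the transposed map. With g =
  0 the bound makes it vanish.\<close>

section \<open>Rank one matrices, ellipticity and the transposed map\<close>

lemma outer_component [simp]: "outer \<xi> a $ b $ j = \<xi> $ b * a $ j"
  by (simp add: outer_def)

lemma norm_vec_sq: "(norm (x :: 'a::real_inner ^ 'i))\<^sup>2 = (\<Sum>i\<in>UNIV. (norm (x $ i))\<^sup>2)"
  by (simp add: power2_norm_eq_inner inner_vec_def)

lemma norm_outer: "norm (outer \<xi> a) = norm \<xi> * norm a"
proof -
  have "(norm (outer \<xi> a))\<^sup>2 = (norm \<xi> * norm a)\<^sup>2"
    by (simp add: norm_vec_sq power_mult_distrib sum_product)
  then show ?thesis by (simp add: power2_eq_iff_nonneg)
qed

lemma outer_scaleR_left: "outer (c *\<^sub>R \<xi>) a = c *\<^sub>R outer \<xi> a"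
  and outer_scaleR_right: "outer \<xi> (c *\<^sub>R a) = c *\<^sub>R outer \<xi> a"
  and outer_add_left: "outer (\<xi> + \<eta>) a = outer \<xi> a + outer \<eta> a"
  and outer_add_right: "outer \<xi> (a + b) = outer \<xi> a + outer \<xi> b"
  by (simp_all add: vec_eq_iff algebra_simps)

lemma bounded_bilinear_outer: "bounded_bilinear outer"
proof
  show "\<exists>K. \<forall>(a::real^'m) (b::real^'n). norm (outer a b) \<le> norm a * norm b * K"
    by (intro exI[of _ 1]) (simp add: norm_outer)
qed (simp_all add: outer_scaleR_left outer_scaleR_right outer_add_left outer_add_right)

definition elliptic_with :: "real \<Rightarrow> (real^'n^'m \<Rightarrow> real^'m) \<Rightarrow> bool" where
  "elliptic_with \<nu> B \<longleftrightarrow> linear B \<and> \<nu> > 0 \<and>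
    (\<forall>\<xi> a. \<nu> * norm \<xi> * norm a \<le> norm (B (outer \<xi> a)))"

lemma elliptic_with_ellip_const:
  fixes A :: "real^'n^'m \<Rightarrow> real^'m"
  assumes "linear A" "ellip_const A > 0"
  shows "elliptic_with (ellip_const A) A"
  unfolding elliptic_with_def
proof (intro conjI allI)
  fix \<xi> :: "real^'m" and a :: "real^'n"
  show "ellip_const A * norm \<xi> * norm a \<le> norm (A (outer \<xi> a))"
  proof (cases "\<xi> = 0 \<or> a = 0")
    case False
    have "ellip_const A \<le> norm (A (outer (\<xi> /\<^sub>R norm \<xi>) (a /\<^sub>R norm a)))"
      unfolding ellip_const_def
      by (rule cInf_lower) (use False in \<open>auto intro!: bdd_belowI[of _ 0] exI[of _ "\<xi> /\<^sub>R norm \<xi>"] exI[of _ "a /\<^sub>R norm a"]\<close>)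
    also have "\<dots> = norm (A (outer \<xi> a)) / (norm \<xi> * norm a)"
      using assms(1) by (simp add: outer_scaleR_left outer_scaleR_right linear_scale field_simps)
    finally show ?thesis using False by (simp add: field_simps)
  qed (auto simp: norm_outer)
qed (use assms in auto)

text \<open>The coefficients A_{abj} with the two indices in R^N exchanged and the column index j
  kept. Up to sign, the operator \<open>mtranspose A\<close> : D is the formal adjoint of A :
  D.\<close>

definition mtranspose :: "(real^'n^'m \<Rightarrow> real^'m) \<Rightarrow> real^'n^'m \<Rightarrow> real^'m" where
  "mtranspose A X = (\<chi> b. \<Sum>j\<in>UNIV. \<Sum>a\<in>UNIV. A (outer (axis b 1) (axis j 1)) $ a * X $ a $ j)"

lemma linear_mtranspose: "linear (mtranspose A)"
  by (rule linearI) (simp_all add: mtranspose_def vec_eq_iff distrib_left sum.distrib sum_distrib_left mult.left_commute)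

text \<open>Both sides are the sum of the products of A_{cbj} with the entries \<eta>_c, \<xi>_b and
  a_j, once the rank one matrix is expanded in elementary matrices.\<close>

lemma inner_mtranspose:
  fixes A :: "real^'n^'m \<Rightarrow> real^'m"
  assumes "linear A"
  shows "mtranspose A (outer \<eta> a) \<bullet> \<xi> = \<eta> \<bullet> A (outer \<xi> a)"
proof -
  have "outer \<xi> a = (\<Sum>b\<in>UNIV. \<Sum>j\<in>UNIV. (\<xi> $ b * a $ j) *\<^sub>R outer (axis b 1) (axis j 1))"
  proof -
    have "(\<xi> $ b * a $ j) * (axis b 1 $ b' * axis j 1 $ j') = (if b = b' then if j = j' then \<xi> $ b * a $ j else 0 else 0)"
      for b b' j j'
      by (simp add: axis_def)
    moreover have "(\<Sum>b\<in>UNIV. \<Sum>j\<in>UNIV. (if b = b' then if j = j' then \<xi> $ b * a $ j else 0 else 0))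
        = \<xi> $ b' * a $ j'" for b' j'
    proof -
      have "(\<Sum>j\<in>UNIV. (if b = b' then if j = j' then \<xi> $ b * a $ j else 0 else 0))
        = (if b = b' then \<xi> $ b' * a $ j' else 0)" for b by simp
      then show ?thesis by simp
    qed
    ultimately show ?thesis by (simp add: vec_eq_iff)
  qed
  then have "A (outer \<xi> a) = (\<Sum>b\<in>UNIV. \<Sum>j\<in>UNIV. (\<xi> $ b * a $ j) *\<^sub>R A (outer (axis b 1) (axis j 1)))"
    using assms by (simp add: linear_sum linear_scale)
  then have "\<eta> \<bullet> A (outer \<xi> a) =
     (\<Sum>b\<in>UNIV. \<Sum>j\<in>UNIV. \<xi> $ b * a $ j * (\<Sum>c\<in>UNIV. \<eta> $ c * A (outer (axis b 1) (axis j 1)) $ c))"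
    by (simp only: inner_sum_right inner_scaleR_right) (simp add: inner_vec_def)
  then show ?thesis
    unfolding mtranspose_def inner_vec_def
    by (simp add: sum_distrib_left sum_distrib_right) (intro sum.cong refl, simp)
qed

text \<open>For fixed a \<noteq> 0 the map taking \<xi> to A : \<xi> \<otimes> a is an injective,
  hence surjective, endomorphism of R^N. Its adjoint is the corresponding map of the transpose and
  has the same smallest singular value; this is seen by pairing with the preimage \<xi> of
  \<eta>.\<close>

lemma elliptic_with_mtranspose:
  fixes A :: "real^'n^'m \<Rightarrow> real^'m"
  assumes "elliptic_with \<nu> A"
  shows "elliptic_with \<nu> (mtranspose A)"
proof -
  have A: "linear A" and \<nu>: "\<nu> > 0" and el: "\<And>\<xi> a. \<nu> * norm \<xi> * norm a \<le> norm (A (outer \<xi> a))"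
    using assms by (auto simp: elliptic_with_def)
  have "\<nu> * norm \<eta> * norm a \<le> norm (mtranspose A (outer \<eta> a))" for \<eta> :: "real^'m" and a :: "real^'n"
  proof (cases "a = 0 \<or> \<eta> = 0")
    case False
    let ?L = "\<lambda>\<xi>. A (outer \<xi> a)"
    have lin: "linear ?L"
      using A by - (rule linearI, simp_all add: outer_add_left outer_scaleR_left linear_add linear_scale)
    have "inj ?L"
      unfolding linear_injective_0[OF lin]
    proof (intro allI impI)
      fix x assume "A (outer x a) = 0"
      then have "\<nu> * norm x * norm a \<le> 0" using el[of x a] by simp
      then show "x = 0" using \<nu> False by (simp add: mult_le_0_iff)
    qed
    then have "surj ?L" using lin linear_injective_imp_surjective by blast
    then obtain \<xi> where "\<eta> = ?L \<xi>" by (rule surjE)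
    then have \<xi>: "?L \<xi> = \<eta>" by simp
    have "\<nu> * norm a * (norm \<eta>)\<^sup>2 = \<nu> * norm a * (mtranspose A (outer \<eta> a) \<bullet> \<xi>)"
      by (simp only: inner_mtranspose[OF A] \<xi> power2_norm_eq_inner)
    also have "\<dots> \<le> \<nu> * norm a * (norm (mtranspose A (outer \<eta> a)) * norm \<xi>)"
      using \<nu> by (intro mult_left_mono norm_cauchy_schwarz) auto
    also have "\<dots> = norm (mtranspose A (outer \<eta> a)) * (\<nu> * norm \<xi> * norm a)" by (simp only: ac_simps)
    also have "\<dots> \<le> norm (mtranspose A (outer \<eta> a)) * norm \<eta>"
      using el[of \<xi> a] \<xi> by (intro mult_left_mono) auto
    finally have "(\<nu> * norm \<eta> * norm a) * norm \<eta> \<le> norm (mtranspose A (outer \<eta> a)) * norm \<eta>"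
      by (simp only: power2_eq_square ac_simps)
    then show ?thesis using False by (simp only: mult_le_cancel_right) auto
  qed auto
  then show ?thesis using \<nu> linear_mtranspose by (auto simp: elliptic_with_def)
qed

section \<open>Finitely supported functions on the integer lattice\<close>

definition lbox :: "nat \<Rightarrow> ('n::finite \<Rightarrow> int) set" where
  "lbox R = {k. \<forall>i. \<bar>k i\<bar> \<le> int R}"

lemma lbox_eq_PiE: "lbox R = (\<Pi>\<^sub>E i\<in>UNIV. {- int R..int R})"
proof -
  have "\<bar>a\<bar> \<le> int R \<longleftrightarrow> a \<in> {- int R..int R}" for a by auto
  then show ?thesis by (simp add: lbox_def PiE_UNIV_domain Pi_def)
qed

lemma finite_lbox [simp]: "finite (lbox R)"
  by (simp add: lbox_eq_PiE finite_PiE)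

definition lshift :: "'n \<Rightarrow> int \<Rightarrow> ('n \<Rightarrow> int) \<Rightarrow> 'n \<Rightarrow> int" where
  "lshift j d k = k(j := k j + d)"

lemma lshift_lshift [simp]: "lshift j d (lshift j e k) = lshift j (d + e) k"
  by (auto simp: lshift_def)

lemma lshift_0 [simp]: "lshift j 0 k = k" by (simp add: lshift_def)

lemma lshift_notin_lbox:
  assumes "k \<notin> lbox (Suc R)" "\<bar>d\<bar> \<le> 1" shows "lshift j d k \<notin> lbox R"
proof -
  obtain i where i: "\<not> \<bar>k i\<bar> \<le> int (Suc R)" using assms(1) by (auto simp: lbox_def)
  then have "\<bar>lshift j d k i\<bar> > int R" using assms(2) i by (auto simp: lshift_def)
  then show ?thesis by (auto simp: lbox_def not_le)
qed

lemma lbox_mono: "R \<le> R' \<Longrightarrow> lbox R \<subseteq> lbox R'"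
  by (auto simp: lbox_def intro: order_trans)

text \<open>A shift by at most one cell permutes the lattice points; the margin
  \<open>R < R'\<close> leaves room for the moved support inside the larger box.\<close>

lemma sum_lshift:
  fixes f :: "('n::finite \<Rightarrow> int) \<Rightarrow> 'v::comm_monoid_add"
  assumes "\<And>k. k \<notin> lbox R \<Longrightarrow> f k = 0" "\<bar>d\<bar> \<le> 1" "R < R'"
  shows "(\<Sum>k\<in>lbox R'. f (lshift j d k)) = (\<Sum>k\<in>lbox R'. f k)"
proof -
  have inj: "inj_on (lshift j (-d)) (lbox R)"
    by (rule inj_on_inverseI[where g = "lshift j d"]) simp
  have sub: "lshift j (-d) ` lbox R \<subseteq> lbox R'"
  proof
    fix k assume "k \<in> lshift j (-d) ` lbox R"
    then have "lshift j d k \<in> lbox R" by auto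
    then have "k \<in> lbox (Suc R)" using lshift_notin_lbox assms(2) by blast
    then show "k \<in> lbox R'" using lbox_mono[of "Suc R" R'] assms(3) by auto
  qed
  have "(\<Sum>k\<in>lbox R'. f (lshift j d k)) = (\<Sum>k\<in>lshift j (-d) ` lbox R. f (lshift j d k))"
  proof (rule sum.mono_neutral_right[OF finite_lbox sub], rule ballI)
    fix k assume k: "k \<in> lbox R' - lshift j (-d) ` lbox R"
    have "lshift j d k \<notin> lbox R"
    proof
      assume "lshift j d k \<in> lbox R"
      then have "lshift j (-d) (lshift j d k) \<in> lshift j (-d) ` lbox R" by blast
      then show False using k by simp
    qed
    then show "f (lshift j d k) = 0" by (rule assms(1))
  qed
  also have "\<dots> = (\<Sum>k\<in>lbox R. f k)"
    by (subst sum.reindex[OF inj]) simp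
  also have "\<dots> = (\<Sum>k\<in>lbox R'. f k)"
    using assms(1,3) lbox_mono[of R R'] by (intro sum.mono_neutral_left) auto
  finally show ?thesis .
qed

section \<open>The discrete Fourier transform on a finite torus\<close>

definition lphase :: "nat \<Rightarrow> ('n::finite \<Rightarrow> int) \<Rightarrow> ('n \<Rightarrow> nat) \<Rightarrow> real" where
  "lphase M k \<theta> = (\<Sum>i\<in>UNIV. 2 * pi * real_of_int (k i) * real (\<theta> i) / real M)"

text \<open>Indices of the characters of the group (Z/MZ)^n; \<open>lphase\<close> is the argument
  of such a character. A box with 2 R < M embeds injectively in this group, so finitely supported
  lattice functions can be treated as functions on it.\<close>

definition ldual :: "nat \<Rightarrow> ('n::finite \<Rightarrow> nat) set" where
  "ldual M = (\<Pi>\<^sub>E i\<in>UNIV. {..<M})"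

lemma finite_ldual [simp]: "finite (ldual M)" by (simp add: ldual_def finite_PiE)

lemma lphase_diff: "lphase M (\<lambda>i. k i - l i) \<theta> = lphase M k \<theta> - lphase M l \<theta>"
  unfolding lphase_def sum_subtractf[symmetric]
  by (rule sum.cong) (simp_all add: right_diff_distrib left_diff_distrib diff_divide_distrib)

lemma lphase_lshift: "lphase M (lshift j d k) \<theta> = lphase M k \<theta> + 2 * pi * d * \<theta> j / M"
proof -
  have "lphase M (lshift j d k) \<theta> - lphase M k \<theta> =
      (\<Sum>i\<in>UNIV. if i = j then 2 * pi * d * \<theta> j / M else 0)"
    unfolding lphase_def lshift_def sum_subtractf[symmetric]
    by (rule sum.cong) (auto simp: algebra_simps add_divide_distrib)
  then show ?thesis by simp
qed

text \<open>A geometric sum in the powers of one root of unity; |d| < M excludes that d is a nonzero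
  multiple of M, so the root is 1 only for d = 0.\<close>

lemma sum_root_of_unity:
  fixes d :: int
  assumes "\<bar>d\<bar> < int M"
  shows "(\<Sum>t<M. cis (2 * pi * d * real t / real M)) = (if d = 0 then of_nat M else 0)"
proof (cases "d = 0")
  case False
  define z where "z = cis (2 * pi * d / M)"
  have M: "M > 0" using assms by linarith
  have "z \<noteq> 1"
  proof
    assume "z = 1"
    then have "cos (2 * pi * d / M) = 1" by (metis z_def Re_complex_of_real cis.sel(1) of_real_1)
    then obtain m :: int where "2 * pi * d / M = m * 2 * pi" using cos_one_2pi_int by auto
    then have "real_of_int d = of_int (m * int M)" using M by (simp add: field_simps)
    then have "d = m * int M" by linarith
    then have "\<bar>m\<bar> * int M < 1 * int M" "m \<noteq> 0" using assms False by (auto simp: abs_mult)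
    then show False using M by (subst (asm) mult_less_cancel_right) auto
  qed
  have "z ^ M = cis (2 * pi * d)" using M by (simp add: z_def Complex.DeMoivre)
  also have "\<dots> = 1" by (metis Ints_of_int cis_multiple_2pi mult.commute mult.assoc)
  finally have "z ^ M = 1" .
  moreover have "cis (2 * pi * d * real t / real M) = z ^ t" for t
    by (simp add: z_def Complex.DeMoivre algebra_simps)
  ultimately show ?thesis using geometric_sum[OF \<open>z \<noteq> 1\<close>, of M] False by simp
qed simp

lemma cis_sum: "finite I \<Longrightarrow> cis (\<Sum>i\<in>I. f i) = (\<Prod>i\<in>I. cis (f i))"
  by (induction I rule: finite_induct) (auto simp: cis_mult[symmetric])

text \<open>Orthogonality of characters: the exponential factorises over the coordinates, and a
  single coordinate with k i \<noteq> l i already annihilates the product. Coordinates differ by at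
  most 2 R < M.\<close>

lemma sum_cos_lphase:
  fixes k l :: "'n::finite \<Rightarrow> int"
  assumes "k \<in> lbox R" "l \<in> lbox R" "2 * R < M"
  shows "(\<Sum>\<theta>\<in>ldual M. cos (lphase M k \<theta> - lphase M l \<theta>)) = (if k = l then real M ^ CARD('n) else 0)"
proof -
  define d where "d i = k i - l i" for i
  have d: "\<bar>d i\<bar> < int M" for i
  proof -
    have "\<bar>k i\<bar> \<le> int R" "\<bar>l i\<bar> \<le> int R" using assms by (auto simp: lbox_def)
    then show ?thesis using assms(3) by (auto simp: d_def)
  qed
  have "(\<Sum>\<theta>\<in>ldual M. cis (lphase M d \<theta>)) =
      (\<Sum>\<theta>\<in>ldual M. \<Prod>i\<in>UNIV. cis (2 * pi * d i * real (\<theta> i) / real M))"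
    by (simp add: lphase_def cis_sum)
  also have "\<dots> = (\<Prod>i\<in>UNIV. \<Sum>t<M. cis (2 * pi * d i * real t / real M))"
    unfolding ldual_def by (rule prod_sum_PiE[symmetric]) auto
  also have "\<dots> = (\<Prod>i\<in>UNIV. if d i = 0 then of_nat M else 0)"
    by (rule prod.cong) (use sum_root_of_unity[OF d] in auto)
  also have "\<dots> = (if k = l then of_nat M ^ CARD('n) else 0)"
    by (auto simp: d_def fun_eq_iff)
  finally have "(\<Sum>\<theta>\<in>ldual M. cis (lphase M d \<theta>)) = of_real (if k = l then real M ^ CARD('n) else 0)"
    by simp
  then have "Re (\<Sum>\<theta>\<in>ldual M. cis (lphase M d \<theta>)) = (if k = l then real M ^ CARD('n) else 0)"
    by (metis Re_complex_of_real)
  then show ?thesis unfolding d_def lphase_diff Re_sum by (simp only: cis.sel)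
qed

text \<open>Cosine and sine transforms stand for the real and imaginary parts (up to sign) of the
  complex transform, so the values remain in the real space on which the real linear map B
  acts.\<close>

definition lcos :: "nat \<Rightarrow> nat \<Rightarrow> (('n::finite \<Rightarrow> int) \<Rightarrow> 'v::real_inner) \<Rightarrow> ('n \<Rightarrow> nat) \<Rightarrow> 'v" where
  "lcos R M g \<theta> = (\<Sum>k\<in>lbox R. cos (lphase M k \<theta>) *\<^sub>R g k)"

definition lsin :: "nat \<Rightarrow> nat \<Rightarrow> (('n::finite \<Rightarrow> int) \<Rightarrow> 'v::real_inner) \<Rightarrow> ('n \<Rightarrow> nat) \<Rightarrow> 'v" where
  "lsin R M g \<theta> = (\<Sum>k\<in>lbox R. sin (lphase M k \<theta>) *\<^sub>R g k)"

text \<open>Expanding both squares, cos cos + sin sin is the cosine of the phase difference, and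
  orthogonality leaves only the diagonal terms.\<close>

lemma lattice_Parseval:
  fixes g :: "('n::finite \<Rightarrow> int) \<Rightarrow> 'v::real_inner"
  assumes "2 * R < M"
  shows "(\<Sum>\<theta>\<in>ldual M. (norm (lcos R M g \<theta>))\<^sup>2 + (norm (lsin R M g \<theta>))\<^sup>2)
       = real M ^ CARD('n) * (\<Sum>k\<in>lbox R. (norm (g k))\<^sup>2)"
proof -
  have "(norm (lcos R M g \<theta>))\<^sup>2 + (norm (lsin R M g \<theta>))\<^sup>2 =
     (\<Sum>k\<in>lbox R. \<Sum>l\<in>lbox R. cos (lphase M k \<theta> - lphase M l \<theta>) * (g k \<bullet> g l))" for \<theta>
    by (simp add: power2_norm_eq_inner lcos_def lsin_def inner_sum_left inner_sum_right cos_diff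
        sum_distrib_left sum.distrib[symmetric])
      (intro sum.cong refl, simp add: algebra_simps inner_commute)
  then have "(\<Sum>\<theta>\<in>ldual M. (norm (lcos R M g \<theta>))\<^sup>2 + (norm (lsin R M g \<theta>))\<^sup>2) =
     (\<Sum>\<theta>\<in>ldual M. \<Sum>k\<in>lbox R. \<Sum>l\<in>lbox R. cos (lphase M k \<theta> - lphase M l \<theta>) * (g k \<bullet> g l))" by simp
  also have "\<dots> = (\<Sum>k\<in>lbox R. \<Sum>\<theta>\<in>ldual M. \<Sum>l\<in>lbox R. cos (lphase M k \<theta> - lphase M l \<theta>) * (g k \<bullet> g l))"
    by (rule sum.swap)
  also have "\<dots> = (\<Sum>k\<in>lbox R. \<Sum>l\<in>lbox R. \<Sum>\<theta>\<in>ldual M. cos (lphase M k \<theta> - lphase M l \<theta>) * (g k \<bullet> g l))"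
    by (rule sum.cong[OF refl], rule sum.swap)
  also have "\<dots> = (\<Sum>k\<in>lbox R. \<Sum>l\<in>lbox R. (if k = l then real M ^ CARD('n) * (g k \<bullet> g k) else 0))"
    by (intro sum.cong refl) (simp add: sum_distrib_right[symmetric] sum_cos_lphase[OF _ _ assms] del: sum_constant)
  also have "\<dots> = real M ^ CARD('n) * (\<Sum>k\<in>lbox R. (norm (g k))\<^sup>2)"
    by (simp add: sum_distrib_left power2_norm_eq_inner)
  finally show ?thesis .
qed

text \<open>Central differences have a purely imaginary symbol, which is what makes real ellipticity
  applicable. The factor 1 / (2 h) is supplied only when the mesh size enters.\<close>

definition cdiff :: "(('n::finite \<Rightarrow> int) \<Rightarrow> real^'m) \<Rightarrow> ('n \<Rightarrow> int) \<Rightarrow> real^'n^'m" where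
  "cdiff g k = (\<chi> b j. g (lshift j 1 k) $ b - g (lshift j (-1) k) $ b)"

text \<open>The difference of the phases shifted by -\<delta> and +\<delta> gives 2 sin \<delta>
  times the conjugate transform. Thus at each frequency both transforms of \<open>cdiff g\<close>
  are rank one with the same real direction \<open>s\<close>.\<close>

lemma cdiff_transform:
  fixes g :: "('n::finite \<Rightarrow> int) \<Rightarrow> real^'m"
    and M :: nat
  assumes g: "\<And>k. k \<notin> lbox R \<Longrightarrow> g k = 0"
  defines "s \<equiv> \<lambda>\<theta>. (\<chi> j. 2 * sin (2 * pi * real (\<theta> j) / real M))"
  shows "lcos (Suc R) M (cdiff g) \<theta> = outer (lsin (Suc R) M g \<theta>) (s \<theta>)"
    and "lsin (Suc R) M (cdiff g) \<theta> = outer (- lcos (Suc R) M g \<theta>) (s \<theta>)"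
proof -
  \<comment> \<open>Summation by parts: the shift of g is traded for a shift of the phase.\<close>
  have *: "(\<Sum>k\<in>lbox (Suc R). c (lphase M k \<theta>) * (g (lshift j d k) $ b))
      = (\<Sum>k\<in>lbox (Suc R). c (lphase M k \<theta> - 2 * pi * d * \<theta> j / M) * g k $ b)"
    if "\<bar>d\<bar> \<le> 1" for c :: "real \<Rightarrow> real" and j b and d :: int
  proof -
    have "(\<Sum>k\<in>lbox (Suc R). c (lphase M k \<theta>) * (g (lshift j d k) $ b)) =
       (\<Sum>k\<in>lbox (Suc R). (\<lambda>k. c (lphase M (lshift j (-d) k) \<theta>) * g k $ b) (lshift j d k))"
      by simp
    also have "\<dots> = (\<Sum>k\<in>lbox (Suc R). c (lphase M (lshift j (-d) k) \<theta>) * g k $ b)"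
      by (rule sum_lshift[where R = R]) (use g that in auto)
    finally show ?thesis by (simp add: lphase_lshift)
  qed
  show "lcos (Suc R) M (cdiff g) \<theta> = outer (lsin (Suc R) M g \<theta>) (s \<theta>)"
    unfolding vec_eq_iff
  proof (intro allI)
    fix b j
    have "lcos (Suc R) M (cdiff g) \<theta> $ b $ j = (\<Sum>k\<in>lbox (Suc R). cos (lphase M k \<theta>) * (g (lshift j 1 k) $ b))
        - (\<Sum>k\<in>lbox (Suc R). cos (lphase M k \<theta>) * (g (lshift j (-1) k) $ b))"
      by (simp add: lcos_def cdiff_def sum_subtractf[symmetric] algebra_simps)
    also have "\<dots> = outer (lsin (Suc R) M g \<theta>) (s \<theta>) $ b $ j"
      unfolding *[of 1 cos j b, simplified abs_one, OF order_refl] *[of "-1" cos j b, simplified abs_minus abs_one, OF order_refl] sum_subtractf[symmetric]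
      by (simp add: lsin_def s_def cos_diff cos_add sum_distrib_right) (rule sum.cong[OF refl], simp add: algebra_simps)
    finally show "lcos (Suc R) M (cdiff g) \<theta> $ b $ j = outer (lsin (Suc R) M g \<theta>) (s \<theta>) $ b $ j" .
  qed
  show "lsin (Suc R) M (cdiff g) \<theta> = outer (- lcos (Suc R) M g \<theta>) (s \<theta>)"
    unfolding vec_eq_iff
  proof (intro allI)
    fix b j
    have "lsin (Suc R) M (cdiff g) \<theta> $ b $ j = (\<Sum>k\<in>lbox (Suc R). sin (lphase M k \<theta>) * (g (lshift j 1 k) $ b))
        - (\<Sum>k\<in>lbox (Suc R). sin (lphase M k \<theta>) * (g (lshift j (-1) k) $ b))"
      by (simp add: lsin_def cdiff_def sum_subtractf[symmetric] algebra_simps)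
    also have "\<dots> = outer (- lcos (Suc R) M g \<theta>) (s \<theta>) $ b $ j"
      unfolding *[of 1 sin j b, simplified abs_one, OF order_refl] *[of "-1" sin j b, simplified abs_minus abs_one, OF order_refl] sum_subtractf[symmetric]
      by (simp add: lcos_def s_def sin_diff sin_add sum_distrib_right sum_negf[symmetric]) (rule sum.cong[OF refl], simp add: algebra_simps)
    finally show "lsin (Suc R) M (cdiff g) \<theta> $ b $ j = outer (- lcos (Suc R) M g \<theta>) (s \<theta>) $ b $ j" .
  qed
qed

text \<open>Ellipticity is used at each frequency separately, where the transforms are real rank one
  matrices. Parseval is an identity in both directions, so no constant is lost.\<close>

lemma lattice_elliptic_estimate:
  fixes g :: "('n::finite \<Rightarrow> int) \<Rightarrow> real^'m" and B :: "real^'n^'m \<Rightarrow> real^'m"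
  assumes B: "elliptic_with \<nu> B" and g: "\<And>k. k \<notin> lbox R \<Longrightarrow> g k = 0"
  shows "\<nu>\<^sup>2 * (\<Sum>k\<in>lbox (Suc R). (norm (cdiff g k))\<^sup>2) \<le> (\<Sum>k\<in>lbox (Suc R). (norm (B (cdiff g k)))\<^sup>2)"
proof -
  \<comment> \<open>The number of lattice points of \<open>lbox (Suc R)\<close> in each direction,
    the least modulus for which the box embeds in the torus.\<close>
  define M where "M = 2 * Suc R + 1"
  have M: "2 * Suc R < M" "M > 0" by (auto simp: M_def)
  define s :: "('n \<Rightarrow> nat) \<Rightarrow> real^'n" where "s \<equiv> \<lambda>\<theta>. (\<chi> j. 2 * sin (2 * pi * real (\<theta> j) / M))"
  have lin: "linear B" and \<nu>: "\<nu> > 0" using B by (auto simp: elliptic_with_def)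
  have el: "\<nu>\<^sup>2 * (norm (outer \<xi> a))\<^sup>2 \<le> (norm (B (outer \<xi> a)))\<^sup>2" for \<xi> a
  proof -
    have "(\<nu> * norm (outer \<xi> a))\<^sup>2 \<le> (norm (B (outer \<xi> a)))\<^sup>2"
      using B \<nu> unfolding elliptic_with_def by (intro power_mono) (auto simp: norm_outer mult.assoc)
    then show ?thesis by (simp only: power_mult_distrib)
  qed
  have lB: "lcos (Suc R) M (\<lambda>k. B (cdiff g k)) \<theta> = B (lcos (Suc R) M (cdiff g) \<theta>)"
     "lsin (Suc R) M (\<lambda>k. B (cdiff g k)) \<theta> = B (lsin (Suc R) M (cdiff g) \<theta>)" for \<theta>
    using lin by (simp_all add: lcos_def lsin_def linear_sum linear_scale)
  have tr: "lcos (Suc R) M (cdiff g) \<theta> = outer (lsin (Suc R) M g \<theta>) (s \<theta>)"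
    "lsin (Suc R) M (cdiff g) \<theta> = outer (- lcos (Suc R) M g \<theta>) (s \<theta>)" for \<theta>
    using cdiff_transform[where R = R and g = g and M = M and \<theta> = \<theta>] g unfolding s_def by blast+
  have "real M ^ CARD('n) * (\<nu>\<^sup>2 * (\<Sum>k\<in>lbox (Suc R). (norm (cdiff g k))\<^sup>2))
      = (\<Sum>\<theta>\<in>ldual M. \<nu>\<^sup>2 * (norm (outer (lsin (Suc R) M g \<theta>) (s \<theta>)))\<^sup>2 +
           \<nu>\<^sup>2 * (norm (outer (- lcos (Suc R) M g \<theta>) (s \<theta>)))\<^sup>2)"
    using lattice_Parseval[OF M(1), of "cdiff g"]
    unfolding tr distrib_left[symmetric] sum_distrib_left[symmetric]
    by (simp only: mult.left_commute[of _ "\<nu>\<^sup>2"])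
  also have "\<dots> \<le> (\<Sum>\<theta>\<in>ldual M. (norm (B (outer (lsin (Suc R) M g \<theta>) (s \<theta>))))\<^sup>2 +
           (norm (B (outer (- lcos (Suc R) M g \<theta>) (s \<theta>))))\<^sup>2)"
    by (intro sum_mono add_mono el)
  also have "\<dots> = real M ^ CARD('n) * (\<Sum>k\<in>lbox (Suc R). (norm (B (cdiff g k)))\<^sup>2)"
    using lattice_Parseval[OF M(1), of "\<lambda>k. B (cdiff g k)"] unfolding lB tr
    by (simp only:)
  finally show ?thesis using M(2) by simp
qed

text \<open>After normalising each factor by its sum, the weighted inequality of arithmetic and
  geometric means (convexity of exp) bounds the product by a convex combination whose sum over t is
  1. Strict positivity makes the logarithms meaningful.\<close>

lemma weighted_Holder_sum:
  fixes a :: "'i \<Rightarrow> 't \<Rightarrow> real"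
  assumes S: "finite S" "S \<noteq> {}" and I: "finite I" "I \<noteq> {}"
    and a: "\<And>i t. i \<in> I \<Longrightarrow> t \<in> S \<Longrightarrow> a i t > 0"
    and w: "\<And>i. i \<in> I \<Longrightarrow> w i \<ge> 0" "(\<Sum>i\<in>I. w i) = 1"
  shows "(\<Sum>t\<in>S. \<Prod>i\<in>I. a i t powr w i) \<le> (\<Prod>i\<in>I. (\<Sum>t\<in>S. a i t) powr w i)"
proof -
  define A where "A i = (\<Sum>t\<in>S. a i t)" for i
  have A: "A i > 0" if "i \<in> I" for i unfolding A_def using S a that by (intro sum_pos) auto
  have pt: "(\<Prod>i\<in>I. a i t powr w i) \<le> (\<Prod>i\<in>I. A i powr w i) * (\<Sum>i\<in>I. w i * (a i t / A i))" if t: "t \<in> S" for t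
  proof -
    have "(\<Prod>i\<in>I. (a i t / A i) powr w i) = (\<Prod>i\<in>I. exp (w i *\<^sub>R ln (a i t / A i)))"
      by (intro prod.cong refl) (use a A t in \<open>force simp: powr_def\<close>)
    also have "\<dots> = exp (\<Sum>i\<in>I. w i *\<^sub>R ln (a i t / A i))" using I by (simp add: exp_sum)
    also have "\<dots> \<le> (\<Sum>i\<in>I. w i * exp (ln (a i t / A i)))"
      by (rule convex_on_sum[OF I exp_convex w(2)]) (use w in auto)
    also have "\<dots> = (\<Sum>i\<in>I. w i * (a i t / A i))"
      by (intro sum.cong refl) (use a A t in simp)
    finally have *: "(\<Prod>i\<in>I. (a i t / A i) powr w i) \<le> (\<Sum>i\<in>I. w i * (a i t / A i))" .
    have "(\<Prod>i\<in>I. a i t powr w i) = (\<Prod>i\<in>I. A i powr w i * (a i t / A i) powr w i)"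
      by (intro prod.cong refl) (use a A t in \<open>simp add: powr_mult[symmetric] less_imp_le less_imp_neq[symmetric]\<close>)
    also have "\<dots> = (\<Prod>i\<in>I. A i powr w i) * (\<Prod>i\<in>I. (a i t / A i) powr w i)"
      by (rule prod.distrib)
    also have "\<dots> \<le> (\<Prod>i\<in>I. A i powr w i) * (\<Sum>i\<in>I. w i * (a i t / A i))"
      by (intro mult_left_mono * prod_nonneg) auto
    finally show ?thesis .
  qed
  have "(\<Sum>t\<in>S. \<Prod>i\<in>I. a i t powr w i) \<le> (\<Sum>t\<in>S. (\<Prod>i\<in>I. A i powr w i) * (\<Sum>i\<in>I. w i * (a i t / A i)))"
    by (intro sum_mono pt)
  also have "\<dots> = (\<Prod>i\<in>I. A i powr w i) * (\<Sum>i\<in>I. \<Sum>t\<in>S. w i * (a i t / A i))"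
    by (simp only: sum_distrib_left) (rule sum.swap)
  also have "(\<Sum>i\<in>I. \<Sum>t\<in>S. w i * (a i t / A i)) = (\<Sum>i\<in>I. w i)"
  proof (intro sum.cong refl)
    fix i assume i: "i \<in> I"
    have "(\<Sum>t\<in>S. w i * (a i t / A i)) = w i * (A i / A i)"
      by (simp add: sum_distrib_left[symmetric] sum_divide_distrib[symmetric] A_def)
    then show "(\<Sum>t\<in>S. w i * (a i t / A i)) = w i" using A[OF i] by simp
  qed
  finally show ?thesis using w by (simp add: A_def)
qed

section \<open>The discrete Gagliardo--Nirenberg--Sobolev inequality\<close>

text \<open>Discrete integration over one coordinate. The result is still a function of all
  coordinates, constant in direction j, so sums over different coordinates can be iterated and
  multiplied without changing types.\<close>

definition line_sum :: "int set \<Rightarrow> 'n \<Rightarrow> (('n \<Rightarrow> int) \<Rightarrow> real) \<Rightarrow> ('n \<Rightarrow> int) \<Rightarrow> real" where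
  "line_sum S j f k = (\<Sum>t\<in>S. f (k(j := t)))"

fun iter_line_sum :: "int set \<Rightarrow> 'n list \<Rightarrow> (('n \<Rightarrow> int) \<Rightarrow> real) \<Rightarrow> ('n \<Rightarrow> int) \<Rightarrow> real" where
  "iter_line_sum S [] f = f"
| "iter_line_sum S (j # js) f = iter_line_sum S js (line_sum S j f)"

lemma line_sum_upd [simp]: "line_sum S j f (k(j := t)) = line_sum S j f k"
  by (simp add: line_sum_def)

lemma line_sum_commute:
  assumes "i \<noteq> j"
  shows "line_sum S i (line_sum S j f) = line_sum S j (line_sum S i f)"
proof
  fix k
  show "line_sum S i (line_sum S j f) k = line_sum S j (line_sum S i f) k"
    unfolding line_sum_def by (subst sum.swap) (simp add: fun_upd_twist[OF assms])
qed

lemma line_sum_mono: "(\<And>k. f k \<le> g k) \<Longrightarrow> line_sum S j f k \<le> line_sum S j g k"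
  unfolding line_sum_def by (rule sum_mono) blast

lemma iter_line_sum_mono: "(\<And>k. f k \<le> g k) \<Longrightarrow> iter_line_sum S js f k \<le> iter_line_sum S js g k"
proof (induction js arbitrary: f g k)
  case (Cons j js)
  show ?case by (simp, rule Cons.IH, rule line_sum_mono, rule Cons.prems)
qed simp

lemma line_sum_pos:
  assumes "finite S" "S \<noteq> {}" "\<And>k. f k > 0"
  shows "line_sum S j f k > 0"
  unfolding line_sum_def using assms by (intro sum_pos) auto

text \<open>Fubini for finite sums: a point of the larger product set corresponds to its j-th
  coordinate together with the point in which that coordinate is reset to k j.\<close>

lemma iter_line_sum_eq:
  assumes "distinct js" "finite S"
  shows "iter_line_sum S js f k = (\<Sum>y | (\<forall>i\<in>set js. y i \<in> S) \<and> (\<forall>i. i \<notin> set js \<longrightarrow> y i = k i). f y)"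
  using assms(1)
proof (induction js arbitrary: f)
  case Nil
  have "{y. \<forall>i. y i = k i} = {k}" by (auto simp: fun_eq_iff)
  then show ?case by simp
next
  case (Cons j js)
  let ?X = "\<lambda>js. {y. (\<forall>i\<in>set js. y i \<in> S) \<and> (\<forall>i. i \<notin> set js \<longrightarrow> y i = k i)}"
  have "iter_line_sum S (j # js) f k = (\<Sum>y\<in>?X js. \<Sum>t\<in>S. f (y(j := t)))"
    using Cons by (simp add: line_sum_def)
  also have "\<dots> = (\<Sum>(y, t)\<in>?X js \<times> S. f (y(j := t)))" by (rule sum.cartesian_product)
  also have "\<dots> = (\<Sum>y\<in>?X (j # js). f y)"
    by (rule sum.reindex_bij_witness[where i = "\<lambda>y. (y(j := k j), y j)" and j = "\<lambda>(y, t). y(j := t)"])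
      (use Cons.prems in \<open>auto simp: fun_eq_iff\<close>)
  finally show ?case .
qed

text \<open>The induction integrates out one coordinate at a time: after summing over \<open>j\<close>, the
  Hoelder inequality with exponents \<open>1 - (|js| - 1) p, p, ..., p\<close> moves the sum inside.\<close>

lemma iter_line_sum_Holder:
  fixes f :: "('n \<Rightarrow> int) \<Rightarrow> real"
  assumes S: "finite S" "S \<noteq> {}" and p: "p \<ge> 0"
  shows "distinct js \<Longrightarrow> (real (length js) - 1) * p \<le> 1 \<Longrightarrow> (\<And>k. f k > 0) \<Longrightarrow>
    iter_line_sum S js (\<lambda>k. f k powr (1 - (real (length js) - 1) * p) * (\<Prod>i\<in>set js. line_sum S i f k powr p)) k
      \<le> iter_line_sum S js f k powr (1 + p)"
proof (induction js arbitrary: f)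
  case Nil
  then show ?case by simp
next
  case (Cons j js)
  let ?m = "real (length js)"
  have j: "j \<notin> set js" and d: "distinct js" using Cons.prems by auto
  have mp: "?m * p \<le> 1" using Cons.prems by simp
  have Tpos: "line_sum S i f k > 0" for i k using line_sum_pos[OF S Cons.prems(3)] .
  have step: "line_sum S j (\<lambda>k. f k powr (1 - ?m * p) * (\<Prod>i\<in>set (j # js). line_sum S i f k powr p)) k
      \<le> line_sum S j f k powr (1 - (?m - 1) * p) * (\<Prod>i\<in>set js. line_sum S i (line_sum S j f) k powr p)" for k
  proof -
    \<comment> \<open>\<open>None\<close> stands for the factor f itself, which carries the
      remaining weight 1 - ?m * p; \<open>Some i\<close> stands for the line sum in direction i with
      weight p. The weights add up to 1.\<close>
    let ?I = "insert None (Some ` set js)"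
    define a where "a x t = (case x of None \<Rightarrow> f (k(j := t)) | Some i \<Rightarrow> line_sum S i f (k(j := t)))" for x t
    define w where "w x = (case x of None \<Rightarrow> 1 - ?m * p | Some i \<Rightarrow> p)" for x :: "'n option"
    have prodI: "(\<Prod>x\<in>?I. h x) = h None * (\<Prod>i\<in>set js. h (Some i))" for h :: "'n option \<Rightarrow> real"
      by (subst prod.insert) (auto simp: prod.reindex)
    have sumw: "(\<Sum>x\<in>?I. w x) = 1"
      by (subst sum.insert) (auto simp: sum.reindex w_def distinct_card[OF d])
    \<comment> \<open>The factor belonging to j is constant along direction j and leaves the sum;
      the Hoelder inequality is applied to the others.\<close>
    have "line_sum S j (\<lambda>k. f k powr (1 - ?m * p) * (\<Prod>i\<in>set (j # js). line_sum S i f k powr p)) k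
      = line_sum S j f k powr p * (\<Sum>t\<in>S. \<Prod>x\<in>?I. a x t powr w x)"
      unfolding prodI using j
      by (subst line_sum_def) (simp add: a_def w_def sum_distrib_left mult_ac)
    also have "\<dots> \<le> line_sum S j f k powr p * (\<Prod>x\<in>?I. (\<Sum>t\<in>S. a x t) powr w x)"
      by (intro mult_left_mono weighted_Holder_sum S sumw)
        (use Cons.prems(3) Tpos mp p in \<open>auto simp: a_def w_def split: option.split\<close>)
    also have "(\<Prod>x\<in>?I. (\<Sum>t\<in>S. a x t) powr w x) =
       line_sum S j f k powr (1 - ?m * p) * (\<Prod>i\<in>set js. line_sum S j (line_sum S i f) k powr p)"
      unfolding prodI by (simp add: a_def w_def line_sum_def)
    also have "(\<Prod>i\<in>set js. line_sum S j (line_sum S i f) k powr p) = (\<Prod>i\<in>set js. line_sum S i (line_sum S j f) k powr p)"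
    proof (intro prod.cong refl)
      fix i assume "i \<in> set js"
      then have "i \<noteq> j" using j by auto
      then show "line_sum S j (line_sum S i f) k powr p = line_sum S i (line_sum S j f) k powr p"
        by (metis line_sum_commute)
    qed
    also have "line_sum S j f k powr p * (line_sum S j f k powr (1 - ?m * p) * (\<Prod>i\<in>set js. line_sum S i (line_sum S j f) k powr p))
       = line_sum S j f k powr (p + (1 - ?m * p)) * (\<Prod>i\<in>set js. line_sum S i (line_sum S j f) k powr p)"
      by (simp only: powr_add mult.assoc)
    \<comment> \<open>The two powers of the line sum combine to exactly the exponent that the
      induction hypothesis requires for one index less.\<close>
    also have "p + (1 - ?m * p) = 1 - (?m - 1) * p" by (simp add: left_diff_distrib)
    finally show ?thesis .
  qed
  have "iter_line_sum S (j # js) (\<lambda>k. f k powr (1 - (real (length (j # js)) - 1) * p) *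
          (\<Prod>i\<in>set (j # js). line_sum S i f k powr p)) k
     = iter_line_sum S js (line_sum S j (\<lambda>k. f k powr (1 - ?m * p) *
          (\<Prod>i\<in>set (j # js). line_sum S i f k powr p))) k" by simp
  also have "\<dots> \<le> iter_line_sum S js (\<lambda>k. line_sum S j f k powr (1 - (?m - 1) * p) *
      (\<Prod>i\<in>set js. line_sum S i (line_sum S j f) k powr p)) k"
    by (rule iter_line_sum_mono, rule step)
  also have "\<dots> \<le> iter_line_sum S js (line_sum S j f) k powr (1 + p)"
  proof (rule Cons.IH[OF d _ Tpos])
    show "(?m - 1) * p \<le> 1" using mp p by (simp add: left_diff_distrib)
  qed
  finally show ?case by simp
qed

text \<open>Gagliardo's argument: v is below the line sum of f in each of the n directions, so its
  power n / (n - 1) is below the product of the n line sums, each raised to p = 1 / (n - 1).\<close>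

lemma lattice_GNS_pos:
  fixes f v :: "('n::finite \<Rightarrow> int) \<Rightarrow> real"
  assumes n: "CARD('n) \<ge> 2" and f: "\<And>k. f k > 0" and v: "\<And>k. v k \<ge> 0"
    and le: "\<And>j k. k \<in> lbox R \<Longrightarrow> v k \<le> line_sum {- int R..int R} j f k"
  shows "(\<Sum>k\<in>lbox R. v k powr (real CARD('n) / (real CARD('n) - 1)))
       \<le> (\<Sum>k\<in>lbox R. f k) powr (real CARD('n) / (real CARD('n) - 1))"
proof -
  let ?S = "{- int R..int R}"
  define p where "p = 1 / (real CARD('n) - 1)"
  have p: "p > 0" using n by (simp add: p_def)
  have n1: "(real CARD('n) - 1) * p = 1" using n by (simp add: p_def)
  have n2: "real CARD('n) / (real CARD('n) - 1) = real CARD('n) * p" by (simp add: p_def)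
  have n3: "real CARD('n) * p = 1 + p" using n1 by (simp add: left_diff_distrib)
  obtain js :: "'n list" where js: "set js = UNIV" "distinct js"
    using finite_distinct_list[of "UNIV :: 'n set"] by auto
  have len: "length js = CARD('n)" using distinct_card[OF js(2)] js(1) by simp
  have X: "{y. (\<forall>i\<in>set js. y i \<in> ?S) \<and> (\<forall>i. i \<notin> set js \<longrightarrow> y i = k i)} = lbox R" for k
  proof -
    have "\<bar>a\<bar> \<le> int R \<longleftrightarrow> a \<in> ?S" for a by auto
    then show ?thesis using js(1) by (simp add: lbox_def)
  qed
  have eq: "iter_line_sum ?S js h k = (\<Sum>y\<in>lbox R. h y)" for h k
    using iter_line_sum_eq[OF js(2), of ?S h k] by (simp only: X) simp
  have "(\<Sum>k\<in>lbox R. v k powr (real CARD('n) * p)) \<le> (\<Sum>k\<in>lbox R. \<Prod>i\<in>UNIV. line_sum ?S i f k powr p)"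
  proof (rule sum_mono)
    fix k :: "'n \<Rightarrow> int" assume k: "k \<in> lbox R"
    have "v k powr (real CARD('n) * p) = (\<Prod>i\<in>(UNIV::'n set). v k powr p)"
      using v[of k] by (cases "v k = 0") (simp_all add: powr_realpow[symmetric] powr_powr mult.commute)
    also have "\<dots> \<le> (\<Prod>i\<in>UNIV. line_sum ?S i f k powr p)"
      by (intro prod_mono) (use v le[OF k] p in \<open>auto intro!: powr_mono2\<close>)
    finally show "v k powr (real CARD('n) * p) \<le> (\<Prod>i\<in>UNIV. line_sum ?S i f k powr p)" .
  qed
  \<comment> \<open>With (n - 1) p = 1 the power of f in the Hoelder lemma has exponent 0 and equals
    1, so only the product of line sums remains.\<close>
  also have "\<dots> = iter_line_sum ?S js (\<lambda>k. f k powr (1 - (real (length js) - 1) * p) *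
      (\<Prod>i\<in>set js. line_sum ?S i f k powr p)) (\<lambda>_. 0)"
    using f[THEN less_imp_neq, THEN not_sym] unfolding eq len n1 by (simp add: js)
  also have "\<dots> \<le> iter_line_sum ?S js f (\<lambda>_. 0) powr (1 + p)"
    by (rule iter_line_sum_Holder) (use js p n1 f len in auto)
  finally show ?thesis unfolding n2 eq n3 .
qed

text \<open>Positivity of f is removed by adding a constant d > 0, harmless on a finite box, and
  letting d tend to 0.\<close>

lemma lattice_GNS:
  fixes f v :: "('n::finite \<Rightarrow> int) \<Rightarrow> real"
  assumes n: "CARD('n) \<ge> 2" and f: "\<And>k. f k \<ge> 0" and v: "\<And>k. v k \<ge> 0"
    and le: "\<And>j k. k \<in> lbox R \<Longrightarrow> v k \<le> line_sum {- int R..int R} j f k"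
  shows "(\<Sum>k\<in>lbox R. v k powr (real CARD('n) / (real CARD('n) - 1)))
       \<le> (\<Sum>k\<in>lbox R. f k) powr (real CARD('n) / (real CARD('n) - 1))"
proof (rule tendsto_lowerbound)
  let ?e = "real CARD('n) / (real CARD('n) - 1)"
  have e: "?e > 0" using n by simp
  have "((\<lambda>d. (\<Sum>k\<in>(lbox R :: ('n \<Rightarrow> int) set). f k + d) powr ?e) \<longlongrightarrow> (\<Sum>k\<in>lbox R. f k + 0) powr ?e) (at_right 0)"
  proof (intro tendsto_powr2 tendsto_intros tendsto_sum)
    show "\<forall>\<^sub>F d in at_right 0. 0 \<le> (\<Sum>k\<in>(lbox R :: ('n \<Rightarrow> int) set). f k + d)"
      unfolding eventually_at_right_field using f by (intro exI[of _ 1]) (auto intro!: sum_nonneg)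
  qed (use e in auto)
  then show "((\<lambda>d. (\<Sum>k\<in>(lbox R :: ('n \<Rightarrow> int) set). f k + d) powr ?e) \<longlongrightarrow> (\<Sum>k\<in>lbox R. f k) powr ?e) (at_right 0)"
    by simp
  have "(\<Sum>k\<in>(lbox R :: ('n \<Rightarrow> int) set). v k powr ?e) \<le> (\<Sum>k\<in>(lbox R :: ('n \<Rightarrow> int) set). f k + d) powr ?e" if "d > 0" for d
  proof (rule lattice_GNS_pos[OF n _ v])
    fix j and k :: "'n \<Rightarrow> int" assume "k \<in> lbox R"
    then have "v k \<le> line_sum {- int R..int R} j f k" by (rule le)
    also have "\<dots> \<le> line_sum {- int R..int R} j (\<lambda>k. f k + d) k" by (rule line_sum_mono) (use that in simp)
    finally show "v k \<le> line_sum {- int R..int R} j (\<lambda>k. f k + d) k" .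
  qed (use f that in \<open>auto intro: add_nonneg_pos\<close>)
  then show "\<forall>\<^sub>F d in at_right 0. (\<Sum>k\<in>lbox R. v k powr ?e) \<le> (\<Sum>k\<in>lbox R. f k + d) powr ?e"
    by (auto simp: eventually_at_filter)
qed simp

section \<open>The discrete Sobolev inequality with exponent 2n/(n-2)\<close>

lemma int_telescope_le:
  fixes h :: "int \<Rightarrow> real"
  assumes "a \<le> b"
  shows "\<bar>h b - h a\<bar> \<le> (\<Sum>t\<in>{a..<b}. \<bar>h (t + 1) - h t\<bar>)"
  using assms
proof (induction b rule: int_ge_induct)
  case (step i)
  have "{a..<i + 1} = insert i {a..<i}" using step by auto
  then show ?case using step by simp
qed simp

text \<open>The fundamental theorem of calculus along a lattice line: telescope from the coordinate
  -(R + 1), where v vanishes because the point is just outside the support box.\<close>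

lemma le_line_sum_diff:
  fixes f v :: "('n::finite \<Rightarrow> int) \<Rightarrow> real"
  assumes f: "\<And>k. f k \<ge> 0" and v0: "\<And>k. k \<notin> lbox R \<Longrightarrow> v k = 0"
    and df: "\<And>k. \<bar>v (lshift j 1 k) - v k\<bar> \<le> f k" and k: "k \<in> lbox (Suc R)"
  shows "v k \<le> line_sum {- int (Suc R)..int (Suc R)} j f k"
proof -
  let ?a = "- int (Suc R)"
  define h where "h t = v (k(j := t))" for t
  have kj: "?a \<le> k j" "k j \<le> int (Suc R)" using k by (auto simp: lbox_def abs_le_iff dest!: spec[of _ j])
  have "k(j := ?a) \<notin> lbox R" by (auto simp: lbox_def intro!: exI[of _ j])
  then have "h ?a = 0" by (simp add: h_def v0)
  then have "v k \<le> \<bar>h (k j) - h ?a\<bar>" by (simp add: h_def)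
  also have "\<dots> \<le> (\<Sum>t\<in>{?a..<k j}. \<bar>h (t + 1) - h t\<bar>)" by (rule int_telescope_le[OF kj(1)])
  also have "\<dots> \<le> (\<Sum>t\<in>{?a..<k j}. f (k(j := t)))"
  proof (rule sum_mono)
    fix t show "\<bar>h (t + 1) - h t\<bar> \<le> f (k(j := t))"
      using df[of "k(j := t)"] by (simp add: h_def lshift_def)
  qed
  also have "\<dots> \<le> (\<Sum>t\<in>{?a..int (Suc R)}. f (k(j := t)))"
    by (rule sum_mono2) (use kj f in auto)
  finally show ?thesis by (simp add: line_sum_def)
qed

text \<open>The mean value theorem, with the derivative at the intermediate point bounded by its
  values at the end points since c \<ge> 1. A zero end point is treated directly, as
  differentiability of the power is used only on the positive axis.\<close>

lemma powr_diff_le: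
  fixes a b c :: real
  assumes "a \<ge> 0" "b \<ge> 0" "c \<ge> 1"
  shows "\<bar>a powr c - b powr c\<bar> \<le> c * (a powr (c - 1) + b powr (c - 1)) * \<bar>a - b\<bar>"
proof -
  have main: "x powr c - y powr c \<le> c * (x powr (c - 1) + y powr (c - 1)) * (x - y)" if "0 \<le> y" "y < x" for x y :: real
  proof (cases "y = 0")
    case True
    have "x powr c = x powr (c - 1) * x" using that by (simp add: powr_diff)
    also have "\<dots> \<le> c * (x powr (c - 1) * x)" using assms(3) that by (simp add: mult_ge1_I)
    finally show ?thesis using True by (simp add: mult.assoc)
  next
    case False
    then have y: "0 < y" using that by simp
    have "\<exists>z. y < z \<and> z < x \<and> x powr c - y powr c = (x - y) * (c * z powr (c - 1))"
      by (rule MVT2[OF that(2)]) (use y in \<open>auto intro!: derivative_eq_intros\<close>)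
    then obtain z where z: "y < z" "z < x" "x powr c - y powr c = (x - y) * (c * z powr (c - 1))" by blast
    have "z powr (c - 1) \<le> x powr (c - 1) + y powr (c - 1)"
      using powr_mono2[of "c - 1" z x] z y assms(3) by (simp add: add_increasing2)
    then have "(x - y) * (c * z powr (c - 1)) \<le> (x - y) * (c * (x powr (c - 1) + y powr (c - 1)))"
      using that assms(3) by (intro mult_left_mono) auto
    then show ?thesis using z(3) by (simp only: mult.commute mult.left_commute mult.assoc)
  qed
  have mono: "y powr c \<le> x powr c" if "0 \<le> y" "y \<le> x" for x y :: real
    using that assms(3) by (intro powr_mono2) auto
  consider "a = b" | "b < a" | "a < b" by linarith
  then show ?thesis
  proof cases
    case 2 then show ?thesis using main[of b a] mono[of b a] assms by simp
  next
    case 3 then show ?thesis using main[of a b] mono[of a b] assms by (simp add: add.commute)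
  qed simp
qed

text \<open>With c = 2 (n - 1) / (n - 2), this is c^2 times 4 n: c comes from differentiating |g|^c,
  and 4 n from Cauchy-Schwarz over n directions with two shifted copies of |g|.\<close>

definition sobolev_const :: "nat \<Rightarrow> real" where
  "sobolev_const n = 4 * real n * (2 * (real n - 1) / (real n - 2))\<^sup>2"

text \<open>The inequality for exponent 1 is applied to |g|^c. The choice of c makes the same power
  sum P appear on both sides, on the right only to the order 1/2 after Cauchy-Schwarz, so it can be
  divided out.\<close>

lemma lattice_Sobolev:
  fixes g :: "('n::finite \<Rightarrow> int) \<Rightarrow> 'v::real_normed_vector"
  assumes n: "CARD('n) \<ge> 3" and g0: "\<And>k. k \<notin> lbox R \<Longrightarrow> g k = 0"
  shows "(\<Sum>k\<in>lbox (Suc R). norm (g k) powr sobolev_exp CARD('n))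
     \<le> (sobolev_const CARD('n) * (\<Sum>k\<in>lbox (Suc R). \<Sum>j\<in>UNIV. (norm (g (lshift j 1 k) - g k))\<^sup>2))
          powr (sobolev_exp CARD('n) / 2)"
proof -
  define N where "N = real CARD('n)"
  define c where "c = 2 * (N - 1) / (N - 2)"
  define q where "q = sobolev_exp CARD('n)"
  have N: "N \<ge> 3" using n by (simp add: N_def)
  have c: "c \<ge> 1" using N by (simp add: c_def field_simps)
  have q: "q = 2 * N / (N - 2)" by (simp add: q_def sobolev_exp_def N_def)
  have q0: "q > 0" using N by (simp add: q)
  \<comment> \<open>The two requirements that determine c: the Gagliardo exponent turns |g|^c into
    |g|^q, and the square of |g|^(c - 1) is |g|^q as well.\<close>
  have cq: "c * (N / (N - 1)) = q" "2 * (c - 1) = q"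
  proof -
    have "c * (N / (N - 1)) = 2 * N / (N - 2) * ((N - 1) / (N - 1))"
      unfolding c_def times_divide_times_eq by (simp only: mult_ac)
    then show "c * (N / (N - 1)) = q" using N by (simp add: q)
    show "2 * (c - 1) = q" using N by (simp add: c_def q field_simps)
  qed
  define P where "P = (\<Sum>k\<in>lbox (Suc R). norm (g k) powr q)"
  define E where "E = (\<Sum>k\<in>lbox (Suc R). \<Sum>j\<in>UNIV. (norm (g (lshift j 1 k) - g k))\<^sup>2)"
  define d where "d k j = norm (g (lshift j 1 k) - g k)" for k j
  define b where "b k j = norm (g (lshift j 1 k)) powr (c - 1) + norm (g k) powr (c - 1)" for k j
  define f where "f k = (\<Sum>j\<in>UNIV. c * (b k j * d k j))" for k
  define v where "v k = norm (g k) powr c" for k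
  have bd: "b k j \<ge> 0" "d k j \<ge> 0" for k j by (auto simp: b_def d_def)
  have f0: "f k \<ge> 0" for k unfolding f_def using bd c by (intro sum_nonneg) auto
  have df: "\<bar>v (lshift j 1 k) - v k\<bar> \<le> f k" for j k
  proof -
    have "\<bar>v (lshift j 1 k) - v k\<bar> \<le> c * b k j * \<bar>norm (g (lshift j 1 k)) - norm (g k)\<bar>"
      unfolding v_def b_def using c by (intro powr_diff_le) auto
    also have "\<dots> \<le> c * b k j * d k j"
      unfolding d_def using c bd[of k j] by (intro mult_left_mono norm_triangle_ineq3) auto
    also have "\<dots> = c * (b k j * d k j)" by simp
    also have "\<dots> \<le> f k" unfolding f_def
      by (rule member_le_sum) (use bd c in auto)
    finally show ?thesis .
  qed
  have v0: "v k = 0" if "k \<notin> lbox R" for k using g0[OF that] by (simp add: v_def)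
  have "(\<Sum>k\<in>lbox (Suc R). v k powr (N / (N - 1))) \<le> (\<Sum>k\<in>lbox (Suc R). f k) powr (N / (N - 1))"
    unfolding N_def
  proof (rule lattice_GNS)
    fix j and k :: "'n \<Rightarrow> int" assume "k \<in> lbox (Suc R)"
    then show "v k \<le> line_sum {- int (Suc R)..int (Suc R)} j f k"
      by (intro le_line_sum_diff f0 v0 df)
  qed (use n f0 in \<open>auto simp: v_def\<close>)
  also have "(\<Sum>k\<in>lbox (Suc R). v k powr (N / (N - 1))) = P"
    by (simp only: P_def v_def powr_powr cq)
  finally have GNS: "P \<le> (\<Sum>k\<in>lbox (Suc R). f k) powr (N / (N - 1))" .
  have P0: "P \<ge> 0" and E0: "E \<ge> 0" by (auto simp: P_def E_def intro!: sum_nonneg)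
  have shP: "(\<Sum>k\<in>lbox (Suc R). norm (g (lshift j 1 k)) powr q) = P" for j
    unfolding P_def by (rule sum_lshift[where R = R]) (use g0 in auto)
  have b2: "(b k j)\<^sup>2 \<le> 2 * (norm (g (lshift j 1 k)) powr q + norm (g k) powr q)" for k j
  proof -
    have sq: "(x powr (c - 1))\<^sup>2 = x powr q" if "x \<ge> 0" for x :: real
      using cq(2) by (simp add: power2_eq_square powr_add[symmetric])
    have "(x + y)\<^sup>2 \<le> 2 * (x\<^sup>2 + y\<^sup>2)" for x y :: real
      using zero_le_power2[of "x - y"] by (simp add: power2_sum power2_diff)
    from this[of "norm (g (lshift j 1 k)) powr (c - 1)" "norm (g k) powr (c - 1)"]
    show ?thesis unfolding b_def by (simp add: sq)
  qed
  \<comment> \<open>The constant 4 N: n directions, a factor 2 from the square of a sum of two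
    terms, and two terms that both sum to P by shift invariance.\<close>
  have B: "(\<Sum>k\<in>lbox (Suc R). \<Sum>j\<in>UNIV. (b k j)\<^sup>2) \<le> 4 * N * P"
  proof -
    have "(\<Sum>k\<in>lbox (Suc R). \<Sum>j\<in>UNIV. (b k j)\<^sup>2)
      \<le> (\<Sum>k\<in>lbox (Suc R). \<Sum>j\<in>UNIV. 2 * (norm (g (lshift j 1 k)) powr q + norm (g k) powr q))"
      by (intro sum_mono b2)
    also have "\<dots> = (\<Sum>j\<in>UNIV. \<Sum>k\<in>lbox (Suc R). 2 * (norm (g (lshift j 1 k)) powr q + norm (g k) powr q))"
      by (rule sum.swap)
    also have "\<dots> = (\<Sum>j\<in>(UNIV::'n set). 2 * (P + P))"
      by (simp only: sum_distrib_left[symmetric] sum.distrib shP P_def[symmetric])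
    also have "\<dots> = 4 * N * P" by (simp add: N_def)
    finally show ?thesis .
  qed
  have F: "(\<Sum>k\<in>lbox (Suc R). f k)\<^sup>2 \<le> c\<^sup>2 * (4 * N * P * E)"
  proof -
    let ?X = "lbox (Suc R) \<times> (UNIV :: 'n set)"
    have "(\<Sum>k\<in>lbox (Suc R). f k) = c * (\<Sum>x\<in>?X. b (fst x) (snd x) * d (fst x) (snd x))"
      by (simp add: f_def sum_distrib_left sum.cartesian_product case_prod_unfold)
    then have "(\<Sum>k\<in>lbox (Suc R). f k)\<^sup>2 = c\<^sup>2 * (\<Sum>x\<in>?X. b (fst x) (snd x) * d (fst x) (snd x))\<^sup>2"
      by (simp add: power_mult_distrib)
    also have "\<dots> \<le> c\<^sup>2 * ((\<Sum>x\<in>?X. (b (fst x) (snd x))\<^sup>2) * (\<Sum>x\<in>?X. (d (fst x) (snd x))\<^sup>2))"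
      by (intro mult_left_mono Cauchy_Schwarz_ineq_sum) auto
    also have "(\<Sum>x\<in>?X. (b (fst x) (snd x))\<^sup>2) = (\<Sum>k\<in>lbox (Suc R). \<Sum>j\<in>UNIV. (b k j)\<^sup>2)"
      by (simp add: sum.cartesian_product case_prod_unfold)
    also have "(\<Sum>x\<in>?X. (d (fst x) (snd x))\<^sup>2) = E"
      by (simp add: E_def d_def sum.cartesian_product case_prod_unfold)
    also have "c\<^sup>2 * ((\<Sum>k\<in>lbox (Suc R). \<Sum>j\<in>UNIV. (b k j)\<^sup>2) * E) \<le> c\<^sup>2 * (4 * N * P * E)"
      by (intro mult_left_mono mult_right_mono B E0) auto
    finally show ?thesis .
  qed
  define K where "K = sobolev_const CARD('n)"
  have K: "K = c\<^sup>2 * (4 * N)" by (simp add: K_def sobolev_const_def c_def N_def)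
  \<comment> \<open>For P > 0, the Gagliardo bound and Cauchy-Schwarz give P to the power 2 (N - 1)
    / N below K E P; cancelling P leaves (N - 2) / N, whose reciprocal is q / 2.\<close>
  have "P \<le> (K * E) powr (q / 2)"
  proof (cases "P = 0")
    case False
    then have P1: "P > 0" using P0 by simp
    let ?s = "\<Sum>k\<in>lbox (Suc R). f k"
    have s0: "?s \<ge> 0" by (intro sum_nonneg f0)
    have "P powr ((N - 1) / N) \<le> (?s powr (N / (N - 1))) powr ((N - 1) / N)"
      using GNS P0 N by (intro powr_mono2) auto
    also have "\<dots> = ?s" using N s0 by (simp add: powr_powr)
    finally have "(P powr ((N - 1) / N))\<^sup>2 \<le> ?s\<^sup>2" by (intro power_mono) auto
    also have "\<dots> \<le> K * E * P" using F by (simp add: K mult_ac)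
    also have "(P powr ((N - 1) / N))\<^sup>2 = P powr (2 * ((N - 1) / N))"
      by (simp add: power2_eq_square powr_add[symmetric])
    also have "2 * ((N - 1) / N) = (N - 2) / N + 1" using N by (simp add: field_simps)
    also have "P powr ((N - 2) / N + 1) = P powr ((N - 2) / N) * P" using P1 by (simp add: powr_add)
    finally have KE: "P powr ((N - 2) / N) \<le> K * E" using P1 by simp
    have "P = (P powr ((N - 2) / N)) powr (q / 2)" using P1 N by (simp add: powr_powr q)
    also have "\<dots> \<le> (K * E) powr (q / 2)" using KE q0 by (intro powr_mono2) auto
    finally show ?thesis .
  qed simp
  then show ?thesis by (simp add: P_def E_def K_def q_def)
qed

section \<open>From the lattice to compactly supported continuously differentiable maps\<close>

definition lvec :: "real \<Rightarrow> ('n::finite \<Rightarrow> int) \<Rightarrow> real^'n" where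
  "lvec h k = (\<chi> i. h * of_int (k i))"

definition lfloor :: "real \<Rightarrow> real^'n::finite \<Rightarrow> 'n \<Rightarrow> int" where
  "lfloor h x = (\<lambda>i. \<lfloor>x $ i / h\<rfloor>)"

lemma lvec_lshift: "lvec h (lshift j d k) = lvec h k + (h * of_int d) *\<^sub>R axis j 1"
  by (simp add: vec_eq_iff lvec_def lshift_def axis_def distrib_left)

lemma lfloor_eq_iff:
  assumes "h > 0"
  shows "lfloor h x = k \<longleftrightarrow> (\<forall>i. h * of_int (k i) \<le> x $ i \<and> x $ i < h * (of_int (k i) + 1))"
  unfolding lfloor_def fun_eq_iff floor_eq_iff using assms by (simp add: field_simps)

lemma norm_lvec_lfloor:
  fixes x :: "real^'n::finite"
  assumes "h > 0"
  shows "norm (lvec h (lfloor h x) - x) \<le> real CARD('n) * h"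
proof -
  have "\<bar>(lvec h (lfloor h x) - x) $ i\<bar> \<le> h" for i
    using lfloor_eq_iff[OF assms, of x "lfloor h x"]
    by (auto simp: lvec_def distrib_left dest!: spec[of _ i])
  then have "(\<Sum>i\<in>UNIV. \<bar>(lvec h (lfloor h x) - x) $ i\<bar>) \<le> (\<Sum>i\<in>(UNIV::'n set). h)"
    by (intro sum_mono)
  then show ?thesis using norm_le_l1_cart[of "lvec h (lfloor h x) - x"] by simp
qed

text \<open>The half-open cell lies between the open and the closed box with the same corners, and
  these have equal measure.\<close>

lemma lcell_measure:
  fixes k :: "'n::finite \<Rightarrow> int"
  assumes h: "h > 0"
  shows "{x. lfloor h x = k} \<in> sets borel" "emeasure lborel {x. lfloor h x = k} = ennreal (h ^ CARD('n))"
proof -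
  have "{x. lfloor h x = k} = (\<Inter>i. {x. h * of_int (k i) \<le> x $ i} \<inter> {x. x $ i < h * (of_int (k i) + 1)})"
    by (auto simp: lfloor_eq_iff[OF h])
  also have "\<dots> \<in> sets borel"
    by (intro borel_closed borel_open sets.countable_INT' sets.Int)
       (auto intro!: closed_Collect_le open_Collect_less continuous_intros)
  finally show meas: "{x. lfloor h x = k} \<in> sets borel" .
  define a where "a = lvec h k"
  define b where "b = lvec h k + (\<chi> i. h)"
  have sub: "box a b \<subseteq> {x. lfloor h x = k}" "{x. lfloor h x = k} \<subseteq> cbox a b"
    by (auto simp: lfloor_eq_iff[OF h] mem_box_cart a_def b_def lvec_def distrib_left less_imp_le)
  have inn: "(b - a) \<bullet> i = h" if "i \<in> Basis" for i
    using that by (auto simp: Basis_vec_def b_def a_def inner_axis)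
  have le: "a \<bullet> i \<le> b \<bullet> i" if "i \<in> Basis" for i
    using inn[OF that] h by (simp add: inner_diff_left)
  have pr: "(\<Prod>i\<in>Basis. (b - a) \<bullet> i) = h ^ CARD('n)"
    by (simp add: inn cong: prod.cong)
  have "emeasure lborel {x. lfloor h x = k} \<le> emeasure lborel (cbox a b)"
    by (rule emeasure_mono) (use sub in auto)
  moreover have "emeasure lborel (box a b) \<le> emeasure lborel {x. lfloor h x = k}"
    by (rule emeasure_mono) (use sub meas in auto)
  ultimately show "emeasure lborel {x. lfloor h x = k} = ennreal (h ^ CARD('n))"
    using le by (simp add: emeasure_lborel_box_eq emeasure_lborel_cbox_eq pr)
qed

lemma has_bochner_integral_lattice:
  fixes \<phi> :: "('n::finite \<Rightarrow> int) \<Rightarrow> real"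
  assumes h: "h > 0" and \<phi>: "\<And>k. k \<notin> lbox R \<Longrightarrow> \<phi> k = 0"
  shows "has_bochner_integral lborel (\<lambda>x. \<phi> (lfloor h x)) (h ^ CARD('n) * (\<Sum>k\<in>lbox R. \<phi> k))"
proof -
  have "has_bochner_integral lborel (\<lambda>x. \<Sum>k\<in>lbox R. indicator {x. lfloor h x = k} x *\<^sub>R \<phi> k)
      (\<Sum>k\<in>(lbox R :: ('n \<Rightarrow> int) set). measure lborel {x. lfloor h x = k} *\<^sub>R \<phi> k)"
    by (intro has_bochner_integral_sum has_bochner_integral_indicator)
       (auto simp: lcell_measure[OF h])
  moreover have "(\<Sum>k\<in>lbox R. indicator {x. lfloor h x = k} x *\<^sub>R \<phi> k) = \<phi> (lfloor h x)" for x
  proof -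
    have "(\<Sum>k\<in>lbox R. indicator {x. lfloor h x = k} x *\<^sub>R \<phi> k) = (\<Sum>k\<in>lbox R. if lfloor h x = k then \<phi> k else 0)"
      by (intro sum.cong) (auto simp: indicator_def)
    then show ?thesis using \<phi>[of "lfloor h x"] by auto
  qed
  moreover have "measure lborel {x. lfloor h x = k} = h ^ CARD('n)" for k :: "'n \<Rightarrow> int"
    using lcell_measure(2)[OF h, of k] h by (simp add: measure_def)
  ultimately show ?thesis by (simp add: sum_distrib_left)
qed

text \<open>Only partial derivatives along the axes with a continuous matrix of values, and no total
  derivative: this is what difference quotients see and what differentiation under a convolution
  integral delivers.\<close>

definition C1_compact :: "(real^'n \<Rightarrow> real^'m) \<Rightarrow> (real^'n \<Rightarrow> real^'n^'m) \<Rightarrow> bool" where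
  "C1_compact w Dw \<longleftrightarrow> continuous_on UNIV w \<and> continuous_on UNIV Dw \<and> (\<exists>R. \<forall>x. norm x > R \<longrightarrow> w x = 0) \<and>
     (\<forall>x b j. ((\<lambda>t. w (x + t *\<^sub>R axis j 1) $ b) has_real_derivative Dw x $ b $ j) (at 0))"

lemma line_derivative_shift:
  fixes f :: "real^'n \<Rightarrow> real"
  assumes "\<And>x. ((\<lambda>t. f (x + t *\<^sub>R axis j 1)) has_real_derivative D x) (at 0)"
  shows "((\<lambda>t. f (x + t *\<^sub>R axis j 1)) has_real_derivative D (x + s *\<^sub>R axis j 1)) (at s)"
proof -
  have "(\<lambda>t. f (x + (t + s) *\<^sub>R axis j 1)) = (\<lambda>t. f ((x + s *\<^sub>R axis j 1) + t *\<^sub>R axis j 1))"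
    by (simp add: scaleR_left_distrib ac_simps)
  then have "((\<lambda>t. f (x + (t + s) *\<^sub>R axis j 1)) has_real_derivative D (x + s *\<^sub>R axis j 1)) (at 0)"
    using assms[of "x + s *\<^sub>R axis j 1"] by simp
  then show ?thesis
    using DERIV_shift[of "\<lambda>t. f (x + t *\<^sub>R axis j 1)" _ 0 s] by simp
qed

lemma line_mean_value:
  fixes f :: "real^'n \<Rightarrow> real"
  assumes "\<And>x. ((\<lambda>t. f (x + t *\<^sub>R axis j 1)) has_real_derivative D x) (at 0)" "a < b"
  obtains s where "a < s" "s < b"
    "f (x + b *\<^sub>R axis j 1) - f (x + a *\<^sub>R axis j 1) = (b - a) * D (x + s *\<^sub>R axis j 1)"
proof -
  have "\<exists>s. a < s \<and> s < b \<and> f (x + b *\<^sub>R axis j 1) - f (x + a *\<^sub>R axis j 1) = (b - a) * D (x + s *\<^sub>R axis j 1)"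
    by (rule MVT2[OF assms(2)]) (rule line_derivative_shift[OF assms(1)])
  then show ?thesis using that by blast
qed

lemma line_derivative_zero_outside:
  fixes f D :: "real^'n::finite \<Rightarrow> real"
  assumes d: "\<And>x. ((\<lambda>t. f (x + t *\<^sub>R axis j 1)) has_real_derivative D x) (at 0)"
    and f0: "\<And>x. norm x > R \<Longrightarrow> f x = 0" and x: "norm x > R"
  shows "D x = 0"
proof -
  have "((\<lambda>t. norm (x + t *\<^sub>R axis j 1)) \<longlongrightarrow> norm (x + 0 *\<^sub>R axis j 1)) (at 0)"
    by (intro tendsto_intros)
  then have "\<forall>\<^sub>F t in at 0. norm (x + t *\<^sub>R axis j 1) > R"
    by (rule order_tendstoD) (use x in simp)
  then have ev: "\<forall>\<^sub>F t in nhds 0. f (x + t *\<^sub>R axis j 1) = 0"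
    using f0 x by (auto simp: eventually_at_filter elim!: eventually_mono)
  have "((\<lambda>t. 0) has_real_derivative D x) (at 0)"
    using d[of x] DERIV_cong_ev[OF refl ev refl] by simp
  then show ?thesis by (metis DERIV_const DERIV_unique)
qed

lemma C1_compact_deriv_zero:
  assumes "C1_compact w Dw" "\<And>x. norm x > R \<Longrightarrow> w x = 0" "norm x > R"
  shows "Dw x = 0"
proof -
  have "Dw x $ b $ j = 0" for b j
    by (rule line_derivative_zero_outside[where f = "\<lambda>x. w x $ b" and R = R and j = j])
      (use assms in \<open>auto simp: C1_compact_def\<close>)
  then show ?thesis by (simp add: vec_eq_iff)
qed

lemma norm_matrix_le_sum: "norm (X :: real^'n^'m) \<le> (\<Sum>b\<in>UNIV. \<Sum>j\<in>UNIV. \<bar>X $ b $ j\<bar>)"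
proof -
  have "norm X \<le> (\<Sum>b\<in>UNIV. norm (X $ b))"
    unfolding norm_vec_def by (rule L2_set_le_sum) simp
  also have "\<dots> \<le> (\<Sum>b\<in>UNIV. \<Sum>j\<in>UNIV. \<bar>X $ b $ j\<bar>)"
    by (intro sum_mono norm_le_l1_cart)
  finally show ?thesis .
qed

lemma matrix_entry_le_norm: "\<bar>(X :: real^'n^'m) $ b $ j\<bar> \<le> norm X"
  by (rule order_trans[OF component_le_norm_cart Finite_Cartesian_Product.norm_nth_le])

lemma dominated_on_cball:
  fixes \<phi> :: "'a::euclidean_space \<Rightarrow> real" and \<phi>s :: "nat \<Rightarrow> 'a \<Rightarrow> real"
  assumes "\<And>i. \<phi>s i \<in> borel_measurable lborel" "\<And>x. (\<lambda>i. \<phi>s i x) \<longlonglongrightarrow> \<phi> x"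
    and "\<And>i x. \<bar>\<phi>s i x\<bar> \<le> K" "\<And>i x. norm x > \<rho> \<Longrightarrow> \<phi>s i x = 0"
  shows "(\<lambda>i. \<integral>x. \<phi>s i x \<partial>lborel) \<longlonglongrightarrow> (\<integral>x. \<phi> x \<partial>lborel)"
proof (rule integral_dominated_convergence[where w = "\<lambda>x. K * indicator (cball 0 \<rho>) x"])
  show "\<phi> \<in> borel_measurable lborel" by (rule borel_measurable_LIMSEQ_real[where u = \<phi>s]) (use assms in auto)
  show "integrable lborel (\<lambda>x. K * indicator (cball (0::'a) \<rho>) x)"
    using emeasure_bounded_finite[OF bounded_cball, of "0::'a" \<rho>]
    by (intro integrable_mult_right integrable_real_indicator) auto
  show "AE x in lborel. norm (\<phi>s i x) \<le> K * indicator (cball 0 \<rho>) x" for i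
    using assms(3)[of i] assms(4)[where i = i] by (auto simp: indicator_def not_le intro!: AE_I2)
qed (use assms in auto)

lemma bounded_if_continuous_compact:
  fixes f :: "real^'n \<Rightarrow> 'b::real_normed_vector"
  assumes "continuous_on UNIV f" "\<And>x. norm x > R \<Longrightarrow> f x = 0"
  obtains K where "K > 0" "\<And>x. norm (f x) \<le> K"
proof -
  have "bounded (f ` cball 0 R)"
    by (intro compact_imp_bounded compact_continuous_image continuous_on_subset[OF assms(1)]) auto
  then obtain K where K: "K > 0" "\<And>x. x \<in> cball 0 R \<Longrightarrow> norm (f x) \<le> K" by (auto simp: bounded_pos)
  show ?thesis
  proof (rule that[OF K(1)])
    fix x show "norm (f x) \<le> K"
      using K assms(2)[of x] by (cases "norm x > R") auto
  qed
qed

lemma tendsto_of_nearby_values: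
  fixes D :: "'a::real_normed_vector \<Rightarrow> 'b::topological_space"
  assumes h: "h \<longlonglongrightarrow> (0::real)" and D: "continuous_on UNIV D"
    and a: "\<And>i. \<exists>z. norm (z - x) \<le> C * h i \<and> a i = D z"
  shows "a \<longlonglongrightarrow> D x"
proof -
  obtain z where z: "\<And>i. norm (z i - x) \<le> C * h i" "\<And>i. a i = D (z i)" using a by metis
  have "(\<lambda>i. C * h i) \<longlonglongrightarrow> 0" using tendsto_mult_left[OF h, of C] by simp
  then have "(\<lambda>i. z i - x) \<longlonglongrightarrow> 0" by (rule Lim_null_comparison[rotated]) (use z in auto)
  then have "z \<longlonglongrightarrow> x" using LIM_zero_iff by blast
  then have "(\<lambda>i. D (z i)) \<longlonglongrightarrow> D x"
    by (rule continuous_on_tendsto_compose[OF D]) auto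
  moreover have "a = (\<lambda>i. D (z i))" by (rule ext) (rule z(2))
  ultimately show ?thesis by simp
qed

text \<open>Both inequalities hold on the lattice \<open>h \<int>\<^sup>n\<close>; the lattice sums are integrals of functions
  that are constant on the cells, and they converge as \<open>h \<rightarrow> 0\<close>.\<close>

lemma C1_compact_estimates:
  fixes w :: "real^'n \<Rightarrow> real^'m" and Dw :: "real^'n \<Rightarrow> real^'n^'m"
  assumes C1: "C1_compact w Dw"
  shows C1_compact_elliptic: "elliptic_with \<nu> B \<Longrightarrow>
      \<nu>\<^sup>2 * (\<integral>x. (norm (Dw x))\<^sup>2 \<partial>lborel) \<le> (\<integral>x. (norm (B (Dw x)))\<^sup>2 \<partial>lborel)"
    and C1_compact_Sobolev: "CARD('n) \<ge> 3 \<Longrightarrow>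
      (\<integral>x. norm (w x) powr sobolev_exp CARD('n) \<partial>lborel)
        \<le> (sobolev_const CARD('n) * (\<integral>x. (norm (Dw x))\<^sup>2 \<partial>lborel)) powr (sobolev_exp CARD('n) / 2)"
proof -
  define N where "N = real CARD('n)"
  define h :: "nat \<Rightarrow> real" where "h i = inverse (Suc i)" for i
  have h0: "h i > 0" and h1: "h i \<le> 1" for i by (simp_all add: h_def divide_simps)
  have hlim: "h \<longlonglongrightarrow> 0" unfolding h_def by (rule LIMSEQ_inverse_real_of_nat)
  have cw: "continuous_on UNIV w" and cD: "continuous_on UNIV Dw"
    and der: "\<And>x b j. ((\<lambda>t. w (x + t *\<^sub>R axis j 1) $ b) has_real_derivative Dw x $ b $ j) (at 0)"
    using C1 by (auto simp: C1_compact_def)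
  obtain R where w0: "\<And>x. norm x > R \<Longrightarrow> w x = 0" using C1 by (auto simp: C1_compact_def)
  have D0: "\<And>x. norm x > R \<Longrightarrow> Dw x = 0" using C1_compact_deriv_zero[OF C1 w0] .
  obtain K where K: "K > 0" "\<And>x. norm (Dw x) \<le> K" using bounded_if_continuous_compact[OF cD D0] by blast
  obtain L where L: "L > 0" "\<And>x. norm (w x) \<le> L" using bounded_if_continuous_compact[OF cw w0] by blast
  \<comment> \<open>All lattice quantities at x are values at points within (N + 1) h of x, and h
    \<le> 1; hence everything vanishes outside the ball of radius \<rho>, uniformly in the
    mesh.\<close>
  define \<rho> where "\<rho> = R + N + 1"
  define y where "y i x = lvec (h i) (lfloor (h i) x)" for i and x :: "real^'n"
  define g where "g i k = w (lvec (h i) k)" for i k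
  define r where "r i = nat \<lceil>R / h i\<rceil>" for i
  have g0: "g i k = 0" if "k \<notin> lbox (r i)" for i k
  proof -
    obtain j where j: "\<bar>k j\<bar> > int (r i)" using \<open>k \<notin> lbox (r i)\<close> by (auto simp: lbox_def not_le)
    have "R / h i \<le> real (r i)" unfolding r_def by (rule real_nat_ceiling_ge)
    also have "\<dots> < \<bar>real_of_int (k j)\<bar>" using j by linarith
    finally have "R < \<bar>lvec (h i) k $ j\<bar>" using h0[of i] by (simp add: lvec_def abs_mult field_simps)
    also have "\<dots> \<le> norm (lvec (h i) k)" by (rule component_le_norm_cart)
    finally show ?thesis by (simp add: g_def w0)
  qed
  have yx: "norm (y i x - x) \<le> N * h i" for i x
    unfolding y_def N_def by (rule norm_lvec_lfloor[OF h0])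
  have near: "norm z > R" if "norm (z - x) \<le> (N + 1) * h i" "norm x > \<rho>" for z x :: "real^'n" and i
  proof -
    have "(N + 1) * h i \<le> (N + 1) * 1" by (intro mult_left_mono h1) (simp add: N_def)
    then show ?thesis using that norm_triangle_ineq2[of x "x - z"] by (simp add: \<rho>_def norm_minus_commute)
  qed
  note conv = tendsto_of_nearby_values[OF hlim, where C = "N + 1"]
  \<comment> \<open>Central quotients serve the elliptic inequality, whose proof needs their
    imaginary symbol; the forward quotients \<open>fd\<close> serve the Sobolev inequality, whose
    proof telescopes from one cell to the next.\<close>
  define cd where "cd i k = (1 / (2 * h i)) *\<^sub>R cdiff (g i) k" for i k
  define fd where "fd i k = (\<chi> b j. (g i (lshift j 1 k) $ b - g i k $ b) / h i) " for i k
  \<comment> \<open>The mean value theorem realises each difference quotient as a derivative at a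
    point close to x, which gives convergence, a uniform bound and a common support at once.\<close>
  have dq: "\<exists>z. norm (z - x) \<le> (N + 1) * h i \<and>
      (w (y i x + t *\<^sub>R axis j 1) $ b - w (y i x + s *\<^sub>R axis j 1) $ b) / (t - s) = Dw z $ b $ j"
    if "- h i \<le> s" "s < t" "t \<le> h i" for i x s t b j
  proof -
    from line_mean_value[OF der that(2), where x = "y i x"]
    obtain u where u: "s < u" "u < t" "w (y i x + t *\<^sub>R axis j 1) $ b - w (y i x + s *\<^sub>R axis j 1) $ b
        = (t - s) * Dw (y i x + u *\<^sub>R axis j 1) $ b $ j" by blast
    have "norm (y i x + u *\<^sub>R axis j 1 - x) \<le> norm (y i x - x) + norm (u *\<^sub>R axis j (1::real) :: real^'n)"
      using norm_triangle_ineq[of "y i x - x" "u *\<^sub>R axis j 1"] by (simp add: algebra_simps)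
    also have "\<dots> \<le> N * h i + h i" using yx[of i x] u that by (simp add: norm_axis_1)
    finally show ?thesis using u by (intro exI[of _ "y i x + u *\<^sub>R axis j 1"]) (simp add: distrib_right)
  qed
  have cdz: "\<exists>z. norm (z - x) \<le> (N + 1) * h i \<and> cd i (lfloor (h i) x) $ b $ j = Dw z $ b $ j" for i x b j
    using dq[of i "- h i" "h i" x j b] h0[of i]
    by (simp add: cd_def cdiff_def g_def lvec_lshift y_def)
  have fdz: "\<exists>z. norm (z - x) \<le> (N + 1) * h i \<and> fd i (lfloor (h i) x) $ b $ j = Dw z $ b $ j" for i x b j
    using dq[of i 0 "h i" x j b] h0[of i]
    by (simp add: fd_def cdiff_def g_def lvec_lshift y_def)
  define K' where "K' = real CARD('m) * (real CARD('n) * K)"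
  have K'0: "K' \<ge> 0" using K by (simp add: K'_def)
  \<comment> \<open>The nearby point may differ from entry to entry of the matrix; therefore the
    norm is bounded by K', the entry bound K times the number of entries.\<close>
  have zprop: "(\<lambda>i. X i) \<longlonglongrightarrow> Dw x \<and> (\<forall>i. norm (X i) \<le> K') \<and> (norm x > \<rho> \<longrightarrow> (\<forall>i. X i = 0))"
    if X: "\<And>i b j. \<exists>z. norm (z - x) \<le> (N + 1) * h i \<and> X i $ b $ j = Dw z $ b $ j"
    for X :: "nat \<Rightarrow> real^'n^'m" and x
  proof (intro conjI allI impI)
    show "(\<lambda>i. X i) \<longlonglongrightarrow> Dw x"
    proof (intro vec_tendstoI)
      fix b j show "(\<lambda>i. X i $ b $ j) \<longlonglongrightarrow> Dw x $ b $ j"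
        by (rule conv[where D = "\<lambda>x. Dw x $ b $ j"]) (use X cD in \<open>auto intro!: continuous_intros\<close>)
    qed
    fix i
    have "\<bar>X i $ b $ j\<bar> \<le> K" for b j
      using X[of i b j] matrix_entry_le_norm order_trans[OF _ K(2)] by metis
    then have "(\<Sum>b\<in>UNIV. \<Sum>j\<in>UNIV. \<bar>X i $ b $ j\<bar>) \<le> (\<Sum>b\<in>(UNIV::'m set). \<Sum>j\<in>(UNIV::'n set). K)"
      by (intro sum_mono)
    then show "norm (X i) \<le> K'" using norm_matrix_le_sum[of "X i"] by (simp add: K'_def)
  next
    fix i assume "norm x > \<rho>"
    then have "X i $ b $ j = 0" for b j
      using X[of i b j] near D0 by (metis zero_index)
    then show "X i = 0" by (simp add: vec_eq_iff)
  qed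
  note cdp = zprop[OF cdz] and fdp = zprop[OF fdz]
  \<comment> \<open>One limit passage for every continuous integrand that vanishes at 0: the scaled
    lattice sum is the integral of a step function, and dominated convergence applies on a fixed
    ball.\<close>
  have lim: "(\<lambda>i. \<integral>x. \<Phi> (X i (lfloor (h i) x)) \<partial>lborel) \<longlonglongrightarrow> (\<integral>x. \<Phi> (Dw x) \<partial>lborel)
      \<and> (\<forall>i. (\<integral>x. \<Phi> (X i (lfloor (h i) x)) \<partial>lborel) = h i ^ CARD('n) * (\<Sum>k\<in>lbox (Suc (r i)). \<Phi> (X i k)))"
    if X: "\<And>i x b j. \<exists>z. norm (z - x) \<le> (N + 1) * h i \<and> X i (lfloor (h i) x) $ b $ j = Dw z $ b $ j"
      and X0: "\<And>i k. k \<notin> lbox (Suc (r i)) \<Longrightarrow> X i k = 0"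
      and \<Phi>: "continuous_on UNIV \<Phi>" "\<Phi> 0 = 0" for \<Phi> :: "real^'n^'m \<Rightarrow> real" and X
  proof -
    have hb: "has_bochner_integral lborel (\<lambda>x. \<Phi> (X i (lfloor (h i) x)))
        (h i ^ CARD('n) * (\<Sum>k\<in>lbox (Suc (r i)). \<Phi> (X i k)))" for i
      by (rule has_bochner_integral_lattice[OF h0]) (simp add: X0 \<Phi>(2))
    have "compact (\<Phi> ` cball 0 K')"
      by (intro compact_continuous_image continuous_on_subset[OF \<Phi>(1)]) auto
    then obtain M where M: "\<And>Y. norm Y \<le> K' \<Longrightarrow> \<bar>\<Phi> Y\<bar> \<le> M"
      by (force dest!: compact_imp_bounded simp: bounded_iff)
    have "(\<lambda>i. \<integral>x. \<Phi> (X i (lfloor (h i) x)) \<partial>lborel) \<longlonglongrightarrow> (\<integral>x. \<Phi> (Dw x) \<partial>lborel)"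
    proof (rule dominated_on_cball)
      show "(\<lambda>x. \<Phi> (X i (lfloor (h i) x))) \<in> borel_measurable lborel" for i
        by (rule borel_measurable_has_bochner_integral[OF hb])
      fix x
      note px = zprop[OF X]
      show "(\<lambda>i. \<Phi> (X i (lfloor (h i) x))) \<longlonglongrightarrow> \<Phi> (Dw x)"
        by (rule continuous_on_tendsto_compose[OF \<Phi>(1)]) (use px in auto)
      show "\<bar>\<Phi> (X i (lfloor (h i) x))\<bar> \<le> M" for i by (intro M) (use px in auto)
      show "\<Phi> (X i (lfloor (h i) x)) = 0" if "norm x > \<rho>" for i using px that by (simp add: \<Phi>(2))
    qed
    then show ?thesis using hb by (auto simp: has_bochner_integral_iff)
  qed
  have cd0: "cd i k = 0" if "k \<notin> lbox (Suc (r i))" for i k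
    using that g0[OF lshift_notin_lbox[OF that, of 1]] g0[OF lshift_notin_lbox[OF that, of "-1"]]
    by (simp add: cd_def cdiff_def vec_eq_iff)
  \<comment> \<open>The shift by 0, in an arbitrary direction, merely says that k is also outside
    the smaller box.\<close>
  have fd0: "fd i k = 0" if "k \<notin> lbox (Suc (r i))" for i k
    using that g0[OF lshift_notin_lbox[OF that, of 1]] g0[OF lshift_notin_lbox[OF that, of 0 undefined]]
    by (simp add: fd_def vec_eq_iff)

  { assume B: "elliptic_with \<nu> B"
    then have lin: "linear B" by (simp add: elliptic_with_def)
    have cB: "continuous_on UNIV (\<lambda>Y. (norm (B Y))\<^sup>2)"
      by (intro continuous_intros linear_continuous_on linear_conv_bounded_linear[THEN iffD1] lin)
    have l1: "(\<lambda>i. \<integral>x. (norm (cd i (lfloor (h i) x)))\<^sup>2 \<partial>lborel) \<longlonglongrightarrow> (\<integral>x. (norm (Dw x))\<^sup>2 \<partial>lborel)"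
      and e1: "\<And>i. (\<integral>x. (norm (cd i (lfloor (h i) x)))\<^sup>2 \<partial>lborel) = h i ^ CARD('n) * (\<Sum>k\<in>lbox (Suc (r i)). (norm (cd i k))\<^sup>2)"
      using lim[of cd "\<lambda>Y. (norm Y)\<^sup>2", OF cdz cd0] by (auto intro!: continuous_intros)
    have l2: "(\<lambda>i. \<integral>x. (norm (B (cd i (lfloor (h i) x))))\<^sup>2 \<partial>lborel) \<longlonglongrightarrow> (\<integral>x. (norm (B (Dw x)))\<^sup>2 \<partial>lborel)"
      and e2: "\<And>i. (\<integral>x. (norm (B (cd i (lfloor (h i) x))))\<^sup>2 \<partial>lborel) = h i ^ CARD('n) * (\<Sum>k\<in>lbox (Suc (r i)). (norm (B (cd i k)))\<^sup>2)"
      using lim[of cd "\<lambda>Y. (norm (B Y))\<^sup>2", OF cdz cd0 cB] lin by (auto simp: linear_0)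
    have "\<nu>\<^sup>2 * (\<integral>x. (norm (cd i (lfloor (h i) x)))\<^sup>2 \<partial>lborel) \<le> (\<integral>x. (norm (B (cd i (lfloor (h i) x))))\<^sup>2 \<partial>lborel)" for i
    proof -
      let ?c = "h i ^ CARD('n) * (1 / (2 * h i))\<^sup>2"
      have "\<nu>\<^sup>2 * (\<integral>x. (norm (cd i (lfloor (h i) x)))\<^sup>2 \<partial>lborel)
          = ?c * (\<nu>\<^sup>2 * (\<Sum>k\<in>lbox (Suc (r i)). (norm (cdiff (g i) k))\<^sup>2))"
        unfolding e1 by (simp add: cd_def power_mult_distrib sum_divide_distrib[symmetric] power_divide)
      also have "\<dots> \<le> ?c * (\<Sum>k\<in>lbox (Suc (r i)). (norm (B (cdiff (g i) k)))\<^sup>2)"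
        by (intro mult_left_mono lattice_elliptic_estimate[OF B g0]) (use h0[of i] in auto)
      also have "\<dots> = (\<integral>x. (norm (B (cd i (lfloor (h i) x))))\<^sup>2 \<partial>lborel)"
        unfolding e2 by (simp add: cd_def linear_scale[OF lin] power_mult_distrib sum_divide_distrib[symmetric] power_divide)
      finally show ?thesis .
    qed
    then show "\<nu>\<^sup>2 * (\<integral>x. (norm (Dw x))\<^sup>2 \<partial>lborel) \<le> (\<integral>x. (norm (B (Dw x)))\<^sup>2 \<partial>lborel)"
      by (intro LIMSEQ_le[OF tendsto_mult_left[OF l1] l2]) auto
  }
  assume n: "CARD('n) \<ge> 3"
  define q where "q = sobolev_exp CARD('n)"
  define C where "C = sobolev_const CARD('n)"
  have N: "N \<ge> 3" using n by (simp add: N_def)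
  have q: "q = 2 * N / (N - 2)" by (simp add: q_def sobolev_exp_def N_def)
  have q0: "q > 0" using N by (simp add: q)
  have C0: "C \<ge> 0" by (simp add: C_def sobolev_const_def)
  have l1: "(\<lambda>i. \<integral>x. (norm (fd i (lfloor (h i) x)))\<^sup>2 \<partial>lborel) \<longlonglongrightarrow> (\<integral>x. (norm (Dw x))\<^sup>2 \<partial>lborel)"
    and e1: "\<And>i. (\<integral>x. (norm (fd i (lfloor (h i) x)))\<^sup>2 \<partial>lborel) = h i ^ CARD('n) * (\<Sum>k\<in>lbox (Suc (r i)). (norm (fd i k))\<^sup>2)"
    using lim[of fd "\<lambda>Y. (norm Y)\<^sup>2", OF fdz fd0] by (auto intro!: continuous_intros)
  have hb: "has_bochner_integral lborel (\<lambda>x. norm (g i (lfloor (h i) x)) powr q)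
        (h i ^ CARD('n) * (\<Sum>k\<in>lbox (Suc (r i)). norm (g i k) powr q))" for i
    by (rule has_bochner_integral_lattice[OF h0]) (use g0 lbox_mono[of "r i" "Suc (r i)"] in auto)
  have wz: "\<exists>z. norm (z - x) \<le> (N + 1) * h i \<and> g i (lfloor (h i) x) = w z" for i x
    using yx[of i x] h0[of i] by (intro exI[of _ "y i x"]) (simp add: y_def g_def distrib_right)
  have l2: "(\<lambda>i. \<integral>x. norm (g i (lfloor (h i) x)) powr q \<partial>lborel) \<longlonglongrightarrow> (\<integral>x. norm (w x) powr q \<partial>lborel)"
  proof (rule dominated_on_cball)
    show "(\<lambda>x. norm (g i (lfloor (h i) x)) powr q) \<in> borel_measurable lborel" for i
      by (rule borel_measurable_has_bochner_integral[OF hb])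
    fix x
    show "(\<lambda>i. norm (g i (lfloor (h i) x)) powr q) \<longlonglongrightarrow> norm (w x) powr q"
      using conv[OF cw wz, of x] q0 by (intro tendsto_powr2 tendsto_norm tendsto_const) auto
    show "\<bar>norm (g i (lfloor (h i) x)) powr q\<bar> \<le> L powr q" for i
      using L q0 wz[of x i] by (auto intro!: powr_mono2)
    show "norm (g i (lfloor (h i) x)) powr q = 0" if "norm x > \<rho>" for i
      using wz[of x i] near[OF _ that] w0 by (metis norm_zero powr_0)
  qed
  have le: "(\<integral>x. norm (g i (lfloor (h i) x)) powr q \<partial>lborel)
      \<le> (C * (\<integral>x. (norm (fd i (lfloor (h i) x)))\<^sup>2 \<partial>lborel)) powr (q / 2)" for i
  proof -
    have fdn: "(\<Sum>j\<in>UNIV. (norm (g i (lshift j 1 k) - g i k))\<^sup>2) = (h i)\<^sup>2 * (norm (fd i k))\<^sup>2" for k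
    proof -
      have "(h i)\<^sup>2 * (norm (fd i k))\<^sup>2 = (\<Sum>b\<in>UNIV. \<Sum>j\<in>UNIV. (g i (lshift j 1 k) $ b - g i k $ b)\<^sup>2)"
        using h0[of i] by (simp add: fd_def norm_vec_sq sum_distrib_left power_divide)
      also have "\<dots> = (\<Sum>j\<in>UNIV. (norm (g i (lshift j 1 k) - g i k))\<^sup>2)"
        unfolding norm_vec_sq by (subst sum.swap) simp
      finally show ?thesis by simp
    qed
    let ?E = "\<Sum>k\<in>lbox (Suc (r i)). (norm (fd i k))\<^sup>2"
    have E0: "?E \<ge> 0" by (intro sum_nonneg) auto
    have hp: "h i powr N = h i ^ CARD('n)" using h0[of i] by (simp add: N_def powr_realpow)
    \<comment> \<open>Scale invariance, which singles out q = 2 N / (N - 2): the powers of the mesh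
      size on the two sides of the lattice inequality agree.\<close>
    have Nq: "N + q = N * (q / 2)" using N by (simp add: q field_simps)
    have "(h i powr 2) powr (q / 2) = h i powr q" by (simp add: powr_powr)
    then have hq: "h i powr N * (h i powr 2) powr (q / 2) = (h i powr N) powr (q / 2)"
      by (simp only: powr_powr powr_add[symmetric] Nq)
    have h2: "(h i)\<^sup>2 = h i powr 2" using h0[of i] by (simp add: powr_numeral)
    have "(\<integral>x. norm (g i (lfloor (h i) x)) powr q \<partial>lborel) = h i powr N * (\<Sum>k\<in>lbox (Suc (r i)). norm (g i k) powr q)"
      using hb by (simp add: has_bochner_integral_iff hp)
    also have "\<dots> \<le> h i powr N * (C * (\<Sum>k\<in>lbox (Suc (r i)). \<Sum>j\<in>UNIV. (norm (g i (lshift j 1 k) - g i k))\<^sup>2)) powr (q / 2)"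
      unfolding q_def C_def by (intro mult_left_mono lattice_Sobolev n g0) auto
    also have "\<dots> = h i powr N * (h i powr 2 * (C * ?E)) powr (q / 2)"
      unfolding fdn sum_distrib_left[symmetric] h2 by (simp only: mult.left_commute)
    also have "\<dots> = (h i powr N * (h i powr 2) powr (q / 2)) * (C * ?E) powr (q / 2)"
      using C0 E0 by (simp only: powr_mult powr_ge_zero mult_nonneg_nonneg mult.assoc)
    also have "\<dots> = (h i powr N) powr (q / 2) * (C * ?E) powr (q / 2)"
      unfolding hq ..
    also have "\<dots> = (h i powr N * (C * ?E)) powr (q / 2)"
      using C0 E0 by (simp only: powr_mult powr_ge_zero mult_nonneg_nonneg)
    also have "\<dots> = (C * (\<integral>x. (norm (fd i (lfloor (h i) x)))\<^sup>2 \<partial>lborel)) powr (q / 2)"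
      unfolding e1 hp by (simp only: mult.left_commute)
    finally show ?thesis .
  qed
  have "(\<lambda>i. (C * (\<integral>x. (norm (fd i (lfloor (h i) x)))\<^sup>2 \<partial>lborel)) powr (q / 2))
      \<longlonglongrightarrow> (C * (\<integral>x. (norm (Dw x))\<^sup>2 \<partial>lborel)) powr (q / 2)"
    using q0 C0 by (intro tendsto_powr2 tendsto_mult_left l1 tendsto_const) auto
  then have "(\<integral>x. norm (w x) powr q \<partial>lborel) \<le> (C * (\<integral>x. (norm (Dw x))\<^sup>2 \<partial>lborel)) powr (q / 2)"
    by (rule LIMSEQ_le[OF l2]) (use le in auto)
  then show "(\<integral>x. norm (w x) powr sobolev_exp CARD('n) \<partial>lborel)
        \<le> (sobolev_const CARD('n) * (\<integral>x. (norm (Dw x))\<^sup>2 \<partial>lborel)) powr (sobolev_exp CARD('n) / 2)"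
    by (simp add: q_def C_def)
qed

section \<open>A class of smooth functions\<close>

text \<open>The flat function exp(-1/t) together with its quotients by powers of t: the linear span
  of this family is closed under differentiation, which the flat function alone is not.\<close>

definition bexp :: "nat \<Rightarrow> real \<Rightarrow> real" where
  "bexp k t = (if t > 0 then exp (- 1 / t) / t ^ k else 0)"

lemma bexp_tendsto_0: "(bexp k \<longlongrightarrow> 0) (at 0)"
proof -
  have "((\<lambda>t. inverse t ^ k / exp (inverse t)) \<longlongrightarrow> 0) (at_right (0::real))"
    by (rule filterlim_compose[OF tendsto_power_div_exp_0 filterlim_inverse_at_top_right])
  moreover have "\<forall>\<^sub>F t in at_right 0. inverse t ^ k / exp (inverse t) = bexp k t"
    by (auto simp: eventually_at_filter bexp_def exp_minus field_simps)
  ultimately have r: "(bexp k \<longlongrightarrow> 0) (at_right 0)" by (rule Lim_transform_eventually)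
  have "(bexp k \<longlongrightarrow> 0) (at_left 0)"
    by (rule Lim_transform_eventually[OF tendsto_const]) (auto simp: eventually_at_filter bexp_def)
  then show ?thesis using r by (simp add: filterlim_at_split)
qed

text \<open>Away from 0 this is the quotient rule. At 0 the difference quotient of
  \<open>bexp k\<close> is \<open>bexp (k + 1)\<close>, which tends to 0 because the exponential
  beats every power.\<close>

lemma DERIV_bexp: "(bexp k has_real_derivative bexp (k + 2) t - real k * bexp (k + 1) t) (at t)"
proof -
  consider "t > 0" | "t < 0" | "t = 0" by linarith
  then show ?thesis
  proof cases
    case 1
    have "((\<lambda>t. exp (- 1 / t) / t ^ k) has_real_derivative bexp (k + 2) t - real k * bexp (k + 1) t) (at t)"
    proof -
      have e: "((\<lambda>t. exp (- 1 / t)) has_real_derivative exp (- 1 / t) / t\<^sup>2) (at t)"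
        using 1 by (auto intro!: derivative_eq_intros simp: power2_eq_square)
      have "((\<lambda>t. exp (- 1 / t) / t ^ k) has_real_derivative
          (exp (- 1 / t) / t\<^sup>2 * t ^ k - exp (- 1 / t) * (real k * t ^ (k - 1))) / (t ^ k * t ^ k)) (at t)"
        using DERIV_divide[OF e DERIV_pow[of k t]] 1 by simp
      moreover have "(exp (- 1 / t) / t\<^sup>2 * t ^ k - exp (- 1 / t) * (real k * t ^ (k - 1))) / (t ^ k * t ^ k)
          = bexp (k + 2) t - real k * bexp (k + 1) t"
      \<comment> \<open>The truncated subtraction in t ^ (k - 1) makes k = 0 a separate
        case.\<close>
      proof (cases k)
        case 0 then show ?thesis using 1 by (simp add: bexp_def power2_eq_square)
      next
        case (Suc m)
        then show ?thesis using 1 by (simp add: bexp_def power2_eq_square diff_divide_distrib)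
      qed
      ultimately show ?thesis by (rule back_subst)
    qed
    moreover have ev: "\<forall>\<^sub>F x in nhds t. exp (- 1 / x) / x ^ k = bexp k x"
      using eventually_nhds_in_open[of "{0<..}" t] 1 by (auto simp: bexp_def elim!: eventually_mono)
    ultimately show ?thesis by (metis DERIV_cong_ev[OF refl ev refl])
  next
    case 2
    have ev: "\<forall>\<^sub>F x in nhds t. 0 = bexp k x"
      using eventually_nhds_in_open[of "{..<0}" t] 2 by (auto simp: bexp_def elim!: eventually_mono)
    have "(bexp k has_real_derivative 0) (at t)"
      using DERIV_const[of 0] by (metis DERIV_cong_ev[OF refl ev refl])
    moreover have "bexp (k + 2) t - real k * bexp (k + 1) t = 0" using 2 by (simp add: bexp_def)
    ultimately show ?thesis by simp
  next
    case 3
    have "(bexp (k + 1) \<longlongrightarrow> 0) (at 0)" by (rule bexp_tendsto_0)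
    then have "((\<lambda>h. (bexp k (0 + h) - bexp k 0) / h) \<longlongrightarrow> 0) (at 0)"
      by (rule Lim_transform_eventually) (auto simp: eventually_at_filter bexp_def)
    then show ?thesis using 3 by (simp add: DERIV_def bexp_def)
  qed
qed

text \<open>An algebra generated by functions of one coordinate and closed under partial
  derivatives. Closure gives all iterated partials in one induction, so smoothness reduces to
  continuity of the members.\<close>

inductive_set smooth_alg :: "(real^'n::finite \<Rightarrow> real) set" where
  smooth_alg_bexp: "(\<lambda>x. bexp k (a + b * x $ j)) \<in> smooth_alg"
| smooth_alg_const: "(\<lambda>x. c) \<in> smooth_alg"
| smooth_alg_add: "f \<in> smooth_alg \<Longrightarrow> g \<in> smooth_alg \<Longrightarrow> (\<lambda>x. f x + g x) \<in> smooth_alg"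
| smooth_alg_mult: "f \<in> smooth_alg \<Longrightarrow> g \<in> smooth_alg \<Longrightarrow> (\<lambda>x. f x * g x) \<in> smooth_alg"

lemma smooth_alg_prod: "finite I \<Longrightarrow> (\<And>i. i \<in> I \<Longrightarrow> f i \<in> smooth_alg) \<Longrightarrow> (\<lambda>x. \<Prod>i\<in>I. f i x) \<in> smooth_alg"
  by (induction I rule: finite_induct) (auto intro: smooth_alg_mult smooth_alg_const)

lemma smooth_alg_affine: "f \<in> smooth_alg \<Longrightarrow> (\<lambda>x. f (z + c *\<^sub>R x)) \<in> smooth_alg"
proof (induction rule: smooth_alg.induct)
  case (smooth_alg_bexp k a b j)
  have "(\<lambda>x. bexp k (a + b * (z + c *\<^sub>R x) $ j)) = (\<lambda>x. bexp k ((a + b * z $ j) + (b * c) * x $ j))"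
    by (simp add: algebra_simps)
  then show ?case by (simp only: smooth_alg.smooth_alg_bexp)
qed (auto intro: smooth_alg.intros)

lemma smooth_alg_line_deriv:
  fixes f :: "real^'n::finite \<Rightarrow> real"
  shows "f \<in> smooth_alg \<Longrightarrow> \<exists>f'\<in>smooth_alg. \<forall>x. ((\<lambda>t. f (x + t *\<^sub>R axis j 1)) has_real_derivative f' x) (at 0)"
proof (induction rule: smooth_alg.induct)
  case (smooth_alg_bexp k a b i)
  let ?d = "b * (axis j 1 :: real^'n) $ i"
  let ?f' = "\<lambda>x. ?d * bexp (k + 2) (a + b * x $ i) + (- ?d * real k) * bexp (k + 1) (a + b * x $ i)"
  have "?f' \<in> smooth_alg" by (intro smooth_alg.intros)
  moreover have "((\<lambda>t. bexp k (a + b * (x + t *\<^sub>R axis j 1) $ i)) has_real_derivative ?f' x) (at 0)" for x :: "real^'n"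
  proof -
    have "((\<lambda>t. bexp k (a + b * (x $ i + t * (axis j 1 :: real^'n) $ i))) has_real_derivative
       (bexp (k + 2) (a + b * x $ i) - real k * bexp (k + 1) (a + b * x $ i)) * ?d) (at 0)"
      by (rule DERIV_chain2[where f = "bexp k"])
        (use DERIV_bexp[of k "a + b * x $ i"] in \<open>auto intro!: derivative_eq_intros\<close>)
    then show ?thesis by (simp add: left_diff_distrib right_diff_distrib mult_ac)
  qed
  ultimately show ?case by (intro bexI[of _ ?f'] allI)
next
  case (smooth_alg_const c)
  show ?case by (rule bexI[of _ "\<lambda>x. 0"]) (auto intro: smooth_alg.intros)
next
  case (smooth_alg_add f g)
  then obtain f' g' where "f' \<in> smooth_alg" "g' \<in> smooth_alg"
    "\<And>x. ((\<lambda>t. f (x + t *\<^sub>R axis j 1)) has_real_derivative f' x) (at 0)"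
    "\<And>x. ((\<lambda>t. g (x + t *\<^sub>R axis j 1)) has_real_derivative g' x) (at 0)" by blast
  then show ?case by (intro bexI[of _ "\<lambda>x. f' x + g' x"]) (auto intro!: derivative_intros smooth_alg.smooth_alg_add)
next
  case (smooth_alg_mult f g)
  then obtain f' g' where 1: "f' \<in> smooth_alg" "g' \<in> smooth_alg"
    "\<And>x. ((\<lambda>t. f (x + t *\<^sub>R axis j 1)) has_real_derivative f' x) (at 0)"
    "\<And>x. ((\<lambda>t. g (x + t *\<^sub>R axis j 1)) has_real_derivative g' x) (at 0)" by blast
  show ?case
  proof (rule bexI[of _ "\<lambda>x. f' x * g x + g' x * f x"], rule allI)
    fix x show "((\<lambda>t. f (x + t *\<^sub>R axis j 1) * g (x + t *\<^sub>R axis j 1)) has_real_derivative f' x * g x + g' x * f x) (at 0)"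
      using DERIV_mult[OF 1(3)[of x] 1(4)[of x]] by simp
  qed (intro smooth_alg.intros 1 smooth_alg_mult.hyps)
qed

lemma smooth_alg_partial: "f \<in> smooth_alg \<Longrightarrow> partial j f \<in> smooth_alg"
  and smooth_alg_has_partial: "f \<in> smooth_alg \<Longrightarrow>
    ((\<lambda>t. f (x + t *\<^sub>R axis j 1)) has_real_derivative partial j f x) (at 0)"
proof -
  assume "f \<in> smooth_alg"
  then obtain f' where f': "f' \<in> smooth_alg"
    "\<And>x. ((\<lambda>t. f (x + t *\<^sub>R axis j 1)) has_real_derivative f' x) (at 0)" using smooth_alg_line_deriv by blast
  have "partial j f = f'" unfolding partial_def fun_eq_iff using DERIV_imp_deriv[OF f'(2)] by blast
  then show "partial j f \<in> smooth_alg" "((\<lambda>t. f (x + t *\<^sub>R axis j 1)) has_real_derivative partial j f x) (at 0)"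
    using f' by auto
qed

lemma partial_eqI:
  "((\<lambda>t. f (x + t *\<^sub>R axis j 1)) has_real_derivative d) (at 0) \<Longrightarrow> partial j f x = d"
  unfolding partial_def by (rule DERIV_imp_deriv)

lemma smooth_alg_continuous: "f \<in> smooth_alg \<Longrightarrow> continuous_on UNIV f"
proof (induction rule: smooth_alg.induct)
  case (smooth_alg_bexp k a b j)
  have "continuous_on UNIV (bexp k)"
    by (intro continuous_at_imp_continuous_on ballI) (rule DERIV_isCont[OF DERIV_bexp])
  then show ?case
    by (rule continuous_on_compose2) (auto intro!: continuous_intros)
qed (auto intro!: continuous_intros)

lemma smooth_alg_iter_partial: "f \<in> smooth_alg \<Longrightarrow> iter_partial js f \<in> smooth_alg"
  by (induction js) (auto intro: smooth_alg_partial)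

lemma smooth_fun_smooth_alg: "f \<in> smooth_alg \<Longrightarrow> smooth_fun f"
  unfolding smooth_fun_def
  using smooth_alg_iter_partial smooth_alg_continuous smooth_alg_has_partial real_differentiable_def by blast

definition grad :: "(real^'n::finite \<Rightarrow> real) \<Rightarrow> real^'n \<Rightarrow> real^'n" where
  "grad f x = (\<chi> j. partial j f x)"

lemma grad_component [simp]: "grad f x $ j = partial j f x" by (simp add: grad_def)

lemma continuous_on_grad: "f \<in> smooth_alg \<Longrightarrow> continuous_on UNIV (grad f)"
  unfolding grad_def by (intro continuous_on_vec_lambda smooth_alg_continuous smooth_alg_partial)

lemma grad_mult:
  assumes "f \<in> smooth_alg" "g \<in> smooth_alg"
  shows "grad (\<lambda>x. f x * g x) x = f x *\<^sub>R grad g x + g x *\<^sub>R grad f x"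
  unfolding vec_eq_iff
proof
  fix j
  have "partial j (\<lambda>x. f x * g x) x = partial j f x * g x + partial j g x * f x"
    using DERIV_mult[OF smooth_alg_has_partial[OF assms(1), of x j] smooth_alg_has_partial[OF assms(2), of x j]]
    by (intro partial_eqI) simp
  then show "grad (\<lambda>x. f x * g x) x $ j = (f x *\<^sub>R grad g x + g x *\<^sub>R grad f x) $ j" by simp
qed

lemma grad_affine:
  assumes "f \<in> smooth_alg"
  shows "grad (\<lambda>x. f (z + c *\<^sub>R x)) x = c *\<^sub>R grad f (z + c *\<^sub>R x)"
  unfolding vec_eq_iff
proof
  fix j
  have "((\<lambda>t. f ((z + c *\<^sub>R x) + (c * t) *\<^sub>R axis j 1)) has_real_derivative partial j f (z + c *\<^sub>R x) * c) (at 0)"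
    by (rule DERIV_chain2[where f = "\<lambda>t. f ((z + c *\<^sub>R x) + t *\<^sub>R axis j 1)"])
      (use smooth_alg_has_partial[OF assms, of "z + c *\<^sub>R x" j] in \<open>auto intro!: derivative_eq_intros\<close>)
  then have "partial j (\<lambda>x. f (z + c *\<^sub>R x)) x = partial j f (z + c *\<^sub>R x) * c"
    by (intro partial_eqI) (simp add: scaleR_right_distrib add.assoc)
  then show "grad (\<lambda>x. f (z + c *\<^sub>R x)) x $ j = (c *\<^sub>R grad f (z + c *\<^sub>R x)) $ j" by simp
qed

text \<open>A concrete subclass of the test functions, rich enough to contain the mollifiers and the
  cut-offs. The weak equations below are tested against this class only.\<close>

definition smooth_bump :: "(real^'n::finite \<Rightarrow> real) set" where
  "smooth_bump = {f \<in> smooth_alg. \<exists>R. \<forall>x. norm x > R \<longrightarrow> f x = 0}"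

lemma grad_zero_outside:
  assumes "f \<in> smooth_alg" "\<And>x. norm x > R \<Longrightarrow> f x = 0" "norm x > R"
  shows "grad f x = 0"
  using line_derivative_zero_outside[OF smooth_alg_has_partial[OF assms(1)] assms(2,3)]
  by (simp add: vec_eq_iff)

lemma test_fun_smooth_bump: "f \<in> smooth_bump \<Longrightarrow> test_fun f"
  unfolding test_fun_def smooth_bump_def bounded_iff
  by (auto intro: smooth_fun_smooth_alg) (meson not_le)

lemma smooth_bump_mult: "f \<in> smooth_alg \<Longrightarrow> g \<in> smooth_bump \<Longrightarrow> (\<lambda>x. f x * g x) \<in> smooth_bump"
  unfolding smooth_bump_def by (auto intro: smooth_alg_mult)

lemma smooth_bump_affine:
  assumes f: "f \<in> smooth_bump" and c: "c \<noteq> 0"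
  shows "(\<lambda>x. f (z + c *\<^sub>R x)) \<in> smooth_bump"
proof -
  obtain R where R: "\<And>x. norm x > R \<Longrightarrow> f x = 0" and fa: "f \<in> smooth_alg"
    using f by (auto simp: smooth_bump_def)
  have "f (z + c *\<^sub>R x) = 0" if "norm x > (R + norm z) / \<bar>c\<bar>" for x
  proof (rule R)
    have "R + norm z < norm (c *\<^sub>R x)" using that c by (simp add: field_simps)
    also have "\<dots> \<le> norm (z + c *\<^sub>R x) + norm z" using norm_triangle_ineq4[of "z + c *\<^sub>R x" z] by simp
    finally show "R < norm (z + c *\<^sub>R x)" by simp
  qed
  then show ?thesis unfolding smooth_bump_def using smooth_alg_affine[OF fa] by blast
qed

text \<open>Each factor lives on |x_j| < 1, and exp 2 normalises it to 1 at the origin, where both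
  exponentials equal exp(-1). The coefficients 1 and -1 are written out to match the generators of
  \<open>smooth_alg\<close>.\<close>

definition std_bump :: "real^'n::finite \<Rightarrow> real" where
  "std_bump x = (\<Prod>j\<in>UNIV. exp 2 * (bexp 0 (1 + 1 * x $ j) * bexp 0 (1 + (- 1) * x $ j)))"

lemma std_bump_smooth: "std_bump \<in> smooth_bump"
proof -
  have "std_bump \<in> smooth_alg"
    unfolding std_bump_def[abs_def] by (intro smooth_alg_prod smooth_alg.intros) simp
  moreover have "std_bump x = 0" if "norm x > real CARD('n)" for x :: "real^'n"
  proof -
    have "\<exists>j. \<bar>x $ j\<bar> > 1"
    proof (rule ccontr)
      assume "\<not> ?thesis"
      then have "(\<Sum>j\<in>UNIV. \<bar>x $ j\<bar>) \<le> (\<Sum>j\<in>(UNIV::'n set). 1)" by (intro sum_mono) (auto simp: not_less)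
      then show False using norm_le_l1_cart[of x] that by simp
    qed
    then obtain j where "\<bar>x $ j\<bar> > 1" by blast
    then have "bexp 0 (1 + 1 * x $ j) * bexp 0 (1 + (- 1) * x $ j) = 0" by (auto simp: bexp_def)
    then have "exp 2 * (bexp 0 (1 + 1 * x $ j) * bexp 0 (1 + (- 1) * x $ j)) = 0" by (simp only: mult_zero_right)
    then show ?thesis unfolding std_bump_def by (intro prod_zero bexI[of _ j]) auto
  qed
  ultimately show ?thesis unfolding smooth_bump_def by blast
qed

lemma std_bump_nonneg: "std_bump x \<ge> 0"
  unfolding std_bump_def by (intro prod_nonneg) (auto simp: bexp_def)

lemma std_bump_0: "std_bump 0 = 1"
  by (simp add: std_bump_def bexp_def exp_add[symmetric])

section \<open>Mollification\<close>

text \<open>The scalar c is 1 or -1, so translations and point reflections are covered together; a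
  convolution needs both.\<close>

lemma lborel_reflect:
  fixes t :: "'a::euclidean_space"
  assumes "\<bar>c\<bar> = 1"
  shows "distr lborel borel (\<lambda>x. t + c *\<^sub>R x) = lborel"
  using lborel_affine[of c t] assms by (auto simp: density_1)

lemma integral_reflect:
  fixes f :: "'a::euclidean_space \<Rightarrow> 'b::{banach, second_countable_topology}"
  assumes "f \<in> borel_measurable borel" "\<bar>c\<bar> = 1"
  shows "(\<integral>x. f (t + c *\<^sub>R x) \<partial>lborel) = (\<integral>x. f x \<partial>lborel)"
    and "integrable lborel (\<lambda>x. f (t + c *\<^sub>R x)) \<longleftrightarrow> integrable lborel f"
proof -
  have "(\<integral>x. f x \<partial>lborel) = (\<integral>x. f x \<partial>distr lborel borel (\<lambda>x. t + c *\<^sub>R x))"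
    by (simp only: lborel_reflect[OF assms(2)])
  also have "\<dots> = (\<integral>x. f (t + c *\<^sub>R x) \<partial>lborel)"
    by (rule integral_distr) (use assms in auto)
  finally show "(\<integral>x. f (t + c *\<^sub>R x) \<partial>lborel) = (\<integral>x. f x \<partial>lborel)" ..
  have "integrable lborel f \<longleftrightarrow> integrable (distr lborel borel (\<lambda>x. t + c *\<^sub>R x)) f"
    by (simp only: lborel_reflect[OF assms(2)])
  also have "\<dots> \<longleftrightarrow> integrable lborel (\<lambda>x. f (t + c *\<^sub>R x))"
    by (rule integrable_distr_eq) (use assms in auto)
  finally show "integrable lborel (\<lambda>x. f (t + c *\<^sub>R x)) \<longleftrightarrow> integrable lborel f" ..
qed

lemma nn_integral_reflect:
  fixes f :: "'a::euclidean_space \<Rightarrow> ennreal"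
  assumes "f \<in> borel_measurable borel" "\<bar>c\<bar> = 1"
  shows "(\<integral>\<^sup>+x. f (t + c *\<^sub>R x) \<partial>lborel) = (\<integral>\<^sup>+x. f x \<partial>lborel)"
proof -
  have "(\<integral>\<^sup>+x. f x \<partial>lborel) = (\<integral>\<^sup>+x. f x \<partial>distr lborel borel (\<lambda>x. t + c *\<^sub>R x))"
    by (simp only: lborel_reflect[OF assms(2)])
  also have "\<dots> = (\<integral>\<^sup>+x. f (t + c *\<^sub>R x) \<partial>lborel)"
    by (rule nn_integral_distr) (use assms in auto)
  finally show ?thesis ..
qed

lemma integrable_indicator_cball: "integrable lborel (\<lambda>x. indicator (cball (a::'a::euclidean_space) r) x :: real)"
  using emeasure_bounded_finite[OF bounded_cball, of a r] by (intro integrable_real_indicator) auto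

lemma integrable_bounded_support:
  fixes f :: "'a::euclidean_space \<Rightarrow> 'b::{banach, second_countable_topology}"
  assumes f: "f \<in> borel_measurable borel" "\<And>x. norm (f x) \<le> K" "\<And>x. norm x > R \<Longrightarrow> f x = 0"
  shows "integrable lborel f"
proof (rule Bochner_Integration.integrable_bound)
  show "integrable lborel (\<lambda>x. K * indicator (cball (0::'a) R) x)"
    by (intro integrable_mult_right integrable_indicator_cball)
  have "norm (f x) \<le> norm (K * indicator (cball 0 R) x)" for x
    using f(2)[of x] f(3)[of x] by (auto simp: indicator_def not_le)
  then show "AE x in lborel. norm (f x) \<le> norm (K * indicator (cball 0 R) x)" by (intro AE_I2)
qed (use f in auto)

lemma integrable_continuous_compact:
  fixes f :: "real^'n \<Rightarrow> 'b::{banach, second_countable_topology}"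
  assumes "continuous_on UNIV f" "\<And>x. norm x > R \<Longrightarrow> f x = 0"
  shows "integrable lborel f"
proof -
  obtain K where "\<And>x. norm (f x) \<le> K" using bounded_if_continuous_compact[OF assms] by blast
  then show ?thesis
    using assms by (intro integrable_bounded_support) (auto intro: borel_measurable_continuous_onI)
qed

lemma integrable_if_L2_compact:
  fixes w :: "'a::euclidean_space \<Rightarrow> 'b::{banach, second_countable_topology}"
  assumes "w \<in> borel_measurable borel" "integrable lborel (\<lambda>x. (norm (w x))\<^sup>2)" "\<And>x. norm x > R \<Longrightarrow> w x = 0"
  shows "integrable lborel w"
proof (rule Bochner_Integration.integrable_bound)
  show "integrable lborel (\<lambda>x. (norm (w x))\<^sup>2 + indicator (cball (0::'a) R) x)"
    by (intro Bochner_Integration.integrable_add assms integrable_indicator_cball)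
  have a: "a \<le> a\<^sup>2 + 1" for a :: real using zero_le_power2[of "a - 1/2"] by (simp add: power2_eq_square algebra_simps)
  have "norm (w x) \<le> norm ((norm (w x))\<^sup>2 + indicator (cball 0 R) x)" for x
    using a[of "norm (w x)"] assms(3)[of x] by (auto simp: indicator_def not_le)
  then show "AE x in lborel. norm (w x) \<le> norm ((norm (w x))\<^sup>2 + indicator (cball 0 R) x)" by (intro AE_I2)
qed (use assms in auto)

lemma integral_vec_nth:
  fixes f :: "'a \<Rightarrow> ('b::euclidean_space)^'i"
  shows "integrable M f \<Longrightarrow> (\<integral>x. f x \<partial>M) $ i = (\<integral>x. f x $ i \<partial>M)"
  using integral_bounded_linear[OF bounded_linear_vec_nth] by metis

lemma integrable_vec_nth:
  fixes f :: "'a \<Rightarrow> ('b::euclidean_space)^'i"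
  shows "integrable M f \<Longrightarrow> integrable M (\<lambda>x. f x $ i)"
  by (rule integrable_bounded_linear[OF bounded_linear_vec_nth])

text \<open>A general bilinear form serves twice: with scalar multiplication for
  \<open>mollify\<close> and with \<open>outer\<close> for \<open>grad_mollify\<close>.\<close>

lemma integrable_conv:
  fixes h :: "'a::euclidean_space \<Rightarrow> 'c::euclidean_space" and w :: "'a \<Rightarrow> 'd::euclidean_space"
    and b :: "'c \<Rightarrow> 'd \<Rightarrow> 'e::euclidean_space"
  assumes b: "bounded_bilinear b" and h: "continuous_on UNIV h" "\<And>x. norm (h x) \<le> K" and w: "integrable lborel w"
  shows "integrable lborel (\<lambda>y. b (h (x - y)) (w y))"
proof -
  obtain C where C: "C > 0" "\<And>u v. norm (b u v) \<le> norm u * norm v * C"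
    using bounded_bilinear.pos_bounded[OF b] by blast
  have wm: "w \<in> borel_measurable borel" using borel_measurable_integrable[OF w] by simp
  have hm: "(\<lambda>y. h (x - y)) \<in> borel_measurable borel"
    by (rule borel_measurable_continuous_onI, rule continuous_on_compose2[OF h(1)])
       (auto intro!: continuous_intros)
  show ?thesis
  proof (rule Bochner_Integration.integrable_bound)
    show "integrable lborel (\<lambda>y. C * K * norm (w y))" using w by auto
    have "(\<lambda>y. b (h (x - y)) (w y)) \<in> borel_measurable borel"
      by (rule borel_measurable_continuous_Pair[OF hm wm])
        (rule bounded_bilinear.continuous_on[OF b continuous_on_fst[OF continuous_on_id] continuous_on_snd[OF continuous_on_id]])
    then show "(\<lambda>y. b (h (x - y)) (w y)) \<in> borel_measurable lborel" by simp
    have "norm (b (h (x - y)) (w y)) \<le> norm (C * K * norm (w y))" for y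
    proof -
      have K0: "K \<ge> 0" by (rule order_trans[OF norm_ge_zero h(2)])
      have "norm (b (h (x - y)) (w y)) \<le> norm (h (x - y)) * norm (w y) * C" by (rule C(2))
      also have "\<dots> \<le> K * norm (w y) * C" by (intro mult_right_mono h(2) norm_ge_zero less_imp_le[OF C(1)])
      also have "\<dots> = norm (C * K * norm (w y))" using C(1) K0 by simp
      finally show ?thesis .
    qed
    then show "AE y in lborel. norm (b (h (x - y)) (w y)) \<le> norm (C * K * norm (w y))" by (intro AE_I2)
  qed
qed

lemma continuous_conv:
  fixes h :: "'a::euclidean_space \<Rightarrow> 'c::euclidean_space" and w :: "'a \<Rightarrow> 'd::euclidean_space"
    and b :: "'c \<Rightarrow> 'd \<Rightarrow> 'e::euclidean_space"
  assumes b: "bounded_bilinear b" and h: "continuous_on UNIV h" "\<And>x. norm (h x) \<le> K" and w: "integrable lborel w"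
  shows "continuous_on UNIV (\<lambda>x. \<integral>y. b (h (x - y)) (w y) \<partial>lborel)"
proof (rule continuous_at_imp_continuous_on, rule ballI, rule continuous_at_sequentiallyI)
  fix x :: 'a and X assume X: "X \<longlonglongrightarrow> x"
  obtain C where C: "C > 0" "\<And>u v. norm (b u v) \<le> norm u * norm v * C"
    using bounded_bilinear.pos_bounded[OF b] by blast
  note int = integrable_conv[OF b h w]
  show "(\<lambda>i. \<integral>y. b (h (X i - y)) (w y) \<partial>lborel) \<longlonglongrightarrow> (\<integral>y. b (h (x - y)) (w y) \<partial>lborel)"
  proof (rule integral_dominated_convergence[where w = "\<lambda>y. C * K * norm (w y)"])
    show "integrable lborel (\<lambda>y. C * K * norm (w y))" using w by auto
    show "AE y in lborel. (\<lambda>i. b (h (X i - y)) (w y)) \<longlonglongrightarrow> b (h (x - y)) (w y)"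
    proof (rule AE_I2)
      fix y
      have "(\<lambda>i. h (X i - y)) \<longlonglongrightarrow> h (x - y)"
        by (rule continuous_on_tendsto_compose[OF h(1)]) (auto intro!: tendsto_intros X)
      then show "(\<lambda>i. b (h (X i - y)) (w y)) \<longlonglongrightarrow> b (h (x - y)) (w y)"
        by (rule bounded_bilinear.tendsto[OF b]) (rule tendsto_const)
    qed
    show "AE y in lborel. norm (b (h (X i - y)) (w y)) \<le> C * K * norm (w y)" for i
    proof (rule AE_I2)
      fix y
      have "norm (b (h (X i - y)) (w y)) \<le> norm (h (X i - y)) * norm (w y) * C" by (rule C(2))
      also have "\<dots> \<le> K * norm (w y) * C" by (intro mult_right_mono h(2) norm_ge_zero less_imp_le[OF C(1)])
      finally show "norm (b (h (X i - y)) (w y)) \<le> C * K * norm (w y)" by (simp only: mult_ac)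
    qed
  qed (use int in auto)
qed

definition mollify :: "(real^'n \<Rightarrow> real) \<Rightarrow> (real^'n \<Rightarrow> 'v::euclidean_space) \<Rightarrow> real^'n \<Rightarrow> 'v" where
  "mollify f w x = (\<integral>y. f (x - y) *\<^sub>R w y \<partial>lborel)"

text \<open>The derivative falls on the kernel, so the gradient of the mollified map is available
  without any derivative of w.\<close>

definition grad_mollify :: "(real^'n \<Rightarrow> real) \<Rightarrow> (real^'n \<Rightarrow> real^'m) \<Rightarrow> real^'n \<Rightarrow> real^'n^'m" where
  "grad_mollify f w x = (\<integral>y. outer (w y) (grad f (x - y)) \<partial>lborel)"

lemma smooth_bumpE:
  assumes "f \<in> smooth_bump"
  obtains R K where "f \<in> smooth_alg" "continuous_on UNIV f" "continuous_on UNIV (grad f)"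
    "\<And>x. norm x > R \<Longrightarrow> f x = 0" "\<And>x. norm x > R \<Longrightarrow> grad f x = 0"
    "\<And>x. norm (f x) \<le> K" "\<And>x. norm (grad f x) \<le> K"
proof -
  obtain R where R: "f \<in> smooth_alg" "\<And>x. norm x > R \<Longrightarrow> f x = 0" using assms by (auto simp: smooth_bump_def)
  have g: "\<And>x. norm x > R \<Longrightarrow> grad f x = 0" using grad_zero_outside[OF R] by blast
  obtain K where K: "\<And>x. norm (f x) \<le> K"
    using bounded_if_continuous_compact[OF smooth_alg_continuous[OF R(1)] R(2)] by blast
  obtain L where L: "\<And>x. norm (grad f x) \<le> L"
    using bounded_if_continuous_compact[OF continuous_on_grad[OF R(1)] g] by blast
  have "norm (f x) \<le> max K L" "norm (grad f x) \<le> max K L" for x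
    using K[of x] L[of x] by auto
  then show ?thesis using that[of R "max K L"] R g smooth_alg_continuous[OF R(1)] continuous_on_grad[OF R(1)] by blast
qed

lemma continuous_mollify:
  assumes f: "f \<in> smooth_bump" and w: "integrable lborel w"
  shows "continuous_on UNIV (mollify f w)" "integrable lborel (\<lambda>y. f (x - y) *\<^sub>R w y)"
proof -
  obtain R K where f': "continuous_on UNIV f" "\<And>x. norm (f x) \<le> K" using smooth_bumpE[OF f] by metis
  show "continuous_on UNIV (mollify f w)"
    unfolding mollify_def[abs_def] by (rule continuous_conv[OF bounded_bilinear_scaleR f' w])
  show "integrable lborel (\<lambda>y. f (x - y) *\<^sub>R w y)"
    by (rule integrable_conv[OF bounded_bilinear_scaleR f' w])
qed

lemma mollify_zero_outside:
  assumes "\<And>x. norm x > R \<Longrightarrow> f x = 0" "\<And>x. norm x > r \<Longrightarrow> w x = 0" "norm x > R + r"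
  shows "mollify f w x = 0"
proof -
  have "f (x - y) *\<^sub>R w y = 0" for y
  proof (cases "norm y > r")
    case False
    then have "norm (x - y) > R" using assms(3) norm_triangle_ineq2[of x y] by linarith
    then show ?thesis by (simp add: assms(1))
  qed (simp add: assms(2))
  then have "(\<lambda>y. f (x - y) *\<^sub>R w y) = (\<lambda>y. 0)" by blast
  then show ?thesis by (simp add: mollify_def)
qed

lemma integrable_grad_mollify:
  assumes f: "f \<in> smooth_bump" and w: "integrable lborel w"
  shows "integrable lborel (\<lambda>y. outer (w y) (grad f (x - y)))"
    "continuous_on UNIV (grad_mollify f w)"
proof -
  obtain R K where g: "continuous_on UNIV (grad f)" "\<And>x. norm (grad f x) \<le> K" using smooth_bumpE[OF f] by metis
  note bb = bounded_bilinear.flip[OF bounded_bilinear_outer]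
  show "integrable lborel (\<lambda>y. outer (w y) (grad f (x - y)))"
    using integrable_conv[OF bb g w, of x] by simp
  show "continuous_on UNIV (grad_mollify f w)"
    using continuous_conv[OF bb g w] by (simp add: grad_mollify_def[abs_def])
qed

text \<open>Differentiation under the integral: the quotients of the kernel are bounded by the
  supremum of its gradient, so a multiple of |w| dominates.\<close>

lemma C1_compact_mollify:
  fixes w :: "real^'n \<Rightarrow> real^'m"
  assumes f: "f \<in> smooth_bump" and w: "integrable lborel w" and w0: "\<And>x. norm x > r \<Longrightarrow> w x = 0"
  shows "C1_compact (mollify f w) (grad_mollify f w)"
  unfolding C1_compact_def
proof (intro conjI allI)
  obtain R K where fa: "f \<in> smooth_alg" and fR: "\<And>x. norm x > R \<Longrightarrow> f x = 0"
    and g: "\<And>x. norm (grad f x) \<le> K" using smooth_bumpE[OF f] by metis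
  show "continuous_on UNIV (mollify f w)" by (rule continuous_mollify[OF f w])
  show "continuous_on UNIV (grad_mollify f w)" by (rule integrable_grad_mollify[OF f w])
  show "\<exists>R. \<forall>x. norm x > R \<longrightarrow> mollify f w x = 0"
    using mollify_zero_outside[of R f r w, OF fR w0] by blast
  fix x b j
  have L: "grad_mollify f w x $ b $ j = (\<integral>y. w y $ b * partial j f (x - y) \<partial>lborel)"
    unfolding grad_mollify_def using integrable_grad_mollify(1)[OF f w, of x]
    by (simp add: integral_vec_nth integrable_vec_nth)
  have M: "mollify f w x $ b = (\<integral>y. f (x - y) * w y $ b \<partial>lborel)"
    and Mi: "integrable lborel (\<lambda>y. f (x - y) * w y $ b)" for x
    unfolding mollify_def using continuous_mollify(2)[OF f w, of x] integrable_vec_nth[OF continuous_mollify(2)[OF f w, of x], of b]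
    by (simp_all add: integral_vec_nth)
  have "((\<lambda>h. (mollify f w (x + (0 + h) *\<^sub>R axis j 1) $ b - mollify f w (x + 0 *\<^sub>R axis j 1) $ b) / h)
      \<longlongrightarrow> grad_mollify f w x $ b $ j) (at 0)"
    unfolding tendsto_at_iff_sequentially comp_def
  proof (intro allI impI)
    fix X :: "nat \<Rightarrow> real" assume X: "\<forall>i. X i \<in> UNIV - {0}" "X \<longlonglongrightarrow> 0"
    define Q where "Q i y = (f (x + X i *\<^sub>R axis j 1 - y) - f (x - y)) / X i" for i y
    \<comment> \<open>The mean value theorem is stated for an increasing pair of end points, hence
      the distinction by the sign of the increment.\<close>
    have Qb: "\<bar>Q i y\<bar> \<le> K" for i y
    proof -
      note mv = line_mean_value[OF smooth_alg_has_partial[OF fa, of _ j], where x = "x - y"]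
      obtain s where "Q i y = partial j f (x - y + s *\<^sub>R axis j 1)"
      proof (cases "X i > 0")
        case True
        obtain s where "f (x - y + X i *\<^sub>R axis j 1) - f (x - y + 0 *\<^sub>R axis j 1)
            = (X i - 0) * partial j f (x - y + s *\<^sub>R axis j 1)"
          using mv[OF True] by blast
        then have "Q i y = partial j f (x - y + s *\<^sub>R axis j 1)"
          using True by (simp add: Q_def diff_add_eq)
        then show ?thesis by (rule that)
      next
        case False
        then have neg: "X i < 0" using X(1) by (auto simp: not_less less_le)
        obtain s where "f (x - y + 0 *\<^sub>R axis j 1) - f (x - y + X i *\<^sub>R axis j 1)
            = (0 - X i) * partial j f (x - y + s *\<^sub>R axis j 1)"
          using mv[OF neg] by blast
        then have "f (x + X i *\<^sub>R axis j 1 - y) - f (x - y) = X i * partial j f (x - y + s *\<^sub>R axis j 1)"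
          by (simp add: diff_add_eq)
        then have "Q i y = partial j f (x - y + s *\<^sub>R axis j 1)"
          using neg by (simp add: Q_def)
        then show ?thesis by (rule that)
      qed
      moreover have "\<bar>partial j f z\<bar> \<le> K" for z
        using order_trans[OF component_le_norm_cart[of "grad f z" j] g[of z]] by simp
      ultimately show ?thesis by simp
    qed
    have QL: "(\<lambda>i. Q i y) \<longlonglongrightarrow> partial j f (x - y)" for y
    proof -
      note T = smooth_alg_has_partial[OF fa, of "x - y" j, unfolded DERIV_def tendsto_at_iff_sequentially comp_def]
      have "(\<lambda>i. (f (x - y + (0 + X i) *\<^sub>R axis j 1) - f (x - y + 0 *\<^sub>R axis j 1)) / X i) \<longlonglongrightarrow> partial j f (x - y)"
        by (rule T[rule_format]) (use X in auto)
      then show ?thesis by (simp add: Q_def diff_add_eq)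
    qed
    have e: "(\<lambda>y. Q i y * w y $ b) = (\<lambda>y. (f (x + X i *\<^sub>R axis j 1 - y) * w y $ b - f (x - y) * w y $ b) / X i)" for i
      by (simp add: Q_def fun_eq_iff left_diff_distrib)
    have QI: "integrable lborel (\<lambda>y. Q i y * w y $ b)" for i
      unfolding e by (intro integrable_divide Bochner_Integration.integrable_diff Mi)
    have QE: "(\<integral>y. Q i y * w y $ b \<partial>lborel) = (mollify f w (x + (0 + X i) *\<^sub>R axis j 1) $ b - mollify f w (x + 0 *\<^sub>R axis j 1) $ b) / X i" for i
      unfolding e M by (simp add: Bochner_Integration.integral_diff[OF Mi Mi])
    have "(\<lambda>i. \<integral>y. Q i y * w y $ b \<partial>lborel) \<longlonglongrightarrow> (\<integral>y. partial j f (x - y) * w y $ b \<partial>lborel)"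
    proof (rule integral_dominated_convergence[where w = "\<lambda>y. K * norm (w y)"])
      show "integrable lborel (\<lambda>y. K * norm (w y))" using w by auto
      show "AE y in lborel. (\<lambda>i. Q i y * w y $ b) \<longlonglongrightarrow> partial j f (x - y) * w y $ b"
        by (intro AE_I2 tendsto_mult_right QL)
      show "AE y in lborel. norm (Q i y * w y $ b) \<le> K * norm (w y)" for i
        using Qb[of i] component_le_norm_cart[of "w _" b] order_trans[OF abs_ge_zero Qb[of i]]
        by (intro AE_I2) (simp add: abs_mult mult_mono)
      show "(\<lambda>y. partial j f (x - y) * w y $ b) \<in> borel_measurable lborel"
        using integrable_vec_nth[OF integrable_vec_nth[OF integrable_grad_mollify(1)[OF f w, of x], of b], of j]
        by (simp add: mult.commute)
    qed (use QI in auto)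
    then show "(\<lambda>i. (mollify f w (x + (0 + X i) *\<^sub>R axis j 1) $ b - mollify f w (x + 0 *\<^sub>R axis j 1) $ b) / X i)
        \<longlonglongrightarrow> grad_mollify f w x $ b $ j"
      by (simp only: QE L mult.commute)
  qed
  then show "((\<lambda>t. mollify f w (x + t *\<^sub>R axis j 1) $ b) has_real_derivative grad_mollify f w x $ b $ j) (at 0)"
    unfolding DERIV_def .
qed

text \<open>Dividing by the integral of the already scaled bump gives mass one without computing the
  power of s.\<close>

definition mollifier :: "real \<Rightarrow> real^'n::finite \<Rightarrow> real" where
  "mollifier s x = (1 / (\<integral>z. std_bump (0 + (1/s) *\<^sub>R z :: real^'n) \<partial>lborel)) * std_bump (0 + (1/s) *\<^sub>R x)"

lemma std_bump_zero: "\<exists>R>0. \<forall>x::real^'n::finite. norm x > R \<longrightarrow> std_bump x = 0"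
proof -
  obtain R where "\<And>x::real^'n. norm x > R \<Longrightarrow> std_bump x = 0" using std_bump_smooth by (auto simp: smooth_bump_def)
  then show ?thesis by (intro exI[of _ "max R 1"]) auto
qed

text \<open>One radius fixed for each dimension, so that the support of the mollifier of width s has
  radius proportional to s with a known factor.\<close>

definition bump_radius :: "'n::finite itself \<Rightarrow> real" where
  "bump_radius _ = (SOME R. R > 0 \<and> (\<forall>x::real^'n. norm x > R \<longrightarrow> std_bump x = 0))"

lemma bump_radius:
  "bump_radius TYPE('n::finite) > 0" "norm (x::real^'n) > bump_radius TYPE('n) \<Longrightarrow> std_bump x = 0"
proof -
  have "\<exists>R. R > 0 \<and> (\<forall>x::real^'n. norm x > R \<longrightarrow> std_bump x = 0)" using std_bump_zero by blast
  from someI_ex[OF this] show "bump_radius TYPE('n) > 0" "norm (x::real^'n) > bump_radius TYPE('n) \<Longrightarrow> std_bump x = 0"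
    unfolding bump_radius_def by blast+
qed

lemma mollifier_props:
  assumes s: "s > 0"
  shows mollifier_smooth_bump: "mollifier s \<in> (smooth_bump :: (real^'n::finite \<Rightarrow> real) set)"
    and mollifier_nonneg: "mollifier s (x::real^'n) \<ge> 0"
    and mollifier_integral: "has_bochner_integral lborel (mollifier s :: real^'n \<Rightarrow> real) 1"
    and mollifier_zero: "norm (x::real^'n) > bump_radius TYPE('n) * s \<Longrightarrow> mollifier s x = 0"
proof -
  let ?b = "\<lambda>x::real^'n. std_bump (0 + (1/s) *\<^sub>R x)"
  let ?c = "\<integral>z. ?b z \<partial>lborel"
  have b: "?b \<in> smooth_bump" using smooth_bump_affine[OF std_bump_smooth, of "1/s" 0] s by simp
  obtain R K where cont: "continuous_on UNIV ?b" and R: "\<And>x. norm x > R \<Longrightarrow> ?b x = 0"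
    using smooth_bumpE[OF b] by metis
  have int: "integrable lborel ?b" by (rule integrable_continuous_compact[OF cont R])
  have nn: "?b x \<ge> 0" for x by (rule std_bump_nonneg)
  \<comment> \<open>The bump is continuous, nonnegative and equal to 1 at the origin, hence nonzero
    on a nonempty open set; such a set is not negligible.\<close>
  have c: "?c > 0"
  proof -
    have "\<not> (AE x in lborel. ?b x = 0)"
    proof
      assume "AE x in lborel. ?b x = 0"
      moreover have op: "open {x. ?b x \<noteq> 0}" by (intro open_Collect_neq cont continuous_intros)
      ultimately have "emeasure lborel {x. ?b x \<noteq> 0} = 0" by (subst (asm) AE_iff_measurable) auto
      then have "{x. ?b x \<noteq> 0} \<in> null_sets lborel" using op by (auto simp: null_sets_def)
      then have "negligible {x. ?b x \<noteq> 0}" by (metis negligible_iff_null_sets null_sets_completionI)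
      then have "{x. ?b x \<noteq> 0} = {}" using open_not_negligible[OF op] by blast
      moreover have "0 \<in> {x. ?b x \<noteq> 0}" by (simp add: std_bump_0)
      ultimately show False by blast
    qed
    then have "?c \<noteq> 0" using integral_nonneg_eq_0_iff_AE[OF int] nn by auto
    moreover have "?c \<ge> 0" by (rule Bochner_Integration.integral_nonneg) (rule nn)
    ultimately show ?thesis by simp
  qed
  have eq: "mollifier s = (\<lambda>x. (1 / ?c) * ?b x)" by (simp add: mollifier_def fun_eq_iff)
  show "mollifier s \<in> (smooth_bump :: (real^'n \<Rightarrow> real) set)"
    unfolding eq by (rule smooth_bump_mult[OF smooth_alg_const b])
  show "mollifier s x \<ge> 0" unfolding eq using c nn[of x] by simp
  show "has_bochner_integral lborel (mollifier s :: real^'n \<Rightarrow> real) 1"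
    unfolding has_bochner_integral_iff eq using c int by auto
  show "mollifier s x = 0" if "norm x > bump_radius TYPE('n) * s"
  proof -
    have "norm (0 + (1/s) *\<^sub>R x) > bump_radius TYPE('n)" using that s by (simp add: field_simps)
    then have "?b x = 0" by (rule bump_radius(2))
    then show ?thesis by (simp add: eq)
  qed
qed

lemma mollifier_integral_reflect:
  assumes "s > 0"
  shows "has_bochner_integral lborel (\<lambda>y. mollifier s (x - y :: real^'n::finite)) 1"
    "(\<integral>\<^sup>+x. ennreal (mollifier s (x - y :: real^'n::finite)) \<partial>lborel) = 1"
proof -
  note m = mollifier_integral[OF assms, where 'n = 'n]
  have meas: "mollifier s \<in> borel_measurable (borel :: (real^'n) measure)"
    using borel_measurable_has_bochner_integral[OF m] by simp
  have i: "integrable lborel (mollifier s :: real^'n \<Rightarrow> real)" "(\<integral>x. mollifier s (x :: real^'n) \<partial>lborel) = 1"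
    using m by (auto simp: has_bochner_integral_iff)
  show "has_bochner_integral lborel (\<lambda>y. mollifier s (x - y)) 1"
    using integral_reflect[OF meas, of "-1" x] i by (simp add: has_bochner_integral_iff)
  have "(\<integral>\<^sup>+x. ennreal (mollifier s (- y + 1 *\<^sub>R x)) \<partial>lborel) = (\<integral>\<^sup>+x. ennreal (mollifier s (x :: real^'n)) \<partial>lborel)"
    by (rule nn_integral_reflect) (use meas in auto)
  also have "\<dots> = ennreal 1"
    using i mollifier_nonneg[OF assms] by (subst nn_integral_eq_integral) auto
  finally show "(\<integral>\<^sup>+x. ennreal (mollifier s (x - y)) \<partial>lborel) = 1" by simp
qed

text \<open>Jensen's inequality for a probability density in variance form: the mean square
  deviation from the average ?m is nonnegative, and expanding it gives the claim.\<close>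

lemma norm_mollify_sq_le:
  fixes w :: "real^'n::finite \<Rightarrow> 'v::euclidean_space"
  assumes s: "s > 0" and w: "integrable lborel w" "integrable lborel (\<lambda>x. (norm (w x))\<^sup>2)"
  shows "(norm (mollify (mollifier s) w x))\<^sup>2 \<le> (\<integral>y. mollifier s (x - y) * (norm (w y))\<^sup>2 \<partial>lborel)"
    "integrable lborel (\<lambda>y. mollifier s (x - y) * (norm (w y))\<^sup>2)"
proof -
  let ?p = "\<lambda>y. mollifier s (x - y)"
  let ?m = "mollify (mollifier s) w x"
  note sb = mollifier_smooth_bump[OF s, where 'n = 'n]
  have i1: "integrable lborel (\<lambda>y. ?p y *\<^sub>R w y)" by (rule continuous_mollify(2)[OF sb w(1)])
  show i2: "integrable lborel (\<lambda>y. ?p y * (norm (w y))\<^sup>2)"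
    using continuous_mollify(2)[OF sb w(2), of x] by simp
  have i3: "integrable lborel ?p" "(\<integral>y. ?p y \<partial>lborel) = 1"
    using mollifier_integral_reflect(1)[OF s, of x] by (auto simp: has_bochner_integral_iff)
  have "0 \<le> (\<integral>y. ?p y * (norm (w y - ?m))\<^sup>2 \<partial>lborel)"
    by (rule Bochner_Integration.integral_nonneg) (simp add: mollifier_nonneg[OF s])
  also have "(\<lambda>y. ?p y * (norm (w y - ?m))\<^sup>2) = (\<lambda>y. ?p y * (norm (w y))\<^sup>2 - 2 * ((?p y *\<^sub>R w y) \<bullet> ?m) + ?p y * (norm ?m)\<^sup>2)"
    by (simp add: fun_eq_iff power2_norm_eq_inner inner_diff_left inner_diff_right inner_commute algebra_simps)
  also have "(\<integral>y. ?p y * (norm (w y))\<^sup>2 - 2 * ((?p y *\<^sub>R w y) \<bullet> ?m) + ?p y * (norm ?m)\<^sup>2 \<partial>lborel)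
     = (\<integral>y. ?p y * (norm (w y))\<^sup>2 \<partial>lborel) - 2 * ((\<integral>y. ?p y *\<^sub>R w y \<partial>lborel) \<bullet> ?m) + (\<integral>y. ?p y \<partial>lborel) * (norm ?m)\<^sup>2"
    using i1 i2 i3(1) by (simp del: inner_scaleR_left)
  also have "\<dots> = (\<integral>y. ?p y * (norm (w y))\<^sup>2 \<partial>lborel) - (norm ?m)\<^sup>2"
    by (simp add: i3 mollify_def[symmetric] power2_norm_eq_inner[symmetric])
  finally show "(norm ?m)\<^sup>2 \<le> (\<integral>y. ?p y * (norm (w y))\<^sup>2 \<partial>lborel)" by simp
qed

text \<open>Integrate Jensen's inequality and exchange the integrals; the kernel has mass one also
  as a function of x. The map is therefore a contraction of L^2.\<close>

lemma mollify_L2: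
  fixes w :: "real^'n::finite \<Rightarrow> 'v::euclidean_space"
  assumes s: "s > 0" and w: "w \<in> borel_measurable borel" "integrable lborel (\<lambda>x. (norm (w x))\<^sup>2)"
    and w0: "\<And>x. norm x > r \<Longrightarrow> w x = 0"
  shows mollify_L2_integrable: "integrable lborel (\<lambda>x. (norm (mollify (mollifier s) w x))\<^sup>2)"
    and mollify_L2_le: "(\<integral>x. (norm (mollify (mollifier s) w x))\<^sup>2 \<partial>lborel) \<le> (\<integral>x. (norm (w x))\<^sup>2 \<partial>lborel)"
proof -
  note sb = mollifier_smooth_bump[OF s, where 'n = 'n]
  let ?m = "mollify (mollifier s) w"
  have wi: "integrable lborel w" by (rule integrable_if_L2_compact[OF w w0])
  have mR: "?m x = 0" if "norm x > bump_radius TYPE('n) * s + r" for x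
    by (rule mollify_zero_outside[OF mollifier_zero[OF s] w0 that])
  show int: "integrable lborel (\<lambda>x. (norm (?m x))\<^sup>2)"
    by (rule integrable_continuous_compact[of _ "bump_radius TYPE('n) * s + r"])
      (auto intro!: continuous_intros continuous_mollify(1)[OF sb wi] simp: mR)
  have pm: "(\<lambda>x::real^'n. mollifier s x) \<in> borel_measurable borel"
    using sb by (auto elim!: smooth_bumpE intro: borel_measurable_continuous_onI)
  have "ennreal (\<integral>x. (norm (?m x))\<^sup>2 \<partial>lborel) = (\<integral>\<^sup>+x. ennreal ((norm (?m x))\<^sup>2) \<partial>lborel)"
    using int by (subst nn_integral_eq_integral) auto
  also have "\<dots> \<le> (\<integral>\<^sup>+x. \<integral>\<^sup>+y. ennreal (mollifier s (x - y)) * ennreal ((norm (w y))\<^sup>2) \<partial>lborel \<partial>lborel)"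
  proof (rule nn_integral_mono)
    fix x
    have "ennreal ((norm (?m x))\<^sup>2) \<le> ennreal (\<integral>y. mollifier s (x - y) * (norm (w y))\<^sup>2 \<partial>lborel)"
      by (rule ennreal_leI) (rule norm_mollify_sq_le[OF s wi w(2)])
    also have "\<dots> = (\<integral>\<^sup>+y. ennreal (mollifier s (x - y) * (norm (w y))\<^sup>2) \<partial>lborel)"
      by (rule nn_integral_eq_integral[symmetric])
        (intro norm_mollify_sq_le(2)[OF s wi w(2)] AE_I2 mult_nonneg_nonneg mollifier_nonneg[OF s] zero_le_power2)+
    finally show "ennreal ((norm (?m x))\<^sup>2) \<le> (\<integral>\<^sup>+y. ennreal (mollifier s (x - y)) * ennreal ((norm (w y))\<^sup>2) \<partial>lborel)"
      by (simp add: ennreal_mult' mollifier_nonneg[OF s])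
  qed
  also have "\<dots> = (\<integral>\<^sup>+y. \<integral>\<^sup>+x. ennreal (mollifier s (x - y)) * ennreal ((norm (w y))\<^sup>2) \<partial>lborel \<partial>lborel)"
    by (rule lborel_pair.Fubini'[symmetric]) (use pm w(1) in \<open>auto simp: split_beta'\<close>)
  also have "\<dots> = (\<integral>\<^sup>+y. ennreal ((norm (w y))\<^sup>2) \<partial>lborel)"
    using pm by (simp add: nn_integral_multc mollifier_integral_reflect(2)[OF s])
  also have "\<dots> = ennreal (\<integral>x. (norm (w x))\<^sup>2 \<partial>lborel)"
    using w(2) by (subst nn_integral_eq_integral) auto
  finally show "(\<integral>x. (norm (?m x))\<^sup>2 \<partial>lborel) \<le> (\<integral>x. (norm (w x))\<^sup>2 \<partial>lborel)"
    by (simp add: ennreal_le_iff)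
qed

section \<open>Approximation in L^2 by continuous functions and by mollification\<close>

lemma norm_sq_sum_le:
  fixes a b c :: "'v::real_inner"
  shows "(norm (a + b))\<^sup>2 \<le> 2 * (norm a)\<^sup>2 + 2 * (norm b)\<^sup>2"
    and "(norm (a + b + c))\<^sup>2 \<le> 3 * (norm a)\<^sup>2 + 3 * (norm b)\<^sup>2 + 3 * (norm c)\<^sup>2"
proof -
  have "2 * (norm a)\<^sup>2 + 2 * (norm b)\<^sup>2 - (norm (a + b))\<^sup>2 = (norm (a - b))\<^sup>2"
    by (simp add: power2_norm_eq_inner inner_diff_left inner_diff_right inner_add_left inner_add_right inner_commute)
  then show "(norm (a + b))\<^sup>2 \<le> 2 * (norm a)\<^sup>2 + 2 * (norm b)\<^sup>2" by (metis zero_le_power2 diff_ge_0_iff_ge)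
  have "3 * (norm a)\<^sup>2 + 3 * (norm b)\<^sup>2 + 3 * (norm c)\<^sup>2 - (norm (a + b + c))\<^sup>2
      = (norm (a - b))\<^sup>2 + (norm (b - c))\<^sup>2 + (norm (a - c))\<^sup>2"
    by (simp add: power2_norm_eq_inner inner_diff_left inner_diff_right inner_add_left inner_add_right inner_commute)
  moreover have "0 \<le> (norm (a - b))\<^sup>2 + (norm (b - c))\<^sup>2 + (norm (a - c))\<^sup>2" by simp
  ultimately show "(norm (a + b + c))\<^sup>2 \<le> 3 * (norm a)\<^sup>2 + 3 * (norm b)\<^sup>2 + 3 * (norm c)\<^sup>2" by linarith
qed

text \<open>A Lebesgue measurable function is almost everywhere a limit of continuous ones.
  Truncating these both in range and in domain keeps continuity and supplies a dominating
  function.\<close>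

lemma L2_approx_bounded:
  fixes f :: "real^'n::finite \<Rightarrow> 'v::euclidean_space"
  assumes f: "f \<in> borel_measurable borel" "\<And>x. norm (f x) \<le> k" "\<And>x. norm x > k \<Longrightarrow> f x = 0" and e: "e > 0"
  obtains G where "continuous_on UNIV G" "\<And>x. norm x > k + 1 \<Longrightarrow> G x = 0" "\<And>x. norm (G x) \<le> k"
    "(\<integral>x. (norm (f x - G x))\<^sup>2 \<partial>lborel) < e"
proof -
  have k0: "k \<ge> 0" by (rule order_trans[OF norm_ge_zero f(2)])
  have "f \<in> borel_measurable lebesgue" using f(1) by (simp add: measurable_completion)
  then have "f measurable_on UNIV" by (intro lebesgue_measurable_imp_measurable_on) auto
  then obtain N g where N: "negligible N" and g: "\<And>n. continuous_on UNIV (g n)"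
      "\<And>x. x \<notin> N \<Longrightarrow> (\<lambda>n. g n x) \<longlonglongrightarrow> f x"
    unfolding measurable_on_def by auto
  \<comment> \<open>Equal to 1 on the ball of radius k that carries f and to 0 outside the ball of
    radius k + 1.\<close>
  define \<zeta> :: "real^'n \<Rightarrow> real" where "\<zeta> x = max 0 (min 1 (k + 1 - norm x))" for x
  \<comment> \<open>Nearest point projection onto the ball: continuous, bounded, and the identity on
    the values of f.\<close>
  define P where "P = closest_point (cball (0::'v) k)"
  have Pc: "continuous_on UNIV P" unfolding P_def using k0 by (intro continuous_on_closest_point) auto
  have Pn: "norm (P v) \<le> k" for v
    using closest_point_in_set[of "cball (0::'v) k" v] k0 by (auto simp: P_def)
  have Pf: "P (f x) = f x" for x unfolding P_def using f(2) by (intro closest_point_self) auto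
  define G where "G n x = \<zeta> x *\<^sub>R P (g n x)" for n x
  have \<zeta>: "0 \<le> \<zeta> x" "\<zeta> x \<le> 1" for x by (auto simp: \<zeta>_def)
  have Gc: "continuous_on UNIV (G n)" for n
    unfolding G_def \<zeta>_def by (intro continuous_intros continuous_on_compose2[OF Pc g(1)]) auto
  have Gn: "norm (G n x) \<le> k" for n x
    using mult_mono[OF \<zeta>(2)[of x] Pn[of "g n x"]] \<zeta>(1)[of x] k0 by (simp add: G_def)
  have G0: "G n x = 0" if "norm x > k + 1" for n x using that by (simp add: G_def \<zeta>_def)
  have \<zeta>f: "\<zeta> x *\<^sub>R f x = f x" for x
    using f(3)[of x] by (cases "norm x > k") (auto simp: \<zeta>_def)
  have "AE x in lebesgue. x \<notin> N" using N by (simp add: negligible_iff_null_sets AE_not_in)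
  then have AEN: "AE x in lborel. x \<notin> N" by (simp add: AE_completion_iff)
  have Gm: "G n \<in> borel_measurable borel" for n by (intro borel_measurable_continuous_onI Gc)
  have "(\<lambda>n. \<integral>x. (norm (f x - G n x))\<^sup>2 \<partial>lborel) \<longlonglongrightarrow> (\<integral>x. 0 \<partial>(lborel :: (real^'n) measure))"
  proof (rule integral_dominated_convergence[where w = "\<lambda>x. (2 * k)\<^sup>2 * indicator (cball 0 (k + 1)) x"])
    show "integrable lborel (\<lambda>x. (2 * k)\<^sup>2 * indicator (cball (0::real^'n) (k + 1)) x)"
      by (intro integrable_mult_right integrable_indicator_cball)
    show "(\<lambda>x. (norm (f x - G n x))\<^sup>2) \<in> borel_measurable lborel" for n
      using f(1) Gm[of n] by auto
    show "AE x in lborel. (\<lambda>n. (norm (f x - G n x))\<^sup>2) \<longlonglongrightarrow> 0"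
      using AEN
    proof eventually_elim
      case (elim x)
      have "(\<lambda>n. P (g n x)) \<longlonglongrightarrow> P (f x)"
        by (rule continuous_on_tendsto_compose[OF Pc g(2)[OF elim]]) auto
      then have "(\<lambda>n. G n x) \<longlonglongrightarrow> \<zeta> x *\<^sub>R P (f x)" unfolding G_def by (intro tendsto_intros)
      then have "(\<lambda>n. G n x) \<longlonglongrightarrow> f x" by (simp add: Pf \<zeta>f)
      then have "(\<lambda>n. (norm (f x - G n x))\<^sup>2) \<longlonglongrightarrow> (norm (f x - f x))\<^sup>2" by (intro tendsto_intros)
      then show ?case by simp
    qed
    show "AE x in lborel. norm ((norm (f x - G n x))\<^sup>2) \<le> (2 * k)\<^sup>2 * indicator (cball 0 (k + 1)) x" for n
    proof (rule AE_I2)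
      fix x :: "real^'n"
      show "norm ((norm (f x - G n x))\<^sup>2) \<le> (2 * k)\<^sup>2 * indicator (cball 0 (k + 1)) x"
      proof (cases "norm x > k + 1")
        case True then show ?thesis using f(3)[of x] G0 by simp
      next
        case False
        have "norm (f x - G n x) \<le> 2 * k" using norm_triangle_ineq4[of "f x" "G n x"] f(2)[of x] Gn[of n x] by simp
        then have "(norm (f x - G n x))\<^sup>2 \<le> (2 * k)\<^sup>2" by (intro power_mono) auto
        then show ?thesis using False by simp
      qed
    qed
  qed auto
  then have "\<forall>\<^sub>F n in sequentially. (\<integral>x. (norm (f x - G n x))\<^sup>2 \<partial>lborel) < e"
    using e by (intro order_tendstoD(2)) auto
  then obtain n where "(\<integral>x. (norm (f x - G n x))\<^sup>2 \<partial>lborel) < e" by (auto simp: eventually_sequentially)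
  then show ?thesis using that[OF Gc G0 Gn] by blast
qed

lemma integrable_L2_diff:
  fixes f g :: "'a \<Rightarrow> 'v::euclidean_space"
  assumes "f \<in> borel_measurable M" "g \<in> borel_measurable M"
    and "integrable M (\<lambda>x. (norm (f x))\<^sup>2)" "integrable M (\<lambda>x. (norm (g x))\<^sup>2)"
  shows "integrable M (\<lambda>x. (norm (f x - g x))\<^sup>2)" "integrable M (\<lambda>x. (norm (f x + g x))\<^sup>2)"
proof -
  have i: "integrable M (\<lambda>x. 2 * (norm (f x))\<^sup>2 + 2 * (norm (g x))\<^sup>2)" using assms by auto
  show "integrable M (\<lambda>x. (norm (f x - g x))\<^sup>2)"
    by (rule Bochner_Integration.integrable_bound[OF i])
      (use assms norm_sq_sum_le(1)[of "f _" "- g _"] in \<open>auto intro!: AE_I2\<close>)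
  show "integrable M (\<lambda>x. (norm (f x + g x))\<^sup>2)"
    by (rule Bochner_Integration.integrable_bound[OF i])
      (use assms norm_sq_sum_le(1)[of "f _" "g _"] in \<open>auto intro!: AE_I2\<close>)
qed

lemma L2_approx:
  fixes f :: "real^'n::finite \<Rightarrow> 'v::euclidean_space"
  assumes f: "f \<in> borel_measurable borel" "integrable lborel (\<lambda>x. (norm (f x))\<^sup>2)" and e: "e > 0"
  obtains G k where "continuous_on UNIV G" "\<And>x. norm x > k \<Longrightarrow> G x = 0"
    "(\<integral>x. (norm (f x - G x))\<^sup>2 \<partial>lborel) < e"
proof -
  define T where "T k x = (if norm x \<le> real k \<and> norm (f x) \<le> real k then f x else 0)" for k :: nat and x
  have Tm: "T k \<in> borel_measurable borel" for k
  proof -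
    have "{x. norm x \<le> real k \<and> norm (f x) \<le> real k} \<in> sets borel" using f(1) by measurable
    then show ?thesis unfolding T_def by (intro measurable_If f(1) borel_measurable_const) simp
  qed
  have Ti: "integrable lborel (\<lambda>x. (norm (T k x))\<^sup>2)" for k
  proof (rule Bochner_Integration.integrable_bound[OF f(2)])
    show "(\<lambda>x. (norm (T k x))\<^sup>2) \<in> borel_measurable lborel" using Tm[of k] by simp
  qed (auto simp: T_def)
  have "(\<lambda>k. \<integral>x. (norm (f x - T k x))\<^sup>2 \<partial>lborel) \<longlonglongrightarrow> (\<integral>x. 0 \<partial>(lborel :: (real^'n) measure))"
  proof (rule integral_dominated_convergence[OF _ _ f(2)])
    show "(\<lambda>x. (norm (f x - T k x))\<^sup>2) \<in> borel_measurable lborel" for k using f(1) Tm[of k] by auto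
    show "AE x in lborel. (\<lambda>k. (norm (f x - T k x))\<^sup>2) \<longlonglongrightarrow> 0"
    proof (rule AE_I2)
      fix x
      obtain K :: nat where K: "max (norm x) (norm (f x)) \<le> K" using real_arch_simple by blast
      have "\<forall>\<^sub>F k in sequentially. (norm (f x - T k x))\<^sup>2 = 0"
        using eventually_ge_at_top[of K] by eventually_elim (use K in \<open>auto simp: T_def\<close>)
      then show "(\<lambda>k. (norm (f x - T k x))\<^sup>2) \<longlonglongrightarrow> 0" by (rule tendsto_eventually)
    qed
    show "AE x in lborel. norm ((norm (f x - T k x))\<^sup>2) \<le> (norm (f x))\<^sup>2" for k
      by (auto simp: T_def)
  qed auto
  \<comment> \<open>Each of the two errors enters the final estimate with the factor 2, hence e /
    4.\<close>
  then have "\<forall>\<^sub>F k in sequentially. (\<integral>x. (norm (f x - T k x))\<^sup>2 \<partial>lborel) < e / 4"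
    using e by (intro order_tendstoD(2)) auto
  then obtain k where k: "(\<integral>x. (norm (f x - T k x))\<^sup>2 \<partial>lborel) < e / 4" by (auto simp: eventually_sequentially)
  have Tb: "norm (T k x) \<le> real k" "norm x > real k \<Longrightarrow> T k x = 0" for x by (auto simp: T_def)
  have e4: "e / 4 > 0" using e by simp
  obtain G where G: "continuous_on UNIV G" "\<And>x. norm x > real k + 1 \<Longrightarrow> G x = 0"
    and "\<And>x. norm (G x) \<le> real k" and G3: "(\<integral>x. (norm (T k x - G x))\<^sup>2 \<partial>lborel) < e / 4"
    using L2_approx_bounded[OF Tm Tb e4] by blast
  have Gi: "integrable lborel (\<lambda>x. (norm (G x))\<^sup>2)"
    by (rule integrable_continuous_compact[of _ "real k + 1"]) (auto intro!: continuous_intros G(1) simp: G(2))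
  have Gm: "G \<in> borel_measurable borel" by (rule borel_measurable_continuous_onI[OF G(1)])
  have i1: "integrable lborel (\<lambda>x. (norm (f x - T k x))\<^sup>2)" and i2: "integrable lborel (\<lambda>x. (norm (T k x - G x))\<^sup>2)"
    and i3: "integrable lborel (\<lambda>x. (norm (f x - G x))\<^sup>2)"
    using f Tm[of k] Ti[of k] Gm Gi by (auto intro!: integrable_L2_diff)
  have pt: "(norm (f x - G x))\<^sup>2 \<le> 2 * (norm (f x - T k x))\<^sup>2 + 2 * (norm (T k x - G x))\<^sup>2" for x
    using norm_sq_sum_le(1)[of "f x - T k x" "T k x - G x"] by simp
  have "(\<integral>x. (norm (f x - G x))\<^sup>2 \<partial>lborel) \<le> (\<integral>x. 2 * (norm (f x - T k x))\<^sup>2 + 2 * (norm (T k x - G x))\<^sup>2 \<partial>lborel)"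
    by (rule integral_mono) (use i1 i2 i3 pt in auto)
  also have "\<dots> < e" using i1 i2 k G3 by simp
  finally show ?thesis using that[OF G(1,2)] by blast
qed

lemma mollify_diff:
  assumes "f \<in> smooth_bump" "integrable lborel w" "integrable lborel v"
  shows "mollify f (\<lambda>x. w x - v x) x = mollify f w x - mollify f v x"
  unfolding mollify_def scaleR_diff_right
  using continuous_mollify(2)[OF assms(1,2), of x] continuous_mollify(2)[OF assms(1,3), of x] by simp

lemma mollify_tendsto_continuous:
  fixes G :: "real^'n::finite \<Rightarrow> 'v::euclidean_space"
  assumes G: "continuous_on UNIV G" "\<And>x. norm x > r \<Longrightarrow> G x = 0"
    and h: "\<And>i. h i > 0" "h \<longlonglongrightarrow> 0"
  shows "(\<lambda>i. \<integral>x. (norm (mollify (mollifier (h i)) G x - G x))\<^sup>2 \<partial>lborel) \<longlonglongrightarrow> 0"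
proof -
  let ?R = "bump_radius TYPE('n)"
  obtain K where K: "K > 0" "\<And>x. norm (G x) \<le> K" using bounded_if_continuous_compact[OF G] by blast
  have Gi: "integrable lborel G" by (rule integrable_continuous_compact[OF G])
  note sb = mollifier_smooth_bump[OF h(1), where 'n = 'n]
  \<comment> \<open>A mollified value is an average over a ball of radius ?R h, so it is as close to
    v as G is on that ball. This is used with v = G x for convergence and with v = 0 for a uniform
    bound.\<close>
  have close: "norm (mollify (mollifier (h i)) G x - v) \<le> e"
    if "\<And>y. norm (x - y) \<le> ?R * h i \<Longrightarrow> norm (G y - v) \<le> e" for i x v e
  proof -
    note m1 = mollifier_integral_reflect(1)[OF h(1), of i x]
    have i1: "integrable lborel (\<lambda>y. mollifier (h i) (x - y))" "(\<integral>y. mollifier (h i) (x - y) \<partial>lborel) = 1"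
      using m1 by (auto simp: has_bochner_integral_iff)
    have i2: "integrable lborel (\<lambda>y. mollifier (h i) (x - y) *\<^sub>R G y)" by (rule continuous_mollify(2)[OF sb Gi])
    have i3: "integrable lborel (\<lambda>y. mollifier (h i) (x - y) *\<^sub>R (G y - v))"
      unfolding scaleR_diff_right using i1 i2 by auto
    have "mollify (mollifier (h i)) G x - v = (\<integral>y. mollifier (h i) (x - y) *\<^sub>R (G y - v) \<partial>lborel)"
      unfolding scaleR_diff_right mollify_def using i1 i2 by simp
    also have "norm \<dots> \<le> (\<integral>y. norm (mollifier (h i) (x - y) *\<^sub>R (G y - v)) \<partial>lborel)" by (rule integral_norm_bound)
    also have "\<dots> \<le> (\<integral>y. mollifier (h i) (x - y) * e \<partial>lborel)"
    proof (rule integral_mono)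
      show "norm (mollifier (h i) (x - y) *\<^sub>R (G y - v)) \<le> mollifier (h i) (x - y) * e" for y
        using that[of y] mollifier_nonneg[OF h(1), of i "x - y"] mollifier_zero[OF h(1), of i "x - y"]
        by (cases "norm (x - y) \<le> ?R * h i") (auto intro!: mult_left_mono)
      show "integrable lborel (\<lambda>y. norm (mollifier (h i) (x - y) *\<^sub>R (G y - v)))" by (rule integrable_norm[OF i3])
      show "integrable lborel (\<lambda>y. mollifier (h i) (x - y) * e)" using i1 by auto
    qed
    also have "\<dots> = e" using i1 by simp
    finally show ?thesis .
  qed
  \<comment> \<open>A common bound for the widths gives a common support, as dominated convergence
    requires.\<close>
  obtain H where H: "\<And>i. h i \<le> H" using convergent_imp_Bseq[OF convergentI[OF h(2)]]
    by (auto simp: Bseq_def) (metis abs_le_D1)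
  have R0: "?R > 0" by (rule bump_radius)
  have "(\<lambda>i. \<integral>x. (norm (mollify (mollifier (h i)) G x - G x))\<^sup>2 \<partial>lborel) \<longlonglongrightarrow> (\<integral>x. 0 \<partial>(lborel :: (real^'n) measure))"
  proof (rule dominated_on_cball[where K = "(2 * K)\<^sup>2" and \<rho> = "max r (?R * H + r)"])
    show "(\<lambda>x. (norm (mollify (mollifier (h i)) G x - G x))\<^sup>2) \<in> borel_measurable lborel" for i
      using borel_measurable_continuous_onI[OF continuous_mollify(1)[OF sb Gi]] borel_measurable_continuous_onI[OF G(1)]
      by auto
    show "(\<lambda>i. (norm (mollify (mollifier (h i)) G x - G x))\<^sup>2) \<longlonglongrightarrow> 0" for x
    proof -
      have "(\<lambda>i. mollify (mollifier (h i)) G x) \<longlonglongrightarrow> G x"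
      proof (rule metric_LIMSEQ_I)
        fix e :: real assume e: "e > 0"
        have "isCont G x" using G(1) by (simp add: continuous_on_eq_continuous_at)
        then obtain d where d: "d > 0" "\<And>y. norm (y - x) < d \<Longrightarrow> norm (G y - G x) < e / 2"
          unfolding continuous_at_eps_delta dist_norm using e half_gt_zero by blast
        have "\<forall>\<^sub>F i in sequentially. h i < d / ?R"
          using d R0 by (intro order_tendstoD(2)[OF h(2)]) auto
        then obtain N where N: "\<And>i. i \<ge> N \<Longrightarrow> h i < d / ?R" by (auto simp: eventually_sequentially)
        have "dist (mollify (mollifier (h i)) G x) (G x) < e" if "i \<ge> N" for i
        proof -
          have "norm (mollify (mollifier (h i)) G x - G x) \<le> e / 2"
          proof (rule close)
            fix y assume "norm (x - y) \<le> ?R * h i"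
            also have "\<dots> < d" using N[OF that] R0 by (simp add: field_simps)
            finally show "norm (G y - G x) \<le> e / 2" using d(2)[of y] by (simp add: norm_minus_commute)
          qed
          then show ?thesis using e by (simp add: dist_norm)
        qed
        then show "\<exists>N. \<forall>i\<ge>N. dist (mollify (mollifier (h i)) G x) (G x) < e" by blast
      qed
      then have "(\<lambda>i. (norm (mollify (mollifier (h i)) G x - G x))\<^sup>2) \<longlonglongrightarrow> (norm (G x - G x))\<^sup>2"
        by (intro tendsto_intros)
      then show ?thesis by simp
    qed
    fix i x
    have "norm (mollify (mollifier (h i)) G x) \<le> K" using close[of x i 0 K] K(2) by simp
    then have "norm (mollify (mollifier (h i)) G x - G x) \<le> 2 * K"
      using norm_triangle_ineq4[of "mollify (mollifier (h i)) G x" "G x"] K(2)[of x] by simp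
    then show "\<bar>(norm (mollify (mollifier (h i)) G x - G x))\<^sup>2\<bar> \<le> (2 * K)\<^sup>2"
      by (simp only: abs_power2 power_mono norm_ge_zero)
    assume x: "norm x > max r (?R * H + r)"
    have "?R * h i \<le> ?R * H" using H R0 by simp
    then have "norm x > ?R * h i + r" using x by linarith
    then have "mollify (mollifier (h i)) G x = 0"
      by (rule mollify_zero_outside[OF mollifier_zero[OF h(1)] G(2), rotated -1])
    then show "(norm (mollify (mollifier (h i)) G x - G x))\<^sup>2 = 0" using G(2)[of x] x by simp
  qed
  then show ?thesis by simp
qed

text \<open>The usual three-term argument: compare w with a continuous compactly supported G, for
  which convergence is known, and control the mollified difference by the L^2 contraction.\<close>

lemma mollify_tendsto_L2:
  fixes w :: "real^'n::finite \<Rightarrow> 'v::euclidean_space"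
  assumes w: "w \<in> borel_measurable borel" "integrable lborel (\<lambda>x. (norm (w x))\<^sup>2)"
    and w0: "\<And>x. norm x > r \<Longrightarrow> w x = 0" and h: "\<And>i. h i > 0" "h \<longlonglongrightarrow> 0"
  shows "(\<lambda>i. \<integral>x. (norm (mollify (mollifier (h i)) w x - w x))\<^sup>2 \<partial>lborel) \<longlonglongrightarrow> 0"
proof (rule LIMSEQ_I)
  fix e :: real assume e: "e > 0"
  \<comment> \<open>Three squared errors, each weighted by 3, add up to at most 9 e / 12 <
    e.\<close>
  have "e / 12 > 0" using e by simp
  from L2_approx[OF w this] obtain G k where G: "continuous_on UNIV G" "\<And>x. norm x > k \<Longrightarrow> G x = 0"
    "(\<integral>x. (norm (w x - G x))\<^sup>2 \<partial>lborel) < e / 12" by blast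
  have Gm: "G \<in> borel_measurable borel" by (rule borel_measurable_continuous_onI[OF G(1)])
  have Gi: "integrable lborel G" by (rule integrable_continuous_compact[OF G(1,2)])
  have G2: "integrable lborel (\<lambda>x. (norm (G x))\<^sup>2)"
    by (rule integrable_continuous_compact[of _ k]) (auto intro!: continuous_intros G(1) simp: G(2))
  have wi: "integrable lborel w" by (rule integrable_if_L2_compact[OF w w0])
  note sb = mollifier_smooth_bump[OF h(1), where 'n = 'n]
  let ?M = "\<lambda>i. mollify (mollifier (h i))"
  have dm: "(\<lambda>x. w x - G x) \<in> borel_measurable borel" using w(1) Gm by auto
  have d2: "integrable lborel (\<lambda>x. (norm (w x - G x))\<^sup>2)" using w Gm G2 by (auto intro!: integrable_L2_diff)
  have d0: "norm x > max r k \<Longrightarrow> w x - G x = 0" for x using w0 G(2) by simp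
  have "\<forall>\<^sub>F i in sequentially. (\<integral>x. (norm (?M i G x - G x))\<^sup>2 \<partial>lborel) < e / 12"
    using e by (intro order_tendstoD(2)[OF mollify_tendsto_continuous[OF G(1,2) h]]) auto
  then obtain N where N: "\<And>i. i \<ge> N \<Longrightarrow> (\<integral>x. (norm (?M i G x - G x))\<^sup>2 \<partial>lborel) < e / 12"
    by (auto simp: eventually_sequentially)
  have "norm ((\<integral>x. (norm (?M i w x - w x))\<^sup>2 \<partial>lborel) - 0) < e" if "i \<ge> N" for i
  proof -
    have mw: "?M i w \<in> borel_measurable borel" "?M i G \<in> borel_measurable borel"
      by (intro borel_measurable_continuous_onI continuous_mollify(1)[OF sb] wi Gi)+
    have i1: "integrable lborel (\<lambda>x. (norm (?M i (\<lambda>x. w x - G x) x))\<^sup>2)"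
      by (rule mollify_L2_integrable[OF h(1) dm d2 d0])
    have i2: "integrable lborel (\<lambda>x. (norm (?M i G x - G x))\<^sup>2)"
      using mw Gm G2 mollify_L2_integrable[OF h(1) Gm G2 G(2)] by (auto intro!: integrable_L2_diff)
    have i3: "integrable lborel (\<lambda>x. (norm (?M i w x - w x))\<^sup>2)"
      using mw w mollify_L2_integrable[OF h(1) w w0] by (auto intro!: integrable_L2_diff)
    have "(norm (?M i w x - w x))\<^sup>2 \<le> 3 * (norm (?M i (\<lambda>x. w x - G x) x))\<^sup>2 + 3 * (norm (?M i G x - G x))\<^sup>2 + 3 * (norm (w x - G x))\<^sup>2" for x
      using norm_sq_sum_le(2)[of "?M i (\<lambda>x. w x - G x) x" "?M i G x - G x" "- (w x - G x)"]
      unfolding mollify_diff[OF sb wi Gi] by (simp add: norm_minus_commute)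
    then have "(\<integral>x. (norm (?M i w x - w x))\<^sup>2 \<partial>lborel) \<le>
        (\<integral>x. 3 * (norm (?M i (\<lambda>x. w x - G x) x))\<^sup>2 + 3 * (norm (?M i G x - G x))\<^sup>2 + 3 * (norm (w x - G x))\<^sup>2 \<partial>lborel)"
      using i1 i2 i3 d2 by (intro integral_mono) auto
    also have "\<dots> = 3 * (\<integral>x. (norm (?M i (\<lambda>x. w x - G x) x))\<^sup>2 \<partial>lborel) + 3 * (\<integral>x. (norm (?M i G x - G x))\<^sup>2 \<partial>lborel)
        + 3 * (\<integral>x. (norm (w x - G x))\<^sup>2 \<partial>lborel)"
      using i1 i2 d2 by simp
    also have "\<dots> < e"
    proof -
      have "(\<integral>x. (norm (?M i (\<lambda>x. w x - G x) x))\<^sup>2 \<partial>lborel) \<le> (\<integral>x. (norm (w x - G x))\<^sup>2 \<partial>lborel)"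
        by (rule mollify_L2_le[OF h(1) dm d2 d0])
      then show ?thesis using N[OF that] G(3) e by simp
    qed
    finally show ?thesis by (simp add: Bochner_Integration.integral_nonneg)
  qed
  then show "\<exists>N. \<forall>i\<ge>N. norm ((\<integral>x. (norm (?M i w x - w x))\<^sup>2 \<partial>lborel) - 0) < e" by blast
qed

section \<open>The norm of \<open>L\<^sup>2\<close>\<close>

text \<open>The measure is a parameter because the analysis takes place on Borel functions over
  \<open>lborel\<close>, while the space W is defined over \<open>lebesgue\<close>.\<close>

definition L2norm :: "'a measure \<Rightarrow> ('a \<Rightarrow> 'v::euclidean_space) \<Rightarrow> real" where
  "L2norm M f = sqrt (\<integral>x. (norm (f x))\<^sup>2 \<partial>M)"

definition in_L2 :: "'a measure \<Rightarrow> ('a \<Rightarrow> 'v::euclidean_space) \<Rightarrow> bool" where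
  "in_L2 M f \<longleftrightarrow> f \<in> borel_measurable M \<and> integrable M (\<lambda>x. (norm (f x))\<^sup>2)"

lemma L2norm_nonneg [simp]: "L2norm M f \<ge> 0"
  by (simp add: L2norm_def Bochner_Integration.integral_nonneg)

lemma L2norm_sq: "(L2norm M f)\<^sup>2 = (\<integral>x. (norm (f x))\<^sup>2 \<partial>M)"
  by (simp add: L2norm_def Bochner_Integration.integral_nonneg)

lemma in_L2_add: "in_L2 M f \<Longrightarrow> in_L2 M g \<Longrightarrow> in_L2 M (\<lambda>x. f x + g x)"
  and in_L2_diff: "in_L2 M f \<Longrightarrow> in_L2 M g \<Longrightarrow> in_L2 M (\<lambda>x. f x - g x)"
  unfolding in_L2_def using integrable_L2_diff[of f M g] by auto

lemma in_L2_bound: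
  assumes f: "in_L2 M f" and g: "g \<in> borel_measurable M" and le: "AE x in M. norm (g x) \<le> c * norm (f x)"
  shows "in_L2 M g"
  unfolding in_L2_def
proof (rule conjI[OF g], rule Bochner_Integration.integrable_bound)
  show "integrable M (\<lambda>x. c\<^sup>2 * (norm (f x))\<^sup>2)" using f by (auto simp: in_L2_def)
  show "(\<lambda>x. (norm (g x))\<^sup>2) \<in> borel_measurable M" using g by auto
  show "AE x in M. norm ((norm (g x))\<^sup>2) \<le> norm (c\<^sup>2 * (norm (f x))\<^sup>2)"
    using le
  proof eventually_elim
    case (elim x)
    then have "(norm (g x))\<^sup>2 \<le> (c * norm (f x))\<^sup>2" by (intro power_mono) auto
    then show ?case by (simp add: power_mult_distrib)
  qed
qed

lemma L2norm_mono:
  assumes "in_L2 M f" "in_L2 M g" "AE x in M. norm (f x) \<le> c * norm (g x)" "c \<ge> 0"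
  shows "L2norm M f \<le> c * L2norm M g"
proof -
  have "(\<integral>x. (norm (f x))\<^sup>2 \<partial>M) \<le> (\<integral>x. c\<^sup>2 * (norm (g x))\<^sup>2 \<partial>M)"
  proof (rule integral_mono_AE)
    show "AE x in M. (norm (f x))\<^sup>2 \<le> c\<^sup>2 * (norm (g x))\<^sup>2"
      using assms(3)
    proof eventually_elim
      case (elim x)
      then have "(norm (f x))\<^sup>2 \<le> (c * norm (g x))\<^sup>2" by (intro power_mono) auto
      then show ?case by (simp add: power_mult_distrib)
    qed
  qed (use assms in \<open>auto simp: in_L2_def\<close>)
  then have "(L2norm M f)\<^sup>2 \<le> (c * L2norm M g)\<^sup>2" by (simp add: L2norm_sq power_mult_distrib)
  then show ?thesis by (rule power2_le_imp_le) (use assms(4) in simp)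
qed

text \<open>Integrate the pointwise bound of |u + v|^2 by (1 + t) |u|^2 + (1 + 1/t) |v|^2 and choose
  t afterwards. The added e / 2 keeps both norms positive, so that the choice is possible.\<close>

lemma L2norm_triangle:
  assumes f: "in_L2 M f" and g: "in_L2 M g"
  shows "L2norm M (\<lambda>x. f x + g x) \<le> L2norm M f + L2norm M g"
proof (rule field_le_epsilon)
  fix e :: real assume e: "e > 0"
  define a where "a = L2norm M f + e / 2"
  define b where "b = L2norm M g + e / 2"
  have ab: "a > 0" "b > 0"
    unfolding a_def b_def using e by (intro add_nonneg_pos L2norm_nonneg; simp)+
  \<comment> \<open>The minimiser of (1 + t) a^2 + (1 + 1/t) b^2, for which the value is exactly (a
    + b)^2.\<close>
  define t where "t = b / a"
  have t: "t > 0" using ab by (simp add: t_def)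
  have pt: "(norm (u + v))\<^sup>2 \<le> (1 + t) * (norm u)\<^sup>2 + (1 + 1 / t) * (norm v)\<^sup>2" for u v :: 'b
  proof -
    have "norm (u + v) \<le> norm u + norm v" by (rule norm_triangle_ineq)
    then have "(norm (u + v))\<^sup>2 \<le> (norm u + norm v)\<^sup>2" by (intro power_mono) auto
    also have "\<dots> = (norm u)\<^sup>2 + (norm v)\<^sup>2 + 2 * (norm u * norm v)" by (simp add: power2_sum)
    finally have 1: "(norm (u + v))\<^sup>2 \<le> (norm u)\<^sup>2 + (norm v)\<^sup>2 + 2 * (norm u * norm v)" .
    have 2: "2 * (norm u * norm v) \<le> t * (norm u)\<^sup>2 + (1 / t) * (norm v)\<^sup>2"
    proof -
      have "0 \<le> (1 / t) * (t * norm u - norm v)\<^sup>2" using t by simp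
      also have "\<dots> = t * (norm u)\<^sup>2 + (1 / t) * (norm v)\<^sup>2 - 2 * (norm u * norm v)"
        using t by (simp add: power2_diff power_mult_distrib right_diff_distrib distrib_left power2_eq_square[of t])
      finally show ?thesis by simp
    qed
    have "(1 + t) * (norm u)\<^sup>2 + (1 + 1 / t) * (norm v)\<^sup>2
        = (norm u)\<^sup>2 + (norm v)\<^sup>2 + (t * (norm u)\<^sup>2 + (1 / t) * (norm v)\<^sup>2)" by (simp only: distrib_right)
    then show ?thesis using 1 2 by linarith
  qed
  have "(\<integral>x. (norm (f x + g x))\<^sup>2 \<partial>M) \<le> (\<integral>x. (1 + t) * (norm (f x))\<^sup>2 + (1 + 1 / t) * (norm (g x))\<^sup>2 \<partial>M)"
    using f g in_L2_add[OF f g] by (intro integral_mono pt) (auto simp: in_L2_def)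
  also have "\<dots> = (1 + t) * (L2norm M f)\<^sup>2 + (1 + 1 / t) * (L2norm M g)\<^sup>2"
    unfolding L2norm_sq using f g by (simp add: in_L2_def)
  also have "\<dots> \<le> (1 + t) * a\<^sup>2 + (1 + 1 / t) * b\<^sup>2"
    using t e by (intro add_mono mult_left_mono power_mono) (auto simp: a_def b_def)
  also have "\<dots> = (a + b)\<^sup>2"
  proof -
    have "(1 + t) * a\<^sup>2 = a\<^sup>2 + a * b" "(1 + 1 / t) * b\<^sup>2 = b\<^sup>2 + a * b"
      using ab by (simp_all add: t_def distrib_right power2_eq_square)
    then show ?thesis by (simp add: power2_sum)
  qed
  finally have "(L2norm M (\<lambda>x. f x + g x))\<^sup>2 \<le> (a + b)\<^sup>2" unfolding L2norm_sq .
  then have "L2norm M (\<lambda>x. f x + g x) \<le> a + b" by (rule power2_le_imp_le) (use ab in simp)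
  then show "L2norm M (\<lambda>x. f x + g x) \<le> L2norm M f + L2norm M g + e" by (simp add: a_def b_def)
qed

lemma L2norm_minus_commute: "L2norm M (\<lambda>x. f x - g x) = L2norm M (\<lambda>x. g x - f x)"
  by (simp add: L2norm_def norm_minus_commute)

lemma L2norm_triangle_diff:
  assumes f: "in_L2 M f" and g: "in_L2 M g"
  shows "L2norm M f \<le> L2norm M (\<lambda>x. f x - g x) + L2norm M g"
  using L2norm_triangle[OF in_L2_diff[OF f g] g] by simp

lemma L2norm_tendsto:
  assumes f: "\<And>i. in_L2 M (f i)" and g: "in_L2 M g" and lim: "(\<lambda>i. L2norm M (\<lambda>x. f i x - g x)) \<longlonglongrightarrow> 0"
  shows "(\<lambda>i. L2norm M (f i)) \<longlonglongrightarrow> L2norm M g"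
proof -
  have "\<bar>L2norm M (f i) - L2norm M g\<bar> \<le> L2norm M (\<lambda>x. f i x - g x)" for i
    using L2norm_triangle_diff[OF f[of i] g] L2norm_triangle_diff[OF g f[of i]]
      L2norm_minus_commute[of M "f i" g] by linarith
  then have "(\<lambda>i. L2norm M (f i) - L2norm M g) \<longlonglongrightarrow> 0"
    by (intro Lim_null_comparison[OF _ lim]) auto
  then show ?thesis using LIM_zero_iff by blast
qed

lemma Fatou_bound:
  fixes u :: "nat \<Rightarrow> 'a \<Rightarrow> ennreal"
  assumes "\<And>i. u i \<in> borel_measurable M" "AE x in M. (\<lambda>i. u i x) \<longlonglongrightarrow> v x"
    and "\<And>i. (\<integral>\<^sup>+x. u i x \<partial>M) \<le> K i" "K \<longlonglongrightarrow> L"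
  shows "(\<integral>\<^sup>+x. v x \<partial>M) \<le> L"
proof -
  have "(\<integral>\<^sup>+x. v x \<partial>M) = (\<integral>\<^sup>+x. liminf (\<lambda>i. u i x) \<partial>M)"
    by (rule nn_integral_cong_AE) (use assms(2) in \<open>eventually_elim, auto dest: lim_imp_Liminf[rotated]\<close>)
  also have "\<dots> \<le> liminf (\<lambda>i. \<integral>\<^sup>+x. u i x \<partial>M)" by (rule nn_integral_liminf) (rule assms(1))
  also have "\<dots> \<le> liminf K" by (intro Liminf_mono always_eventually allI assms(3))
  also have "\<dots> = L" by (rule lim_imp_Liminf[OF _ assms(4)]) simp
  finally show ?thesis .
qed

section \<open>Weak first order equations\<close>

text \<open>B : Dw = g after integration by parts, so that w needs no gradient. With the identity
  for B it says that g is the weak gradient of w; with the transposed map and g = 0 it describes the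
  annihilator of the range of A : D.\<close>

definition weak_eq :: "(real^'n^'m \<Rightarrow> 'v::euclidean_space) \<Rightarrow> (real^'n \<Rightarrow> real^'m) \<Rightarrow> (real^'n \<Rightarrow> 'v) \<Rightarrow> bool" where
  "weak_eq B w g \<longleftrightarrow> (\<forall>\<phi>\<in>smooth_bump.
     (\<integral>x. B (outer (w x) (grad \<phi> x)) \<partial>lborel) = - (\<integral>x. \<phi> x *\<^sub>R g x \<partial>lborel))"

lemma linear_bounded: "linear (B :: 'a::euclidean_space \<Rightarrow> 'b::euclidean_space) \<Longrightarrow> bounded_linear B"
  by (simp add: linear_conv_bounded_linear)

lemma linear_measurable:
  fixes B :: "'a::euclidean_space \<Rightarrow> 'b::euclidean_space"
  assumes "linear B" "f \<in> borel_measurable M"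
  shows "(\<lambda>x. B (f x)) \<in> borel_measurable M"
  by (rule measurable_compose[OF assms(2)])
    (intro borel_measurable_continuous_onI linear_continuous_on linear_bounded assms(1))

lemma in_L2_linear:
  fixes B :: "'a::euclidean_space \<Rightarrow> 'b::euclidean_space"
  assumes B: "linear B" and f: "in_L2 M f"
  shows "in_L2 M (\<lambda>x. B (f x))"
proof -
  obtain K where "\<And>x. norm (B x) \<le> norm x * K" using bounded_linear.bounded[OF linear_bounded[OF B]] by blast
  then show ?thesis using f
    by (intro in_L2_bound[OF f, of _ K] linear_measurable[OF B]) (auto simp: in_L2_def mult.commute)
qed

text \<open>Test with the reflected kernel, y going to f (x - y). Its gradient in y is minus that of
  f, and this sign cancels the one in the weak equation.\<close>

lemma weak_eq_mollify:
  fixes B :: "real^'n::finite^'m::finite \<Rightarrow> 'v::euclidean_space"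
  assumes B: "linear B" and f: "f \<in> smooth_bump" and w: "integrable lborel w" and e: "weak_eq B w g"
  shows "B (grad_mollify f w x) = mollify f g x"
proof -
  have fa: "f \<in> smooth_alg" using f by (simp add: smooth_bump_def)
  let ?\<phi> = "\<lambda>y. f (x + (-1) *\<^sub>R y)"
  have \<phi>: "?\<phi> \<in> smooth_bump" by (rule smooth_bump_affine[OF f]) simp
  have "B (grad_mollify f w x) = (\<integral>y. B (outer (w y) (grad f (x - y))) \<partial>lborel)"
    unfolding grad_mollify_def
    by (rule integral_bounded_linear[symmetric]) (intro linear_bounded B integrable_grad_mollify(1)[OF f w])+
  also have "\<dots> = (\<integral>y. - B (outer (w y) (grad ?\<phi> y)) \<partial>lborel)"
  proof -
    have gr: "grad ?\<phi> y = - grad f (x - y)" for y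
      using grad_affine[OF fa, of x "-1" y] by simp
    have "outer (w y) (grad f (x - y)) = - outer (w y) (grad ?\<phi> y)" for y
      unfolding gr by (simp add: vec_eq_iff)
    then show ?thesis by (simp add: linear_neg[OF B])
  qed
  also have "\<dots> = (\<integral>y. ?\<phi> y *\<^sub>R g y \<partial>lborel)"
    using e \<phi> by (simp add: weak_eq_def)
  finally show ?thesis by (simp add: mollify_def)
qed

definition hseq :: "nat \<Rightarrow> real" where "hseq i = inverse (real (Suc i))"

lemma hseq: "hseq i > 0" "hseq \<longlonglongrightarrow> 0"
  unfolding hseq_def[abs_def] using LIMSEQ_inverse_real_of_nat by auto

lemma AE_subseq_of_L2:
  fixes f :: "nat \<Rightarrow> 'a \<Rightarrow> 'v::euclidean_space"
  assumes "\<And>i. integrable M (\<lambda>x. (norm (f i x - g x))\<^sup>2)" "(\<lambda>i. \<integral>x. (norm (f i x - g x))\<^sup>2 \<partial>M) \<longlonglongrightarrow> 0"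
  obtains r where "strict_mono (r :: nat \<Rightarrow> nat)" "AE x in M. (\<lambda>i. f (r i) x) \<longlonglongrightarrow> g x"
proof -
  obtain r where r: "strict_mono (r :: nat \<Rightarrow> nat)" "AE x in M. (\<lambda>i. (norm (f (r i) x - g x))\<^sup>2) \<longlonglongrightarrow> 0"
    using tendsto_L1_AE_subseq[of M "\<lambda>i x. (norm (f i x - g x))\<^sup>2"] assms by auto
  have "AE x in M. (\<lambda>i. f (r i) x) \<longlonglongrightarrow> g x"
    using r(2)
  proof eventually_elim
    case (elim x)
    have "(\<lambda>i. sqrt ((norm (f (r i) x - g x))\<^sup>2)) \<longlonglongrightarrow> sqrt 0" by (intro tendsto_intros elim)
    then have "(\<lambda>i. f (r i) x - g x) \<longlonglongrightarrow> 0" using tendsto_norm_zero_iff by force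
    then show ?case using LIM_zero_iff by blast
  qed
  then show ?thesis using that r(1) by blast
qed

text \<open>For the mollified map B applied to the true gradient is the mollified g, so ellipticity
  bounds the gradient and the Sobolev inequality follows; Fatou along an almost everywhere
  convergent subsequence removes the mollification. Nonnegative integrals are used because
  integrability of the power of w is part of the conclusion.\<close>

lemma weak_eq_Sobolev_compact:
  fixes B :: "real^'n::finite^'m::finite \<Rightarrow> real^'m"
  assumes n: "CARD('n) \<ge> 3" and B: "elliptic_with \<nu> B"
    and w: "in_L2 lborel w" "\<And>x. norm x > r \<Longrightarrow> w x = 0"
    and g: "in_L2 lborel g" "\<And>x. norm x > r \<Longrightarrow> g x = 0" and e: "weak_eq B w g"
  shows "(\<integral>\<^sup>+x. ennreal (norm (w x) powr sobolev_exp CARD('n)) \<partial>lborel)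
    \<le> ennreal ((sobolev_const CARD('n) / \<nu>\<^sup>2 * (L2norm lborel g)\<^sup>2) powr (sobolev_exp CARD('n) / 2))"
proof -
  let ?M = "\<lambda>i. mollifier (hseq i) :: real^'n \<Rightarrow> real"
  define q where "q = sobolev_exp CARD('n)"
  have q0: "q > 0" using n by (simp add: q_def sobolev_exp_def)
  have lin: "linear B" and \<nu>: "\<nu> > 0" using B by (auto simp: elliptic_with_def)
  have C0: "sobolev_const CARD('n) \<ge> 0" by (simp add: sobolev_const_def)
  have w': "w \<in> borel_measurable borel" "integrable lborel (\<lambda>x. (norm (w x))\<^sup>2)"
    and g': "g \<in> borel_measurable borel" "integrable lborel (\<lambda>x. (norm (g x))\<^sup>2)"
    using w(1) g(1) by (auto simp: in_L2_def)
  have wi: "integrable lborel w" by (rule integrable_if_L2_compact[OF w' w(2)])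
  note sb = mollifier_smooth_bump[OF hseq(1), where 'n = 'n]
  have mc: "continuous_on UNIV (mollify (?M i) w)" for i by (rule continuous_mollify(1)[OF sb wi])
  have int: "integrable lborel (\<lambda>x. (norm (mollify (?M i) w x - w x))\<^sup>2)" for i
  proof (rule integrable_L2_diff)
    show "integrable lborel (\<lambda>x. (norm (mollify (?M i) w x))\<^sup>2)" by (rule mollify_L2_integrable[OF hseq(1) w' w(2)])
  qed (use w' borel_measurable_continuous_onI[OF mc] in auto)
  obtain s where s: "AE x in lborel. (\<lambda>i. mollify (?M (s i)) w x) \<longlonglongrightarrow> w x"
    using AE_subseq_of_L2[OF int mollify_tendsto_L2[OF w' w(2) hseq]] by blast
  show ?thesis
  proof (rule Fatou_bound[where u = "\<lambda>i x. ennreal (norm (mollify (?M (s i)) w x) powr q)"])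
    show "(\<lambda>x. ennreal (norm (mollify (?M (s i)) w x) powr q)) \<in> borel_measurable lborel" for i
      using borel_measurable_continuous_onI[OF mc, of "s i"] by simp
    show "AE x in lborel. (\<lambda>i. ennreal (norm (mollify (?M (s i)) w x) powr q)) \<longlonglongrightarrow> ennreal (norm (w x) powr sobolev_exp CARD('n))"
      using s
    proof eventually_elim
      case (elim x)
      then show ?case unfolding q_def[symmetric] using q0
        by (intro tendsto_ennrealI tendsto_powr2 tendsto_norm tendsto_const) auto
    qed
    show "(\<integral>\<^sup>+x. ennreal (norm (mollify (?M (s i)) w x) powr q) \<partial>lborel) \<le>
      ennreal ((sobolev_const CARD('n) / \<nu>\<^sup>2 * (L2norm lborel g)\<^sup>2) powr (sobolev_exp CARD('n) / 2))" for i
    proof -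
      let ?D = "grad_mollify (?M (s i)) w"
      have C1: "C1_compact (mollify (?M (s i)) w) ?D" by (rule C1_compact_mollify[OF sb wi w(2)])
      obtain R where R: "\<And>x. norm x > R \<Longrightarrow> mollify (?M (s i)) w x = 0" using C1 by (auto simp: C1_compact_def)
      have "\<nu>\<^sup>2 * (\<integral>x. (norm (?D x))\<^sup>2 \<partial>lborel) \<le> (\<integral>x. (norm (B (?D x)))\<^sup>2 \<partial>lborel)"
        by (rule C1_compact_elliptic[OF C1 B])
      also have "\<dots> = (\<integral>x. (norm (mollify (?M (s i)) g x))\<^sup>2 \<partial>lborel)"
        by (simp add: weak_eq_mollify[OF lin sb wi e])
      also have "\<dots> \<le> (L2norm lborel g)\<^sup>2"
        unfolding L2norm_sq by (rule mollify_L2_le[OF hseq(1) g' g(2)])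
      finally have D: "(\<integral>x. (norm (?D x))\<^sup>2 \<partial>lborel) \<le> (L2norm lborel g)\<^sup>2 / \<nu>\<^sup>2"
        using \<nu> by (simp add: field_simps)
      have ci: "integrable lborel (\<lambda>x. norm (mollify (?M (s i)) w x) powr q)"
      proof (rule integrable_continuous_compact[of _ R])
        show "continuous_on UNIV (\<lambda>x. norm (mollify (?M (s i)) w x) powr q)"
          by (rule continuous_on_powr'[OF continuous_on_norm[OF mc] continuous_on_const]) (use q0 in auto)
      qed (simp add: R)
      have "(\<integral>x. norm (mollify (?M (s i)) w x) powr q \<partial>lborel) \<le> (sobolev_const CARD('n) * (\<integral>x. (norm (?D x))\<^sup>2 \<partial>lborel)) powr (q / 2)"
        unfolding q_def by (rule C1_compact_Sobolev[OF C1 n])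
      also have "\<dots> \<le> (sobolev_const CARD('n) * ((L2norm lborel g)\<^sup>2 / \<nu>\<^sup>2)) powr (q / 2)"
        using q0 C0 D by (intro powr_mono2 mult_left_mono mult_nonneg_nonneg Bochner_Integration.integral_nonneg) auto
      finally show ?thesis using ci by (subst nn_integral_eq_integral) (auto intro!: ennreal_leI simp: q_def)
    qed
  qed simp
qed

text \<open>Here the mollified map has the mollified H as gradient, so both sides converge in L^2
  and the constant survives the limit.\<close>

lemma weak_gradient_elliptic_compact:
  fixes B :: "real^'n::finite^'m::finite \<Rightarrow> real^'m"
  assumes B: "elliptic_with \<nu> B"
    and w: "in_L2 lborel w" "\<And>x. norm x > r \<Longrightarrow> w x = 0"
    and H: "in_L2 lborel H" "\<And>x. norm x > r \<Longrightarrow> H x = 0" and e: "weak_eq (\<lambda>X. X) w H"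
  shows "\<nu> * L2norm lborel H \<le> L2norm lborel (\<lambda>x. B (H x))"
proof -
  let ?M = "\<lambda>i. mollifier (hseq i) :: real^'n \<Rightarrow> real"
  have lin: "linear B" and \<nu>: "\<nu> > 0" using B by (auto simp: elliptic_with_def)
  have w': "w \<in> borel_measurable borel" "integrable lborel (\<lambda>x. (norm (w x))\<^sup>2)"
    and H': "H \<in> borel_measurable borel" "integrable lborel (\<lambda>x. (norm (H x))\<^sup>2)"
    using w(1) H(1) by (auto simp: in_L2_def)
  have BH: "in_L2 lborel (\<lambda>x. B (H x))" by (rule in_L2_linear[OF lin H(1)])
  then have BH': "(\<lambda>x. B (H x)) \<in> borel_measurable borel" "integrable lborel (\<lambda>x. (norm (B (H x)))\<^sup>2)"
    by (auto simp: in_L2_def)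
  have BH0: "norm x > r \<Longrightarrow> B (H x) = 0" for x using H(2) linear_0[OF lin] by simp
  have wi: "integrable lborel w" by (rule integrable_if_L2_compact[OF w' w(2)])
  have Hi: "integrable lborel H" by (rule integrable_if_L2_compact[OF H' H(2)])
  note sb = mollifier_smooth_bump[OF hseq(1), where 'n = 'n]
  have D: "grad_mollify (?M i) w x = mollify (?M i) H x" for i x
    by (rule weak_eq_mollify[OF linear_id[unfolded id_def] sb wi e])
  have Bm: "B (mollify (?M i) H x) = mollify (?M i) (\<lambda>x. B (H x)) x" for i x
    unfolding mollify_def
    by (subst integral_bounded_linear[OF linear_bounded[OF lin] continuous_mollify(2)[OF sb Hi], symmetric])
      (simp add: linear_scale[OF lin])
  have est: "\<nu> * L2norm lborel (mollify (?M i) H) \<le> L2norm lborel (\<lambda>x. B (H x))" for i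
  proof -
    have "\<nu>\<^sup>2 * (L2norm lborel (mollify (?M i) H))\<^sup>2 \<le> (\<integral>x. (norm (mollify (?M i) (\<lambda>x. B (H x)) x))\<^sup>2 \<partial>lborel)"
    proof -
      have "C1_compact (mollify (?M i) w) (grad_mollify (?M i) w)" by (rule C1_compact_mollify[OF sb wi w(2)])
      from C1_compact_elliptic[OF this B] show ?thesis by (simp add: D Bm L2norm_sq)
    qed
    also have "\<dots> \<le> (L2norm lborel (\<lambda>x. B (H x)))\<^sup>2"
      unfolding L2norm_sq by (rule mollify_L2_le[OF hseq(1) BH' BH0])
    finally have "(\<nu> * L2norm lborel (mollify (?M i) H))\<^sup>2 \<le> (L2norm lborel (\<lambda>x. B (H x)))\<^sup>2"
      by (simp add: power_mult_distrib)
    then show ?thesis by (rule power2_le_imp_le) simp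
  qed
  have mH: "in_L2 lborel (mollify (?M i) H)" for i
    unfolding in_L2_def
  proof
    show "integrable lborel (\<lambda>x. (norm (mollify (?M i) H x))\<^sup>2)" by (rule mollify_L2_integrable[OF hseq(1) H' H(2)])
    show "mollify (?M i) H \<in> borel_measurable lborel"
      using borel_measurable_continuous_onI[OF continuous_mollify(1)[OF sb Hi]] by simp
  qed
  have "(\<lambda>i. sqrt (\<integral>x. (norm (mollify (?M i) H x - H x))\<^sup>2 \<partial>lborel)) \<longlonglongrightarrow> sqrt 0"
    by (intro tendsto_real_sqrt mollify_tendsto_L2[OF H' H(2) hseq])
  then have "(\<lambda>i. L2norm lborel (\<lambda>x. mollify (?M i) H x - H x)) \<longlonglongrightarrow> 0" by (simp add: L2norm_def)
  then have "(\<lambda>i. L2norm lborel (mollify (?M i) H)) \<longlonglongrightarrow> L2norm lborel H"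
    by (rule L2norm_tendsto[OF mH H(1)])
  then have "(\<lambda>i. \<nu> * L2norm lborel (mollify (?M i) H)) \<longlonglongrightarrow> \<nu> * L2norm lborel H" by (intro tendsto_intros)
  then show ?thesis by (rule LIMSEQ_le_const2) (use est in auto)
qed

section \<open>Removing the compact support\<close>

lemma outer_zero_right: "outer \<xi> 0 = 0" by (simp add: vec_eq_iff)

definition cutoff :: "real \<Rightarrow> real^'n::finite \<Rightarrow> real" where
  "cutoff R x = std_bump (0 + (1 / R) *\<^sub>R x)"

lemma cutoff_bounds:
  obtains K L where "K > 0" "L > 0"
    "\<And>R (x::real^'n::finite). R > 0 \<Longrightarrow> \<bar>cutoff R x\<bar> \<le> K"
    "\<And>R (x::real^'n). R > 0 \<Longrightarrow> norm (grad (cutoff R) x) \<le> L / R"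
    "\<And>R (x::real^'n). R > 0 \<Longrightarrow> norm x > L * R \<Longrightarrow> cutoff R x = 0"
    "\<And>R (x::real^'n). R > 0 \<Longrightarrow> norm x > L * R \<Longrightarrow> grad (cutoff R) x = 0"
proof -
  obtain r k where sa: "std_bump \<in> (smooth_alg :: (real^'n \<Rightarrow> real) set)"
    and r: "\<And>x::real^'n. norm x > r \<Longrightarrow> std_bump x = 0" "\<And>x::real^'n. norm x > r \<Longrightarrow> grad std_bump x = 0"
    and k: "\<And>x::real^'n. norm (std_bump x) \<le> k" "\<And>x::real^'n. norm (grad std_bump x) \<le> k"
    using smooth_bumpE[OF std_bump_smooth] by metis
  \<comment> \<open>One constant for three purposes: positivity (1), the radius of the support (r)
    and the bound of the bump and its gradient (k).\<close>
  define L where "L = max 1 (max r k)"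
  have gr: "grad (cutoff R) x = (1 / R) *\<^sub>R grad std_bump (0 + (1 / R) *\<^sub>R x)" for R and x :: "real^'n"
    unfolding cutoff_def[abs_def] by (rule grad_affine[OF sa])
  have far: "norm (0 + (1 / R) *\<^sub>R x) > r" if "R > 0" "norm x > L * R" for R and x :: "real^'n"
  proof -
    have "r * R \<le> L * R" using that by (intro mult_right_mono) (auto simp: L_def)
    then have "r * R < norm x" using that by linarith
    then show ?thesis using that by (simp add: field_simps)
  qed
  show ?thesis
  proof (rule that[of L L])
    fix R :: real and x :: "real^'n" assume R: "R > 0"
    show "\<bar>cutoff R x\<bar> \<le> L" using k(1)[of "0 + (1 / R) *\<^sub>R x"] by (simp add: cutoff_def L_def)
    have "norm (grad std_bump (0 + (1 / R) *\<^sub>R x)) \<le> L" using k(2)[of "0 + (1 / R) *\<^sub>R x"] by (simp add: L_def)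
    then show "norm (grad (cutoff R) x) \<le> L / R" unfolding gr using R by (simp add: divide_right_mono)
    assume x: "norm x > L * R"
    show "cutoff R x = 0" unfolding cutoff_def by (rule r(1)[OF far[OF R x]])
    show "grad (cutoff R) x = 0" unfolding gr r(2)[OF far[OF R x]] by simp
  qed (simp_all add: L_def)
qed

lemma cutoff_smooth_bump: "R > 0 \<Longrightarrow> cutoff R \<in> smooth_bump"
  unfolding cutoff_def[abs_def] by (rule smooth_bump_affine[OF std_bump_smooth]) simp

lemma cutoff_tendsto:
  fixes x :: "real^'n::finite"
  shows "(\<lambda>k. cutoff (real (Suc k)) x) \<longlonglongrightarrow> 1"
proof -
  obtain R K where c: "continuous_on UNIV (std_bump :: real^'n \<Rightarrow> real)"
    using smooth_bumpE[OF std_bump_smooth] by metis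
  have "(\<lambda>k. 0 + inverse (real (Suc k)) *\<^sub>R x) \<longlonglongrightarrow> 0 + 0 *\<^sub>R x"
    by (intro tendsto_intros LIMSEQ_inverse_real_of_nat)
  then have "(\<lambda>k. std_bump (0 + inverse (real (Suc k)) *\<^sub>R x)) \<longlonglongrightarrow> std_bump (0 + 0 *\<^sub>R x)"
    by (rule continuous_on_tendsto_compose[OF c]) auto
  then show ?thesis by (simp add: cutoff_def std_bump_0 inverse_eq_divide)
qed

section \<open>Cutting off a solution of a weak equation\<close>

definition in_L2loc :: "(real^'n \<Rightarrow> 'v::euclidean_space) \<Rightarrow> bool" where
  "in_L2loc w \<longleftrightarrow> w \<in> borel_measurable borel \<and> (\<forall>R. in_L2 lborel (\<lambda>x. indicator (cball 0 R) x *\<^sub>R w x))"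

lemma in_L2_imp_L2loc: "in_L2 lborel w \<Longrightarrow> in_L2loc w"
  unfolding in_L2loc_def
proof (intro conjI allI)
  fix R assume w: "in_L2 lborel w"
  then have m: "w \<in> borel_measurable borel" by (simp add: in_L2_def)
  then show "in_L2 lborel (\<lambda>x. indicator (cball 0 R) x *\<^sub>R w x)"
    by (intro in_L2_bound[OF w, of _ 1]) (auto simp: indicator_def)
qed (simp add: in_L2_def)

lemma L2loc_bilinear:
  fixes w :: "real^'n \<Rightarrow> 'v::euclidean_space" and k :: "real^'n \<Rightarrow> 'c::euclidean_space"
    and b :: "'v \<Rightarrow> 'c \<Rightarrow> 'e::euclidean_space"
  assumes b: "bounded_bilinear b" and w: "in_L2loc w" and k: "continuous_on UNIV k" "\<And>x. norm x > R \<Longrightarrow> k x = 0"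
  shows "in_L2 lborel (\<lambda>x. b (w x) (k x))" "integrable lborel (\<lambda>x. b (w x) (k x))"
proof -
  obtain C where C: "C > 0" "\<And>u v. norm (b u v) \<le> norm u * norm v * C"
    using bounded_bilinear.pos_bounded[OF b] by blast
  obtain K where K: "K > 0" "\<And>x. norm (k x) \<le> K" using bounded_if_continuous_compact[OF k] by blast
  have wm: "w \<in> borel_measurable borel" and wR: "in_L2 lborel (\<lambda>x. indicator (cball 0 R) x *\<^sub>R w x)"
    using w by (auto simp: in_L2loc_def)
  have m: "(\<lambda>x. b (w x) (k x)) \<in> borel_measurable lborel"
    by (rule borel_measurable_continuous_Pair)
      (use wm borel_measurable_continuous_onI[OF k(1)] bounded_bilinear.continuous_on[OF b continuous_on_fst[OF continuous_on_id] continuous_on_snd[OF continuous_on_id]] in auto)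
  have z: "b (w x) (k x) = 0" if "norm x > R" for x
    using k(2)[OF that] bounded_bilinear.zero_right[OF b] by simp
  show i: "in_L2 lborel (\<lambda>x. b (w x) (k x))"
  proof (rule in_L2_bound[OF wR m, of "C * K"], rule AE_I2)
    fix x
    show "norm (b (w x) (k x)) \<le> C * K * norm (indicator (cball 0 R) x *\<^sub>R w x)"
    proof (cases "norm x > R")
      case True then show ?thesis using z[OF True] C(1) K(1) by simp
    next
      case False
      have "norm (b (w x) (k x)) \<le> norm (w x) * norm (k x) * C" by (rule C(2))
      also have "\<dots> \<le> norm (w x) * K * C" using C(1) K(2) by (intro mult_right_mono mult_left_mono) auto
      finally show ?thesis using False by (simp add: mult_ac)
    qed
  qed
  show "integrable lborel (\<lambda>x. b (w x) (k x))"
    by (rule integrable_if_L2_compact[of _ R]) (use i m z in \<open>auto simp: in_L2_def\<close>)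
qed

text \<open>The product rule: multiplying w by the cut-off adds the commutator term, in which the
  gradient of the cut-off replaces that of w.\<close>

definition cut_rhs :: "(real^'n^'m \<Rightarrow> 'v::euclidean_space) \<Rightarrow> (real^'n \<Rightarrow> real^'m) \<Rightarrow> (real^'n \<Rightarrow> 'v) \<Rightarrow> real \<Rightarrow> real^'n \<Rightarrow> 'v" where
  "cut_rhs B w g R x = cutoff R x *\<^sub>R g x + B (outer (w x) (grad (cutoff R) x))"

lemma cutoff_in_L2:
  fixes w :: "real^'n::finite \<Rightarrow> real^'m::finite" and B :: "real^'n^'m \<Rightarrow> 'v::euclidean_space"
  assumes B: "linear B" and w: "in_L2loc w" and g: "in_L2 lborel g" and R: "R > 0"
  shows "in_L2 lborel (\<lambda>x. cutoff R x *\<^sub>R w x)" "in_L2 lborel (\<lambda>x. cutoff R x *\<^sub>R g x)"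
    "in_L2 lborel (\<lambda>x. outer (w x) (grad (cutoff R) x))" "in_L2 lborel (cut_rhs B w g R)"
proof -
  obtain \<rho> K where c: "continuous_on UNIV (cutoff R :: real^'n \<Rightarrow> real)" "continuous_on UNIV (grad (cutoff R) :: real^'n \<Rightarrow> _)"
    and z: "\<And>x::real^'n. norm x > \<rho> \<Longrightarrow> cutoff R x = 0" "\<And>x::real^'n. norm x > \<rho> \<Longrightarrow> grad (cutoff R) x = 0"
    using smooth_bumpE[OF cutoff_smooth_bump[OF R]] by metis
  show "in_L2 lborel (\<lambda>x. cutoff R x *\<^sub>R w x)"
    by (rule L2loc_bilinear(1)[OF bounded_bilinear.flip[OF bounded_bilinear_scaleR] w c(1) z(1)])
  show 1: "in_L2 lborel (\<lambda>x. cutoff R x *\<^sub>R g x)"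
    by (rule L2loc_bilinear(1)[OF bounded_bilinear.flip[OF bounded_bilinear_scaleR] in_L2_imp_L2loc[OF g] c(1) z(1)])
  show 2: "in_L2 lborel (\<lambda>x. outer (w x) (grad (cutoff R) x))"
    by (rule L2loc_bilinear(1)[OF bounded_bilinear_outer w c(2) z(2)])
  show "in_L2 lborel (cut_rhs B w g R)"
    unfolding cut_rhs_def[abs_def] by (rule in_L2_add[OF 1 in_L2_linear[OF B 2]])
qed

text \<open>Test the equation for w with the product of the cut-off and \<phi>; the gradient of this
  product splits into the left side of the new equation and the commutator term.\<close>

lemma weak_eq_cutoff:
  fixes w :: "real^'n::finite \<Rightarrow> real^'m::finite" and B :: "real^'n^'m \<Rightarrow> 'v::euclidean_space"
  assumes B: "linear B" and w: "in_L2loc w" and g: "in_L2 lborel g" and R: "R > 0" and e: "weak_eq B w g"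
  shows "weak_eq B (\<lambda>x. cutoff R x *\<^sub>R w x) (cut_rhs B w g R)"
  unfolding weak_eq_def
proof
  fix \<phi> :: "real^'n \<Rightarrow> real" assume \<phi>: "\<phi> \<in> smooth_bump"
  note cb = cutoff_smooth_bump[OF R, where 'a = 'n]
  have sa: "(cutoff R :: real^'n \<Rightarrow> real) \<in> smooth_alg" "\<phi> \<in> smooth_alg" using cb \<phi> by (auto simp: smooth_bump_def)
  obtain r where r: "\<And>x. norm x > r \<Longrightarrow> \<phi> x = 0" "\<And>x. norm x > r \<Longrightarrow> grad \<phi> x = 0" using smooth_bumpE[OF \<phi>] by metis
  have cont: "continuous_on UNIV \<phi>" "continuous_on UNIV (grad \<phi>)" "continuous_on UNIV (cutoff R :: real^'n \<Rightarrow> real)"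
      "continuous_on UNIV (grad (cutoff R) :: real^'n \<Rightarrow> _)"
    using sa smooth_alg_continuous continuous_on_grad by blast+
  have bl: "bounded_linear B" by (rule linear_bounded[OF B])
  have i1: "integrable lborel (\<lambda>x. B (outer (w x) (cutoff R x *\<^sub>R grad \<phi> x)))"
    by (rule integrable_bounded_linear[OF bl L2loc_bilinear(2)[OF bounded_bilinear_outer w, of _ r]])
      (use r cont in \<open>auto intro!: continuous_on_scaleR\<close>)
  have i2: "integrable lborel (\<lambda>x. B (outer (w x) (\<phi> x *\<^sub>R grad (cutoff R) x)))"
    by (rule integrable_bounded_linear[OF bl L2loc_bilinear(2)[OF bounded_bilinear_outer w, of _ r]])
      (use r cont in \<open>auto intro!: continuous_on_scaleR\<close>)
  have i3: "integrable lborel (\<lambda>x. (cutoff R x * \<phi> x) *\<^sub>R g x)"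
    by (rule L2loc_bilinear(2)[OF bounded_bilinear.flip[OF bounded_bilinear_scaleR] in_L2_imp_L2loc[OF g], of _ r])
      (use r cont in \<open>auto intro!: continuous_on_mult\<close>)
  have "(\<lambda>x. cutoff R x * \<phi> x) \<in> smooth_bump" by (rule smooth_bump_mult[OF sa(1) \<phi>])
  then have "(\<integral>x. B (outer (w x) (grad (\<lambda>x. cutoff R x * \<phi> x) x)) \<partial>lborel) = - (\<integral>x. (cutoff R x * \<phi> x) *\<^sub>R g x \<partial>lborel)"
    using e unfolding weak_eq_def by blast
  then have main: "(\<integral>x. B (outer (w x) (cutoff R x *\<^sub>R grad \<phi> x)) \<partial>lborel) + (\<integral>x. B (outer (w x) (\<phi> x *\<^sub>R grad (cutoff R) x)) \<partial>lborel)
      = - (\<integral>x. (cutoff R x * \<phi> x) *\<^sub>R g x \<partial>lborel)"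
    unfolding grad_mult[OF sa] outer_add_right linear_add[OF B] Bochner_Integration.integral_add[OF i1 i2] .
  have "(\<integral>x. \<phi> x *\<^sub>R cut_rhs B w g R x \<partial>lborel) =
     (\<integral>x. (cutoff R x * \<phi> x) *\<^sub>R g x + B (outer (w x) (\<phi> x *\<^sub>R grad (cutoff R) x)) \<partial>lborel)"
    by (simp add: cut_rhs_def scaleR_right_distrib outer_scaleR_right linear_scale[OF B] mult.commute)
  also have "\<dots> = (\<integral>x. (cutoff R x * \<phi> x) *\<^sub>R g x \<partial>lborel) + (\<integral>x. B (outer (w x) (\<phi> x *\<^sub>R grad (cutoff R) x)) \<partial>lborel)"
    by (rule Bochner_Integration.integral_add[OF i3 i2])
  finally have "(\<integral>x. B (outer (w x) (cutoff R x *\<^sub>R grad \<phi> x)) \<partial>lborel) = - (\<integral>x. \<phi> x *\<^sub>R cut_rhs B w g R x \<partial>lborel)"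
    using main by (simp add: algebra_simps eq_neg_iff_add_eq_0)
  moreover have "outer (cutoff R x *\<^sub>R w x) (grad \<phi> x) = outer (w x) (cutoff R x *\<^sub>R grad \<phi> x)" for x
    by (simp only: outer_scaleR_left outer_scaleR_right)
  ultimately show "(\<integral>x. B (outer (cutoff R x *\<^sub>R w x) (grad \<phi> x)) \<partial>lborel) = - (\<integral>x. \<phi> x *\<^sub>R cut_rhs B w g R x \<partial>lborel)"
    by (simp only:)
qed

text \<open>The only condition on w at infinity that the cut-off argument requires: the commutator
  disappears in L^2. It holds for w in L^2 as well as for w in L^q with the Sobolev exponent q, the
  two cases that occur. The radii start at 1.\<close>

definition vanishing_cut :: "(real^'n::finite \<Rightarrow> real^'m::finite) \<Rightarrow> bool" where
  "vanishing_cut w \<longleftrightarrow> (\<lambda>k. L2norm lborel (\<lambda>x. outer (w x) (grad (cutoff (real (Suc k))) x))) \<longlonglongrightarrow> 0"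

text \<open>The truncated g converges by dominated convergence, and the commutator is controlled by
  \<open>vanishing_cut\<close> times a bound for B.\<close>

lemma cut_rhs_tendsto:
  fixes w :: "real^'n::finite \<Rightarrow> real^'m::finite" and B :: "real^'n^'m \<Rightarrow> 'v::euclidean_space"
  assumes B: "linear B" and w: "in_L2loc w" "vanishing_cut w" and g: "in_L2 lborel g"
  shows "(\<lambda>k. L2norm lborel (\<lambda>x. cut_rhs B w g (real (Suc k)) x - g x)) \<longlonglongrightarrow> 0"
proof -
  let ?c = "\<lambda>k. cutoff (real (Suc k)) :: real^'n \<Rightarrow> real"
  obtain K L where K: "K > 0" "\<And>R (x::real^'n). R > 0 \<Longrightarrow> \<bar>cutoff R x\<bar> \<le> K" using cutoff_bounds by metis
  obtain M where M: "M > 0" "\<And>X. norm (B X) \<le> norm X * M" using bounded_linear.pos_bounded[OF linear_bounded[OF B]] by blast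
  have g': "g \<in> borel_measurable borel" "integrable lborel (\<lambda>x. (norm (g x))\<^sup>2)" using g by (auto simp: in_L2_def)
  have d1: "in_L2 lborel (\<lambda>x. ?c k x *\<^sub>R g x - g x)" for k
    by (rule in_L2_diff[OF cutoff_in_L2(2)[OF B w(1) g] g]) simp
  have d2: "in_L2 lborel (\<lambda>x. outer (w x) (grad (?c k) x))" for k
    by (rule cutoff_in_L2(3)[OF B w(1) g]) simp
  have "(\<lambda>k. \<integral>x. (norm (?c k x *\<^sub>R g x - g x))\<^sup>2 \<partial>lborel) \<longlonglongrightarrow> (\<integral>x. 0 \<partial>(lborel :: (real^'n) measure))"
  proof (rule integral_dominated_convergence[where w = "\<lambda>x. (K + 1)\<^sup>2 * (norm (g x))\<^sup>2"])
    show "integrable lborel (\<lambda>x. (K + 1)\<^sup>2 * (norm (g x))\<^sup>2)" using g' by auto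
    show "(\<lambda>x. (norm (?c k x *\<^sub>R g x - g x))\<^sup>2) \<in> borel_measurable lborel" for k
      using d1[of k] by (auto simp: in_L2_def)
    show "AE x in lborel. (\<lambda>k. (norm (?c k x *\<^sub>R g x - g x))\<^sup>2) \<longlonglongrightarrow> 0"
    proof (rule AE_I2)
      fix x
      have "(\<lambda>k. (norm (?c k x *\<^sub>R g x - g x))\<^sup>2) \<longlonglongrightarrow> (norm (1 *\<^sub>R g x - g x))\<^sup>2"
        by (intro tendsto_intros cutoff_tendsto)
      then show "(\<lambda>k. (norm (?c k x *\<^sub>R g x - g x))\<^sup>2) \<longlonglongrightarrow> 0" by simp
    qed
    show "AE x in lborel. norm ((norm (?c k x *\<^sub>R g x - g x))\<^sup>2) \<le> (K + 1)\<^sup>2 * (norm (g x))\<^sup>2" for k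
    proof (rule AE_I2)
      fix x
      have "?c k x *\<^sub>R g x - g x = (?c k x - 1) *\<^sub>R g x" by (simp add: scaleR_left_diff_distrib)
      then have "norm (?c k x *\<^sub>R g x - g x) = \<bar>?c k x - 1\<bar> * norm (g x)" by simp
      also have "\<dots> \<le> (K + 1) * norm (g x)" using K(2)[of "real (Suc k)" x] by (intro mult_right_mono) auto
      finally have "(norm (?c k x *\<^sub>R g x - g x))\<^sup>2 \<le> ((K + 1) * norm (g x))\<^sup>2" by (intro power_mono) auto
      then show "norm ((norm (?c k x *\<^sub>R g x - g x))\<^sup>2) \<le> (K + 1)\<^sup>2 * (norm (g x))\<^sup>2" by (simp add: power_mult_distrib)
    qed
  qed auto
  then have "(\<lambda>k. sqrt (\<integral>x. (norm (?c k x *\<^sub>R g x - g x))\<^sup>2 \<partial>lborel)) \<longlonglongrightarrow> sqrt (\<integral>x. 0 \<partial>(lborel :: (real^'n) measure))"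
    by (rule tendsto_real_sqrt)
  then have l1: "(\<lambda>k. L2norm lborel (\<lambda>x. ?c k x *\<^sub>R g x - g x)) \<longlonglongrightarrow> 0" by (simp add: L2norm_def)
  have l2: "(\<lambda>k. M * L2norm lborel (\<lambda>x. outer (w x) (grad (?c k) x))) \<longlonglongrightarrow> 0"
    using tendsto_mult_left[OF w(2)[unfolded vanishing_cut_def], of M] by simp
  have le: "L2norm lborel (\<lambda>x. cut_rhs B w g (real (Suc k)) x - g x)
      \<le> L2norm lborel (\<lambda>x. ?c k x *\<^sub>R g x - g x) + M * L2norm lborel (\<lambda>x. outer (w x) (grad (?c k) x))" for k
  proof -
    have "(\<lambda>x. cut_rhs B w g (real (Suc k)) x - g x) = (\<lambda>x. (?c k x *\<^sub>R g x - g x) + B (outer (w x) (grad (?c k) x)))"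
      by (simp add: cut_rhs_def fun_eq_iff)
    then have "L2norm lborel (\<lambda>x. cut_rhs B w g (real (Suc k)) x - g x)
      \<le> L2norm lborel (\<lambda>x. ?c k x *\<^sub>R g x - g x) + L2norm lborel (\<lambda>x. B (outer (w x) (grad (?c k) x)))"
      using L2norm_triangle[OF d1[of k] in_L2_linear[OF B d2[of k]]] by simp
    moreover have "L2norm lborel (\<lambda>x. B (outer (w x) (grad (?c k) x))) \<le> M * L2norm lborel (\<lambda>x. outer (w x) (grad (?c k) x))"
      using M by (intro L2norm_mono in_L2_linear[OF B] d2) (auto simp: mult.commute)
    ultimately show ?thesis by linarith
  qed
  show ?thesis
  proof (rule tendsto_sandwich[OF _ _ tendsto_const tendsto_add_zero[OF l1 l2]])
  qed (use le in auto)
qed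

text \<open>Cut off and let the radius grow, again by Fatou. Neither a gradient of w nor
  integrability of its power is presupposed; in particular g = 0 forces w = 0 almost
  everywhere.\<close>

lemma weak_eq_Sobolev:
  fixes B :: "real^'n::finite^'m::finite \<Rightarrow> real^'m"
  assumes n: "CARD('n) \<ge> 3" and B: "elliptic_with \<nu> B"
    and w: "in_L2loc w" "vanishing_cut w" and g: "in_L2 lborel g" and e: "weak_eq B w g"
  shows "(\<integral>\<^sup>+x. ennreal (norm (w x) powr sobolev_exp CARD('n)) \<partial>lborel)
    \<le> ennreal ((sobolev_const CARD('n) / \<nu>\<^sup>2 * (L2norm lborel g)\<^sup>2) powr (sobolev_exp CARD('n) / 2))"
proof -
  let ?c = "\<lambda>k. cutoff (real (Suc k)) :: real^'n \<Rightarrow> real"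
  let ?q = "sobolev_exp CARD('n)"
  let ?g = "\<lambda>k. cut_rhs B w g (real (Suc k))"
  let ?K = "\<lambda>k. (sobolev_const CARD('n) / \<nu>\<^sup>2 * (L2norm lborel (?g k))\<^sup>2) powr (?q / 2)"
  have q0: "?q > 0" using n by (simp add: sobolev_exp_def)
  have lin: "linear B" and \<nu>: "\<nu> > 0" using B by (auto simp: elliptic_with_def)
  have C0: "sobolev_const CARD('n) \<ge> 0" by (simp add: sobolev_const_def)
  obtain K L where z: "\<And>R (x::real^'n). R > 0 \<Longrightarrow> norm x > L * R \<Longrightarrow> cutoff R x = 0"
    "\<And>R (x::real^'n). R > 0 \<Longrightarrow> norm x > L * R \<Longrightarrow> grad (cutoff R) x = 0" using cutoff_bounds by metis
  have g2: "in_L2 lborel (?g k)" for k by (rule cutoff_in_L2(4)[OF lin w(1) g]) simp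
  have gl: "(\<lambda>k. L2norm lborel (?g k)) \<longlonglongrightarrow> L2norm lborel g"
    by (rule L2norm_tendsto[OF g2 g cut_rhs_tendsto[OF lin w g]])
  show ?thesis
  proof (rule Fatou_bound[where u = "\<lambda>k x. ennreal (norm (?c k x *\<^sub>R w x) powr ?q)" and K = "\<lambda>k. ennreal (?K k)"])
    fix k
    have w2: "in_L2 lborel (\<lambda>x. ?c k x *\<^sub>R w x)" by (rule cutoff_in_L2(1)[OF lin w(1) g]) simp
    then have m: "(\<lambda>x. ?c k x *\<^sub>R w x) \<in> borel_measurable lborel" by (simp add: in_L2_def)
    have "(\<lambda>x. norm (?c k x *\<^sub>R w x)) \<in> borel_measurable lborel"
      by (rule measurable_compose[OF m borel_measurable_norm])
    then show "(\<lambda>x. ennreal (norm (?c k x *\<^sub>R w x) powr ?q)) \<in> borel_measurable lborel"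
      by (rule measurable_compose[OF powr_real_measurable[OF _ borel_measurable_const] measurable_ennreal])
    show "(\<integral>\<^sup>+x. ennreal (norm (?c k x *\<^sub>R w x) powr ?q) \<partial>lborel) \<le> ennreal (?K k)"
    proof (rule weak_eq_Sobolev_compact[OF n B w2 _ g2])
      show "norm x > L * real (Suc k) \<Longrightarrow> ?c k x *\<^sub>R w x = 0" for x using z(1)[of "real (Suc k)" x] by simp
      show "norm x > L * real (Suc k) \<Longrightarrow> ?g k x = 0" for x
        using z(1)[of "real (Suc k)" x] z(2)[of "real (Suc k)" x] linear_0[OF lin]
 by (simp add: cut_rhs_def outer_zero_right)
      show "weak_eq B (\<lambda>x. ?c k x *\<^sub>R w x) (?g k)" by (rule weak_eq_cutoff[OF lin w(1) g _ e]) simp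
    qed
  next
    show "AE x in lborel. (\<lambda>k. ennreal (norm (?c k x *\<^sub>R w x) powr ?q)) \<longlonglongrightarrow> ennreal (norm (w x) powr ?q)"
    proof (rule AE_I2)
      fix x
      have "(\<lambda>k. ?c k x *\<^sub>R w x) \<longlonglongrightarrow> 1 *\<^sub>R w x" by (intro tendsto_intros cutoff_tendsto)
      then have "(\<lambda>k. ?c k x *\<^sub>R w x) \<longlonglongrightarrow> w x" by simp
      then show "(\<lambda>k. ennreal (norm (?c k x *\<^sub>R w x) powr ?q)) \<longlonglongrightarrow> ennreal (norm (w x) powr ?q)"
        using q0 by (intro tendsto_ennrealI tendsto_powr2 tendsto_norm tendsto_const) auto
    qed
    show "(\<lambda>k. ennreal (?K k)) \<longlonglongrightarrow> ennreal ((sobolev_const CARD('n) / \<nu>\<^sup>2 * (L2norm lborel g)\<^sup>2) powr (?q / 2))"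
      using q0 C0 by (intro tendsto_ennrealI tendsto_powr2 tendsto_mult_left tendsto_power gl tendsto_const) auto
  qed
qed

text \<open>The truncated gradients converge in L^2 to H, and B is bounded, so the inequality for
  compact support passes to the limit with the same \<nu>.\<close>

lemma weak_gradient_elliptic:
  fixes B :: "real^'n::finite^'m::finite \<Rightarrow> real^'m"
  assumes B: "elliptic_with \<nu> B"
    and w: "in_L2loc w" "vanishing_cut w" and H: "in_L2 lborel H" and e: "weak_eq (\<lambda>X. X) w H"
  shows "\<nu> * L2norm lborel H \<le> L2norm lborel (\<lambda>x. B (H x))"
proof -
  have lin: "linear B" and \<nu>: "\<nu> > 0" using B by (auto simp: elliptic_with_def)
  have lid: "linear (\<lambda>X :: real^'n^'m. X)" by (rule linear_id[unfolded id_def])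
  obtain M where M: "M > 0" "\<And>X. norm (B X) \<le> norm X * M" using bounded_linear.pos_bounded[OF linear_bounded[OF lin]] by blast
  let ?H = "\<lambda>k. cut_rhs (\<lambda>X. X) w H (real (Suc k))"
  obtain K L where z: "\<And>R (x::real^'n). R > 0 \<Longrightarrow> norm x > L * R \<Longrightarrow> cutoff R x = 0"
    "\<And>R (x::real^'n). R > 0 \<Longrightarrow> norm x > L * R \<Longrightarrow> grad (cutoff R) x = 0" using cutoff_bounds by metis
  have H2: "in_L2 lborel (?H k)" for k by (rule cutoff_in_L2(4)[OF lid w(1) H]) simp
  have Hl0: "(\<lambda>k. L2norm lborel (\<lambda>x. ?H k x - H x)) \<longlonglongrightarrow> 0" by (rule cut_rhs_tendsto[OF lid w H])
  have Hl: "(\<lambda>k. L2norm lborel (?H k)) \<longlonglongrightarrow> L2norm lborel H" by (rule L2norm_tendsto[OF H2 H Hl0])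
  have BH2: "in_L2 lborel (\<lambda>x. B (?H k x))" for k by (rule in_L2_linear[OF lin H2])
  have BH: "in_L2 lborel (\<lambda>x. B (H x))" by (rule in_L2_linear[OF lin H])
  have "L2norm lborel (\<lambda>x. B (?H k x) - B (H x)) \<le> M * L2norm lborel (\<lambda>x. ?H k x - H x)" for k
    using M by (intro L2norm_mono in_L2_diff BH2 BH H2 H) (auto simp: linear_diff[OF lin, symmetric] mult.commute)
  then have "(\<lambda>k. L2norm lborel (\<lambda>x. B (?H k x) - B (H x))) \<longlonglongrightarrow> 0"
    by (intro tendsto_sandwich[OF _ _ tendsto_const tendsto_mult_right_zero[OF Hl0, of M]]) auto
  then have Bl: "(\<lambda>k. L2norm lborel (\<lambda>x. B (?H k x))) \<longlonglongrightarrow> L2norm lborel (\<lambda>x. B (H x))"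
    by (rule L2norm_tendsto[OF BH2 BH])
  have "\<nu> * L2norm lborel (?H k) \<le> L2norm lborel (\<lambda>x. B (?H k x))" for k
  proof (rule weak_gradient_elliptic_compact[OF B _ _ H2])
    show "in_L2 lborel (\<lambda>x. cutoff (real (Suc k)) x *\<^sub>R w x)" by (rule cutoff_in_L2(1)[OF lid w(1) H]) simp
    show "norm x > L * real (Suc k) \<Longrightarrow> cutoff (real (Suc k)) x *\<^sub>R w x = 0" for x using z(1)[of "real (Suc k)" x] by simp
    show "norm x > L * real (Suc k) \<Longrightarrow> ?H k x = 0" for x
      using z(1)[of "real (Suc k)" x] z(2)[of "real (Suc k)" x]
 by (simp add: cut_rhs_def outer_zero_right)
    show "weak_eq (\<lambda>X. X) (\<lambda>x. cutoff (real (Suc k)) x *\<^sub>R w x) (?H k)" by (rule weak_eq_cutoff[OF lid w(1) H _ e]) simp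
  qed
  then show ?thesis by (intro LIMSEQ_le[OF tendsto_mult_left[OF Hl] Bl]) auto
qed

section \<open>Integrability conditions under which the commutator vanishes\<close>

lemma vanishing_cut_L2:
  fixes w :: "real^'n::finite \<Rightarrow> real^'m::finite"
  assumes w: "in_L2 lborel w"
  shows "vanishing_cut w"
proof -
  obtain K L where L: "L > 0" "\<And>R (x::real^'n). R > 0 \<Longrightarrow> norm (grad (cutoff R) x) \<le> L / R" using cutoff_bounds by metis
  have lid: "linear (\<lambda>X :: real^'n^'m. X)" by (rule linear_id[unfolded id_def])
  have z: "in_L2 lborel (\<lambda>x::real^'n. 0 :: real^'n^'m)" by (simp add: in_L2_def)
  have le: "L2norm lborel (\<lambda>x. outer (w x) (grad (cutoff (real (Suc k))) x)) \<le> L / real (Suc k) * L2norm lborel w" for k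
  proof (rule L2norm_mono[OF _ w])
    show "in_L2 lborel (\<lambda>x. outer (w x) (grad (cutoff (real (Suc k))) x))"
      by (rule cutoff_in_L2(3)[OF lid in_L2_imp_L2loc[OF w] z]) simp
    show "AE x in lborel. norm (outer (w x) (grad (cutoff (real (Suc k))) x)) \<le> L / real (Suc k) * norm (w x)"
    proof (rule AE_I2)
      fix x
      have "norm (w x) * norm (grad (cutoff (real (Suc k))) x) \<le> norm (w x) * (L / real (Suc k))"
        by (intro mult_left_mono L(2)) auto
      then show "norm (outer (w x) (grad (cutoff (real (Suc k))) x)) \<le> L / real (Suc k) * norm (w x)"
        by (simp only: norm_outer mult.commute)
    qed
    show "0 \<le> L / real (Suc k)" using L(1) by simp
  qed
  have "(\<lambda>k. L * L2norm lborel w * inverse (real (Suc k))) \<longlonglongrightarrow> L * L2norm lborel w * 0"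
    by (intro tendsto_intros LIMSEQ_inverse_real_of_nat)
  then have "(\<lambda>k. L / real (Suc k) * L2norm lborel w) \<longlonglongrightarrow> 0" by (simp add: divide_inverse mult_ac)
  then show ?thesis unfolding vanishing_cut_def
    by (rule tendsto_sandwich[OF _ _ tendsto_const, rotated 2]) (use le in auto)
qed

text \<open>Splits the commutator density, s = |w(x)|. Either s^2 / R^2 is below a fixed multiple of
  s^q, which is integrable; or s is so small that s^2 / R^2 \<le> c R^(-N), whose integral over a
  ball of radius proportional to R is a constant times c. The factor c^(-2/(N-2)) is the one for
  which the two alternatives meet.\<close>

lemma vanishing_cut_pointwise:
  fixes s R c N q :: real
  assumes "s \<ge> 0" "R > 0" "c > 0" "N \<ge> 3" and q: "q = 2 * N / (N - 2)"
  shows "s\<^sup>2 / R\<^sup>2 \<le> min (s\<^sup>2 / R\<^sup>2) (c powr (- 2 / (N - 2)) * s powr q) + c * R powr (- N)"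
proof (cases "s\<^sup>2 / R\<^sup>2 \<le> c powr (- 2 / (N - 2)) * s powr q")
  case True
  have "0 \<le> c * R powr (- N)" using assms by simp
  then show ?thesis using True by simp
next
  case False
  let ?l = "c powr (- 2 / (N - 2))"
  have s: "s > 0" using False assms by (cases "s = 0") auto
  have q2: "q = (q - 2) + 2" by simp
  have s2: "s powr 2 = s\<^sup>2" "R powr 2 = R\<^sup>2" using s assms by (simp_all add: powr_numeral)
  have "s powr q = s powr (q - 2) * s\<^sup>2" by (subst q2, simp only: powr_add s2)
  then have "(?l * s powr (q - 2)) * s\<^sup>2 < (1 / R\<^sup>2) * s\<^sup>2" using False by simp
  then have "?l * s powr (q - 2) < 1 / R\<^sup>2" using s by (simp only: mult_less_cancel_right) auto
  then have "(?l * s powr (q - 2)) powr ((N - 2) / 2) \<le> (1 / R\<^sup>2) powr ((N - 2) / 2)"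
    using assms by (intro powr_mono2) auto
  moreover have "(?l * s powr (q - 2)) powr ((N - 2) / 2) = (1 / c) * s\<^sup>2"
  proof -
    have e1: "- 2 / (N - 2) * ((N - 2) / 2) = - 1" using assms(4) by simp
    have e2: "(q - 2) * ((N - 2) / 2) = 2" unfolding q using assms(4) by (simp add: field_simps)
    have "(?l * s powr (q - 2)) powr ((N - 2) / 2) = ?l powr ((N - 2) / 2) * (s powr (q - 2)) powr ((N - 2) / 2)"
      by (simp add: powr_mult)
    also have "\<dots> = c powr (- 1) * s powr 2" by (simp only: powr_powr e1 e2)
    also have "\<dots> = (1 / c) * s\<^sup>2" using assms(3) by (simp only: s2) (simp add: powr_minus inverse_eq_divide)
    finally show ?thesis .
  qed
  moreover have "(1 / R\<^sup>2) powr ((N - 2) / 2) = R\<^sup>2 * R powr (- N)"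
  proof -
    have "1 / R\<^sup>2 = R powr (- 2)" using assms(2) by (simp add: powr_minus s2 inverse_eq_divide)
    then have "(1 / R\<^sup>2) powr ((N - 2) / 2) = R powr (- 2 * ((N - 2) / 2))" by (simp only: powr_powr)
    also have "- 2 * ((N - 2) / 2) = 2 + (- N)" by simp
    finally show ?thesis by (simp only: powr_add s2)
  qed
  ultimately have "(1 / c) * s\<^sup>2 \<le> R\<^sup>2 * R powr (- N)" by simp
  then have "s\<^sup>2 / R\<^sup>2 \<le> c * R powr (- N)" using assms by (simp add: field_simps)
  moreover have "0 \<le> min (s\<^sup>2 / R\<^sup>2) (?l * s powr q)" by simp
  ultimately show ?thesis by linarith
qed

lemma L2loc_if_Lq:
  fixes w :: "real^'n::finite \<Rightarrow> 'v::euclidean_space"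
  assumes w: "w \<in> borel_measurable borel" "integrable lborel (\<lambda>x. norm (w x) powr q)" and q: "q \<ge> 2"
  shows "in_L2loc w"
  unfolding in_L2loc_def in_L2_def
proof (intro conjI allI w(1))
  fix R
  show m: "(\<lambda>x. indicator (cball 0 R) x *\<^sub>R w x) \<in> borel_measurable lborel"
    using w(1) by (intro borel_measurable_scaleR borel_measurable_indicator) auto
  show "integrable lborel (\<lambda>x. (norm (indicator (cball 0 R) x *\<^sub>R w x))\<^sup>2)"
  proof (rule Bochner_Integration.integrable_bound)
    show "integrable lborel (\<lambda>x. norm (w x) powr q + indicator (cball (0::real^'n) R) x)"
      by (intro Bochner_Integration.integrable_add w(2) integrable_indicator_cball)
    show "(\<lambda>x. (norm (indicator (cball 0 R) x *\<^sub>R w x))\<^sup>2) \<in> borel_measurable lborel"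
      by (rule borel_measurable_power[OF measurable_compose[OF m borel_measurable_norm]])
    have a: "a\<^sup>2 \<le> a powr q + 1" if "a \<ge> 0" for a :: real
    proof (cases "a \<le> 1")
      case True
      then have "a\<^sup>2 \<le> 1" using that by (simp add: power_le_one)
      moreover have "0 \<le> a powr q" by simp
      ultimately show ?thesis by linarith
    next
      case False
      then have "a powr 2 \<le> a powr q" using q by (intro powr_mono) auto
      then show ?thesis using False by (simp add: powr_numeral)
    qed
    show "AE x in lborel. norm ((norm (indicator (cball 0 R) x *\<^sub>R w x))\<^sup>2) \<le> norm (norm (w x) powr q + indicator (cball 0 R) x)"
      by (rule AE_I2) (use a[OF norm_ge_zero] in \<open>auto simp: indicator_def\<close>)
  qed
qed

text \<open>For w in L^q the decay 1/R of the gradient is exactly compensated by the volume of its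
  support, so a size estimate alone gives only boundedness. The pointwise splitting gains a free
  small constant c, and the remaining part tends to 0 by dominated convergence.\<close>

lemma vanishing_cut_Lq:
  fixes w :: "real^'n::finite \<Rightarrow> real^'m::finite"
  assumes n: "CARD('n) \<ge> 3" and w: "w \<in> borel_measurable borel"
    "integrable lborel (\<lambda>x. norm (w x) powr sobolev_exp CARD('n))"
  shows "vanishing_cut w"
proof -
  define N where "N = real CARD('n)"
  define q where "q = sobolev_exp CARD('n)"
  have N: "N \<ge> 3" using n by (simp add: N_def)
  have q: "q = 2 * N / (N - 2)" by (simp add: q_def sobolev_exp_def N_def)
  have q2: "q \<ge> 2" using N by (simp add: q field_simps)
  obtain K L where L: "L > 0" "\<And>R (x::real^'n). R > 0 \<Longrightarrow> norm (grad (cutoff R) x) \<le> L / R"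
    and z: "\<And>R (x::real^'n). R > 0 \<Longrightarrow> norm x > L * R \<Longrightarrow> grad (cutoff R) x = 0" using cutoff_bounds by metis
  have loc: "in_L2loc w" by (rule L2loc_if_Lq[OF w(1) w(2)[folded q_def] q2])
  have lid: "linear (\<lambda>X :: real^'n^'m. X)" by (rule linear_id[unfolded id_def])
  have z2: "in_L2 lborel (\<lambda>x::real^'n. 0 :: real^'n^'m)" by (simp add: in_L2_def)
  let ?R = "\<lambda>k. real (Suc k)"
  let ?D = "\<lambda>k. \<integral>x. (norm (outer (w x) (grad (cutoff (?R k)) x)))\<^sup>2 \<partial>lborel"
  have Di: "integrable lborel (\<lambda>x. (norm (outer (w x) (grad (cutoff (?R k)) x)))\<^sup>2)" for k
    using cutoff_in_L2(3)[OF lid loc z2, of "?R k"] by (simp add: in_L2_def)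
  define V where "V = L ^ CARD('n) * measure lborel (ball (0 :: real^'n) 1)"
  have V0: "V \<ge> 0" using L(1) by (simp add: V_def)
  have "?D \<longlonglongrightarrow> 0"
  proof (rule LIMSEQ_I)
    fix e :: real assume e: "e > 0"
    \<comment> \<open>Makes the volume contribution L^2 V c at most e / 2; the added 1 avoids a
      division by zero.\<close>
    define c where "c = e / (2 * (L\<^sup>2 * V + 1))"
    have LV: "L\<^sup>2 * V \<ge> 0" using V0 by simp
    have c: "c > 0" using e LV by (simp add: c_def)
    have cV: "L\<^sup>2 * V * c \<le> e / 2"
    proof -
      have "L\<^sup>2 * V * c \<le> (L\<^sup>2 * V + 1) * c" using c by (intro mult_right_mono) auto
      also have "\<dots> = e / 2" using LV by (simp add: c_def field_simps)
      finally show ?thesis by simp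
    qed
    define l where "l = c powr (- 2 / (N - 2))"
    \<comment> \<open>Tends to 0 at each point because of the division by the squared radius, and is
      dominated by an integrable multiple of |w|^q.\<close>
    define m where "m k x = min ((norm (w x))\<^sup>2 / (?R k)\<^sup>2) (l * norm (w x) powr q)" for k x
    have lw: "integrable lborel (\<lambda>x. l * norm (w x) powr q)" using w(2) by (auto simp: q_def)
    have mm: "m k \<in> borel_measurable lborel" for k using w(1) unfolding m_def by auto
    have mb: "norm (m k x) \<le> l * norm (w x) powr q" and m0: "0 \<le> m k x" for k x by (auto simp: m_def l_def)
    have mi: "integrable lborel (m k)" for k
      by (rule Bochner_Integration.integrable_bound[OF lw mm]) (intro AE_I2, metis mb abs_ge_self order_trans real_norm_def)
    have "(\<lambda>k. \<integral>x. m k x \<partial>lborel) \<longlonglongrightarrow> (\<integral>x. 0 \<partial>(lborel :: (real^'n) measure))"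
    proof (rule integral_dominated_convergence[OF _ mm lw])
      show "AE x in lborel. (\<lambda>k. m k x) \<longlonglongrightarrow> 0"
      proof (rule AE_I2)
        fix x
        have "(\<lambda>k. (norm (w x))\<^sup>2 * (inverse (?R k))\<^sup>2) \<longlonglongrightarrow> (norm (w x))\<^sup>2 * 0\<^sup>2"
          by (intro tendsto_intros LIMSEQ_inverse_real_of_nat)
        then have "(\<lambda>k. (norm (w x))\<^sup>2 / (?R k)\<^sup>2) \<longlonglongrightarrow> 0" by (simp add: divide_inverse power_inverse)
        then show "(\<lambda>k. m k x) \<longlonglongrightarrow> 0"
          by (rule tendsto_sandwich[OF _ _ tendsto_const, rotated 2]) (use m0 in \<open>auto simp: m_def\<close>)
      qed
      show "AE x in lborel. norm (m k x) \<le> l * norm (w x) powr q" for k by (intro AE_I2 mb)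
    qed auto
    then have "(\<lambda>k. L\<^sup>2 * (\<integral>x. m k x \<partial>lborel)) \<longlonglongrightarrow> L\<^sup>2 * 0" by (intro tendsto_intros) simp
    then have "\<forall>\<^sub>F k in sequentially. L\<^sup>2 * (\<integral>x. m k x \<partial>lborel) < e / 2"
      using e by (intro order_tendstoD(2)[where y = "L\<^sup>2 * 0"]) auto
    then obtain k0 where k0: "\<And>k. k \<ge> k0 \<Longrightarrow> L\<^sup>2 * (\<integral>x. m k x \<partial>lborel) < e / 2" by (auto simp: eventually_sequentially)
    have "norm (?D k - 0) < e" if "k \<ge> k0" for k
    proof -
      let ?I = "\<lambda>x. indicator (cball (0::real^'n) (L * ?R k)) x :: real"
      have pt: "(norm (outer (w x) (grad (cutoff (?R k)) x)))\<^sup>2 \<le> L\<^sup>2 * m k x + L\<^sup>2 * c * ?R k powr (- N) * ?I x" for x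
      proof (cases "norm x > L * ?R k")
        case True
        then show ?thesis using z[of "?R k" x] m0[of k x] by (simp add: outer_zero_right)
      next
        case False
        have "norm (outer (w x) (grad (cutoff (?R k)) x)) \<le> norm (w x) * (L / ?R k)"
          unfolding norm_outer by (intro mult_left_mono L(2)) auto
        then have "(norm (outer (w x) (grad (cutoff (?R k)) x)))\<^sup>2 \<le> (norm (w x) * (L / ?R k))\<^sup>2"
          by (intro power_mono) auto
        also have "\<dots> = L\<^sup>2 * ((norm (w x))\<^sup>2 / (?R k)\<^sup>2)" by (simp add: power_mult_distrib power_divide)
        also have "\<dots> \<le> L\<^sup>2 * (m k x + c * ?R k powr (- N))"
          unfolding m_def l_def
          by (rule mult_left_mono[OF vanishing_cut_pointwise[OF norm_ge_zero _ c N q]]) auto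
        also have "\<dots> = L\<^sup>2 * m k x + L\<^sup>2 * c * ?R k powr (- N) * ?I x" using False by (simp add: distrib_left)
        finally show ?thesis .
      qed
      have "?D k \<le> (\<integral>x. L\<^sup>2 * m k x + L\<^sup>2 * c * ?R k powr (- N) * ?I x \<partial>lborel)"
      proof (rule integral_mono[OF Di _ pt])
        show "integrable lborel (\<lambda>x. L\<^sup>2 * m k x + L\<^sup>2 * c * ?R k powr (- N) * ?I x)"
          by (intro Bochner_Integration.integrable_add integrable_mult_right mi integrable_indicator_cball)
      qed
      also have "\<dots> = L\<^sup>2 * (\<integral>x. m k x \<partial>lborel) + L\<^sup>2 * c * ?R k powr (- N) * (\<integral>x. ?I x \<partial>lborel)"
        by (subst Bochner_Integration.integral_add[OF integrable_mult_right[OF mi] integrable_mult_right[OF integrable_indicator_cball]])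
           (simp only: integral_mult_right_zero)
      also have "(\<integral>x. ?I x \<partial>lborel) = (L * ?R k) ^ CARD('n) * measure lborel (ball (0 :: real^'n) 1)"
        using content_ball_conv_unit_ball[of "L * ?R k" "0::real^'n"] L(1) by (simp add: content_cball_conv_ball)
      also have "L\<^sup>2 * c * ?R k powr (- N) * ((L * ?R k) ^ CARD('n) * measure lborel (ball (0 :: real^'n) 1))
          = L\<^sup>2 * c * V * (?R k powr (- N) * ?R k ^ CARD('n))"
        by (simp add: V_def power_mult_distrib)
      \<comment> \<open>The growth of the ball cancels the decay R^(-N) exactly.\<close>
      also have "?R k powr (- N) * ?R k ^ CARD('n) = 1"
        by (simp add: N_def powr_minus powr_realpow del: of_nat_Suc)
      finally have "?D k \<le> L\<^sup>2 * (\<integral>x. m k x \<partial>lborel) + L\<^sup>2 * V * c" by (simp add: mult_ac)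
      then have "?D k < e" using k0[OF that] cV by linarith
      moreover have "?D k \<ge> 0" by (rule Bochner_Integration.integral_nonneg) simp
      ultimately show ?thesis by simp
    qed
    then show "\<exists>k0. \<forall>k\<ge>k0. norm (?D k - 0) < e" by blast
  qed
  then have "(\<lambda>k. sqrt (?D k)) \<longlonglongrightarrow> sqrt 0" by (rule tendsto_real_sqrt)
  then show ?thesis by (simp add: vanishing_cut_def L2norm_def del: of_nat_Suc)
qed

lemma measurable_vec_nth:
  fixes f :: "'a \<Rightarrow> 'v::euclidean_space^'i"
  shows "f \<in> borel_measurable M \<Longrightarrow> (\<lambda>x. f x $ i) \<in> borel_measurable M"
  by (rule linear_measurable[OF bounded_linear.linear[OF bounded_linear_vec_nth]])

section \<open>Estimates in the space \<open>W\<close>\<close>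

text \<open>The space W consists of Lebesgue measurable maps, whereas convolution and Fubini are
  carried out for Borel maps. The representative is built coordinate by coordinate from the
  real-valued case.\<close>

lemma borel_representative:
  fixes f :: "'a::euclidean_space \<Rightarrow> 'v::euclidean_space"
  assumes "f \<in> borel_measurable lebesgue"
  obtains f' where "f' \<in> borel_measurable borel" "AE x in lborel. f x = f' x"
proof -
  have "\<exists>g. g \<in> borel_measurable lborel \<and> (AE x in lborel. f x \<bullet> b = g x)" if "b \<in> Basis" for b
    using completion_ex_borel_measurable_real[of "\<lambda>x. f x \<bullet> b" lborel] assms by auto
  then obtain g where g: "\<And>b. b \<in> Basis \<Longrightarrow> g b \<in> borel_measurable lborel \<and> (AE x in lborel. f x \<bullet> b = g b x)"
    by metis
  define f' where "f' x = (\<Sum>b\<in>Basis. g b x *\<^sub>R b)" for x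
  have "f' \<in> borel_measurable borel"
    unfolding f'_def using g by (intro borel_measurable_sum borel_measurable_scaleR borel_measurable_const) auto
  moreover have "AE x in lborel. \<forall>b\<in>Basis. f x \<bullet> b = g b x"
    using g by (intro AE_finite_allI) auto
  then have "AE x in lborel. f x = f' x"
  proof eventually_elim
    case (elim x)
    have "f x = (\<Sum>b\<in>Basis. (f x \<bullet> b) *\<^sub>R b)" by (rule euclidean_representation[symmetric])
    also have "\<dots> = f' x" unfolding f'_def by (rule sum.cong) (use elim in auto)
    finally show ?case .
  qed
  ultimately show ?thesis by (rule that)
qed

lemma lebesgue_integral_representative:
  fixes h h' :: "'a::euclidean_space \<Rightarrow> 'b::{banach, second_countable_topology}"
  assumes h': "h' \<in> borel_measurable borel" and h: "h \<in> borel_measurable lebesgue" and ae: "AE x in lborel. h x = h' x"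
  shows "integral\<^sup>L lebesgue h = integral\<^sup>L lborel h'" "integrable lebesgue h \<longleftrightarrow> integrable lborel h'"
proof -
  have ae': "AE x in lebesgue. h x = h' x" using ae by (rule AE_completion)
  have m': "h' \<in> borel_measurable lebesgue" using h' by (simp add: measurable_completion)
  have "integral\<^sup>L lebesgue h = integral\<^sup>L lebesgue h'" by (rule integral_cong_AE[OF h m' ae'])
  then show "integral\<^sup>L lebesgue h = integral\<^sup>L lborel h'" using h' by (simp add: integral_completion)
  have "integrable lebesgue h \<longleftrightarrow> integrable lebesgue h'" by (rule integrable_cong_AE[OF h m' ae'])
  then show "integrable lebesgue h \<longleftrightarrow> integrable lborel h'" using h' by (simp add: integrable_completion)
qed

lemma in_L2_representative:
  fixes f f' :: "'a::euclidean_space \<Rightarrow> 'v::euclidean_space"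
  assumes f': "f' \<in> borel_measurable borel" and f: "f \<in> borel_measurable lebesgue" and ae: "AE x in lborel. f x = f' x"
  shows "in_L2 lebesgue f \<longleftrightarrow> in_L2 lborel f'" "L2norm lebesgue f = L2norm lborel f'"
proof -
  have m: "(\<lambda>x. (norm (f' x))\<^sup>2) \<in> borel_measurable borel" "(\<lambda>x. (norm (f x))\<^sup>2) \<in> borel_measurable lebesgue"
    using f' f by auto
  have a: "AE x in lborel. (norm (f x))\<^sup>2 = (norm (f' x))\<^sup>2" using ae by eventually_elim simp
  show "in_L2 lebesgue f \<longleftrightarrow> in_L2 lborel f'" "L2norm lebesgue f = L2norm lborel f'"
    using lebesgue_integral_representative[OF m a] f f' by (auto simp: in_L2_def L2norm_def)
qed

lemma Lp_space_2: "Lp_space 2 f \<longleftrightarrow> in_L2 lebesgue f"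
  and Lp_norm_2: "Lp_norm 2 f = L2norm lebesgue f"
  by (simp_all add: Lp_space_def in_L2_def Lp_norm_def L2norm_def powr_numeral powr_half_sqrt
      Bochner_Integration.integral_nonneg)

lemma weak_gradient_imp_weak_eq:
  fixes u u' :: "real^'n::finite \<Rightarrow> real^'m::finite"
  assumes wg: "weak_gradient u G" and u: "u \<in> borel_measurable lebesgue" and G: "G \<in> borel_measurable lebesgue"
    and u': "in_L2loc u'" "AE x in lborel. u x = u' x" and G': "in_L2 lborel G'" "AE x in lborel. G x = G' x"
  shows "weak_eq (\<lambda>X. X) u' G'"
  unfolding weak_eq_def
proof
  fix \<phi> :: "real^'n \<Rightarrow> real" assume \<phi>: "\<phi> \<in> smooth_bump"
  obtain r where c: "continuous_on UNIV \<phi>" "continuous_on UNIV (grad \<phi>)"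
    and r: "\<And>x. norm x > r \<Longrightarrow> \<phi> x = 0" "\<And>x. norm x > r \<Longrightarrow> grad \<phi> x = 0" using smooth_bumpE[OF \<phi>] by metis
  have sa: "\<phi> \<in> smooth_alg" using \<phi> by (simp add: smooth_bump_def)
  have i1: "integrable lborel (\<lambda>x. outer (u' x) (grad \<phi> x))"
    by (rule L2loc_bilinear(2)[OF bounded_bilinear_outer u'(1) c(2) r(2)])
  have i2: "integrable lborel (\<lambda>x. \<phi> x *\<^sub>R G' x)"
    by (rule L2loc_bilinear(2)[OF bounded_bilinear.flip[OF bounded_bilinear_scaleR] in_L2_imp_L2loc[OF G'(1)] c(1) r(1)])
  have m: "u' \<in> borel_measurable borel" "G' \<in> borel_measurable borel" "\<phi> \<in> borel_measurable borel"
    using u' G' c by (auto simp: in_L2loc_def in_L2_def intro: borel_measurable_continuous_onI)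
  have mp: "partial j \<phi> \<in> borel_measurable borel" for j
    by (intro borel_measurable_continuous_onI smooth_alg_continuous smooth_alg_partial sa)
  have ml: "\<phi> \<in> borel_measurable lebesgue" "partial j \<phi> \<in> borel_measurable lebesgue" for j
    using m(3) mp by (simp_all add: measurable_completion)
  show "(\<integral>x. outer (u' x) (grad \<phi> x) \<partial>lborel) = - (\<integral>x. \<phi> x *\<^sub>R G' x \<partial>lborel)"
    unfolding vec_eq_iff
  proof (intro allI)
    fix b j
    have "(\<integral>x. u x $ b * partial j \<phi> x \<partial>lebesgue) = (\<integral>x. u' x $ b * partial j \<phi> x \<partial>lborel)"
      by (rule lebesgue_integral_representative(1)) (use m mp ml u u'(2) in \<open>auto elim!: eventually_mono intro!: borel_measurable_times measurable_vec_nth\<close>)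
    moreover have "(\<integral>x. G x $ b $ j * \<phi> x \<partial>lebesgue) = (\<integral>x. G' x $ b $ j * \<phi> x \<partial>lborel)"
      by (rule lebesgue_integral_representative(1)) (use m ml G G'(2) in \<open>auto elim!: eventually_mono intro!: borel_measurable_times measurable_vec_nth\<close>)
    moreover have "(\<integral>x. u x $ b * partial j \<phi> x \<partial>lebesgue) = - (\<integral>x. G x $ b $ j * \<phi> x \<partial>lebesgue)"
      using wg test_fun_smooth_bump[OF \<phi>] unfolding weak_gradient_def by blast
    ultimately have e: "(\<integral>x. u' x $ b * partial j \<phi> x \<partial>lborel) = - (\<integral>x. G' x $ b $ j * \<phi> x \<partial>lborel)" by simp
    have "(\<integral>x. outer (u' x) (grad \<phi> x) \<partial>lborel) $ b $ j = (\<integral>x. u' x $ b * partial j \<phi> x \<partial>lborel)"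
      by (simp add: integral_vec_nth[OF i1] integral_vec_nth[OF integrable_vec_nth[OF i1]])
    moreover have "(\<integral>x. \<phi> x *\<^sub>R G' x \<partial>lborel) $ b $ j = (\<integral>x. G' x $ b $ j * \<phi> x \<partial>lborel)"
      by (simp only: integral_vec_nth[OF i2] integral_vec_nth[OF integrable_vec_nth[OF i2]]) (simp add: mult.commute)
    ultimately show "(\<integral>x. outer (u' x) (grad \<phi> x) \<partial>lborel) $ b $ j = (- (\<integral>x. \<phi> x *\<^sub>R G' x \<partial>lborel)) $ b $ j"
      using e by simp
  qed
qed

lemma weak_eq_linear:
  fixes B :: "real^'n::finite^'m::finite \<Rightarrow> 'v::euclidean_space"
  assumes B: "linear B" and u: "in_L2loc u" and G: "in_L2 lborel G" and e: "weak_eq (\<lambda>X. X) u G"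
  shows "weak_eq B u (\<lambda>x. B (G x))"
  unfolding weak_eq_def
proof
  fix \<phi> :: "real^'n \<Rightarrow> real" assume \<phi>: "\<phi> \<in> smooth_bump"
  obtain r where c: "continuous_on UNIV \<phi>" "continuous_on UNIV (grad \<phi>)"
    and r: "\<And>x. norm x > r \<Longrightarrow> \<phi> x = 0" "\<And>x. norm x > r \<Longrightarrow> grad \<phi> x = 0" using smooth_bumpE[OF \<phi>] by metis
  have i1: "integrable lborel (\<lambda>x. outer (u x) (grad \<phi> x))"
    by (rule L2loc_bilinear(2)[OF bounded_bilinear_outer u c(2) r(2)])
  have i2: "integrable lborel (\<lambda>x. \<phi> x *\<^sub>R G x)"
    by (rule L2loc_bilinear(2)[OF bounded_bilinear.flip[OF bounded_bilinear_scaleR] in_L2_imp_L2loc[OF G] c(1) r(1)])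
  have "(\<integral>x. B (outer (u x) (grad \<phi> x)) \<partial>lborel) = B (\<integral>x. outer (u x) (grad \<phi> x) \<partial>lborel)"
    by (rule integral_bounded_linear[OF linear_bounded[OF B] i1])
  also have "\<dots> = B (- (\<integral>x. \<phi> x *\<^sub>R G x \<partial>lborel))" using e \<phi> by (simp add: weak_eq_def)
  also have "\<dots> = - (\<integral>x. B (\<phi> x *\<^sub>R G x) \<partial>lborel)"
    by (simp add: linear_neg[OF B] integral_bounded_linear[OF linear_bounded[OF B] i2])
  finally show "(\<integral>x. B (outer (u x) (grad \<phi> x)) \<partial>lborel) = - (\<integral>x. \<phi> x *\<^sub>R B (G x) \<partial>lborel)"
    by (simp add: linear_scale[OF B])
qed

text \<open>On a Borel representative the Sobolev exponent supplies both local square integrability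
  and \<open>vanishing_cut\<close>, so the whole-space estimates apply; in the second one B : Du
  takes the role of g.\<close>

lemma in_W_estimates:
  fixes u :: "real^'n::finite \<Rightarrow> real^'m::finite"
  assumes n: "CARD('n) \<ge> 3" and B: "elliptic_with \<nu> B" and W: "in_W u G"
  shows "\<nu> * L2norm lebesgue G \<le> L2norm lebesgue (\<lambda>x. B (G x))"
    and "Lp_norm (sobolev_exp CARD('n)) u \<le> sqrt (sobolev_const CARD('n)) / \<nu> * L2norm lebesgue (\<lambda>x. B (G x))"
proof -
  define q where "q = sobolev_exp CARD('n)"
  have lin: "linear B" and \<nu>: "\<nu> > 0" using B by (auto simp: elliptic_with_def)
  have q: "q \<ge> 2" using n by (simp add: q_def sobolev_exp_def field_simps)
  have u: "u \<in> borel_measurable lebesgue" "integrable lebesgue (\<lambda>x. norm (u x) powr q)"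
    and G: "in_L2 lebesgue G" and wg: "weak_gradient u G"
    using W unfolding in_W_def Lp_space_2 by (auto simp: Lp_space_def q_def)
  have Gm: "G \<in> borel_measurable lebesgue" using G by (simp add: in_L2_def)
  obtain u' where u': "u' \<in> borel_measurable borel" "AE x in lborel. u x = u' x" using borel_representative[OF u(1)] by blast
  obtain G' where G': "G' \<in> borel_measurable borel" "AE x in lborel. G x = G' x" using borel_representative[OF Gm] by blast
  have G2: "in_L2 lborel G'" using in_L2_representative(1)[OF G'(1) Gm G'(2)] G by simp
  have mu: "(\<lambda>x. norm (u' x) powr q) \<in> borel_measurable borel" "(\<lambda>x. norm (u x) powr q) \<in> borel_measurable lebesgue"
    using u(1) u'(1) by auto
  have au: "AE x in lborel. norm (u x) powr q = norm (u' x) powr q" using u'(2) by eventually_elim simp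
  note ru = lebesgue_integral_representative[OF mu au]
  have ui: "integrable lborel (\<lambda>x. norm (u' x) powr q)" using u(2) ru(2) by simp
  have loc: "in_L2loc u'" by (rule L2loc_if_Lq[OF u'(1) ui q])
  have van: "vanishing_cut u'" by (rule vanishing_cut_Lq[OF n u'(1) ui[unfolded q_def]])
  have e: "weak_eq (\<lambda>X. X) u' G'" by (rule weak_gradient_imp_weak_eq[OF wg u(1) Gm loc u'(2) G2 G'(2)])
  have BG: "L2norm lebesgue (\<lambda>x. B (G x)) = L2norm lborel (\<lambda>x. B (G' x))"
    by (rule in_L2_representative(2)) (use G' Gm in \<open>auto intro: linear_measurable[OF lin] elim!: eventually_mono\<close>)
  have GG: "L2norm lebesgue G = L2norm lborel G'" by (rule in_L2_representative(2)[OF G'(1) Gm G'(2)])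
  show "\<nu> * L2norm lebesgue G \<le> L2norm lebesgue (\<lambda>x. B (G x))"
    unfolding BG GG by (rule weak_gradient_elliptic[OF B loc van G2 e])
  let ?N = "L2norm lborel (\<lambda>x. B (G' x))"
  let ?C = "sobolev_const CARD('n)"
  have C0: "?C \<ge> 0" by (simp add: sobolev_const_def)
  have "(\<integral>\<^sup>+x. ennreal (norm (u' x) powr q) \<partial>lborel) \<le> ennreal ((?C / \<nu>\<^sup>2 * ?N\<^sup>2) powr (q / 2))"
    unfolding q_def
    by (rule weak_eq_Sobolev[OF n B loc van in_L2_linear[OF lin G2] weak_eq_linear[OF lin loc G2 e]])
  then have "(\<integral>x. norm (u' x) powr q \<partial>lborel) \<le> (?C / \<nu>\<^sup>2 * ?N\<^sup>2) powr (q / 2)"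
    using ui by (subst (asm) nn_integral_eq_integral) auto
  \<comment> \<open>Taking the q-th root turns the power q / 2 into a square root, whatever q
    is.\<close>
  then have "(\<integral>x. norm (u' x) powr q \<partial>lborel) powr (1 / q) \<le> ((?C / \<nu>\<^sup>2 * ?N\<^sup>2) powr (q / 2)) powr (1 / q)"
    using q by (intro powr_mono2 Bochner_Integration.integral_nonneg) auto
  also have "\<dots> = (?C / \<nu>\<^sup>2 * ?N\<^sup>2) powr (1 / 2)"
  proof -
    have "q / 2 * (1 / q) = 1 / 2" using q by simp
    then show ?thesis by (simp only: powr_powr)
  qed
  also have "\<dots> = sqrt (?C / \<nu>\<^sup>2 * ?N\<^sup>2)" by (rule powr_half_sqrt) (use C0 in simp)
  also have "\<dots> = sqrt ?C / \<nu> * ?N" using \<nu> by (simp add: real_sqrt_mult real_sqrt_divide)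
  finally show "Lp_norm (sobolev_exp CARD('n)) u \<le> sqrt ?C / \<nu> * L2norm lebesgue (\<lambda>x. B (G x))"
    unfolding BG Lp_norm_def q_def[symmetric] ru(1) .
qed

text \<open>Orthogonality to all A : D(\<phi> \<xi>) is the weak equation for the transposed map
  with right side 0. As r is square integrable, the Sobolev bound holds for it and reads: the
  integral of |r|^q is at most 0.\<close>

lemma annihilator_zero:
  fixes r :: "real^'n::finite \<Rightarrow> real^'m::finite"
  assumes n: "CARD('n) \<ge> 3" and A: "elliptic_with \<nu> A" and r: "in_L2 lebesgue r"
    and orth: "\<And>\<phi> \<xi>. \<phi> \<in> smooth_bump \<Longrightarrow> (\<integral>x. r x \<bullet> A (outer \<xi> (grad \<phi> x)) \<partial>lebesgue) = 0"
  shows "AE x in lebesgue. r x = 0"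
proof -
  define q where "q = sobolev_exp CARD('n)"
  have lin: "linear A" using A by (simp add: elliptic_with_def)
  have rm: "r \<in> borel_measurable lebesgue" using r by (simp add: in_L2_def)
  obtain r' where r': "r' \<in> borel_measurable borel" "AE x in lborel. r x = r' x" using borel_representative[OF rm] by blast
  have r2: "in_L2 lborel r'" using in_L2_representative(1)[OF r'(1) rm r'(2)] r by simp
  note loc = in_L2_imp_L2loc[OF r2]
  let ?B = "mtranspose A"
  have z: "in_L2 lborel (\<lambda>x::real^'n. 0 :: real^'m)" by (simp add: in_L2_def)
  have e: "weak_eq ?B r' (\<lambda>x. 0)"
    unfolding weak_eq_def
  proof
    fix \<phi> :: "real^'n \<Rightarrow> real" assume \<phi>: "\<phi> \<in> smooth_bump"
    obtain s where c: "continuous_on UNIV (grad \<phi>)" "\<And>x. norm x > s \<Longrightarrow> grad \<phi> x = 0" using smooth_bumpE[OF \<phi>] by metis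
    have gm: "grad \<phi> \<in> borel_measurable borel" by (rule borel_measurable_continuous_onI[OF c(1)])
    have i1: "integrable lborel (\<lambda>x. ?B (outer (r' x) (grad \<phi> x)))"
      by (rule integrable_bounded_linear[OF linear_bounded[OF linear_mtranspose] L2loc_bilinear(2)[OF bounded_bilinear_outer loc c]])
    have "(\<integral>x. ?B (outer (r' x) (grad \<phi> x)) \<partial>lborel) \<bullet> \<xi> = 0" for \<xi>
    proof -
      have lo: "linear (\<lambda>a. A (outer \<xi> a))"
        by (rule linearI) (simp_all add: outer_add_right outer_scaleR_right linear_add[OF lin] linear_scale[OF lin])
      have am: "(\<lambda>x. A (outer \<xi> (grad \<phi> x))) \<in> borel_measurable borel" by (rule linear_measurable[OF lo gm])
      have "(\<integral>x. ?B (outer (r' x) (grad \<phi> x)) \<partial>lborel) \<bullet> \<xi> = (\<integral>x. ?B (outer (r' x) (grad \<phi> x)) \<bullet> \<xi> \<partial>lborel)"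
        using i1 by simp
      also have "\<dots> = (\<integral>x. r' x \<bullet> A (outer \<xi> (grad \<phi> x)) \<partial>lborel)" by (simp add: inner_mtranspose[OF lin])
      also have "\<dots> = (\<integral>x. r x \<bullet> A (outer \<xi> (grad \<phi> x)) \<partial>lebesgue)"
      proof (rule lebesgue_integral_representative(1)[symmetric])
        show "(\<lambda>x. r' x \<bullet> A (outer \<xi> (grad \<phi> x))) \<in> borel_measurable borel"
          by (rule borel_measurable_inner[OF r'(1) am])
        have "(\<lambda>x. A (outer \<xi> (grad \<phi> x))) \<in> borel_measurable lebesgue"
          using am by (simp add: measurable_completion)
        then show "(\<lambda>x. r x \<bullet> A (outer \<xi> (grad \<phi> x))) \<in> borel_measurable lebesgue"
          by (rule borel_measurable_inner[OF rm])
        show "AE x in lborel. r x \<bullet> A (outer \<xi> (grad \<phi> x)) = r' x \<bullet> A (outer \<xi> (grad \<phi> x))"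
          using r'(2) by eventually_elim (rule arg_cong[where f = "\<lambda>v. v \<bullet> _"])
      qed
      finally show ?thesis using orth[OF \<phi>] by simp
    qed
    \<comment> \<open>Choosing the vector itself as \<xi> shows that its norm is zero.\<close>
    from this[of "\<integral>x. ?B (outer (r' x) (grad \<phi> x)) \<partial>lborel"]
    have "(\<integral>x. ?B (outer (r' x) (grad \<phi> x)) \<partial>lborel) = 0" by (simp only: inner_eq_zero_iff)
    then show "(\<integral>x. ?B (outer (r' x) (grad \<phi> x)) \<partial>lborel) = - (\<integral>x. \<phi> x *\<^sub>R (0 :: real^'m) \<partial>lborel)" by simp
  qed
  have "(\<integral>\<^sup>+x. ennreal (norm (r' x) powr q) \<partial>lborel)
      \<le> ennreal ((sobolev_const CARD('n) / \<nu>\<^sup>2 * (L2norm lborel (\<lambda>x::real^'n. 0 :: real^'m))\<^sup>2) powr (q / 2))"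
    unfolding q_def by (rule weak_eq_Sobolev[OF n elliptic_with_mtranspose[OF A] loc vanishing_cut_L2[OF r2] z e])
  also have "\<dots> = 0" by (simp add: L2norm_def)
  finally have "(\<integral>\<^sup>+x. ennreal (norm (r' x) powr q) \<partial>lborel) = 0" by simp
  moreover have "(\<lambda>x. ennreal (norm (r' x) powr q)) \<in> borel_measurable lborel" using r'(1) by simp
  ultimately have "AE x in lborel. ennreal (norm (r' x) powr q) = 0" by (simp only: nn_integral_0_iff_AE)
  then have "AE x in lborel. r x = 0"
    using r'(2)
  proof eventually_elim
    case (elim x)
    then have "norm (r' x) powr q = 0" by (simp add: ennreal_eq_0_iff)
    then show ?case using elim(2) by simp
  qed
  then show ?thesis by (rule AE_completion)
qed

section \<open>Completeness of \<open>L\<^sup>p\<close>\<close>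

lemma powr_add_le:
  fixes a b p :: real
  assumes "a \<ge> 0" "b \<ge> 0" "p \<ge> 0"
  shows "(a + b) powr p \<le> 2 powr p * (a powr p + b powr p)"
proof -
  have "(a + b) powr p \<le> (2 * max a b) powr p" using assms by (intro powr_mono2) auto
  also have "\<dots> = 2 powr p * (max a b) powr p" using assms by (simp add: powr_mult)
  also have "\<dots> \<le> 2 powr p * (a powr p + b powr p)" by (intro mult_left_mono) (auto simp: max_def)
  finally show ?thesis .
qed

lemma Lp_space_lincomb:
  assumes u: "Lp_space p u" and v: "Lp_space p v" and p: "p \<ge> 0"
  shows "Lp_space p (\<lambda>x. a *\<^sub>R u x + b *\<^sub>R v x)"
  unfolding Lp_space_def
proof
  have m: "u \<in> borel_measurable lebesgue" "v \<in> borel_measurable lebesgue" using u v by (auto simp: Lp_space_def)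
  show mm: "(\<lambda>x. a *\<^sub>R u x + b *\<^sub>R v x) \<in> borel_measurable lebesgue" using m by (intro borel_measurable_add borel_measurable_scaleR) auto
  show "integrable lebesgue (\<lambda>x. norm (a *\<^sub>R u x + b *\<^sub>R v x) powr p)"
  proof (rule Bochner_Integration.integrable_bound)
    show "integrable lebesgue (\<lambda>x. 2 powr p * (\<bar>a\<bar> powr p * norm (u x) powr p + \<bar>b\<bar> powr p * norm (v x) powr p))"
      using u v by (auto simp: Lp_space_def)
    show "(\<lambda>x. norm (a *\<^sub>R u x + b *\<^sub>R v x) powr p) \<in> borel_measurable lebesgue"
      by (rule powr_real_measurable[OF measurable_compose[OF mm borel_measurable_norm] borel_measurable_const])
    show "AE x in lebesgue. norm (norm (a *\<^sub>R u x + b *\<^sub>R v x) powr p)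
        \<le> norm (2 powr p * (\<bar>a\<bar> powr p * norm (u x) powr p + \<bar>b\<bar> powr p * norm (v x) powr p))"
    proof (rule AE_I2)
      fix x
      have "norm (a *\<^sub>R u x + b *\<^sub>R v x) powr p \<le> (\<bar>a\<bar> * norm (u x) + \<bar>b\<bar> * norm (v x)) powr p"
        using norm_triangle_ineq[of "a *\<^sub>R u x" "b *\<^sub>R v x"] p by (intro powr_mono2) auto
      also have "\<dots> \<le> 2 powr p * ((\<bar>a\<bar> * norm (u x)) powr p + (\<bar>b\<bar> * norm (v x)) powr p)"
        using p by (intro powr_add_le) auto
      also have "\<dots> = 2 powr p * (\<bar>a\<bar> powr p * norm (u x) powr p + \<bar>b\<bar> powr p * norm (v x) powr p)"
        by (simp add: powr_mult)
      finally show "norm (norm (a *\<^sub>R u x + b *\<^sub>R v x) powr p)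
        \<le> norm (2 powr p * (\<bar>a\<bar> powr p * norm (u x) powr p + \<bar>b\<bar> powr p * norm (v x) powr p))" by simp
    qed
  qed
qed

text \<open>Riesz-Fischer without Minkowski's inequality: along a fast subsequence the sum of the
  p-th powers of the increments, weighted by 2^j, is integrable and hence finite almost everywhere.
  Each term is then bounded, so the increments decay geometrically. This works for every p >
  0.\<close>

lemma Lp_complete:
  fixes f :: "nat \<Rightarrow> 'a \<Rightarrow> 'v::euclidean_space"
  assumes p: "p > 0" and f: "\<And>k. f k \<in> borel_measurable M"
    and i: "\<And>k l. integrable M (\<lambda>x. norm (f k x - f l x) powr p)"
    and C: "\<And>e. e > 0 \<Longrightarrow> \<exists>N. \<forall>k\<ge>N. \<forall>l\<ge>N. (\<integral>x. norm (f k x - f l x) powr p \<partial>M) < e"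
  obtains g where "g \<in> borel_measurable M"
    "\<And>e. e > 0 \<Longrightarrow> \<exists>N. \<forall>k\<ge>N. integrable M (\<lambda>x. norm (f k x - g x) powr p) \<and> (\<integral>x. norm (f k x - g x) powr p \<partial>M) \<le> e"
proof -
  define I where "I k l = (\<integral>x. norm (f k x - f l x) powr p \<partial>M)" for k l
  \<comment> \<open>Chosen so that the weighted increment of index j has integral at most
    (1/2)^j.\<close>
  define \<epsilon> where "\<epsilon> j = (1/2) ^ j / (2 ^ j) powr p" for j :: nat
  have "\<epsilon> j > 0" for j by (simp add: \<epsilon>_def)
  then have "\<exists>N. \<forall>k\<ge>N. \<forall>l\<ge>N. I k l < \<epsilon> j" for j using C[of "\<epsilon> j"] by (simp add: I_def)
  then obtain N where N: "\<And>j k l. k \<ge> N j \<Longrightarrow> l \<ge> N j \<Longrightarrow> I k l < \<epsilon> j" by metis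
  \<comment> \<open>The sum makes both r j and r (j + 1) at least N j, and the summand j lets the
    subsequence exceed every index.\<close>
  define r where "r j = j + (\<Sum>m\<le>j. N m)" for j
  have rN: "r j \<ge> N j" and rS: "r (Suc j) \<ge> N j" and rj: "r j \<ge> j" for j
  proof -
    have "N j \<le> (\<Sum>m\<le>j. N m)" by (rule member_le_sum) auto
    then show "r j \<ge> N j" "r (Suc j) \<ge> N j" "r j \<ge> j" by (auto simp: r_def)
  qed
  define u where "u j x = ennreal ((2 ^ j * norm (f (r (Suc j)) x - f (r j) x)) powr p)" for j x
  have nm: "(\<lambda>x. norm (f k x - f l x)) \<in> borel_measurable M" for k l
    by (rule measurable_compose[OF borel_measurable_diff[OF f f] borel_measurable_norm])
  have um: "u j \<in> borel_measurable M" for j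
    unfolding u_def[abs_def]
    by (rule measurable_compose[OF powr_real_measurable[OF borel_measurable_times[OF borel_measurable_const nm] borel_measurable_const] measurable_ennreal])
  have ui: "(\<integral>\<^sup>+x. u j x \<partial>M) \<le> ennreal ((1/2) ^ j)" for j
  proof -
    have "(\<integral>\<^sup>+x. u j x \<partial>M) = (\<integral>\<^sup>+x. ennreal ((2 ^ j) powr p * norm (f (r (Suc j)) x - f (r j) x) powr p) \<partial>M)"
      by (simp add: u_def powr_mult)
    also have "\<dots> = ennreal (\<integral>x. (2 ^ j) powr p * norm (f (r (Suc j)) x - f (r j) x) powr p \<partial>M)"
      by (rule nn_integral_eq_integral) (use i in auto)
    also have "\<dots> = ennreal ((2 ^ j) powr p * I (r (Suc j)) (r j))" by (simp add: I_def)
    also have "\<dots> \<le> ennreal ((2 ^ j) powr p * \<epsilon> j)"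
      using N[OF rS rN, of j] by (intro ennreal_leI mult_left_mono) auto
    also have "(2 ^ j) powr p * \<epsilon> j = (1/2) ^ j" by (simp add: \<epsilon>_def)
    finally show ?thesis .
  qed
  have sm: "(\<lambda>x. \<Sum>j. u j x) \<in> borel_measurable M"
  proof -
    note um[measurable]
    show ?thesis by measurable
  qed
  have "(\<integral>\<^sup>+x. (\<Sum>j. u j x) \<partial>M) = (\<Sum>j. \<integral>\<^sup>+x. u j x \<partial>M)" by (rule nn_integral_suminf[OF um])
  also have "\<dots> \<le> (\<Sum>j. ennreal ((1/2) ^ j))" by (intro suminf_le ui) auto
  also have "\<dots> = ennreal (\<Sum>j. (1/2) ^ j)" by (rule suminf_ennreal2) (auto intro: summable_geometric)
  finally have "(\<integral>\<^sup>+x. (\<Sum>j. u j x) \<partial>M) \<noteq> \<infinity>" by (auto simp: top_unique)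
  then have "AE x in M. (\<Sum>j. u j x) \<noteq> \<infinity>" by (rule nn_integral_PInf_AE[rotated]) (rule sm)
  then have conv: "AE x in M. (\<lambda>j. f (r j) x) \<longlonglongrightarrow> lim (\<lambda>j. f (r j) x)"
  proof eventually_elim
    case (elim x)
    then obtain S where S: "S \<ge> 0" "(\<Sum>j. u j x) = ennreal S" by (cases "\<Sum>j. u j x") auto
    \<comment> \<open>A single term of a series of nonnegative terms is below its sum; the weight
      2^j becomes the geometric decay.\<close>
    have d: "norm (f (r (Suc j)) x - f (r j) x) \<le> S powr (1 / p) * (1/2) ^ j" for j
    proof -
      have "u j x = (\<Sum>m\<in>{j}. u m x)" by simp
      also have "\<dots> \<le> (\<Sum>m. u m x)" by (rule sum_le_suminf) auto
      finally have "(2 ^ j * norm (f (r (Suc j)) x - f (r j) x)) powr p \<le> S" using S by (simp add: u_def)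
      then have "((2 ^ j * norm (f (r (Suc j)) x - f (r j) x)) powr p) powr (1 / p) \<le> S powr (1 / p)"
        using p by (intro powr_mono2) auto
      then have "2 ^ j * norm (f (r (Suc j)) x - f (r j) x) \<le> S powr (1 / p)" using p by (simp add: powr_powr)
      then show ?thesis by (simp add: field_simps power_divide)
    qed
    have "summable (\<lambda>j. f (r (Suc j)) x - f (r j) x)"
      by (rule summable_comparison_test'[where g = "\<lambda>j. S powr (1 / p) * (1/2) ^ j" and N = 0])
        (use d in \<open>auto intro: summable_mult summable_geometric\<close>)
    then have "convergent (\<lambda>n. \<Sum>j<n. f (r (Suc j)) x - f (r j) x)" by (simp add: summable_iff_convergent)
    then have "convergent (\<lambda>n. f (r n) x - f (r 0) x)" by (simp only: sum_lessThan_telescope[of "\<lambda>j. f (r j) x"])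
    then obtain l where "(\<lambda>n. f (r n) x - f (r 0) x) \<longlonglongrightarrow> l" by (auto simp: convergent_def)
    then have "(\<lambda>n. (f (r n) x - f (r 0) x) + f (r 0) x) \<longlonglongrightarrow> l + f (r 0) x" by (intro tendsto_intros)
    then have "convergent (\<lambda>n. f (r n) x)" by (auto simp: convergent_def)
    then show ?case by (simp add: convergent_LIMSEQ_iff)
  qed
  define g where "g x = lim (\<lambda>j. f (r j) x)" for x
  have gm: "g \<in> borel_measurable M" unfolding g_def[abs_def] by (rule borel_measurable_lim_metric) (rule f)
  show ?thesis
  proof (rule that[OF gm])
    fix e :: real assume e: "e > 0"
    then obtain K where K: "\<And>k l. k \<ge> K \<Longrightarrow> l \<ge> K \<Longrightarrow> I k l < e" using C[OF e] by (auto simp: I_def)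
    have "integrable M (\<lambda>x. norm (f k x - g x) powr p) \<and> (\<integral>x. norm (f k x - g x) powr p \<partial>M) \<le> e" if k: "k \<ge> K" for k
    proof -
      have pm: "(\<lambda>x. norm (f k x - g x) powr p) \<in> borel_measurable M"
        by (rule powr_real_measurable[OF measurable_compose[OF borel_measurable_diff[OF f gm] borel_measurable_norm] borel_measurable_const])
      have le: "(\<integral>\<^sup>+x. ennreal (norm (f k x - g x) powr p) \<partial>M) \<le> ennreal e"
      proof (rule Fatou_bound[where u = "\<lambda>j x. ennreal (norm (f k x - f (r (j + K)) x) powr p)" and K = "\<lambda>_. ennreal e"])
        show "(\<lambda>x. ennreal (norm (f k x - f (r (j + K)) x) powr p)) \<in> borel_measurable M" for j
          by (rule measurable_compose[OF powr_real_measurable[OF nm borel_measurable_const] measurable_ennreal])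
        show "AE x in M. (\<lambda>j. ennreal (norm (f k x - f (r (j + K)) x) powr p)) \<longlonglongrightarrow> ennreal (norm (f k x - g x) powr p)"
          using conv
        proof eventually_elim
          case (elim x)
          then have "(\<lambda>j. f (r (j + K)) x) \<longlonglongrightarrow> g x" unfolding g_def by (rule LIMSEQ_ignore_initial_segment)
          then show ?case using p
            by (intro tendsto_ennrealI tendsto_powr2 tendsto_norm tendsto_diff tendsto_const) auto
        qed
        show "(\<integral>\<^sup>+x. ennreal (norm (f k x - f (r (j + K)) x) powr p) \<partial>M) \<le> ennreal e" for j
        proof -
          have "r (j + K) \<ge> K" using rj[of "j + K"] by simp
          then have "I k (r (j + K)) \<le> e" using K[OF k] by (simp add: less_imp_le)
          then show ?thesis using i by (subst nn_integral_eq_integral) (auto simp: I_def intro!: ennreal_leI)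
        qed
      qed simp
      have int: "integrable M (\<lambda>x. norm (f k x - g x) powr p)"
        by (rule integrableI_bounded[OF pm]) (use le in \<open>auto simp: less_top[symmetric] top_unique\<close>)
      then have "ennreal (\<integral>x. norm (f k x - g x) powr p \<partial>M) \<le> ennreal e"
        using le by (subst (asm) nn_integral_eq_integral) auto
      then show ?thesis using int e by (simp add: ennreal_le_iff)
    qed
    then show "\<exists>N. \<forall>k\<ge>N. integrable M (\<lambda>x. norm (f k x - g x) powr p) \<and> (\<integral>x. norm (f k x - g x) powr p \<partial>M) \<le> e" by blast
  qed
qed

section \<open>The space \<open>W\<close>\<close>

text \<open>Replaces Hoelder's inequality when an L^p function is paired with a bounded function of
  compact support. Below e the first term suffices, above e the power does.\<close>

lemma powr_ge_linear:
  fixes a e p :: real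
  assumes "a \<ge> 0" "e > 0" "p \<ge> 1"
  shows "a \<le> e + e powr (1 - p) * a powr p"
proof (cases "a \<le> e")
  case False
  then have a: "a > 0" "e < a" using assms by auto
  have "a = a powr (1 - p) * a powr p" using a by (simp add: powr_add[symmetric])
  also have "\<dots> \<le> e powr (1 - p) * a powr p"
    using assms a by (intro mult_right_mono powr_mono2') auto
  finally show ?thesis using assms by simp
qed (use assms in \<open>simp add: add_increasing2\<close>)

text \<open>The parameter e stays free: the first term is made small by e and the second afterwards
  by the p-th power integral.\<close>

lemma Lp_bounded_integrable:
  fixes u :: "'a::euclidean_space \<Rightarrow> 'v::euclidean_space" and b :: "'a \<Rightarrow> real"
  assumes u: "u \<in> borel_measurable lebesgue" "integrable lebesgue (\<lambda>x. norm (u x) powr p)" and p: "p \<ge> 1"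
    and b: "b \<in> borel_measurable lebesgue" "\<And>x. \<bar>b x\<bar> \<le> K" "\<And>x. norm x > R \<Longrightarrow> b x = 0" and K: "K \<ge> 0" and e: "e > 0"
  shows "integrable lebesgue (\<lambda>x. norm (u x) * b x)"
    "\<bar>\<integral>x. norm (u x) * \<bar>b x\<bar> \<partial>lebesgue\<bar> \<le> K * e * measure lborel (cball (0::'a) R) + K * e powr (1 - p) * (\<integral>x. norm (u x) powr p \<partial>lebesgue)"
proof -
  let ?I = "\<lambda>x. indicator (cball (0::'a) R) x :: real"
  have Im: "?I \<in> borel_measurable borel" by (rule borel_measurable_indicator) auto
  have Ii: "integrable lebesgue ?I" "(\<integral>x. ?I x \<partial>lebesgue) = measure lborel (cball (0::'a) R)"
    using integrable_indicator_cball[of "0::'a" R] Im by (simp_all add: integrable_completion integral_completion)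
  let ?g = "\<lambda>x. K * e * ?I x + K * e powr (1 - p) * norm (u x) powr p"
  have g: "integrable lebesgue ?g" using Ii(1) u(2) by auto
  have pt: "norm (u x) * \<bar>b x\<bar> \<le> ?g x" for x
  proof (cases "norm x > R")
    case True then show ?thesis using b(3) K by simp
  next
    case False
    have "norm (u x) * \<bar>b x\<bar> \<le> (e + e powr (1 - p) * norm (u x) powr p) * K"
      using powr_ge_linear[OF norm_ge_zero e p, of "u x"] b(2)[of x] e by (intro mult_mono) auto
    then show ?thesis using False by (simp add: algebra_simps)
  qed
  have m1: "(\<lambda>x. norm (u x)) \<in> borel_measurable lebesgue" by (rule measurable_compose[OF u(1) borel_measurable_norm])
  show "integrable lebesgue (\<lambda>x. norm (u x) * b x)"
  proof (rule Bochner_Integration.integrable_bound[OF g])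
    show "(\<lambda>x. norm (u x) * b x) \<in> borel_measurable lebesgue" by (rule borel_measurable_times[OF m1 b(1)])
    show "AE x in lebesgue. norm (norm (u x) * b x) \<le> norm (?g x)"
    proof (rule AE_I2)
      fix x show "norm (norm (u x) * b x) \<le> norm (?g x)"
        using pt[of x] abs_ge_self[of "?g x"] by (simp only: real_norm_def abs_mult abs_norm_cancel)
    qed
  qed
  then have "integrable lebesgue (\<lambda>x. norm (norm (u x) * b x))" by (rule integrable_norm)
  then have i: "integrable lebesgue (\<lambda>x. norm (u x) * \<bar>b x\<bar>)" by (simp add: abs_mult)
  have "(\<integral>x. norm (u x) * \<bar>b x\<bar> \<partial>lebesgue) \<le> (\<integral>x. ?g x \<partial>lebesgue)" by (rule integral_mono[OF i g pt])
  also have "\<dots> = K * e * measure lborel (cball (0::'a) R) + K * e powr (1 - p) * (\<integral>x. norm (u x) powr p \<partial>lebesgue)"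
    using Ii u(2) by (subst Bochner_Integration.integral_add) auto
  finally show "\<bar>\<integral>x. norm (u x) * \<bar>b x\<bar> \<partial>lebesgue\<bar> \<le> K * e * measure lborel (cball (0::'a) R) + K * e powr (1 - p) * (\<integral>x. norm (u x) powr p \<partial>lebesgue)"
    by (simp add: Bochner_Integration.integral_nonneg)
qed

lemma Lp_linear_integrable:
  fixes u :: "'a::euclidean_space \<Rightarrow> 'v::euclidean_space" and b :: "'a \<Rightarrow> real" and T :: "'v \<Rightarrow> real"
  assumes u: "u \<in> borel_measurable lebesgue" "integrable lebesgue (\<lambda>x. norm (u x) powr p)" and p: "p \<ge> 1"
    and b: "b \<in> borel_measurable lebesgue" "\<And>x. \<bar>b x\<bar> \<le> K" "\<And>x. norm x > R \<Longrightarrow> b x = 0"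
    and T: "linear T" "\<And>v. \<bar>T v\<bar> \<le> norm v"
  shows "integrable lebesgue (\<lambda>x. T (u x) * b x)"
    "\<bar>\<integral>x. T (u x) * b x \<partial>lebesgue\<bar> \<le> (\<integral>x. norm (u x) * \<bar>b x\<bar> \<partial>lebesgue)"
proof -
  have K: "K \<ge> 0" by (rule order_trans[OF abs_ge_zero b(2)])
  have i: "integrable lebesgue (\<lambda>x. norm (u x) * \<bar>b x\<bar>)"
    using integrable_norm[OF Lp_bounded_integrable(1)[OF u p b K zero_less_one]] by (simp add: abs_mult)
  have le: "norm (T (u x) * b x) \<le> norm (u x) * \<bar>b x\<bar>" for x
    unfolding real_norm_def abs_mult by (intro mult_right_mono T(2)) simp
  show j: "integrable lebesgue (\<lambda>x. T (u x) * b x)"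
    by (rule Bochner_Integration.integrable_bound[OF i])
      (use le in \<open>auto intro!: borel_measurable_times linear_measurable[OF T(1) u(1)] b(1) AE_I2 simp: abs_mult\<close>)
  have "norm (\<integral>x. T (u x) * b x \<partial>lebesgue) \<le> (\<integral>x. norm (u x) * \<bar>b x\<bar> \<partial>lebesgue)"
    by (rule Bochner_Integration.integral_norm_bound_integral[OF j i le])
  then show "\<bar>\<integral>x. T (u x) * b x \<partial>lebesgue\<bar> \<le> (\<integral>x. norm (u x) * \<bar>b x\<bar> \<partial>lebesgue)" by simp
qed

text \<open>Integrability is part of the notion because the Bochner integral of a non-integrable
  function is 0, which would make the bound meaningless.\<close>

definition Lp_conv :: "real \<Rightarrow> (nat \<Rightarrow> 'a::euclidean_space \<Rightarrow> 'v::euclidean_space) \<Rightarrow> ('a \<Rightarrow> 'v) \<Rightarrow> bool" where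
  "Lp_conv p f g \<longleftrightarrow> (\<forall>e>0. \<exists>N. \<forall>k\<ge>N. integrable lebesgue (\<lambda>x. norm (f k x - g x) powr p)
      \<and> (\<integral>x. norm (f k x - g x) powr p \<partial>lebesgue) \<le> e)"

lemma Lp_conv_weak:
  fixes u :: "nat \<Rightarrow> 'a::euclidean_space \<Rightarrow> 'v::euclidean_space" and b :: "'a \<Rightarrow> real" and T :: "'v \<Rightarrow> real"
  assumes u: "\<And>k. Lp_space p (u k)" and v: "Lp_space p v" and c: "Lp_conv p u v" and p: "p \<ge> 1"
    and b: "b \<in> borel_measurable lebesgue" "\<And>x. \<bar>b x\<bar> \<le> K" "\<And>x. norm x > R \<Longrightarrow> b x = 0"
    and T: "linear T" "\<And>v. \<bar>T v\<bar> \<le> norm v"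
  shows "(\<lambda>k. \<integral>x. T (u k x) * b x \<partial>lebesgue) \<longlonglongrightarrow> (\<integral>x. T (v x) * b x \<partial>lebesgue)"
proof (rule LIMSEQ_I)
  fix \<delta> :: real assume \<delta>: "\<delta> > 0"
  have K: "K \<ge> 0" by (rule order_trans[OF abs_ge_zero b(2)])
  define V where "V = measure lborel (cball (0::'a) R)"
  have V: "V \<ge> 0" by (simp add: V_def)
  \<comment> \<open>Makes the part independent of u at most \<delta> / 2; only then is the index N
    chosen, for which the rest is at most \<delta> / 4.\<close>
  define e where "e = \<delta> / (2 * (K * V + 1))"
  have KV: "K * V \<ge> 0" using K V by simp
  have e: "e > 0" using \<delta> KV by (simp add: e_def)
  have e1: "K * e * V \<le> \<delta> / 2"
  proof -
    have "K * e * V \<le> (K * V + 1) * e" using e by (simp add: algebra_simps)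
    also have "\<dots> = \<delta> / 2" using KV by (simp add: e_def field_simps)
    finally show ?thesis by simp
  qed
  define a where "a = K * e powr (1 - p) + 1"
  have a: "a > 0" using K by (simp add: a_def add_nonneg_pos)
  have "\<delta> / 4 / a > 0" using \<delta> a by simp
  from c[unfolded Lp_conv_def, rule_format, OF this]
  obtain N where N: "\<And>k. k \<ge> N \<Longrightarrow> integrable lebesgue (\<lambda>x. norm (u k x - v x) powr p)"
    "\<And>k. k \<ge> N \<Longrightarrow> (\<integral>x. norm (u k x - v x) powr p \<partial>lebesgue) \<le> \<delta> / 4 / a" by blast
  have "norm ((\<integral>x. T (u k x) * b x \<partial>lebesgue) - (\<integral>x. T (v x) * b x \<partial>lebesgue)) < \<delta>" if "k \<ge> N" for k
  proof -
    have um: "u k \<in> borel_measurable lebesgue" "v \<in> borel_measurable lebesgue" using u v by (auto simp: Lp_space_def)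
    have dm: "(\<lambda>x. u k x - v x) \<in> borel_measurable lebesgue" by (rule borel_measurable_diff[OF um])
    have di: "integrable lebesgue (\<lambda>x. norm (u k x - v x) powr p)" by (rule N(1)[OF that])
    have i1: "integrable lebesgue (\<lambda>x. T (u k x) * b x)"
      by (rule Lp_linear_integrable(1)[OF _ _ p b T]) (use u in \<open>auto simp: Lp_space_def\<close>)
    have i2: "integrable lebesgue (\<lambda>x. T (v x) * b x)"
      by (rule Lp_linear_integrable(1)[OF _ _ p b T]) (use v in \<open>auto simp: Lp_space_def\<close>)
    have "(\<integral>x. T (u k x) * b x \<partial>lebesgue) - (\<integral>x. T (v x) * b x \<partial>lebesgue) = (\<integral>x. T (u k x) * b x - T (v x) * b x \<partial>lebesgue)"
      by (rule Bochner_Integration.integral_diff[OF i1 i2, symmetric])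
    also have "\<dots> = (\<integral>x. T (u k x - v x) * b x \<partial>lebesgue)" by (simp only: linear_diff[OF T(1)] left_diff_distrib)
    finally have "norm ((\<integral>x. T (u k x) * b x \<partial>lebesgue) - (\<integral>x. T (v x) * b x \<partial>lebesgue))
        = \<bar>\<integral>x. T (u k x - v x) * b x \<partial>lebesgue\<bar>" by (simp only: real_norm_def)
    also have "\<dots> \<le> (\<integral>x. norm (u k x - v x) * \<bar>b x\<bar> \<partial>lebesgue)"
      by (rule Lp_linear_integrable(2)[OF dm di p b T])
    also have "\<dots> \<le> K * e * V + K * e powr (1 - p) * (\<integral>x. norm (u k x - v x) powr p \<partial>lebesgue)"
      unfolding V_def by (rule order_trans[OF abs_ge_self Lp_bounded_integrable(2)[OF dm di p b K e]])
    also have "\<dots> < \<delta>"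
    proof -
      have "K * e powr (1 - p) * (\<integral>x. norm (u k x - v x) powr p \<partial>lebesgue) \<le> a * (\<delta> / 4 / a)"
      proof (rule mult_mono[OF _ N(2)[OF that]])
        show "K * e powr (1 - p) \<le> a" by (simp add: a_def)
        show "0 \<le> a" using a by simp
        show "0 \<le> (\<integral>x. norm (u k x - v x) powr p \<partial>lebesgue)" by (rule Bochner_Integration.integral_nonneg) simp
      qed
      also have "\<dots> = \<delta> / 4" using a by simp
      finally show ?thesis using e1 \<delta> by linarith
    qed
    finally show ?thesis .
  qed
  then show "\<exists>N. \<forall>k\<ge>N. norm ((\<integral>x. T (u k x) * b x \<partial>lebesgue) - (\<integral>x. T (v x) * b x \<partial>lebesgue)) < \<delta>" by blast
qed

text \<open>The integral of the difference quotients vanishes by translation invariance.\<close>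

lemma integral_line_derivative_zero:
  fixes f D :: "real^'n::finite \<Rightarrow> real"
  assumes d: "\<And>x. ((\<lambda>t. f (x + t *\<^sub>R axis j 1)) has_real_derivative D x) (at 0)"
    and c: "continuous_on UNIV f" "continuous_on UNIV D" and f0: "\<And>x. norm x > R \<Longrightarrow> f x = 0"
  shows "(\<integral>x. D x \<partial>lborel) = 0"
proof -
  let ?e = "axis j 1 :: real^'n"
  have D0: "norm x > R \<Longrightarrow> D x = 0" for x by (rule line_derivative_zero_outside[OF d f0])
  obtain K where K: "\<And>x. norm (D x) \<le> K" using bounded_if_continuous_compact[OF c(2) D0] by blast
  have fm: "f \<in> borel_measurable borel" by (rule borel_measurable_continuous_onI[OF c(1)])
  have fi: "integrable lborel f" by (rule integrable_continuous_compact[OF c(1) f0])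
  define Q where "Q k x = (f (hseq k *\<^sub>R ?e + 1 *\<^sub>R x) - f x) / hseq k" for k x
  have si: "integrable lborel (\<lambda>x. f (hseq k *\<^sub>R ?e + 1 *\<^sub>R x))" for k
    using integral_reflect(2)[OF fm, of 1 "hseq k *\<^sub>R ?e"] fi by simp
  have Qi: "integrable lborel (Q k)" for k
    unfolding Q_def[abs_def] by (intro integrable_divide Bochner_Integration.integrable_diff si fi)
  have Q0: "(\<integral>x. Q k x \<partial>lborel) = 0" for k
    unfolding Q_def using Bochner_Integration.integral_diff[OF si fi, of k] integral_reflect(1)[OF fm, of 1 "hseq k *\<^sub>R ?e"] by simp
  have "(\<lambda>k. \<integral>x. Q k x \<partial>lborel) \<longlonglongrightarrow> (\<integral>x. D x \<partial>lborel)"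
  proof (rule dominated_on_cball[where K = K and \<rho> = "R + 1"])
    show "Q k \<in> borel_measurable lborel" for k using Qi by (rule borel_measurable_integrable)
    fix x
    have T: "((\<lambda>h. (f (x + (0 + h) *\<^sub>R ?e) - f (x + 0 *\<^sub>R ?e)) / h) \<longlongrightarrow> D x) (at 0)"
      using d[of x] unfolding DERIV_def .
    have "(\<lambda>k. (f (x + (0 + hseq k) *\<^sub>R ?e) - f (x + 0 *\<^sub>R ?e)) / hseq k) \<longlonglongrightarrow> D x"
      by (rule T[unfolded tendsto_at_iff_sequentially comp_def, rule_format])
        (use hseq in \<open>auto simp: less_imp_neq[THEN not_sym]\<close>)
    then show "(\<lambda>k. Q k x) \<longlonglongrightarrow> D x" by (simp add: Q_def add.commute)
    fix k
    obtain s where "f (x + hseq k *\<^sub>R ?e) - f (x + 0 *\<^sub>R ?e) = (hseq k - 0) * D (x + s *\<^sub>R ?e)"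
      using line_mean_value[OF d hseq(1)] by blast
    then have "Q k x = D (x + s *\<^sub>R ?e)" using hseq(1)[of k] by (simp add: Q_def add.commute)
    then show "\<bar>Q k x\<bar> \<le> K" using K[of "x + s *\<^sub>R ?e"] by simp
    assume x: "norm x > R + 1"
    have "norm (hseq k *\<^sub>R ?e) \<le> 1" using hseq(1)[of k] by (simp add: norm_axis_1 hseq_def divide_simps)
    moreover have "norm x \<le> norm (hseq k *\<^sub>R ?e + 1 *\<^sub>R x) + norm (hseq k *\<^sub>R ?e)"
      using norm_triangle_ineq4[of "hseq k *\<^sub>R ?e + 1 *\<^sub>R x" "hseq k *\<^sub>R ?e"] by simp
    ultimately have "norm (hseq k *\<^sub>R ?e + 1 *\<^sub>R x) > R" using x by linarith
    moreover have "norm x > R" using x by simp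
    ultimately show "Q k x = 0" by (simp only: Q_def f0) simp
  qed
  then have "(\<lambda>k::nat. 0) \<longlonglongrightarrow> (\<integral>x. D x \<partial>lborel)" by (simp only: Q0)
  then show ?thesis by (rule LIMSEQ_unique[OF _ tendsto_const])
qed

section \<open>The linear structure and the completeness of W\<close>

lemma test_funE:
  fixes \<phi> :: "real^'n::finite \<Rightarrow> real"
  assumes "test_fun \<phi>"
  obtains R K where "continuous_on UNIV \<phi>" "\<And>j. continuous_on UNIV (partial j \<phi>)"
    "\<And>x. norm x > R \<Longrightarrow> \<phi> x = 0" "\<And>j x. norm x > R \<Longrightarrow> partial j \<phi> x = 0"
    "\<And>x. \<bar>\<phi> x\<bar> \<le> K" "\<And>j x. \<bar>partial j \<phi> x\<bar> \<le> K"
    "\<And>j x. ((\<lambda>t. \<phi> (x + t *\<^sub>R axis j 1)) has_real_derivative partial j \<phi> x) (at 0)"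
proof -
  have sm: "\<And>js. continuous_on UNIV (iter_partial js \<phi>)"
      "\<And>js j x. (\<lambda>t. iter_partial js \<phi> (x + t *\<^sub>R axis j 1)) differentiable (at 0)"
    using assms unfolding test_fun_def smooth_fun_def by auto
  have c: "continuous_on UNIV \<phi>" "\<And>j. continuous_on UNIV (partial j \<phi>)"
    using sm(1)[of "[]"] sm(1)[of "[_]"] by simp_all
  have d: "((\<lambda>t. \<phi> (x + t *\<^sub>R axis j 1)) has_real_derivative partial j \<phi> x) (at 0)" for j x
    using sm(2)[of "[]" x j] unfolding partial_def by (simp add: DERIV_deriv_iff_real_differentiable)
  obtain R where R: "\<And>x. norm x > R \<Longrightarrow> \<phi> x = 0"
    using assms unfolding test_fun_def bounded_iff by (metis (mono_tags, lifting) mem_Collect_eq not_le)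
  have p0: "norm x > R \<Longrightarrow> partial j \<phi> x = 0" for j x
    by (rule line_derivative_zero_outside[OF d R])
  obtain K where K: "\<And>x. norm (\<phi> x) \<le> K" using bounded_if_continuous_compact[OF c(1) R] by blast
  have "\<exists>L. \<forall>x. norm (partial j \<phi> x) \<le> L" for j
    using bounded_if_continuous_compact[OF c(2) p0] by metis
  then obtain L where L: "\<And>j x. norm (partial j \<phi> x) \<le> L j" by metis
  define M where "M = max K (Max (range L))"
  have "L j \<le> M" for j unfolding M_def by (simp add: max.coboundedI2)
  then have "\<bar>\<phi> x\<bar> \<le> M" "\<bar>partial j \<phi> x\<bar> \<le> M" for j x
    using K[of x] L[of j x] order_trans by (auto simp: M_def max.coboundedI1)
  then show ?thesis using that[of R M] c R p0 d by blast
qed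

lemma lebesgue_measurable_continuous:
  fixes f :: "'a::euclidean_space \<Rightarrow> 'b::real_normed_vector"
  shows "continuous_on UNIV f \<Longrightarrow> f \<in> borel_measurable lebesgue"
  by (simp add: measurable_completion borel_measurable_continuous_onI)

lemma vec_nth_functional:
  shows "linear (\<lambda>v :: real^'m. v $ b)" "\<bar>(v :: real^'m) $ b\<bar> \<le> norm v"
    and "linear (\<lambda>v :: real^'n^'m. v $ b $ j)" "\<bar>(X :: real^'n^'m) $ b $ j\<bar> \<le> norm X"
  by (auto intro!: linearI component_le_norm_cart matrix_entry_le_norm)

lemma sobolev_exp_ge_2: "n \<ge> 3 \<Longrightarrow> sobolev_exp n \<ge> 2"
  by (simp add: sobolev_exp_def field_simps)

text \<open>The clauses on local integrability follow from membership in the Lebesgue spaces, by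
  pairing with the indicator of a compact set. Afterwards only the integral identity has to be
  checked.\<close>

lemma in_W_iff:
  fixes u :: "real^'n::finite \<Rightarrow> real^'m::finite"
  assumes n: "CARD('n) \<ge> 3"
  shows "in_W u G \<longleftrightarrow> Lp_space (sobolev_exp CARD('n)) u \<and> Lp_space 2 G \<and>
    (\<forall>\<phi> b j. test_fun \<phi> \<longrightarrow> (\<integral>x. u x $ b * partial j \<phi> x \<partial>lebesgue) = - (\<integral>x. G x $ b $ j * \<phi> x \<partial>lebesgue))"
proof -
  have loc: "locally_integrable (\<lambda>x. T (w x))"
    if w: "Lp_space p w" and p: "p \<ge> 1" and T: "linear T" "\<And>v. \<bar>T v\<bar> \<le> norm v"
    for w :: "real^'n \<Rightarrow> 'v::euclidean_space" and T :: "'v \<Rightarrow> real" and p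
    unfolding locally_integrable_def set_integrable_def
  proof (intro allI impI)
    fix K :: "(real^'n) set" assume K: "compact K"
    obtain R where R: "\<And>x. x \<in> K \<Longrightarrow> norm x \<le> R" using compact_imp_bounded[OF K] by (auto simp: bounded_iff)
    have "integrable lebesgue (\<lambda>x. T (w x) * indicator K x)"
    proof (rule Lp_linear_integrable(1)[OF _ _ p _ _ _ T, of w _ 1 R])
      show "indicator K \<in> borel_measurable lebesgue"
        using K by (intro borel_measurable_indicator) (simp add: borel_compact sets_completionI_sets)
      show "norm x > R \<Longrightarrow> indicator K x = 0" for x using R[of x] by (auto simp: indicator_def)
    qed (use w in \<open>auto simp: Lp_space_def indicator_def\<close>)
    then show "integrable lebesgue (\<lambda>x. indicator K x *\<^sub>R T (w x))" by (simp add: mult.commute)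
  qed
  have q: "sobolev_exp CARD('n) \<ge> 1" using sobolev_exp_ge_2[OF n] by simp
  have "locally_integrable (\<lambda>x. u x $ b)" if "Lp_space (sobolev_exp CARD('n)) u" for b
    by (rule loc[OF that q vec_nth_functional(1,2)])
  moreover have "locally_integrable (\<lambda>x. G x $ b $ j)" if "Lp_space 2 G" for b j
    by (rule loc[OF that _ vec_nth_functional(3,4)]) simp
  ultimately show ?thesis unfolding in_W_def weak_gradient_def by blast
qed

lemma in_W_integrable:
  fixes u :: "real^'n::finite \<Rightarrow> real^'m::finite"
  assumes n: "CARD('n) \<ge> 3" and W: "in_W u G" and \<phi>: "test_fun \<phi>"
  shows "integrable lebesgue (\<lambda>x. u x $ b * partial j \<phi> x)" "integrable lebesgue (\<lambda>x. G x $ b $ j * \<phi> x)"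
proof -
  obtain R K where c: "continuous_on UNIV \<phi>" "\<And>j. continuous_on UNIV (partial j \<phi>)"
    "\<And>x. norm x > R \<Longrightarrow> \<phi> x = 0" "\<And>j x. norm x > R \<Longrightarrow> partial j \<phi> x = 0"
    "\<And>x. \<bar>\<phi> x\<bar> \<le> K" "\<And>j x. \<bar>partial j \<phi> x\<bar> \<le> K" by (rule test_funE[OF \<phi>]) blast
  have q: "sobolev_exp CARD('n) \<ge> 1" using sobolev_exp_ge_2[OF n] by simp
  have u: "u \<in> borel_measurable lebesgue" "integrable lebesgue (\<lambda>x. norm (u x) powr sobolev_exp CARD('n))"
    and G: "G \<in> borel_measurable lebesgue" "integrable lebesgue (\<lambda>x. norm (G x) powr 2)"
    using W unfolding in_W_def Lp_space_def by auto
  show "integrable lebesgue (\<lambda>x. u x $ b * partial j \<phi> x)"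
    by (rule Lp_linear_integrable(1)[OF u q lebesgue_measurable_continuous[OF c(2)] c(6) c(4) vec_nth_functional(1,2)])
  show "integrable lebesgue (\<lambda>x. G x $ b $ j * \<phi> x)"
    by (rule Lp_linear_integrable(1)[OF G _ lebesgue_measurable_continuous[OF c(1)] c(5) c(3) vec_nth_functional(3,4)]) simp
qed

lemma in_W_lincomb:
  fixes u :: "real^'n::finite \<Rightarrow> real^'m::finite"
  assumes n: "CARD('n) \<ge> 3" and u: "in_W u G" and v: "in_W v H"
  shows "in_W (\<lambda>x. a *\<^sub>R u x + c *\<^sub>R v x) (\<lambda>x. a *\<^sub>R G x + c *\<^sub>R H x)"
  unfolding in_W_iff[OF n]
proof (intro conjI allI impI)
  have q: "sobolev_exp CARD('n) \<ge> 0" using sobolev_exp_ge_2[OF n] by simp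
  show "Lp_space (sobolev_exp CARD('n)) (\<lambda>x. a *\<^sub>R u x + c *\<^sub>R v x)" "Lp_space 2 (\<lambda>x. a *\<^sub>R G x + c *\<^sub>R H x)"
    using u v q unfolding in_W_def by (auto intro: Lp_space_lincomb)
  fix \<phi> :: "real^'n \<Rightarrow> real" and b j assume \<phi>: "test_fun \<phi>"
  note i = in_W_integrable[OF n u \<phi>, of b j] in_W_integrable[OF n v \<phi>, of b j]
  have e: "(\<integral>x. u x $ b * partial j \<phi> x \<partial>lebesgue) = - (\<integral>x. G x $ b $ j * \<phi> x \<partial>lebesgue)"
    "(\<integral>x. v x $ b * partial j \<phi> x \<partial>lebesgue) = - (\<integral>x. H x $ b $ j * \<phi> x \<partial>lebesgue)"
    using u v \<phi> unfolding in_W_iff[OF n] by blast+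
  have "(\<integral>x. (a *\<^sub>R u x + c *\<^sub>R v x) $ b * partial j \<phi> x \<partial>lebesgue)
      = (\<integral>x. a * (u x $ b * partial j \<phi> x) + c * (v x $ b * partial j \<phi> x) \<partial>lebesgue)"
    by (simp add: distrib_right mult.assoc)
  also have "\<dots> = a * (\<integral>x. u x $ b * partial j \<phi> x \<partial>lebesgue) + c * (\<integral>x. v x $ b * partial j \<phi> x \<partial>lebesgue)"
    using i by simp
  also have "\<dots> = - (a * (\<integral>x. G x $ b $ j * \<phi> x \<partial>lebesgue) + c * (\<integral>x. H x $ b $ j * \<phi> x \<partial>lebesgue))"
    unfolding e by simp
  also have "a * (\<integral>x. G x $ b $ j * \<phi> x \<partial>lebesgue) + c * (\<integral>x. H x $ b $ j * \<phi> x \<partial>lebesgue)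
      = (\<integral>x. a * (G x $ b $ j * \<phi> x) + c * (H x $ b $ j * \<phi> x) \<partial>lebesgue)"
    using i by simp
  also have "\<dots> = (\<integral>x. (a *\<^sub>R G x + c *\<^sub>R H x) $ b $ j * \<phi> x \<partial>lebesgue)"
    by (simp add: distrib_right mult.assoc)
  finally show "(\<integral>x. (a *\<^sub>R u x + c *\<^sub>R v x) $ b * partial j \<phi> x \<partial>lebesgue)
      = - (\<integral>x. (a *\<^sub>R G x + c *\<^sub>R H x) $ b $ j * \<phi> x \<partial>lebesgue)" .
qed

lemma in_W_diff:
  fixes u :: "real^'n::finite \<Rightarrow> real^'m::finite"
  assumes n: "CARD('n) \<ge> 3" and u: "in_W u G" and v: "in_W v H"
  shows "in_W (\<lambda>x. u x - v x) (\<lambda>x. G x - H x)"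
  using in_W_lincomb[OF n u v, of 1 "-1"] by simp

text \<open>Integration by parts: the derivative of the product with a test function has integral
  zero. These elements of W are the ones against which the minimal residual is tested.\<close>

lemma in_W_smooth_bump:
  fixes \<phi> :: "real^'n::finite \<Rightarrow> real" and \<xi> :: "real^'m::finite"
  assumes n: "CARD('n) \<ge> 3" and \<phi>: "\<phi> \<in> smooth_bump"
  shows "in_W (\<lambda>x. \<phi> x *\<^sub>R \<xi>) (\<lambda>x. outer \<xi> (grad \<phi> x))"
  unfolding in_W_iff[OF n]
proof (intro conjI allI impI)
  obtain R where c: "continuous_on UNIV \<phi>" "continuous_on UNIV (grad \<phi>)"
    and R: "\<And>x. norm x > R \<Longrightarrow> \<phi> x = 0" "\<And>x. norm x > R \<Longrightarrow> grad \<phi> x = 0" using smooth_bumpE[OF \<phi>] by metis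
  have sa: "\<phi> \<in> smooth_alg" using \<phi> by (simp add: smooth_bump_def)
  have Lp: "Lp_space p w" if w: "continuous_on UNIV w" "\<And>x. norm x > R \<Longrightarrow> w x = 0" and p: "p > 0"
    for w :: "real^'n \<Rightarrow> 'v::euclidean_space" and p
    unfolding Lp_space_def
  proof
    show "w \<in> borel_measurable lebesgue" by (rule lebesgue_measurable_continuous[OF w(1)])
    have cp: "continuous_on UNIV (\<lambda>x. norm (w x) powr p)"
      by (rule continuous_on_powr'[OF continuous_on_norm[OF w(1)] continuous_on_const]) (use p in auto)
    have "integrable lborel (\<lambda>x. norm (w x) powr p)"
      by (rule integrable_continuous_compact[OF cp, of R]) (simp add: w(2))
    then show "integrable lebesgue (\<lambda>x. norm (w x) powr p)"
      using borel_measurable_continuous_onI[OF cp] by (simp add: integrable_completion)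
  qed
  show "Lp_space (sobolev_exp CARD('n)) (\<lambda>x. \<phi> x *\<^sub>R \<xi>)"
    by (rule Lp) (use R sobolev_exp_ge_2[OF n] in \<open>auto intro!: continuous_intros c\<close>)
  show "Lp_space 2 (\<lambda>x. outer \<xi> (grad \<phi> x))"
    by (rule Lp) (use R in \<open>auto intro!: bounded_bilinear.continuous_on[OF bounded_bilinear_outer] c continuous_on_const simp: outer_zero_right\<close>)
  fix \<psi> :: "real^'n \<Rightarrow> real" and b j assume \<psi>: "test_fun \<psi>"
  obtain S K where d: "continuous_on UNIV \<psi>" "\<And>j. continuous_on UNIV (partial j \<psi>)"
    "\<And>x. norm x > S \<Longrightarrow> \<psi> x = 0" "\<And>j x. norm x > S \<Longrightarrow> partial j \<psi> x = 0"
    "\<And>j x. ((\<lambda>t. \<psi> (x + t *\<^sub>R axis j 1)) has_real_derivative partial j \<psi> x) (at 0)" by (rule test_funE[OF \<psi>]) blast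
  have cp: "continuous_on UNIV (partial j \<phi>)" by (intro smooth_alg_continuous smooth_alg_partial sa)
  have z: "(\<integral>x. partial j \<phi> x * \<psi> x + partial j \<psi> x * \<phi> x \<partial>lborel) = 0"
  proof (rule integral_line_derivative_zero[where f = "\<lambda>x. \<phi> x * \<psi> x" and R = R and j = j])
    show "((\<lambda>t. \<phi> (x + t *\<^sub>R axis j 1) * \<psi> (x + t *\<^sub>R axis j 1)) has_real_derivative partial j \<phi> x * \<psi> x + partial j \<psi> x * \<phi> x) (at 0)" for x
      using DERIV_mult[OF smooth_alg_has_partial[OF sa, of x j] d(5)[of x j]] by simp
  qed (use R in \<open>auto intro!: continuous_intros c cp d\<close>)
  have i1: "integrable lborel (\<lambda>x. partial j \<phi> x * \<psi> x)"
    by (rule integrable_continuous_compact[of _ S]) (auto intro!: continuous_intros cp d(1) simp: d(3))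
  have i2: "integrable lborel (\<lambda>x. partial j \<psi> x * \<phi> x)"
    by (rule integrable_continuous_compact[of _ R]) (auto intro!: continuous_intros c d(2) simp: R)
  have z2: "(\<integral>x. partial j \<psi> x * \<phi> x \<partial>lborel) = - (\<integral>x. partial j \<phi> x * \<psi> x \<partial>lborel)"
    using z unfolding Bochner_Integration.integral_add[OF i1 i2] by linarith
  have m: "(\<lambda>x. (\<phi> x *\<^sub>R \<xi>) $ b * partial j \<psi> x) \<in> borel_measurable lborel" "(\<lambda>x. outer \<xi> (grad \<phi> x) $ b $ j * \<psi> x) \<in> borel_measurable lborel"
    unfolding measurable_lborel1 by (auto intro!: borel_measurable_continuous_onI continuous_intros c cp d)
  have "(\<integral>x. (\<phi> x *\<^sub>R \<xi>) $ b * partial j \<psi> x \<partial>lebesgue) = (\<integral>x. \<xi> $ b * (partial j \<psi> x * \<phi> x) \<partial>lborel)"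
    unfolding integral_completion[OF m(1)] by (simp add: mult_ac)
  also have "\<dots> = - (\<integral>x. \<xi> $ b * (partial j \<phi> x * \<psi> x) \<partial>lborel)" by (simp add: z2)
  also have "(\<integral>x. \<xi> $ b * (partial j \<phi> x * \<psi> x) \<partial>lborel) = (\<integral>x. outer \<xi> (grad \<phi> x) $ b $ j * \<psi> x \<partial>lebesgue)"
    unfolding integral_completion[OF m(2)] by (simp add: mult_ac)
  finally show "(\<integral>x. (\<phi> x *\<^sub>R \<xi>) $ b * partial j \<psi> x \<partial>lebesgue) = - (\<integral>x. outer \<xi> (grad \<phi> x) $ b $ j * \<psi> x \<partial>lebesgue)" .
qed

lemma in_W_in_L2: "in_W u G \<Longrightarrow> in_L2 lebesgue G"
  by (simp add: in_W_def Lp_space_2)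

lemma Lp_norm_powr:
  assumes "p > 0"
  shows "(\<integral>x. norm (u x) powr p \<partial>lebesgue) = Lp_norm p u powr p"
  using assms by (simp add: Lp_norm_def powr_powr Bochner_Integration.integral_nonneg)

lemma Lp_norm_nonneg [simp]: "Lp_norm p u \<ge> 0" by (simp add: Lp_norm_def)

text \<open>The Cauchy condition concerns A : Du only, the quantity that both the minimisation and
  the iteration control. The estimates turn it into Cauchy conditions for u and Du, and the weak
  gradient identity is stable under these convergences.\<close>

lemma W_complete:
  fixes u :: "nat \<Rightarrow> real^'n::finite \<Rightarrow> real^'m::finite"
  assumes n: "CARD('n) \<ge> 3" and A: "elliptic_with \<nu> A" and W: "\<And>k. in_W (u k) (G k)"
    and C: "\<And>e. e > 0 \<Longrightarrow> \<exists>N. \<forall>k\<ge>N. \<forall>l\<ge>N. L2norm lebesgue (\<lambda>x. A (G k x - G l x)) < e"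
  obtains v H where "in_W v H" "(\<lambda>k. L2norm lebesgue (\<lambda>x. G k x - H x)) \<longlonglongrightarrow> 0"
proof -
  define q where "q = sobolev_exp CARD('n)"
  have q: "q \<ge> 2" unfolding q_def by (rule sobolev_exp_ge_2[OF n])
  have \<nu>: "\<nu> > 0" using A by (simp add: elliptic_with_def)
  \<comment> \<open>A common constant for both estimates, so that one Cauchy argument serves u and
    its gradient.\<close>
  define S where "S = max (sqrt (sobolev_const CARD('n)) / \<nu>) (1 / \<nu>)"
  have S: "S > 0" using \<nu> by (simp add: S_def less_max_iff_disj)
  have W': "in_W (\<lambda>x. u k x - u l x) (\<lambda>x. G k x - G l x)" for k l by (rule in_W_diff[OF n W W])
  have Su: "Lp_norm q (\<lambda>x. u k x - u l x) \<le> S * L2norm lebesgue (\<lambda>x. A (G k x - G l x))" for k l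
  proof -
    have "Lp_norm q (\<lambda>x. u k x - u l x) \<le> sqrt (sobolev_const CARD('n)) / \<nu> * L2norm lebesgue (\<lambda>x. A (G k x - G l x))"
      unfolding q_def by (rule in_W_estimates(2)[OF n A W'])
    also have "\<dots> \<le> S * L2norm lebesgue (\<lambda>x. A (G k x - G l x))" by (intro mult_right_mono) (auto simp: S_def)
    finally show ?thesis .
  qed
  have SG: "Lp_norm 2 (\<lambda>x. G k x - G l x) \<le> S * L2norm lebesgue (\<lambda>x. A (G k x - G l x))" for k l
  proof -
    have "Lp_norm 2 (\<lambda>x. G k x - G l x) \<le> 1 / \<nu> * L2norm lebesgue (\<lambda>x. A (G k x - G l x))"
      using in_W_estimates(1)[OF n A W', of k l] \<nu> by (simp add: Lp_norm_2 field_simps)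
    also have "\<dots> \<le> S * L2norm lebesgue (\<lambda>x. A (G k x - G l x))" by (intro mult_right_mono) (auto simp: S_def)
    finally show ?thesis .
  qed
  have Cau: "\<exists>N. \<forall>k\<ge>N. \<forall>l\<ge>N. (\<integral>x. norm (w k x - w l x) powr p \<partial>lebesgue) < e"
    if p: "p > 0" and e: "e > 0" and le: "\<And>k l. Lp_norm p (\<lambda>x. w k x - w l x) \<le> S * L2norm lebesgue (\<lambda>x. A (G k x - G l x))"
    for w :: "nat \<Rightarrow> real^'n \<Rightarrow> 'v::euclidean_space" and p e
  proof -
    define d where "d = e powr (1 / p) / S"
    have d: "d > 0" using e S by (simp add: d_def)
    obtain N where N: "\<And>k l. k \<ge> N \<Longrightarrow> l \<ge> N \<Longrightarrow> L2norm lebesgue (\<lambda>x. A (G k x - G l x)) < d" using C[OF d] by blast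
    have "(\<integral>x. norm (w k x - w l x) powr p \<partial>lebesgue) < e" if "k \<ge> N" "l \<ge> N" for k l
    proof -
      have "Lp_norm p (\<lambda>x. w k x - w l x) < S * d" using le[of k l] N[OF that] S by (smt (verit) mult_less_cancel_left_pos)
      then have "Lp_norm p (\<lambda>x. w k x - w l x) powr p < (S * d) powr p" using p by (intro powr_less_mono2) auto
      also have "(S * d) powr p = e" using S e p by (simp add: d_def powr_powr)
      finally show ?thesis by (simp only: Lp_norm_powr[OF p])
    qed
    then show ?thesis by blast
  qed
  have uL: "Lp_space q (u k)" "Lp_space 2 (G k)" for k using W[of k] by (auto simp: in_W_def q_def)
  have dL: "Lp_space q (\<lambda>x. u k x - u l x)" "Lp_space 2 (\<lambda>x. G k x - G l x)" for k l
    using W'[of k l] by (auto simp: in_W_def q_def)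
  have q0: "q > 0" "q \<ge> 1" "q \<ge> 0" using q by auto
  obtain v where v: "v \<in> borel_measurable lebesgue" "Lp_conv q u v"
  proof (rule Lp_complete[OF q0(1), of u lebesgue])
    show "u k \<in> borel_measurable lebesgue" for k using uL[of k] by (simp add: Lp_space_def)
    show "integrable lebesgue (\<lambda>x. norm (u k x - u l x) powr q)" for k l using dL[of k l] by (simp add: Lp_space_def)
    show "\<exists>N. \<forall>k\<ge>N. \<forall>l\<ge>N. (\<integral>x. norm (u k x - u l x) powr q \<partial>lebesgue) < e" if "e > 0" for e
      by (rule Cau[OF q0(1) that Su])
  qed (use that in \<open>auto simp: Lp_conv_def\<close>)
  obtain H where H: "H \<in> borel_measurable lebesgue" "Lp_conv 2 G H"
  proof (rule Lp_complete[OF zero_less_numeral, of G lebesgue])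
    show "G k \<in> borel_measurable lebesgue" for k using uL[of k] by (simp add: Lp_space_def)
    show "integrable lebesgue (\<lambda>x. norm (G k x - G l x) powr 2)" for k l using dL[of k l] by (simp add: Lp_space_def)
    show "\<exists>N. \<forall>k\<ge>N. \<forall>l\<ge>N. (\<integral>x. norm (G k x - G l x) powr 2 \<partial>lebesgue) < e" if "e > 0" for e
      by (rule Cau[OF zero_less_numeral that SG])
  qed (use that in \<open>auto simp: Lp_conv_def\<close>)
  have limL: "Lp_space p z" if w: "\<And>k. Lp_space p (w k)" and z: "z \<in> borel_measurable lebesgue" and c: "Lp_conv p w z" and p: "p \<ge> 0"
    for w :: "nat \<Rightarrow> real^'n \<Rightarrow> 'v::euclidean_space" and z p
  proof -
    obtain N where N: "integrable lebesgue (\<lambda>x. norm (w N x - z x) powr p)"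
      using c unfolding Lp_conv_def by (metis order_refl zero_less_one)
    have wm: "w N \<in> borel_measurable lebesgue" using w by (simp add: Lp_space_def)
    have "Lp_space p (\<lambda>x. w N x - z x)"
      unfolding Lp_space_def using N borel_measurable_diff[OF wm z] by simp
    from Lp_space_lincomb[OF w[of N] this p, of 1 "-1"] show ?thesis by simp
  qed
  have vL: "Lp_space q v" by (rule limL[OF uL(1) v q0(3)])
  have HL: "Lp_space 2 H" by (rule limL[OF uL(2) H]) simp
  have "in_W v H"
    unfolding in_W_iff[OF n]
  proof (intro conjI allI impI)
    show "Lp_space (sobolev_exp CARD('n)) v" "Lp_space 2 H" using vL HL by (auto simp: q_def)
    fix \<phi> :: "real^'n \<Rightarrow> real" and b j assume \<phi>: "test_fun \<phi>"
    obtain R K where c: "continuous_on UNIV \<phi>" "\<And>j. continuous_on UNIV (partial j \<phi>)"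
      "\<And>x. norm x > R \<Longrightarrow> \<phi> x = 0" "\<And>j x. norm x > R \<Longrightarrow> partial j \<phi> x = 0"
      "\<And>x. \<bar>\<phi> x\<bar> \<le> K" "\<And>j x. \<bar>partial j \<phi> x\<bar> \<le> K" by (rule test_funE[OF \<phi>]) blast
    have l1: "(\<lambda>k. \<integral>x. u k x $ b * partial j \<phi> x \<partial>lebesgue) \<longlonglongrightarrow> (\<integral>x. v x $ b * partial j \<phi> x \<partial>lebesgue)"
      by (rule Lp_conv_weak[OF uL(1) vL v(2) q0(2) lebesgue_measurable_continuous[OF c(2)] c(6) c(4) vec_nth_functional(1,2)])
    have l2: "(\<lambda>k. \<integral>x. G k x $ b $ j * \<phi> x \<partial>lebesgue) \<longlonglongrightarrow> (\<integral>x. H x $ b $ j * \<phi> x \<partial>lebesgue)"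
      by (rule Lp_conv_weak[OF uL(2) HL H(2) _ lebesgue_measurable_continuous[OF c(1)] c(5) c(3) vec_nth_functional(3,4)]) simp
    have e: "(\<integral>x. u k x $ b * partial j \<phi> x \<partial>lebesgue) = - (\<integral>x. G k x $ b $ j * \<phi> x \<partial>lebesgue)" for k
      using W[of k] \<phi> unfolding in_W_iff[OF n] by blast
    show "(\<integral>x. v x $ b * partial j \<phi> x \<partial>lebesgue) = - (\<integral>x. H x $ b $ j * \<phi> x \<partial>lebesgue)"
      by (rule LIMSEQ_unique[OF l1]) (unfold e, rule tendsto_minus[OF l2])
  qed
  moreover have "(\<lambda>k. L2norm lebesgue (\<lambda>x. G k x - H x)) \<longlonglongrightarrow> 0"
  proof (rule LIMSEQ_I)
    fix e :: real assume e: "e > 0"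
    then have "(e / 2)\<^sup>2 > 0" by simp
    from H(2)[unfolded Lp_conv_def, rule_format, OF this]
    obtain N where N: "\<And>k. k \<ge> N \<Longrightarrow> (\<integral>x. norm (G k x - H x) powr 2 \<partial>lebesgue) \<le> (e / 2)\<^sup>2" by blast
    have "norm (L2norm lebesgue (\<lambda>x. G k x - H x) - 0) < e" if "k \<ge> N" for k
    proof -
      have "(L2norm lebesgue (\<lambda>x. G k x - H x))\<^sup>2 \<le> (e / 2)\<^sup>2"
        using N[OF that] by (simp add: L2norm_sq powr_numeral)
      then have "L2norm lebesgue (\<lambda>x. G k x - H x) \<le> e / 2" by (rule power2_le_imp_le) (use e in simp)
      then have "L2norm lebesgue (\<lambda>x. G k x - H x) < e" using e by linarith
      then show ?thesis by simp
    qed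
    then show "\<exists>N. \<forall>k\<ge>N. norm (L2norm lebesgue (\<lambda>x. G k x - H x) - 0) < e" by blast
  qed
  ultimately show ?thesis by (rule that)
qed

section \<open>Solvability of the linear system\<close>

lemma in_L2_inner_integrable:
  fixes r s :: "'a \<Rightarrow> 'v::euclidean_space"
  assumes r: "in_L2 M r" and s: "in_L2 M s"
  shows "integrable M (\<lambda>x. r x \<bullet> s x)"
proof (rule Bochner_Integration.integrable_bound)
  show "integrable M (\<lambda>x. (norm (r x))\<^sup>2 + (norm (s x))\<^sup>2)" using r s by (auto simp: in_L2_def)
  show "(\<lambda>x. r x \<bullet> s x) \<in> borel_measurable M" using r s by (auto simp: in_L2_def intro: borel_measurable_inner)
  have "\<bar>a \<bullet> b\<bar> \<le> (norm a)\<^sup>2 + (norm b)\<^sup>2" for a b :: 'v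
  proof -
    have "2 * (norm a * norm b) \<le> (norm a)\<^sup>2 + (norm b)\<^sup>2"
      using zero_le_power2[of "norm a - norm b"] by (simp add: power2_diff)
    moreover have "\<bar>a \<bullet> b\<bar> \<le> norm a * norm b" by (rule Cauchy_Schwarz_ineq2)
    moreover have "0 \<le> norm a * norm b" by simp
    ultimately show ?thesis by linarith
  qed
  then show "AE x in M. norm (r x \<bullet> s x) \<le> norm ((norm (r x))\<^sup>2 + (norm (s x))\<^sup>2)" by (intro AE_I2) simp
qed

lemma L2norm_eq_0:
  assumes f: "in_L2 M f" and z: "L2norm M f = 0"
  shows "AE x in M. f x = 0"
proof -
  have "(\<integral>x. (norm (f x))\<^sup>2 \<partial>M) = 0" using z by (simp only: L2norm_sq[symmetric]) simp
  moreover have "integrable M (\<lambda>x. (norm (f x))\<^sup>2)" using f by (simp add: in_L2_def)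
  ultimately have "AE x in M. (norm (f x))\<^sup>2 = 0"
    using integral_nonneg_eq_0_iff_AE[of M "\<lambda>x. (norm (f x))\<^sup>2"] by simp
  then show ?thesis by eventually_elim simp
qed

lemma L2norm_cong:
  assumes "f \<in> borel_measurable M" "g \<in> borel_measurable M" "AE x in M. f x = g x"
  shows "L2norm M f = L2norm M g"
proof -
  have "(\<lambda>x. (norm (f x))\<^sup>2) \<in> borel_measurable M" "(\<lambda>x. (norm (g x))\<^sup>2) \<in> borel_measurable M"
    using assms by auto
  moreover have "AE x in M. (norm (f x))\<^sup>2 = (norm (g x))\<^sup>2" using assms(3) by eventually_elim simp
  ultimately show ?thesis unfolding L2norm_def by (intro arg_cong[where f = sqrt] integral_cong_AE)
qed

lemma in_W_zero:
  assumes "CARD('n::finite) \<ge> 3"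
  shows "in_W (\<lambda>x::real^'n. 0 :: real^'m::finite) (\<lambda>x. 0)"
proof -
  have "outer (0 :: real^'m) v = 0" for v :: "real^'n" by (simp add: vec_eq_iff)
  then show ?thesis using in_W_smooth_bump[OF assms std_bump_smooth, of "0 :: real^'m"] by simp
qed

lemma elliptic_bound:
  fixes A :: "real^'n::finite^'m::finite \<Rightarrow> real^'m"
  assumes "elliptic_with \<nu> A"
  obtains M where "M > 0" "\<And>X. norm (A X) \<le> M * norm X"
proof -
  have "linear A" using assms by (simp add: elliptic_with_def)
  then obtain M where "M > 0" "\<And>X. norm (A X) \<le> norm X * M"
    using bounded_linear.pos_bounded[OF linear_bounded] by blast
  then show ?thesis using that[of M] by (simp add: mult.commute)
qed

text \<open>Minimise the residual over \<open>W\<close>: the parallelogram identity makes a minimising sequence Cauchy,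
  and the residual of the minimiser annihilates the range, hence vanishes.\<close>

lemma linear_system_solvable:
  fixes A :: "real^'n::finite^'m::finite \<Rightarrow> real^'m"
  assumes n: "CARD('n) \<ge> 3" and A: "elliptic_with \<nu> A" and f: "in_L2 lebesgue f"
  obtains u G where "in_W u G" "AE x in lebesgue. A (G x) = f x"
proof -
  have lin: "linear A" using A by (simp add: elliptic_with_def)
  let ?N = "\<lambda>g. L2norm lebesgue g"
  define S where "S = {?N (\<lambda>x. f x - A (G x)) | u G. in_W (u :: real^'n \<Rightarrow> real^'m) G}"
  define d where "d = Inf S"
  have Sne: "S \<noteq> {}" using in_W_zero[OF n] unfolding S_def by blast
  have Sb: "bdd_below S" by (rule bdd_belowI[of _ 0]) (auto simp: S_def)
  have d0: "d \<ge> 0" unfolding d_def by (rule cInf_greatest[OF Sne]) (auto simp: S_def)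
  have dle: "d \<le> ?N (\<lambda>x. f x - A (G x))" if "in_W u G" for u :: "real^'n \<Rightarrow> real^'m" and G
    unfolding d_def by (rule cInf_lower[OF _ Sb]) (use that in \<open>auto simp: S_def\<close>)
  have "\<exists>u G. in_W (u :: real^'n \<Rightarrow> real^'m) G \<and> ?N (\<lambda>x. f x - A (G x)) < d + hseq k" for k
  proof -
    have "\<exists>y\<in>S. y < d + hseq k"
      using cInf_lessD[OF Sne, of "d + hseq k"] hseq(1)[of k] by (auto simp: d_def)
    then show ?thesis unfolding S_def by blast
  qed
  then obtain u G where W: "\<And>k. in_W (u k :: real^'n \<Rightarrow> real^'m) (G k)"
    and small: "\<And>k. ?N (\<lambda>x. f x - A (G k x)) < d + hseq k" by metis
  have GL: "in_L2 lebesgue (G k)" for k by (rule in_W_in_L2[OF W])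
  have rL: "in_L2 lebesgue (\<lambda>x. f x - A (H x))" if "in_L2 lebesgue H" for H
    by (rule in_L2_diff[OF f in_L2_linear[OF lin that]])
  \<comment> \<open>The midpoint of two competitors is again in W, so its residual is at least d;
    the parallelogram identity then bounds the distance of the competitors.\<close>
  have para: "(?N (\<lambda>x. A (G k x - G l x)))\<^sup>2 \<le> 2 * (?N (\<lambda>x. f x - A (G k x)))\<^sup>2 + 2 * (?N (\<lambda>x. f x - A (G l x)))\<^sup>2 - 4 * d\<^sup>2" for k l
  proof -
    let ?H = "\<lambda>x. (1/2) *\<^sub>R G k x + (1/2) *\<^sub>R G l x"
    have Wm: "in_W (\<lambda>x. (1/2) *\<^sub>R u k x + (1/2) *\<^sub>R u l x) ?H" by (rule in_W_lincomb[OF n W W])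
    have HL: "in_L2 lebesgue ?H" by (rule in_W_in_L2[OF Wm])
    have id: "(norm (A (G k x - G l x)))\<^sup>2 = 2 * (norm (f x - A (G k x)))\<^sup>2 + 2 * (norm (f x - A (G l x)))\<^sup>2
        - 4 * (norm (f x - A (?H x)))\<^sup>2" for x
    proof -
      have 1: "A (G k x - G l x) = (f x - A (G l x)) - (f x - A (G k x))" by (simp add: linear_diff[OF lin])
      have 2: "f x - A (?H x) = (1/2) *\<^sub>R ((f x - A (G k x)) + (f x - A (G l x)))"
        by (simp add: linear_add[OF lin] linear_scale[OF lin] scaleR_right_diff_distrib scaleR_right_distrib)
      have "(norm (b - a))\<^sup>2 = 2 * (norm a)\<^sup>2 + 2 * (norm b)\<^sup>2 - 4 * (norm ((1/2) *\<^sub>R (a + b)))\<^sup>2" for a b :: "real^'m"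
        unfolding power2_norm_eq_inner
        by (simp add: inner_diff_left inner_diff_right inner_add_left inner_add_right inner_commute add_divide_distrib)
      then show ?thesis unfolding 1 2 .
    qed
    have i: "integrable lebesgue (\<lambda>x. (norm (f x - A (H x)))\<^sup>2)" if "in_L2 lebesgue H" for H
      using rL[OF that] by (simp add: in_L2_def)
    have "(?N (\<lambda>x. A (G k x - G l x)))\<^sup>2 = 2 * (?N (\<lambda>x. f x - A (G k x)))\<^sup>2 + 2 * (?N (\<lambda>x. f x - A (G l x)))\<^sup>2
        - 4 * (?N (\<lambda>x. f x - A (?H x)))\<^sup>2"
      unfolding L2norm_sq id using i[OF GL[of k]] i[OF GL[of l]] i[OF HL] by simp
    moreover have "d\<^sup>2 \<le> (?N (\<lambda>x. f x - A (?H x)))\<^sup>2" using dle[OF Wm] d0 by (intro power_mono)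
    ultimately show ?thesis by linarith
  qed
  have Cau: "\<exists>N. \<forall>k\<ge>N. \<forall>l\<ge>N. ?N (\<lambda>x. A (G k x - G l x)) < e" if e: "e > 0" for e
  proof -
    have "(\<lambda>k. 4 * ((d + hseq k)\<^sup>2 - d\<^sup>2)) \<longlonglongrightarrow> 4 * ((d + 0)\<^sup>2 - d\<^sup>2)" by (intro tendsto_intros hseq(2))
    then have "(\<lambda>k. 4 * ((d + hseq k)\<^sup>2 - d\<^sup>2)) \<longlonglongrightarrow> 0" by simp
    then have "\<forall>\<^sub>F k in sequentially. 4 * ((d + hseq k)\<^sup>2 - d\<^sup>2) < e\<^sup>2" by (rule order_tendstoD(2)) (use e in simp)
    then obtain N where N: "4 * ((d + hseq N)\<^sup>2 - d\<^sup>2) < e\<^sup>2" by (auto simp: eventually_sequentially)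
    have sq: "(?N (\<lambda>x. f x - A (G k x)))\<^sup>2 \<le> (d + hseq N)\<^sup>2" if "k \<ge> N" for k
    proof (rule power_mono)
      have "hseq k \<le> hseq N" using that by (simp add: hseq_def le_imp_inverse_le)
      then show "?N (\<lambda>x. f x - A (G k x)) \<le> d + hseq N" using small[of k] by linarith
    qed simp
    have "?N (\<lambda>x. A (G k x - G l x)) < e" if "k \<ge> N" "l \<ge> N" for k l
    proof -
      have arith: "y < t" if "y \<le> 2 * a + 2 * b - 4 * c" "a \<le> p" "b \<le> p" "4 * (p - c) < t"
        for y :: real and a :: real and b :: real and c :: real and p :: real and t :: real
      proof -
        have "2 * a + 2 * b \<le> 4 * p" using that(2,3) by simp
        then have "y \<le> 4 * p - 4 * c" using that(1) by simp
        also have "\<dots> < t" using that(4) by (simp add: right_diff_distrib)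
        finally show ?thesis .
      qed
      have "(?N (\<lambda>x. A (G k x - G l x)))\<^sup>2 < e\<^sup>2"
        by (rule arith[OF para[of k l] sq[OF that(1)] sq[OF that(2)] N])
      then show ?thesis by (rule power2_less_imp_less) (use e in simp)
    qed
    then show ?thesis by blast
  qed
  obtain v H where vH: "in_W v H" and lim: "(\<lambda>k. ?N (\<lambda>x. G k x - H x)) \<longlonglongrightarrow> 0"
    using W_complete[OF n A W Cau] by blast
  have HL: "in_L2 lebesgue H" by (rule in_W_in_L2[OF vH])
  obtain M where M: "M > 0" "\<And>X. norm (A X) \<le> M * norm X" using elliptic_bound[OF A] by blast
  define r where "r x = f x - A (H x)" for x
  have r: "in_L2 lebesgue r" unfolding r_def by (rule rL[OF HL])
  have "?N r \<le> d"
  proof -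
    have "?N r \<le> (d + hseq k) + M * ?N (\<lambda>x. G k x - H x)" for k
    proof -
      have D: "in_L2 lebesgue (\<lambda>x. A (G k x - H x))" by (rule in_L2_linear[OF lin in_L2_diff[OF GL HL]])
      have "r = (\<lambda>x. (f x - A (G k x)) + A (G k x - H x))" by (simp add: r_def fun_eq_iff linear_diff[OF lin])
      then have "?N r \<le> ?N (\<lambda>x. f x - A (G k x)) + ?N (\<lambda>x. A (G k x - H x))"
        using L2norm_triangle[OF rL[OF GL[of k]] D] by simp
      moreover have "?N (\<lambda>x. A (G k x - H x)) \<le> M * ?N (\<lambda>x. G k x - H x)"
        using M by (intro L2norm_mono D in_L2_diff GL HL) auto
      ultimately show ?thesis using small[of k] by linarith
    qed
    moreover have "(\<lambda>k. (d + hseq k) + M * ?N (\<lambda>x. G k x - H x)) \<longlonglongrightarrow> (d + 0) + M * 0"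
      by (intro tendsto_intros hseq(2) lim)
    ultimately show ?thesis by (intro LIMSEQ_le_const[of _ d]) auto
  qed
  moreover have "d \<le> ?N r" unfolding r_def by (rule dle[OF vH])
  ultimately have rd: "?N r = d" by simp
  \<comment> \<open>The first variation at the minimiser: moving in direction w changes the squared
    residual by a quadratic in t that is never negative.\<close>
  have orth: "(\<integral>x. r x \<bullet> A (K x) \<partial>lebesgue) = 0" if K: "in_W w K" for w :: "real^'n \<Rightarrow> real^'m" and K
  proof -
    define p where "p = (\<integral>x. r x \<bullet> A (K x) \<partial>lebesgue)"
    define s where "s = (?N (\<lambda>x. A (K x)))\<^sup>2"
    have AK: "in_L2 lebesgue (\<lambda>x. A (K x))" by (rule in_L2_linear[OF lin in_W_in_L2[OF K]])
    have quad: "0 \<le> t\<^sup>2 * s - 2 * t * p" for t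
    proof -
      have Wt: "in_W (\<lambda>x. 1 *\<^sub>R v x + t *\<^sub>R w x) (\<lambda>x. 1 *\<^sub>R H x + t *\<^sub>R K x)" by (rule in_W_lincomb[OF n vH K])
      have eq: "f x - A (1 *\<^sub>R H x + t *\<^sub>R K x) = r x - t *\<^sub>R A (K x)" for x
        by (simp add: r_def linear_add[OF lin] linear_scale[OF lin])
      have pt: "(norm (r x - t *\<^sub>R A (K x)))\<^sup>2 = (norm (r x))\<^sup>2 - 2 * t * (r x \<bullet> A (K x)) + t\<^sup>2 * (norm (A (K x)))\<^sup>2" for x
        unfolding power2_norm_eq_inner by (simp add: inner_diff_left inner_diff_right inner_commute power2_eq_square)
      have i: "integrable lebesgue (\<lambda>x. (norm (r x))\<^sup>2)" "integrable lebesgue (\<lambda>x. r x \<bullet> A (K x))"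
        "integrable lebesgue (\<lambda>x. (norm (A (K x)))\<^sup>2)"
        using r AK in_L2_inner_integrable[OF r AK] by (simp_all add: in_L2_def)
      have "d\<^sup>2 \<le> (?N (\<lambda>x. r x - t *\<^sub>R A (K x)))\<^sup>2"
        using dle[OF Wt] d0 unfolding eq by (intro power_mono)
      also have "\<dots> = (?N r)\<^sup>2 - 2 * t * p + t\<^sup>2 * s"
        unfolding L2norm_sq pt p_def s_def using i by simp
      finally show ?thesis unfolding rd by linarith
    qed
    have s0: "s \<ge> 0" by (simp add: s_def)
    have "p = 0"
    proof (rule ccontr)
      assume "p \<noteq> 0"
      \<comment> \<open>Almost the minimiser p / s of the quadratic; the added 1 covers s = 0 and
        still makes the value negative when p is not 0.\<close>
      have "0 \<le> (p / (s + 1))\<^sup>2 * s - 2 * (p / (s + 1)) * p" by (rule quad)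
      also have "\<dots> = (p\<^sup>2 / (s + 1)) * (s / (s + 1) - 2)"
        by (simp add: power2_eq_square right_diff_distrib)
      also have "\<dots> < 0"
      proof (rule mult_pos_neg)
        show "0 < p\<^sup>2 / (s + 1)" using \<open>p \<noteq> 0\<close> s0 by simp
        have "s / (s + 1) \<le> 1" using s0 by simp
        then show "s / (s + 1) - 2 < 0" by linarith
      qed
      finally show False by simp
    qed
    then show ?thesis by (simp add: p_def)
  qed
  have "AE x in lebesgue. r x = 0"
    by (rule annihilator_zero[OF n A r]) (rule orth[OF in_W_smooth_bump[OF n]])
  then have "AE x in lebesgue. A (H x) = f x" by eventually_elim (simp add: r_def)
  then show ?thesis using that vH by blast
qed

section \<open>The nonlinear system\<close>

text \<open>Approximate G by simple functions: on each level set the matrix argument is constant,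
  where measurability is assumed. Continuity in the second argument passes to the limit off a null
  set, which is masked by an indicator.\<close>

lemma caratheodory_measurable:
  fixes F :: "real^'n::finite \<Rightarrow> real^'n^'m::finite \<Rightarrow> real^'m"
  assumes F: "caratheodory F" and G: "G \<in> borel_measurable lebesgue"
  shows "(\<lambda>x. F x (G x)) \<in> borel_measurable lebesgue"
proof -
  have Fm: "\<And>X. (\<lambda>x. F x X) \<in> borel_measurable lebesgue" and Fc: "AE x in lebesgue. continuous_on UNIV (F x)"
    using F by (auto simp: caratheodory_def)
  obtain N where N0: "{x \<in> space lebesgue. \<not> continuous_on UNIV (F x)} \<subseteq> N" "emeasure lebesgue N = 0" "N \<in> sets lebesgue"
    using Fc by (rule AE_E)
  then have N: "N \<in> null_sets lebesgue" by (simp add: null_sets_def)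
  from N0(1) have Nc: "continuous_on UNIV (F x)" if "x \<notin> N" for x using that by auto
  obtain s where s: "\<And>i. simple_function lebesgue (s i)" "\<And>x. (\<lambda>i. s i x) \<longlonglongrightarrow> G x"
    using borel_measurable_implies_sequence_metric[OF G, of 0] by auto
  have sm: "(\<lambda>x. F x (s i x)) \<in> borel_measurable lebesgue" for i
  proof -
    have fin: "finite (range (s i))" using simple_functionD(1)[OF s(1)[of i]] by simp
    have "(\<lambda>x. F x (s i x)) = (\<lambda>x. \<Sum>y\<in>range (s i). indicator (s i -` {y}) x *\<^sub>R F x y)"
    proof
      fix x
      have "(\<Sum>y\<in>range (s i). indicator (s i -` {y}) x *\<^sub>R F x y) = (\<Sum>y\<in>range (s i). if y = s i x then F x y else 0)"
        by (rule sum.cong) (auto simp: indicator_def)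
      also have "\<dots> = F x (s i x)" using fin by simp
      finally show "F x (s i x) = (\<Sum>y\<in>range (s i). indicator (s i -` {y}) x *\<^sub>R F x y)" ..
    qed
    moreover have "s i -` {y} \<in> sets lebesgue" for y using simple_functionD(2)[OF s(1)[of i], of "{y}"] by simp
    ultimately show ?thesis
      by (simp only:) (intro borel_measurable_sum borel_measurable_scaleR borel_measurable_indicator Fm)
  qed
  have Ns: "- N \<in> sets lebesgue"
    using sets.compl_sets[OF N0(3)] by (simp add: Compl_eq_Diff_UNIV)
  have "(\<lambda>x. indicator (- N) x *\<^sub>R F x (G x)) \<in> borel_measurable lebesgue"
  proof (rule borel_measurable_LIMSEQ_metric)
    show "(\<lambda>x. indicator (- N) x *\<^sub>R F x (s i x)) \<in> borel_measurable lebesgue" for i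
      by (rule borel_measurable_scaleR[OF borel_measurable_indicator[OF Ns] sm])
    fix x
    show "(\<lambda>i. indicator (- N) x *\<^sub>R F x (s i x)) \<longlonglongrightarrow> indicator (- N) x *\<^sub>R F x (G x)"
    proof (cases "x \<in> N")
      case False
      have "(\<lambda>i. F x (s i x)) \<longlonglongrightarrow> F x (G x)"
        by (rule continuous_on_tendsto_compose[OF Nc[OF False] s(2)]) auto
      then show ?thesis by (intro tendsto_intros)
    qed simp
  qed
  moreover have "AE x in lebesgue. indicator (- N) x *\<^sub>R F x (G x) = F x (G x)"
    using AE_not_in[OF N] by eventually_elim simp
  ultimately show ?thesis by (rule borel_measurable_AE)
qed

text \<open>In the AK-condition the exceptional null set may depend on X and Y. Since gradients vary
  with x, one null set for all pairs is needed: take the union over a countable dense set of pairs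
  and extend by continuity of \<open>F x\<close>.\<close>

lemma AE_all_AK:
  fixes F :: "real^'n::finite \<Rightarrow> real^'n^'m::finite \<Rightarrow> real^'m"
  assumes F: "caratheodory F" and lin: "linear A"
    and AK: "\<And>X Y. AE x in lebesgue. norm (\<alpha> x *\<^sub>R (F x (X + Y) - F x Y) - A X) \<le> b * norm X + c * norm (A X)"
  shows "AE x in lebesgue. \<forall>X Y. norm (\<alpha> x *\<^sub>R (F x (X + Y) - F x Y) - A X) \<le> b * norm X + c * norm (A X)"
proof -
  obtain D :: "((real^'n^'m) \<times> (real^'n^'m)) set" where D: "countable D"
    "\<And>U. open U \<Longrightarrow> U \<noteq> {} \<Longrightarrow> \<exists>d\<in>D. d \<in> U"
    by (rule countable_dense_setE) blast
  have cA: "continuous_on UNIV A" by (rule linear_continuous_on[OF linear_bounded[OF lin]])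
  have "AE x in lebesgue. \<forall>Z\<in>D. norm (\<alpha> x *\<^sub>R (F x (fst Z + snd Z) - F x (snd Z)) - A (fst Z)) \<le> b * norm (fst Z) + c * norm (A (fst Z))"
    using AK by (subst AE_ball_countable[OF D(1)]) (rule ballI)
  moreover have "AE x in lebesgue. continuous_on UNIV (F x)" using F by (simp add: caratheodory_def)
  ultimately show ?thesis
  proof eventually_elim
    case (elim x)
    \<comment> \<open>The set of violating pairs is open; if it were nonempty, it would contain a
      pair from the dense set.\<close>
    let ?U = "{Z. b * norm (fst Z) + c * norm (A (fst Z)) < norm (\<alpha> x *\<^sub>R (F x (fst Z + snd Z) - F x (snd Z)) - A (fst Z))}"
    have c1: "continuous_on UNIV (\<lambda>Z :: (real^'n^'m) \<times> (real^'n^'m). A (fst Z))"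
      by (rule continuous_on_compose2[OF cA continuous_on_fst[OF continuous_on_id]]) simp
    have c2: "continuous_on UNIV (\<lambda>Z :: (real^'n^'m) \<times> (real^'n^'m). F x (fst Z + snd Z))"
      by (rule continuous_on_compose2[OF elim(2) continuous_on_add[OF continuous_on_fst[OF continuous_on_id] continuous_on_snd[OF continuous_on_id]]]) simp
    have c3: "continuous_on UNIV (\<lambda>Z :: (real^'n^'m) \<times> (real^'n^'m). F x (snd Z))"
      by (rule continuous_on_compose2[OF elim(2) continuous_on_snd[OF continuous_on_id]]) simp
    have op: "open ?U"
      by (intro open_Collect_less continuous_on_add continuous_on_mult continuous_on_const continuous_on_norm
          continuous_on_fst continuous_on_id continuous_on_diff continuous_on_scaleR c1 c2 c3)
    have "?U = {}"
    proof (rule ccontr)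
      assume "?U \<noteq> {}"
      then obtain Z where "Z \<in> D" "Z \<in> ?U" using D(2)[OF op] by blast
      then show False using elim(1) by (simp add: not_less[symmetric])
    qed
    show ?case
    proof (intro allI)
      fix X Y
      have "(X, Y) \<notin> ?U" using \<open>?U = {}\<close> by blast
      then show "norm (\<alpha> x *\<^sub>R (F x (X + Y) - F x Y) - A X) \<le> b * norm X + c * norm (A X)" by simp
    qed
  qed
qed

text \<open>The place where the sharp constant enters. Pointwise, \<nu> |X| cannot be absorbed by |A
  X| for a general matrix X; after integration it can, because X is the gradient of a map in
  W.\<close>

lemma near_linear_L2:
  fixes A :: "real^'n::finite^'m::finite \<Rightarrow> real^'m" and E :: "real^'n \<Rightarrow> real^'m"
  assumes n: "CARD('n) \<ge> 3" and A: "elliptic_with \<nu> A" and W: "in_W w X"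
    and E: "E \<in> borel_measurable lebesgue" "AE x in lebesgue. norm (E x) \<le> b * \<nu> * norm (X x) + c * norm (A (X x))"
    and bc: "b > 0" "c > 0"
  shows "in_L2 lebesgue E" "L2norm lebesgue E \<le> (b + c) * L2norm lebesgue (\<lambda>x. A (X x))"
proof -
  have lin: "linear A" and \<nu>: "\<nu> > 0" using A by (auto simp: elliptic_with_def)
  have X: "in_L2 lebesgue X" by (rule in_W_in_L2[OF W])
  have AX: "in_L2 lebesgue (\<lambda>x. A (X x))" by (rule in_L2_linear[OF lin X])
  have Xm: "X \<in> borel_measurable lebesgue" "(\<lambda>x. A (X x)) \<in> borel_measurable lebesgue" using X AX by (auto simp: in_L2_def)
  have nm: "(\<lambda>x. norm (X x)) \<in> borel_measurable lebesgue" "(\<lambda>x. norm (A (X x))) \<in> borel_measurable lebesgue"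
    by (rule measurable_compose[OF Xm(1) borel_measurable_norm], rule measurable_compose[OF Xm(2) borel_measurable_norm])
  define g1 where "g1 x = b * \<nu> * norm (X x)" for x
  define g2 where "g2 x = c * norm (A (X x))" for x
  have g1: "in_L2 lebesgue g1"
    by (rule in_L2_bound[OF X, of _ "b * \<nu>"]) (use bc \<nu> nm in \<open>auto simp: g1_def[abs_def]\<close>)
  have g2: "in_L2 lebesgue g2"
    by (rule in_L2_bound[OF AX, of _ c]) (use bc nm in \<open>auto simp: g2_def[abs_def]\<close>)
  have g12: "in_L2 lebesgue (\<lambda>x. g1 x + g2 x)" by (rule in_L2_add[OF g1 g2])
  have le: "AE x in lebesgue. norm (E x) \<le> 1 * norm (g1 x + g2 x)"
    using E(2)
  proof eventually_elim
    case (elim x)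
    then show ?case using abs_ge_self[of "g1 x + g2 x"] unfolding g1_def g2_def real_norm_def mult_1 by linarith
  qed
  show EL: "in_L2 lebesgue E" by (rule in_L2_bound[OF g12 E(1) le])
  have "L2norm lebesgue E \<le> 1 * L2norm lebesgue (\<lambda>x. g1 x + g2 x)" by (rule L2norm_mono[OF EL g12 le]) simp
  also have "\<dots> \<le> L2norm lebesgue g1 + L2norm lebesgue g2" using L2norm_triangle[OF g1 g2] by simp
  also have "\<dots> \<le> b * \<nu> * L2norm lebesgue X + c * L2norm lebesgue (\<lambda>x. A (X x))"
  proof (rule add_mono)
    show "L2norm lebesgue g1 \<le> b * \<nu> * L2norm lebesgue X"
      by (rule L2norm_mono[OF g1 X]) (use bc \<nu> in \<open>auto simp: g1_def\<close>)
    show "L2norm lebesgue g2 \<le> c * L2norm lebesgue (\<lambda>x. A (X x))"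
      by (rule L2norm_mono[OF g2 AX]) (use bc in \<open>auto simp: g2_def\<close>)
  qed
  also have "\<dots> \<le> b * L2norm lebesgue (\<lambda>x. A (X x)) + c * L2norm lebesgue (\<lambda>x. A (X x))"
  proof (rule add_right_mono)
    have "b * (\<nu> * L2norm lebesgue X) \<le> b * L2norm lebesgue (\<lambda>x. A (X x))"
      by (rule mult_left_mono[OF in_W_estimates(1)[OF n A W]]) (use bc in simp)
    then show "b * \<nu> * L2norm lebesgue X \<le> b * L2norm lebesgue (\<lambda>x. A (X x))" by (simp only: mult.assoc)
  qed
  finally show "L2norm lebesgue E \<le> (b + c) * L2norm lebesgue (\<lambda>x. A (X x))" by (simp only: distrib_right)
qed

text \<open>The data of the AK-condition with the exceptional set independent of X and Y, and with
  positive bounds for the weight and its reciprocal.\<close>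

locale near_linear_system =
  fixes F :: "real^'n::finite \<Rightarrow> real^'n^'m::finite \<Rightarrow> real^'m" and A :: "real^'n^'m \<Rightarrow> real^'m"
    and \<nu> :: real and \<alpha> :: "real^'n \<Rightarrow> real" and b c K K' :: real
  assumes n: "CARD('n) \<ge> 3" and F: "caratheodory F" and A: "elliptic_with \<nu> A"
    and \<alpha>m: "\<alpha> \<in> borel_measurable lebesgue" and \<alpha>0: "\<And>x. \<alpha> x > 0"
    and K: "K > 0" "AE x in lebesgue. \<alpha> x \<le> K" and K': "K' > 0" "AE x in lebesgue. 1 / \<alpha> x \<le> K'"
    and bc: "b > 0" "c > 0" "b + c < 1"
    and near: "AE x in lebesgue. \<forall>X Y. norm (\<alpha> x *\<^sub>R (F x (X + Y) - F x Y) - A X) \<le> b * \<nu> * norm X + c * norm (A X)"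
begin

abbreviation N2 :: "(real^'n \<Rightarrow> 'v::euclidean_space) \<Rightarrow> real" where "N2 \<equiv> L2norm lebesgue"

lemma lin: "linear A" and \<nu>: "\<nu> > 0"
  using A by (auto simp: elliptic_with_def)

lemma FG_measurable: "in_L2 lebesgue G \<Longrightarrow> (\<lambda>x. F x (G x)) \<in> borel_measurable lebesgue"
  by (rule caratheodory_measurable[OF F]) (simp add: in_L2_def)

lemma lipschitz:
  obtains L where "L > 0" "AE x in lebesgue. \<forall>X Y. norm (\<alpha> x *\<^sub>R (F x X - F x Y)) \<le> L * norm (X - Y)"
proof -
  obtain M where M: "M > 0" "\<And>X. norm (A X) \<le> M * norm X" using elliptic_bound[OF A] by blast
  define L where "L = M + b * \<nu> + c * M"
  have L: "L > 0" using M bc \<nu> by (simp add: L_def add_pos_pos)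
  have "AE x in lebesgue. \<forall>X Y. norm (\<alpha> x *\<^sub>R (F x X - F x Y)) \<le> L * norm (X - Y)"
    using near
  proof eventually_elim
    case (elim x)
    show ?case
    proof (intro allI)
      fix X Y
      have "norm (\<alpha> x *\<^sub>R (F x ((X - Y) + Y) - F x Y) - A (X - Y)) \<le> b * \<nu> * norm (X - Y) + c * norm (A (X - Y))"
        using elim by blast
      then have 1: "norm (\<alpha> x *\<^sub>R (F x X - F x Y) - A (X - Y)) \<le> b * \<nu> * norm (X - Y) + c * norm (A (X - Y))"
        by (simp only: diff_add_cancel)
      have 2: "norm (\<alpha> x *\<^sub>R (F x X - F x Y)) \<le> norm (\<alpha> x *\<^sub>R (F x X - F x Y) - A (X - Y)) + norm (A (X - Y))"
        using norm_triangle_ineq[of "\<alpha> x *\<^sub>R (F x X - F x Y) - A (X - Y)" "A (X - Y)"] by simp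
      have 3: "c * norm (A (X - Y)) \<le> c * (M * norm (X - Y))" using M(2) bc(2) by (intro mult_left_mono) auto
      have "L * norm (X - Y) = M * norm (X - Y) + b * \<nu> * norm (X - Y) + c * (M * norm (X - Y))"
        by (simp only: L_def distrib_right mult.assoc)
      then show "norm (\<alpha> x *\<^sub>R (F x X - F x Y)) \<le> L * norm (X - Y)" using 1 2 3 M(2)[of "X - Y"] by linarith
    qed
  qed
  then show ?thesis using that L by blast
qed

text \<open>Without F(x, 0) = 0 the composition F(x, G x) itself may fail to be square integrable;
  differences are, by the Lipschitz bound and the bounds on the weight.\<close>

lemma scaled_difference:
  assumes G: "in_L2 lebesgue G" and H: "in_L2 lebesgue H"
  shows "in_L2 lebesgue (\<lambda>x. \<alpha> x *\<^sub>R (F x (G x) - F x (H x)))" "in_L2 lebesgue (\<lambda>x. F x (G x) - F x (H x))"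
    "N2 (\<lambda>x. \<alpha> x *\<^sub>R (F x (G x) - F x (H x))) \<le> K * N2 (\<lambda>x. F x (G x) - F x (H x))"
proof -
  obtain L where L: "L > 0" "AE x in lebesgue. \<forall>X Y. norm (\<alpha> x *\<^sub>R (F x X - F x Y)) \<le> L * norm (X - Y)"
    by (rule lipschitz)
  have m: "(\<lambda>x. F x (G x) - F x (H x)) \<in> borel_measurable lebesgue"
    by (intro borel_measurable_diff FG_measurable G H)
  have m2: "(\<lambda>x. \<alpha> x *\<^sub>R (F x (G x) - F x (H x))) \<in> borel_measurable lebesgue" by (rule borel_measurable_scaleR[OF \<alpha>m m])
  have "AE x in lebesgue. norm (\<alpha> x *\<^sub>R (F x (G x) - F x (H x))) \<le> L * norm (G x - H x)"
    using L(2) by eventually_elim blast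
  then show 1: "in_L2 lebesgue (\<lambda>x. \<alpha> x *\<^sub>R (F x (G x) - F x (H x)))"
    by (rule in_L2_bound[OF in_L2_diff[OF G H] m2])
  have "AE x in lebesgue. norm (F x (G x) - F x (H x)) \<le> K' * norm (\<alpha> x *\<^sub>R (F x (G x) - F x (H x)))"
    using K'(2)
  proof eventually_elim
    case (elim x)
    have "norm (F x (G x) - F x (H x)) = 1 / \<alpha> x * norm (\<alpha> x *\<^sub>R (F x (G x) - F x (H x)))"
      using \<alpha>0[of x] by simp
    also have "\<dots> \<le> K' * norm (\<alpha> x *\<^sub>R (F x (G x) - F x (H x)))" by (rule mult_right_mono[OF elim norm_ge_zero])
    finally show ?case .
  qed
  then show 2: "in_L2 lebesgue (\<lambda>x. F x (G x) - F x (H x))" by (rule in_L2_bound[OF 1 m])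
  have "AE x in lebesgue. norm (\<alpha> x *\<^sub>R (F x (G x) - F x (H x))) \<le> K * norm (F x (G x) - F x (H x))"
    using K(2)
  proof eventually_elim
    case (elim x)
    then have "\<alpha> x * norm (F x (G x) - F x (H x)) \<le> K * norm (F x (G x) - F x (H x))"
      by (rule mult_right_mono[OF _ norm_ge_zero])
    then show ?case using \<alpha>0[of x] by simp
  qed
  then show "N2 (\<lambda>x. \<alpha> x *\<^sub>R (F x (G x) - F x (H x))) \<le> K * N2 (\<lambda>x. F x (G x) - F x (H x))"
    by (rule L2norm_mono[OF 1 2]) (use K(1) in simp)
qed

text \<open>Nearness in the sense of Campanato: measured by |A : D|, the weighted nonlinear operator
  differs from the linear one by a map with Lipschitz constant b + c.\<close>

lemma contraction:
  assumes u: "in_W u G" and v: "in_W v H"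
  shows "N2 (\<lambda>x. A (G x - H x) - \<alpha> x *\<^sub>R (F x (G x) - F x (H x))) \<le> (b + c) * N2 (\<lambda>x. A (G x - H x))"
    "in_L2 lebesgue (\<lambda>x. A (G x - H x) - \<alpha> x *\<^sub>R (F x (G x) - F x (H x)))"
proof -
  note W = in_W_diff[OF n u v]
  note L = in_W_in_L2[OF u] in_W_in_L2[OF v]
  have AL: "in_L2 lebesgue (\<lambda>x. A (G x - H x))" by (rule in_L2_linear[OF lin in_W_in_L2[OF W]])
  have m: "(\<lambda>x. A (G x - H x) - \<alpha> x *\<^sub>R (F x (G x) - F x (H x))) \<in> borel_measurable lebesgue"
    using in_L2_diff[OF AL scaled_difference(1)[OF L]] by (simp add: in_L2_def)
  have ae: "AE x in lebesgue. norm (A (G x - H x) - \<alpha> x *\<^sub>R (F x (G x) - F x (H x)))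
      \<le> b * \<nu> * norm (G x - H x) + c * norm (A (G x - H x))"
    using near
  proof eventually_elim
    case (elim x)
    then have "norm (\<alpha> x *\<^sub>R (F x ((G x - H x) + H x) - F x (H x)) - A (G x - H x))
      \<le> b * \<nu> * norm (G x - H x) + c * norm (A (G x - H x))" by blast
    then show ?case by (simp only: diff_add_cancel norm_minus_commute[of "A (G x - H x)"])
  qed
  show "N2 (\<lambda>x. A (G x - H x) - \<alpha> x *\<^sub>R (F x (G x) - F x (H x))) \<le> (b + c) * N2 (\<lambda>x. A (G x - H x))"
    "in_L2 lebesgue (\<lambda>x. A (G x - H x) - \<alpha> x *\<^sub>R (F x (G x) - F x (H x)))"
    using near_linear_L2[OF n A W m ae bc(1,2)] by blast+
qed

text \<open>The triangle inequality with the error term absorbed on the left, which is possible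
  because b + c < 1.\<close>

lemma linear_part_le:
  assumes u: "in_W u G" and v: "in_W v H"
  shows "N2 (\<lambda>x. A (G x - H x)) \<le> K / (1 - (b + c)) * N2 (\<lambda>x. F x (G x) - F x (H x))"
proof -
  note L = in_W_in_L2[OF u] in_W_in_L2[OF v]
  let ?a = "N2 (\<lambda>x. A (G x - H x))"
  have "?a = N2 (\<lambda>x. (A (G x - H x) - \<alpha> x *\<^sub>R (F x (G x) - F x (H x))) + \<alpha> x *\<^sub>R (F x (G x) - F x (H x)))" by simp
  also have "\<dots> \<le> N2 (\<lambda>x. A (G x - H x) - \<alpha> x *\<^sub>R (F x (G x) - F x (H x))) + N2 (\<lambda>x. \<alpha> x *\<^sub>R (F x (G x) - F x (H x)))"
    by (rule L2norm_triangle[OF contraction(2)[OF u v] scaled_difference(1)[OF L]])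
  also have "\<dots> \<le> (b + c) * ?a + K * N2 (\<lambda>x. F x (G x) - F x (H x))"
    by (rule add_mono[OF contraction(1)[OF u v] scaled_difference(3)[OF L]])
  finally have "(1 - (b + c)) * ?a \<le> K * N2 (\<lambda>x. F x (G x) - F x (H x))" by (simp add: left_diff_distrib)
  then show ?thesis using bc(3) by (simp add: field_simps)
qed

text \<open>The first factor bounds the two parts of the norm of W by |A : Du|; the second comes
  from absorbing the nearness error.\<close>

definition W_const :: real where
  "W_const = (sqrt (sobolev_const CARD('n)) / \<nu> + 1 / \<nu>) * (K / (1 - (b + c)))"

lemma W_const_pos: "W_const > 0"
  unfolding W_const_def using \<nu> K(1) bc(3)
  by (intro mult_pos_pos add_nonneg_pos) (auto simp: sobolev_const_def)

lemma W_norm_le: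
  assumes u: "in_W u G" and v: "in_W v H"
  shows "W_norm (\<lambda>x. u x - v x) (\<lambda>x. G x - H x) \<le> W_const * N2 (\<lambda>x. F x (G x) - F x (H x))"
proof -
  note W = in_W_diff[OF n u v]
  let ?a = "N2 (\<lambda>x. A (G x - H x))"
  let ?s = "sqrt (sobolev_const CARD('n)) / \<nu>"
  have "N2 (\<lambda>x. G x - H x) \<le> 1 / \<nu> * ?a" using in_W_estimates(1)[OF n A W] \<nu> by (simp add: field_simps)
  then have "W_norm (\<lambda>x. u x - v x) (\<lambda>x. G x - H x) \<le> ?s * ?a + 1 / \<nu> * ?a"
    unfolding W_norm_def Lp_norm_2 by (intro add_mono in_W_estimates(2)[OF n A W])
  also have "\<dots> = (?s + 1 / \<nu>) * ?a" by (simp only: distrib_right)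
  also have "\<dots> \<le> (?s + 1 / \<nu>) * (K / (1 - (b + c)) * N2 (\<lambda>x. F x (G x) - F x (H x)))"
    by (rule mult_left_mono[OF linear_part_le[OF u v]]) (use \<nu> in \<open>simp add: sobolev_const_def\<close>)
  finally show ?thesis by (simp only: W_const_def mult.assoc)
qed

lemma unique:
  assumes u: "in_W u G" and v: "in_W v H"
    and f: "AE x in lebesgue. F x (G x) = f x" "AE x in lebesgue. F x (H x) = f x"
  shows "AE x in lebesgue. u x = v x"
proof -
  let ?q = "sobolev_exp CARD('n)"
  have q: "?q > 0" using sobolev_exp_ge_2[OF n] by simp
  have "AE x in lebesgue. (norm (F x (G x) - F x (H x)))\<^sup>2 = 0" using f by eventually_elim simp
  then have "(\<integral>x. (norm (F x (G x) - F x (H x)))\<^sup>2 \<partial>lebesgue) = 0" by (rule integral_eq_zero_AE)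
  then have "N2 (\<lambda>x. F x (G x) - F x (H x)) = 0" by (simp add: L2norm_def)
  then have "W_norm (\<lambda>x. u x - v x) (\<lambda>x. G x - H x) \<le> 0" using W_norm_le[OF u v] by simp
  then have "Lp_norm ?q (\<lambda>x. u x - v x) = 0"
    unfolding W_norm_def using Lp_norm_nonneg[of ?q "\<lambda>x. u x - v x"] Lp_norm_nonneg[of 2 "\<lambda>x. G x - H x"] by linarith
  then have z: "(\<integral>x. norm (u x - v x) powr ?q \<partial>lebesgue) = 0" by (simp add: Lp_norm_powr[OF q])
  have "integrable lebesgue (\<lambda>x. norm (u x - v x) powr ?q)"
    using in_W_diff[OF n u v] by (simp add: in_W_def Lp_space_def)
  then have "AE x in lebesgue. norm (u x - v x) powr ?q = 0"
    using integral_nonneg_eq_0_iff_AE[of lebesgue "\<lambda>x. norm (u x - v x) powr ?q"] z by simp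
  then show ?thesis by eventually_elim simp
qed

text \<open>Campanato's iteration: \<open>A : Du\<^sub>k\<^sub>+\<^sub>1 = A : Du\<^sub>k - \<alpha> (F(\<cdot>, Du\<^sub>k) - f)\<close> contracts \<open>A : D\<close> by the factor \<open>b + c\<close>.\<close>

lemma exists_solution:
  assumes F0: "AE x in lebesgue. F x 0 = 0" and f: "in_L2 lebesgue f"
  obtains u G where "in_W u G" "AE x in lebesgue. F x (G x) = f x"
proof -
  let ?R = "\<lambda>G x. \<alpha> x *\<^sub>R (F x (G x) - f x)"
  have zL: "in_L2 lebesgue (\<lambda>x::real^'n. 0 :: real^'n^'m)" by (rule in_W_in_L2[OF in_W_zero[OF n]])
  have \<alpha>f: "in_L2 lebesgue (\<lambda>x. \<alpha> x *\<^sub>R f x)"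
  proof (rule in_L2_bound[OF f])
    show "(\<lambda>x. \<alpha> x *\<^sub>R f x) \<in> borel_measurable lebesgue"
      using f by (intro borel_measurable_scaleR \<alpha>m) (simp add: in_L2_def)
    show "AE x in lebesgue. norm (\<alpha> x *\<^sub>R f x) \<le> K * norm (f x)"
      using K(2)
    proof eventually_elim
      case (elim x)
      then have "\<alpha> x * norm (f x) \<le> K * norm (f x)" by (rule mult_right_mono[OF _ norm_ge_zero])
      then show ?case using \<alpha>0[of x] by simp
    qed
  qed
  \<comment> \<open>F(x, 0) = 0 turns F(x, G x) into a difference, which is square integrable;
    without it the residual of the iteration need not be in L^2.\<close>
  have RL: "in_L2 lebesgue (?R G)" if G: "in_L2 lebesgue G" for G
  proof (rule in_L2_bound[OF in_L2_diff[OF scaled_difference(1)[OF G zL] \<alpha>f], of _ 1])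
    show "?R G \<in> borel_measurable lebesgue"
      using f by (intro borel_measurable_scaleR borel_measurable_diff \<alpha>m FG_measurable G) (simp add: in_L2_def)
    show "AE x in lebesgue. norm (?R G x) \<le> 1 * norm (\<alpha> x *\<^sub>R (F x (G x) - F x 0) - \<alpha> x *\<^sub>R f x)"
      using F0 by eventually_elim (simp add: scaleR_right_diff_distrib)
  qed
  \<comment> \<open>Membership in W is a premise inside the existential, so that a choice function
    exists on all pairs and can simply be iterated.\<close>
  have step: "\<exists>p'. in_W (fst p) (snd p) \<longrightarrow> in_W (fst p' :: real^'n \<Rightarrow> real^'m) (snd p') \<and>
      (AE x in lebesgue. A (snd p' x) = A (snd p x) - ?R (snd p) x)" for p :: "(real^'n \<Rightarrow> real^'m) \<times> (real^'n \<Rightarrow> real^'n^'m)"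
  proof (cases "in_W (fst p) (snd p)")
    case True
    note L = in_W_in_L2[OF True]
    obtain u G where "in_W u G" "AE x in lebesgue. A (G x) = A (snd p x) - ?R (snd p) x"
      by (rule linear_system_solvable[OF n A in_L2_diff[OF in_L2_linear[OF lin L] RL[OF L]]])
    then show ?thesis by (intro exI[of _ "(u, G)"]) simp
  qed simp
  have "\<exists>S. \<forall>p. in_W (fst p) (snd p) \<longrightarrow> in_W (fst (S p) :: real^'n \<Rightarrow> real^'m) (snd (S p)) \<and>
      (AE x in lebesgue. A (snd (S p) x) = A (snd p x) - ?R (snd p) x)"
    by (rule choice) (rule allI, rule step)
  then obtain S where S: "\<forall>p. in_W (fst p) (snd p) \<longrightarrow> in_W (fst (S p) :: real^'n \<Rightarrow> real^'m) (snd (S p)) \<and>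
      (AE x in lebesgue. A (snd (S p) x) = A (snd p x) - ?R (snd p) x)"
    by (rule exE)
  define P where "P k = (S ^^ k) ((\<lambda>x. 0), (\<lambda>x. 0))" for k
  define u where "u k = fst (P k)" for k
  define G where "G k = snd (P k)" for k
  have W: "in_W (u k) (G k)" for k
  proof (induction k)
    case 0 show ?case using in_W_zero[OF n] by (simp add: u_def G_def P_def)
  next
    case (Suc k) then show ?case using S[rule_format, of "P k"] by (simp add: u_def G_def P_def)
  qed
  have GL: "in_L2 lebesgue (G k)" for k by (rule in_W_in_L2[OF W])
  have it: "AE x in lebesgue. A (G (Suc k) x) = A (G k x) - ?R (G k) x" for k
    using S[rule_format, of "P k"] W[of k] by (simp add: u_def G_def P_def)
  have DL: "in_L2 lebesgue (\<lambda>x. A (G k x - G l x))" for k l by (rule in_L2_linear[OF lin in_L2_diff[OF GL GL]])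
  define a where "a k = N2 (\<lambda>x. A (G (Suc k) x - G k x))" for k
  define \<kappa> where "\<kappa> = b + c"
  have \<kappa>: "\<kappa> > 0" "\<kappa> < 1" using bc by (simp_all add: \<kappa>_def)
  have aS: "a (Suc k) \<le> \<kappa> * a k" for k
  proof -
    have "a (Suc k) = N2 (\<lambda>x. A (G (Suc k) x - G k x) - \<alpha> x *\<^sub>R (F x (G (Suc k) x) - F x (G k x)))"
      unfolding a_def
    proof (rule L2norm_cong)
      show "(\<lambda>x. A (G (Suc (Suc k)) x - G (Suc k) x)) \<in> borel_measurable lebesgue" using DL by (simp add: in_L2_def)
      show "(\<lambda>x. A (G (Suc k) x - G k x) - \<alpha> x *\<^sub>R (F x (G (Suc k) x) - F x (G k x))) \<in> borel_measurable lebesgue"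
        using contraction(2)[OF W W] by (simp add: in_L2_def)
      show "AE x in lebesgue. A (G (Suc (Suc k)) x - G (Suc k) x)
          = A (G (Suc k) x - G k x) - \<alpha> x *\<^sub>R (F x (G (Suc k) x) - F x (G k x))"
        using it[of "Suc k"] it[of k]
      proof eventually_elim
        case (elim x)
        have "A (G (Suc (Suc k)) x - G (Suc k) x) = - ?R (G (Suc k)) x" by (simp add: linear_diff[OF lin] elim(1))
        moreover have "A (G (Suc k) x - G k x) = - ?R (G k) x" by (simp add: linear_diff[OF lin] elim(2))
        ultimately show ?case by (simp add: scaleR_right_diff_distrib)
      qed
    qed
    also have "\<dots> \<le> \<kappa> * a k" unfolding a_def \<kappa>_def by (rule contraction(1)[OF W W])
    finally show ?thesis .
  qed
  have ak: "a k \<le> \<kappa> ^ k * a 0" for k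
  proof (induction k)
    case (Suc k)
    have "a (Suc k) \<le> \<kappa> * a k" by (rule aS)
    also have "\<dots> \<le> \<kappa> * (\<kappa> ^ k * a 0)" by (rule mult_left_mono[OF Suc]) (use \<kappa> in simp)
    finally show ?case by (simp only: power_Suc mult.assoc)
  qed simp
  have a0: "a k \<ge> 0" for k by (simp add: a_def)
  \<comment> \<open>The sum of the geometric series that dominates the increments.\<close>
  define B where "B = a 0 / (1 - \<kappa>)"
  have B: "B \<ge> 0" "B * (1 - \<kappa>) = a 0" using a0[of 0] \<kappa> by (simp_all add: B_def)
  \<comment> \<open>The right side is the partial geometric sum from l to l + m in closed form,
    which makes the induction telescope.\<close>
  have tail: "N2 (\<lambda>x. A (G (l + m) x - G l x)) \<le> \<kappa> ^ l * B - \<kappa> ^ (l + m) * B" for l m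
  proof (induction m)
    case 0 show ?case using linear_0[OF lin] by (simp add: L2norm_def)
  next
    case (Suc m)
    have "(\<lambda>x. A (G (l + Suc m) x - G l x)) = (\<lambda>x. A (G (Suc (l + m)) x - G (l + m) x) + A (G (l + m) x - G l x))"
      by (simp add: fun_eq_iff linear_diff[OF lin])
    then have "N2 (\<lambda>x. A (G (l + Suc m) x - G l x)) \<le> a (l + m) + N2 (\<lambda>x. A (G (l + m) x - G l x))"
      unfolding a_def using L2norm_triangle[OF DL[of "Suc (l + m)" "l + m"] DL[of "l + m" l]] by simp
    also have "\<dots> \<le> \<kappa> ^ (l + m) * (B * (1 - \<kappa>)) + (\<kappa> ^ l * B - \<kappa> ^ (l + m) * B)"
      unfolding B(2) by (rule add_mono[OF ak Suc])
    also have "\<dots> = \<kappa> ^ l * B - \<kappa> ^ (l + Suc m) * B" by (simp add: right_diff_distrib left_diff_distrib mult_ac)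
    finally show ?case .
  qed
  have Cau: "\<exists>N. \<forall>k\<ge>N. \<forall>l\<ge>N. N2 (\<lambda>x. A (G k x - G l x)) < e" if e: "e > 0" for e
  proof -
    have "(\<lambda>l. \<kappa> ^ l * B) \<longlonglongrightarrow> 0 * B" by (intro tendsto_intros LIMSEQ_realpow_zero) (use \<kappa> in auto)
    then have "\<forall>\<^sub>F l in sequentially. \<kappa> ^ l * B < e" by (intro order_tendstoD(2)) (use e in auto)
    then obtain N where N: "\<And>l. l \<ge> N \<Longrightarrow> \<kappa> ^ l * B < e" by (auto simp: eventually_sequentially)
    have one: "N2 (\<lambda>x. A (G k x - G l x)) < e" if "l \<ge> N" "k \<ge> l" for k l
    proof -
      have "N2 (\<lambda>x. A (G k x - G l x)) \<le> \<kappa> ^ l * B - \<kappa> ^ k * B" using tail[of l "k - l"] that by simp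
      moreover have "\<kappa> ^ k * B \<ge> 0" using \<kappa> B by simp
      ultimately show ?thesis using N[OF that(1)] by linarith
    qed
    have "N2 (\<lambda>x. A (G k x - G l x)) < e" if "k \<ge> N" "l \<ge> N" for k l
    proof (cases "k \<ge> l")
      case True then show ?thesis using one that by blast
    next
      case False
      then have "N2 (\<lambda>x. A (G l x - G k x)) < e" using one[of k l] that by simp
      moreover have "N2 (\<lambda>x. A (G k x - G l x)) = N2 (\<lambda>x. A (G l x - G k x))"
        unfolding linear_diff[OF lin] by (rule L2norm_minus_commute)
      ultimately show ?thesis by (simp only:)
    qed
    then show ?thesis by blast
  qed
  obtain v H where vH: "in_W v H" and lim: "(\<lambda>k. N2 (\<lambda>x. G k x - H x)) \<longlonglongrightarrow> 0"
    using W_complete[OF n A W Cau] by blast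
  have HL: "in_L2 lebesgue H" by (rule in_W_in_L2[OF vH])
  obtain L where L: "L > 0" "AE x in lebesgue. \<forall>X Y. norm (\<alpha> x *\<^sub>R (F x X - F x Y)) \<le> L * norm (X - Y)" by (rule lipschitz)
  \<comment> \<open>The residual of the limit differs from that of an iterate by a Lipschitz term,
    and the residual of the k-th iterate is, up to sign, its next increment of A : D, which is at
    most the k-th geometric term. Both tend to 0.\<close>
  have bound: "N2 (?R H) \<le> L * N2 (\<lambda>x. G k x - H x) + \<kappa> ^ k * a 0" for k
  proof -
    have D: "in_L2 lebesgue (\<lambda>x. \<alpha> x *\<^sub>R (F x (H x) - F x (G k x)))" by (rule scaled_difference(1)[OF HL GL])
    have "?R H = (\<lambda>x. \<alpha> x *\<^sub>R (F x (H x) - F x (G k x)) + ?R (G k) x)" by (simp add: fun_eq_iff scaleR_right_diff_distrib)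
    then have "N2 (?R H) \<le> N2 (\<lambda>x. \<alpha> x *\<^sub>R (F x (H x) - F x (G k x))) + N2 (?R (G k))"
      using L2norm_triangle[OF D RL[OF GL[of k]]] by simp
    also have "N2 (\<lambda>x. \<alpha> x *\<^sub>R (F x (H x) - F x (G k x))) \<le> L * N2 (\<lambda>x. G k x - H x)"
    proof (rule L2norm_mono[OF D in_L2_diff[OF GL HL]])
      show "AE x in lebesgue. norm (\<alpha> x *\<^sub>R (F x (H x) - F x (G k x))) \<le> L * norm (G k x - H x)"
        using L(2)
      proof eventually_elim
        case (elim x)
        then have "norm (\<alpha> x *\<^sub>R (F x (H x) - F x (G k x))) \<le> L * norm (H x - G k x)" by blast
        then show ?case by (simp only: norm_minus_commute[of "H x"])
      qed
    qed (use L in simp)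
    also have "N2 (?R (G k)) = a k"
      unfolding a_def
    proof -
      have "N2 (?R (G k)) = N2 (\<lambda>x. A (G k x - G (Suc k) x))"
      proof (rule L2norm_cong)
        show "?R (G k) \<in> borel_measurable lebesgue" using RL[OF GL] by (simp add: in_L2_def)
        show "(\<lambda>x. A (G k x - G (Suc k) x)) \<in> borel_measurable lebesgue" using DL by (simp add: in_L2_def)
        show "AE x in lebesgue. ?R (G k) x = A (G k x - G (Suc k) x)"
          using it[of k] by eventually_elim (simp add: linear_diff[OF lin])
      qed
      also have "\<dots> = N2 (\<lambda>x. A (G (Suc k) x - G k x))" unfolding linear_diff[OF lin] by (rule L2norm_minus_commute)
      finally show "N2 (?R (G k)) = N2 (\<lambda>x. A (G (Suc k) x - G k x))" .
    qed
    finally show ?thesis using ak[of k] by linarith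
  qed
  have "(\<lambda>k. L * N2 (\<lambda>x. G k x - H x) + \<kappa> ^ k * a 0) \<longlonglongrightarrow> L * 0 + 0 * a 0"
    by (intro tendsto_intros lim LIMSEQ_realpow_zero) (use \<kappa> in auto)
  then have "N2 (?R H) \<le> L * 0 + 0 * a 0" by (rule LIMSEQ_le_const) (use bound in blast)
  then have "N2 (?R H) = 0" using L2norm_nonneg[of lebesgue "?R H"] by linarith
  then have "AE x in lebesgue. ?R H x = 0" by (rule L2norm_eq_0[OF RL[OF HL]])
  then have "AE x in lebesgue. F x (H x) = f x"
  proof eventually_elim
    case (elim x)
    then show ?case using \<alpha>0[of x] by simp
  qed
  then show ?thesis using that vH by blast
qed

text \<open>The comparison estimate against the zero map, at which F vanishes by assumption.\<close>

lemma solution_bound: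
  assumes F0: "AE x in lebesgue. F x 0 = 0" and u: "in_W u G" and f: "in_L2 lebesgue f"
    and e: "AE x in lebesgue. F x (G x) = f x"
  shows "W_norm u G \<le> W_const * N2 f"
proof -
  have z: "in_W (\<lambda>x::real^'n. 0 :: real^'m) (\<lambda>x. 0)" by (rule in_W_zero[OF n])
  have "N2 (\<lambda>x. F x (G x) - F x 0) = N2 f"
  proof (rule L2norm_cong)
    show "(\<lambda>x. F x (G x) - F x 0) \<in> borel_measurable lebesgue"
      by (intro borel_measurable_diff FG_measurable in_W_in_L2[OF u] in_W_in_L2[OF z])
    show "f \<in> borel_measurable lebesgue" using f by (simp add: in_L2_def)
    show "AE x in lebesgue. F x (G x) - F x 0 = f x" using e F0 by eventually_elim simp
  qed
  then show ?thesis using W_norm_le[OF u z] by simp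
qed

end

section \<open>Passage from the AK-condition to the near-linear setting and conclusion\<close>

lemma AK_condition_near_linear:
  fixes F :: "real^'n::finite \<Rightarrow> real^'n^'m::finite \<Rightarrow> real^'m" and A :: "real^'n^'m \<Rightarrow> real^'m"
  assumes "CARD('n) \<ge> 3" "caratheodory F" "linear A" "ellip_const A > 0" "AK_condition F A"
  obtains \<alpha> b c K K' where "near_linear_system F A (ellip_const A) \<alpha> b c K K'"
  using assms(5) unfolding AK_condition_def
proof (elim exE conjE)
  fix \<alpha> :: "real^'n \<Rightarrow> real" and b c B B'
  assume \<alpha>: "\<alpha> \<in> borel_measurable lebesgue" "\<forall>x. \<alpha> x > 0"
    and B: "AE x in lebesgue. \<alpha> x \<le> B" "AE x in lebesgue. 1 / \<alpha> x \<le> B'"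
    and bc: "b > 0" "c > 0" "b + c < 1"
    and near: "\<forall>X Y. AE x in lebesgue. norm (\<alpha> x *\<^sub>R (F x (X + Y) - F x Y) - A X)
      \<le> b * ellip_const A * norm X + c * norm (A X)"
  \<comment> \<open>The essential bounds are raised to at least 1, which makes them
    positive.\<close>
  have B2: "AE x in lebesgue. \<alpha> x \<le> max B 1" using B(1) by eventually_elim simp
  have B2': "AE x in lebesgue. 1 / \<alpha> x \<le> max B' 1" using B(2) by eventually_elim simp
  have "near_linear_system F A (ellip_const A) \<alpha> b c (max B 1) (max B' 1)"
    by (rule near_linear_system.intro[OF assms(1,2) elliptic_with_ellip_const[OF assms(3,4)] \<alpha>(1) spec[OF \<alpha>(2)]
        _ B2 _ B2' bc AE_all_AK[OF assms(2,3) near[rule_format]]]) simp_all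
  then show thesis by (rule that)
qed

theorem mainTheorem1:
  fixes F :: "real^'n::finite \<Rightarrow> real^'n^'m::finite \<Rightarrow> real^'m"
    and A :: "real^'n^'m \<Rightarrow> real^'m"
  assumes "CARD('n) \<ge> 3" and "CARD('m) \<ge> 2"
    and "caratheodory F" and "linear A" and "ellip_const A > 0" and "AK_condition F A"
  shows "(\<exists>C>0. \<forall>u v Gu Gv. in_W u Gu \<longrightarrow> in_W v Gv \<longrightarrow>
            W_norm (\<lambda>x. v x - u x) (\<lambda>x. Gv x - Gu x)
              \<le> C * Lp_norm 2 (\<lambda>x. F x (Gv x) - F x (Gu x)))
    \<and> (\<forall>f u v Gu Gv. in_W u Gu \<longrightarrow> in_W v Gv \<longrightarrow>
            (AE x in lebesgue. F x (Gu x) = f x) \<longrightarrow> (AE x in lebesgue. F x (Gv x) = f x) \<longrightarrow>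
            (AE x in lebesgue. u x = v x))
    \<and> ((AE x in lebesgue. F x 0 = 0) \<longrightarrow>
        (\<exists>C>0. \<forall>f. Lp_space 2 f \<longrightarrow>
           (\<exists>u G. in_W u G \<and> (AE x in lebesgue. F x (G x) = f x)
              \<and> (\<forall>v H. in_W v H \<longrightarrow> (AE x in lebesgue. F x (H x) = f x) \<longrightarrow>
                    (AE x in lebesgue. v x = u x))
              \<and> W_norm u G \<le> C * Lp_norm 2 f)))"
proof -
  obtain \<alpha> b c K K' where "near_linear_system F A (ellip_const A) \<alpha> b c K K'"
    by (rule AK_condition_near_linear[OF assms(1,3-6)])
  then interpret near_linear_system F A "ellip_const A" \<alpha> b c K K' .
  show ?thesis
    unfolding Lp_space_2 Lp_norm_2
  proof (intro conjI impI)
    show "\<exists>C>0. \<forall>u v Gu Gv. in_W u Gu \<longrightarrow> in_W v Gv \<longrightarrow>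
        W_norm (\<lambda>x. v x - u x) (\<lambda>x. Gv x - Gu x) \<le> C * N2 (\<lambda>x. F x (Gv x) - F x (Gu x))"
      by (intro exI[of _ W_const] conjI W_const_pos allI impI) (rule W_norm_le)
    show "\<forall>f u v Gu Gv. in_W u Gu \<longrightarrow> in_W v Gv \<longrightarrow>
        (AE x in lebesgue. F x (Gu x) = f x) \<longrightarrow> (AE x in lebesgue. F x (Gv x) = f x) \<longrightarrow>
        (AE x in lebesgue. u x = v x)"
      by (intro allI impI) (rule unique)
    assume F0: "AE x in lebesgue. F x 0 = 0"
    show "\<exists>C>0. \<forall>f. in_L2 lebesgue f \<longrightarrow>
        (\<exists>u G. in_W u G \<and> (AE x in lebesgue. F x (G x) = f x)
          \<and> (\<forall>v H. in_W v H \<longrightarrow> (AE x in lebesgue. F x (H x) = f x) \<longrightarrow> (AE x in lebesgue. v x = u x))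
          \<and> W_norm u G \<le> C * N2 f)"
    proof (intro exI[of _ W_const] conjI allI impI W_const_pos)
      fix f :: "real^'n \<Rightarrow> real^'m" assume f: "in_L2 lebesgue f"
      obtain u G where uG: "in_W u G" "AE x in lebesgue. F x (G x) = f x" by (rule exists_solution[OF F0 f])
      have "\<forall>v H. in_W v H \<longrightarrow> (AE x in lebesgue. F x (H x) = f x) \<longrightarrow> (AE x in lebesgue. v x = u x)"
        by (intro allI impI) (rule unique[OF _ uG(1) _ uG(2)])
      then show "\<exists>u G. in_W u G \<and> (AE x in lebesgue. F x (G x) = f x)
          \<and> (\<forall>v H. in_W v H \<longrightarrow> (AE x in lebesgue. F x (H x) = f x) \<longrightarrow> (AE x in lebesgue. v x = u x))
          \<and> W_norm u G \<le> W_const * N2 f"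
        using uG solution_bound[OF F0 uG(1) f uG(2)] by (intro exI[of _ u] exI[of _ G] conjI)
    qed
  qed
qed

end
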